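(* There exists a real birational map $f$ of the surface $X=\mathbb P^1\times\mathbb P^1$ such that (1) $\lambda(f)>1$; (2) the real locus $X(\mathbb R)\simeq\mathbb R^2/\mathbb Z^2$ is contained in the Fatou set of $f$. More precisely, $X(\mathbb R)$ is contained in a rotation domain of $f$ in the strong sense.
   Context: $X=\mathbb P^1\times\mathbb P^1$ carries its standard real structure (complex conjugation of coordinates), so $X(\mathbb R)=\mathbb P^1(\mathbb R)\times\mathbb P^1(\mathbb R)$. A birational map is real if it commutes with this structure. The (first) dynamical degree is $\lambda(f)=\lim_{n\to+\infty}\|(f^n)_*\|^{1/n}$, where $(f^n)_*$ is the action of $f^n$ on $H^{1,1}(X;\mathbb R)$. The Fatou set of a birational map $f$ is the set of points $x\in X(\mathbb{C})$ having a neighbourhood $U$ such that $U$ contains no indeterminacy point of $f^n$ for any $n\in\mathbb Z$ and $(f^n|_U)_{n\in\mathbb Z}$ is a normal family. A rotation domain in the strong sense is an open set $\Omega\subset X(\mathbb{C})$ on which $f$ is conjugate, by a biholomorphism $\psi: D\to\Omega$, to a rotation $(z_1,z_2)\mapsto(e^{i\alpha_1}z_1,e^{i\alpha_2}z_2)$, $\alpha_1,\alpha_2\in\mathbb R$, on a circular domain $D\subset\mathbb C^2$, i.e. a domain invariant under all maps $(z_1,z_2)\mapsto(e^{it_1}z_1,e^{it_2}z_2)$, $t_1,t_2\in\mathbb R$. *)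

theory Defs
  imports "HOL-Analysis.Analysis"
begin

section \<open>The projective line and the surface X = P1 x P1\<close>

definition proj_rel :: "complex^2 \<Rightarrow> complex^2 \<Rightarrow> bool" where
  "proj_rel x y \<longleftrightarrow> x \<noteq> 0 \<and> y \<noteq> 0 \<and> (\<exists>c. c \<noteq> 0 \<and> y = c *s x)"

lemma part_equivp_proj_rel: "part_equivp proj_rel"
proof (rule part_equivpI)
  show "\<exists>x. proj_rel x x"
    by (rule exI[of _ "vector [1, 1]"]) (auto simp: proj_rel_def vec_eq_iff forall_2 intro!: exI[of _ 1])
  show "symp proj_rel"
  proof (rule sympI)
    fix x y assume "proj_rel x y"
    then obtain c where c: "x \<noteq> 0" "y \<noteq> 0" "c \<noteq> 0" "y = c *s x"
      by (auto simp: proj_rel_def)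
    then have "x = inverse c *s y" by (simp add: vec_eq_iff)
    with c show "proj_rel y x"
      unfolding proj_rel_def using nonzero_imp_inverse_nonzero by blast
  qed
  show "transp proj_rel"
  proof (rule transpI)
    fix x y z assume "proj_rel x y" "proj_rel y z"
    then obtain c d where "x \<noteq> 0" "z \<noteq> 0" "c \<noteq> 0" "y = c *s x" "d \<noteq> 0" "z = d *s y"
      by (auto simp: proj_rel_def)
    then have "d * c \<noteq> 0" "z = (d * c) *s x" by (simp_all add: vec_eq_iff)
    with \<open>x \<noteq> 0\<close> \<open>z \<noteq> 0\<close> show "proj_rel x z" unfolding proj_rel_def by blast
  qed
qed

text \<open>The constructor \<open>proj\<close> sends \<open>(x\<^sub>1, x\<^sub>2) \<noteq> 0\<close> to the point \<open>[x\<^sub>1 : x\<^sub>2]\<close>; its value at 0 is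
  meaningless.\<close>

quotient_type P1 = "complex^2" / partial: proj_rel
  morphisms rep_P1 proj
  by (rule part_equivp_proj_rel)

lemma proj_cases: obtains x where "x \<noteq> 0" "p = proj x"
proof -
  have "p = proj (rep_P1 p)" and "proj_rel (rep_P1 p) (rep_P1 p)"
    using Quotient3_abs_rep[OF Quotient3_P1] Quotient3_rep_reflp[OF Quotient3_P1] by metis+
  then show ?thesis using that unfolding proj_rel_def by blast
qed

lemma proj_eq_iff:
  assumes "x \<noteq> 0" "y \<noteq> 0"
  shows "proj x = proj y \<longleftrightarrow> (\<exists>c. c \<noteq> 0 \<and> y = c *s x)"
proof -
  have "proj_rel x x" "proj_rel y y"
    using assms by (auto simp: proj_rel_def intro!: exI[of _ 1])
  then have "proj x = proj y \<longleftrightarrow> proj_rel x y"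
    using Quotient3_rel[OF Quotient3_P1] by metis
  then show ?thesis using assms by (simp add: proj_rel_def)
qed

subsection \<open>The chordal metric\<close>

lemma norm_sq_C2: "(norm (x::complex^2))\<^sup>2 = (cmod (x$1))\<^sup>2 + (cmod (x$2))\<^sup>2"
  by (simp add: norm_vec_def L2_set_def sum_2)

lemma norm_scale_C2: "norm (c *s (x::complex^2)) = cmod c * norm x"
proof -
  have "(norm (c *s x))\<^sup>2 = (cmod c * norm x)\<^sup>2"
    by (simp add: norm_sq_C2 power_mult_distrib norm_mult distrib_left)
  then show ?thesis by (simp add: power2_eq_iff_nonneg)
qed

text \<open>The embedding of the Riemann sphere as the unit sphere of \<open>complex \<times> real\<close>, used only to
  prove the triangle inequality.\<close>

definition stereo :: "complex^2 \<Rightarrow> complex \<times> real" where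
  "stereo x = (2 * (x$1) * cnj (x$2) / of_real ((norm x)\<^sup>2),
               ((cmod (x$1))\<^sup>2 - (cmod (x$2))\<^sup>2) / (norm x)\<^sup>2)"

definition chordal :: "complex^2 \<Rightarrow> complex^2 \<Rightarrow> real" where
  "chordal x y = cmod (x$1 * y$2 - x$2 * y$1) / (norm x * norm y)"

lemma dist_stereo:
  assumes "x \<noteq> 0" "y \<noteq> 0"
  shows "dist (stereo x) (stereo y) = 2 * chordal x y"
proof -
  define N M where "N = (norm x)\<^sup>2" and "M = (norm y)\<^sup>2"
  have NM: "N \<noteq> 0" "M \<noteq> 0" using assms by (auto simp: N_def M_def)
  obtain a1 a2 b1 b2 where x: "x$1 = Complex a1 a2" "x$2 = Complex b1 b2"
    by (meson complex.exhaust_sel)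
  obtain c1 c2 d1 d2 where y: "y$1 = Complex c1 c2" "y$2 = Complex d1 d2"
    by (meson complex.exhaust_sel)
  have N: "N = a1\<^sup>2 + a2\<^sup>2 + b1\<^sup>2 + b2\<^sup>2" and M: "M = c1\<^sup>2 + c2\<^sup>2 + d1\<^sup>2 + d2\<^sup>2"
    unfolding N_def M_def by (simp_all add: norm_sq_C2 x y cmod_power2)
  define u1 u2 u3 where u: "u1 = 2 * (a1 * b1 + a2 * b2)" "u2 = 2 * (a2 * b1 - a1 * b2)"
    "u3 = a1\<^sup>2 + a2\<^sup>2 - b1\<^sup>2 - b2\<^sup>2"
  define v1 v2 v3 where v: "v1 = 2 * (c1 * d1 + c2 * d2)" "v2 = 2 * (c2 * d1 - c1 * d2)"
    "v3 = c1\<^sup>2 + c2\<^sup>2 - d1\<^sup>2 - d2\<^sup>2"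
  define w where "w = (cmod (x$1 * y$2 - x$2 * y$1))\<^sup>2"
  have w: "w = (a1 * d1 - a2 * d2 - b1 * c1 + b2 * c2)\<^sup>2 + (a1 * d2 + a2 * d1 - b1 * c2 - b2 * c1)\<^sup>2"
    unfolding w_def by (simp add: x y cmod_power2 algebra_simps)
  have uu: "u1\<^sup>2 + u2\<^sup>2 + u3\<^sup>2 = N\<^sup>2" and vv: "v1\<^sup>2 + v2\<^sup>2 + v3\<^sup>2 = M\<^sup>2"
    unfolding u v N M by algebra+
  have uv: "2 * N * M - 2 * (u1 * v1 + u2 * v2 + u3 * v3) = 4 * w"
    unfolding u v N M w by algebra
  have sx: "stereo x = (Complex (u1 / N) (u2 / N), u3 / N)"
    unfolding stereo_def N_def[symmetric]
    by (simp add: x u complex_eq_iff cmod_power2 Re_divide_of_real Im_divide_of_real algebra_simps)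
  have sy: "stereo y = (Complex (v1 / M) (v2 / M), v3 / M)"
    unfolding stereo_def M_def[symmetric]
    by (simp add: y v complex_eq_iff cmod_power2 Re_divide_of_real Im_divide_of_real algebra_simps)
  have "(dist (stereo x) (stereo y))\<^sup>2
      = (u1/N - v1/M)\<^sup>2 + (u2/N - v2/M)\<^sup>2 + (u3/N - v3/M)\<^sup>2"
    unfolding sx sy dist_prod_def
    by (simp add: dist_norm cmod_power2)
  also have "\<dots> = (u1\<^sup>2 + u2\<^sup>2 + u3\<^sup>2)/N\<^sup>2 + (v1\<^sup>2 + v2\<^sup>2 + v3\<^sup>2)/M\<^sup>2
      - 2 * (u1 * v1 + u2 * v2 + u3 * v3)/(N*M)"
    using NM by (simp add: power2_diff power_divide add_divide_distrib algebra_simps)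
  also have "\<dots> = (2 * N * M - 2 * (u1 * v1 + u2 * v2 + u3 * v3))/(N*M)"
    unfolding uu vv using NM by (simp add: diff_divide_distrib)
  also have "\<dots> = 4 * w / (N * M)" unfolding uv ..
  also have "\<dots> = (2 * chordal x y)\<^sup>2"
    unfolding chordal_def w_def N_def M_def by (simp add: power_mult_distrib power_divide)
  finally show ?thesis
    by (simp add: power2_eq_iff_nonneg chordal_def)
qed

lemma chordal_scale:
  assumes "c \<noteq> 0" "d \<noteq> 0"
  shows "chordal (c *s x) (d *s y) = chordal x y"
proof -
  have "(c *s x)$1 * (d *s y)$2 - (c *s x)$2 * (d *s y)$1 = (c * d) * (x$1 * y$2 - x$2 * y$1)"
    by (simp add: algebra_simps)
  then show ?thesis
    using assms unfolding chordal_def by (simp only: norm_scale_C2 norm_mult) (simp add: field_simps)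
qed

lemma chordal_eq_0_iff:
  assumes "x \<noteq> 0" "y \<noteq> 0"
  shows "chordal x y = 0 \<longleftrightarrow> proj x = proj y"
proof -
  have "x$1 * y$2 = x$2 * y$1 \<longleftrightarrow> (\<exists>c. c \<noteq> 0 \<and> y = c *s x)"
  proof
    assume e: "x$1 * y$2 = x$2 * y$1"
    have "x$1 \<noteq> 0 \<or> x$2 \<noteq> 0" using assms by (auto simp: vec_eq_iff forall_2)
    then obtain c where c: "y = c *s x"
    proof
      assume "x$1 \<noteq> 0"
      then have "y = (y$1 / x$1) *s x" using e by (simp add: vec_eq_iff forall_2 field_simps)
      then show ?thesis using that by blast
    next
      assume "x$2 \<noteq> 0"
      then have "y = (y$2 / x$2) *s x" using e by (simp add: vec_eq_iff forall_2 field_simps)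
      then show ?thesis using that by blast
    qed
    then show "\<exists>c. c \<noteq> 0 \<and> y = c *s x" using assms by (intro exI[of _ c]) auto
  qed auto
  then show ?thesis using assms by (simp add: chordal_def proj_eq_iff)
qed

instantiation P1 :: metric_space
begin

lift_definition dist_P1 :: "P1 \<Rightarrow> P1 \<Rightarrow> real" is chordal
  by (auto simp: proj_rel_def chordal_scale)

definition uniformity_P1 :: "(P1 \<times> P1) filter" where
  "uniformity_P1 = (INF e\<in>{0 <..}. principal {(p, q). dist p q < e})"

definition open_P1 :: "P1 set \<Rightarrow> bool" where
  "open_P1 U \<longleftrightarrow> (\<forall>p\<in>U. eventually (\<lambda>(p', q). p' = p \<longrightarrow> q \<in> U) uniformity)"

lemma dist_proj: "x \<noteq> 0 \<Longrightarrow> y \<noteq> 0 \<Longrightarrow> dist (proj x) (proj y) = chordal x y"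
  by (rule dist_P1.abs_eq) (auto simp: proj_rel_def eq_onp_def intro!: exI[of _ 1])

instance
proof
  fix p q r :: P1
  obtain x y z where xyz: "x \<noteq> 0" "p = proj x" "y \<noteq> 0" "q = proj y" "z \<noteq> 0" "r = proj z"
    by (metis proj_cases)
  show "dist p q = 0 \<longleftrightarrow> p = q"
    using xyz by (simp add: dist_proj chordal_eq_0_iff)
  show "dist p q \<le> dist p r + dist q r"
    using xyz dist_triangle2[of "stereo x" "stereo y" "stereo z"]
    by (simp add: dist_proj dist_stereo)
qed (simp_all add: uniformity_P1_def open_P1_def)

end

type_synonym X = "P1 \<times> P1"

subsection \<open>Real structure\<close>

lift_definition cnj_P1 :: "P1 \<Rightarrow> P1" is "\<lambda>x. \<chi> i. cnj (x$i)"
proof -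
  fix x y :: "complex^2" assume "proj_rel x y"
  then obtain c where c: "x \<noteq> 0" "y \<noteq> 0" "c \<noteq> 0" "y = c *s x" by (auto simp: proj_rel_def)
  then have "cnj c \<noteq> 0" "(\<chi> i. cnj (y$i)) = cnj c *s (\<chi> i. cnj (x$i))"
    "(\<chi> i. cnj (x$i)) \<noteq> 0" "(\<chi> i. cnj (y$i)) \<noteq> 0"
    by (simp_all add: vec_eq_iff)
  then show "proj_rel (\<chi> i. cnj (x$i)) (\<chi> i. cnj (y$i))" unfolding proj_rel_def by blast
qed

definition conj_X :: "X \<Rightarrow> X" where
  "conj_X p = (cnj_P1 (fst p), cnj_P1 (snd p))"

definition P1_real :: "P1 set" where
  "P1_real = {proj x |x. x \<noteq> 0 \<and> (\<forall>i. x$i \<in> \<real>)}"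

definition X_real :: "X set" where
  "X_real = P1_real \<times> P1_real"

section \<open>Birational maps of X\<close>

text \<open>Bihomogeneous polynomials of bidegree \<open>(a, b)\<close>, as polynomial functions of the two pairs of
  homogeneous coordinates.\<close>

definition bihom :: "nat \<Rightarrow> nat \<Rightarrow> (complex^2 \<Rightarrow> complex^2 \<Rightarrow> complex) \<Rightarrow> bool" where
  "bihom a b P \<longleftrightarrow> (\<exists>c :: nat \<Rightarrow> nat \<Rightarrow> complex. \<forall>x y. P x y =
     (\<Sum>i\<le>a. \<Sum>j\<le>b. c i j * (x$1) ^ i * (x$2) ^ (a - i) * (y$1) ^ j * (y$2) ^ (b - j)))"

definition bihom_dvd ::
    "(complex^2 \<Rightarrow> complex^2 \<Rightarrow> complex) \<Rightarrow> (complex^2 \<Rightarrow> complex^2 \<Rightarrow> complex) \<Rightarrow> bool" where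
  "bihom_dvd H P \<longleftrightarrow> (\<exists>k l R. bihom k l R \<and> (\<forall>x y. P x y = H x y * R x y))"

text \<open>Two coprime forms of the same bidegree, bundled as a map to \<open>complex^2\<close>. Factors of
  bihomogeneous polynomials are bihomogeneous, so it suffices to exclude bihomogeneous common
  factors; the forms cannot both vanish identically, since 0 is divisible by everything.\<close>

definition coprime_forms :: "(complex^2 \<Rightarrow> complex^2 \<Rightarrow> complex^2) \<Rightarrow> bool" where
  "coprime_forms F \<longleftrightarrow>
     (\<exists>a b. \<forall>i. bihom a b (\<lambda>x y. F x y $ i)) \<and>
     (\<forall>k l H. bihom k l H \<and> (\<forall>i. bihom_dvd H (\<lambda>x y. F x y $ i)) \<longrightarrow> k = 0 \<and> l = 0)"

text \<open>A rational map of X is given by a pair of rational functions \<open>F\<^sub>1/F\<^sub>2\<close>, \<open>G\<^sub>1/G\<^sub>2\<close> in lowest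
  terms. It is represented as a partial function, undefined exactly at its indeterminacy points.\<close>

definition is_lift :: "(X \<rightharpoonup> X) \<Rightarrow> (complex^2 \<Rightarrow> complex^2 \<Rightarrow> complex^2)
    \<Rightarrow> (complex^2 \<Rightarrow> complex^2 \<Rightarrow> complex^2) \<Rightarrow> bool" where
  "is_lift f F G \<longleftrightarrow> coprime_forms F \<and> coprime_forms G \<and>
     (\<forall>x y. x \<noteq> 0 \<longrightarrow> y \<noteq> 0 \<longrightarrow>
        f (proj x, proj y) =
          (if F x y = 0 \<or> G x y = 0 then None else Some (proj (F x y), proj (G x y))))"

definition rational_map :: "(X \<rightharpoonup> X) \<Rightarrow> bool" where
  "rational_map f \<longleftrightarrow> (\<exists>F G. is_lift f F G)"

text \<open>Domains of definition are Zariski open, so two rational maps are equal as soon as they agree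
  wherever a composition is defined, provided that this set is not empty.\<close>

definition rat_inverse :: "(X \<rightharpoonup> X) \<Rightarrow> (X \<rightharpoonup> X) \<Rightarrow> bool" where
  "rat_inverse f g \<longleftrightarrow> rational_map f \<and> rational_map g \<and>
     dom (g \<circ>\<^sub>m f) \<noteq> {} \<and> (g \<circ>\<^sub>m f) \<subseteq>\<^sub>m Some \<and>
     dom (f \<circ>\<^sub>m g) \<noteq> {} \<and> (f \<circ>\<^sub>m g) \<subseteq>\<^sub>m Some"

definition birational_map :: "(X \<rightharpoonup> X) \<Rightarrow> bool" where
  "birational_map f \<longleftrightarrow> (\<exists>g. rat_inverse f g)"

definition rat_inv :: "(X \<rightharpoonup> X) \<Rightarrow> (X \<rightharpoonup> X)" where
  "rat_inv f = (THE g. rat_inverse f g)"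

text \<open>The composition as a rational map may extend the composition of partial functions.\<close>

definition rat_comp :: "(X \<rightharpoonup> X) \<Rightarrow> (X \<rightharpoonup> X) \<Rightarrow> (X \<rightharpoonup> X)" where
  "rat_comp f g = (THE h. rational_map h \<and> (f \<circ>\<^sub>m g) \<subseteq>\<^sub>m h)"

primrec rat_pow :: "(X \<rightharpoonup> X) \<Rightarrow> nat \<Rightarrow> (X \<rightharpoonup> X)" where
  "rat_pow f 0 = Some"
| "rat_pow f (Suc n) = rat_comp f (rat_pow f n)"

definition rat_zpow :: "(X \<rightharpoonup> X) \<Rightarrow> int \<Rightarrow> (X \<rightharpoonup> X)" where
  "rat_zpow f n = (if 0 \<le> n then rat_pow f (nat n) else rat_pow (rat_inv f) (nat (- n)))"

text \<open>For partial functions this equality includes that the indeterminacy set is invariant.\<close>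

definition real_map :: "(X \<rightharpoonup> X) \<Rightarrow> bool" where
  "real_map f \<longleftrightarrow> (\<forall>p. f (conj_X p) = map_option conj_X (f p))"

section \<open>Action on cohomology and dynamical degree\<close>

text \<open>The classes of the two families of fibres, that is, the first Chern classes of \<open>O(1,0)\<close> and
  \<open>O(0,1)\<close>, form a basis of the real vector space \<open>H\<^sup>1\<^sup>,\<^sup>1(X;\<real>)\<close>, which is spanned by the classes of
  divisors. In this basis, the class of the effective divisor \<open>P = 0\<close> is the bidegree of \<open>P\<close>.\<close>

type_synonym H11 = "real \<times> real"

definition divisor_class :: "(complex^2 \<Rightarrow> complex^2 \<Rightarrow> complex) \<Rightarrow> H11" where
  "divisor_class P = (THE v. \<exists>a b. bihom a b P \<and> v = (real a, real b))"

definition effective_divisor :: "(complex^2 \<Rightarrow> complex^2 \<Rightarrow> complex) \<Rightarrow> bool" where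
  "effective_divisor P \<longleftrightarrow> (\<exists>a b. bihom a b P) \<and> (\<exists>x y. P x y \<noteq> 0)"

text \<open>The pull-back is the linear map with \<open>f\<^sup>*[D] = [f\<^sup>*D]\<close> for every effective divisor \<open>D\<close>, where an
  equation of \<open>f\<^sup>*D\<close> is obtained by substituting a lift of \<open>f\<close> into an equation of \<open>D\<close>.\<close>

definition pullback :: "(X \<rightharpoonup> X) \<Rightarrow> H11 \<Rightarrow> H11" where
  "pullback f = (THE L. linear L \<and>
     (\<forall>F G P. is_lift f F G \<and> effective_divisor P \<and>
        effective_divisor (\<lambda>x y. P (F x y) (G x y)) \<longrightarrow>
        L (divisor_class P) = divisor_class (\<lambda>x y. P (F x y) (G x y))))"

text \<open>For a birational map, \<open>f\<^sub>* = (\<pi>\<^sub>2)\<^sub>* \<circ> (\<pi>\<^sub>1)\<^sup>* = (f\<^sup>-\<^sup>1)\<^sup>*\<close>, where \<open>\<pi>\<^sub>1, \<pi>\<^sub>2\<close> are the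
  projections of the graph.\<close>

definition pushforward :: "(X \<rightharpoonup> X) \<Rightarrow> H11 \<Rightarrow> H11" where
  "pushforward f = pullback (rat_inv f)"

definition dynamical_degree :: "(X \<rightharpoonup> X) \<Rightarrow> real" where
  "dynamical_degree f = lim (\<lambda>n. root n (onorm (pushforward (rat_pow f n))))"

section \<open>Fatou set\<close>

text \<open>Since X is compact, a normal family is one in which every sequence has a subsequence
  converging uniformly on compact subsets.\<close>

definition iterates_normal_on :: "(X \<rightharpoonup> X) \<Rightarrow> X set \<Rightarrow> bool" where
  "iterates_normal_on f U \<longleftrightarrow>
     (\<forall>n :: nat \<Rightarrow> int. \<exists>(r :: nat \<Rightarrow> nat) g. strict_mono r \<and>
        (\<forall>K. compact K \<and> K \<subseteq> U \<longrightarrow>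
           uniform_limit K (\<lambda>j p. the (rat_zpow f (n (r j)) p)) g sequentially))"

definition fatou_set :: "(X \<rightharpoonup> X) \<Rightarrow> X set" where
  "fatou_set f = {p. \<exists>U. open U \<and> p \<in> U \<and> (\<forall>n. U \<subseteq> dom (rat_zpow f n)) \<and>
     iterates_normal_on f U}"

section \<open>Rotation domains\<close>

definition holomorphic_C2 :: "(complex^2 \<Rightarrow> complex^2) \<Rightarrow> (complex^2) set \<Rightarrow> bool" where
  "holomorphic_C2 h D \<longleftrightarrow> (\<forall>z\<in>D. \<exists>A :: complex^2^2. (h has_derivative (\<lambda>v. A *v v)) (at z))"

definition affine_P1 :: "bool \<Rightarrow> complex \<Rightarrow> P1" where
  "affine_P1 s t = proj (if s then vector [t, 1] else vector [1, t])"

text \<open>The four standard affine parametrisations, whose inverses form the atlas of X.\<close>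

definition affine_X :: "bool \<Rightarrow> bool \<Rightarrow> complex^2 \<Rightarrow> X" where
  "affine_X s s' z = (affine_P1 s (z$1), affine_P1 s' (z$2))"

definition biholomorphism :: "(complex^2 \<Rightarrow> X) \<Rightarrow> (complex^2) set \<Rightarrow> X set \<Rightarrow> bool" where
  "biholomorphism \<psi> D \<Omega> \<longleftrightarrow> open D \<and> open \<Omega> \<and> bij_betw \<psi> D \<Omega> \<and> continuous_on D \<psi> \<and>
     (\<forall>s s'. holomorphic_C2 (inv (affine_X s s') \<circ> \<psi>) (D \<inter> \<psi> -` range (affine_X s s')) \<and>
             holomorphic_C2 (inv_into D \<psi> \<circ> affine_X s s') (affine_X s s' -` \<Omega>))"

definition rotation :: "real^2 \<Rightarrow> complex^2 \<Rightarrow> complex^2" where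
  "rotation \<alpha> z = (\<chi> i. cis (\<alpha>$i) * z$i)"

definition circular_domain :: "(complex^2) set \<Rightarrow> bool" where
  "circular_domain D \<longleftrightarrow> open D \<and> connected D \<and> D \<noteq> {} \<and> (\<forall>t. rotation t ` D \<subseteq> D)"

definition strong_rotation_domain :: "(X \<rightharpoonup> X) \<Rightarrow> X set \<Rightarrow> bool" where
  "strong_rotation_domain f \<Omega> \<longleftrightarrow> open \<Omega> \<and>
     (\<exists>D \<psi> \<alpha>. circular_domain D \<and> biholomorphism \<psi> D \<Omega> \<and>
        (\<forall>z\<in>D. f (\<psi> z) = Some (\<psi> (rotation \<alpha> z))))"

end

theory Submission
  imports Defs "HOL-Computational_Algebra.Polynomial_Factorial"
    "HOL-Computational_Algebra.Field_as_Ring" "HOL-Computational_Algebra.Fundamental_Theorem_Algebra"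
begin

text \<open>In the coordinates \<open>z = (x - \<i>) / (x + \<i>)\<close> on both factors the real locus is the unit torus. The map is
  \<open>f(z, w) = (m\<^sub>1 z B(w'), w')\<close> with \<open>w' = m\<^sub>2 w B(z)\<close> and \<open>\<bar>m\<^sub>1\<bar> = \<bar>m\<^sub>2\<bar> = 1\<close>, where
  \<open>B(z) = (z - p) (1 - q z) / ((1 - p z) (z - q))\<close> has modulus 1 on the circle. Whatever \<open>m\<^sub>1, m\<^sub>2\<close> are, the
  condition \<open>0 < q < p\<^sup>3\<close> keeps the orbits of the contracted curves away from the indeterminacy points. Hence
  the degrees multiply under iteration, and \<open>\<lambda>(f)\<close> is the spectral radius \<open>3 + 2 \<surd>2\<close> of the matrix of
  bidegrees.

  For \<open>q = p\<^sup>4\<close> and small \<open>p\<close> the map is close to a rotation near the torus. A KAM iteration, which needs no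
  twist condition because \<open>m\<^sub>1\<close> and \<open>m\<^sub>2\<close> are adjusted along with the conjugacy, conjugates it holomorphically
  to a prescribed Diophantine rotation. In logarithmic coordinates the equation is
  \<open>u\<^sub>1(x + t) - u\<^sub>1(x) - c\<^sub>1 = log B\<close>, and similarly for \<open>u\<^sub>2\<close>; preserving the reflection symmetry of the
  \<open>u\<^sub>i\<close> makes the constants \<open>c\<^sub>i\<close> imaginary. The image of a neighbourhood of the torus under the conjugacy is
  the rotation domain.\<close>

section \<open>Absolutely convergent exponential series on strips\<close>

text \<open>The linearised conjugacy equation has variable coefficients, so it cannot be solved
  frequency by frequency. A substitution removes this obstacle: writing the correction as
  \<open>v = w + Du w\<close> turns the linearisation into
  \<open>M (w(x + t) - w(x)) + DE w\<close>, where \<open>M\<close> is close to the identity and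
  \<open>DE\<close> is the derivative of the current residual. The last term is a product of two
  small quantities and is left to the next error; what remains has constant coefficients after
  multiplication by the inverse of \<open>M\<close>. Small divisors and derivatives cost some width
  of the strip, which quadratic convergence pays for. On the algebraic side, composition, inverse
  and pull-back are specified through the uniqueness of rational maps. Two forms with finitely many
  common zeros are coprime, so one finiteness statement, that each iterate is undefined at only
  finitely many points, shows both that composed lifts stay in lowest terms and that bidegrees
  multiply. It holds because an image point outside the trapped regions has only one
  preimage.\<close>

definition echar :: "int \<times> int \<Rightarrow> complex \<times> complex \<Rightarrow> complex" where
  "echar k x = exp (of_int (fst k) * fst x + of_int (snd k) * snd x)"

definition wt :: "int \<times> int \<Rightarrow> real" where
  "wt k = \<bar>of_int (fst k)\<bar> + \<bar>of_int (snd k)\<bar>"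

text \<open>Arguments are logarithms of the circle coordinates: \<open>echar k\<close> is a Laurent
  monomial, purely imaginary arguments give the unit torus, and \<open>strip r\<close> covers the
  product of the annuli with radii \<open>exp (- r)\<close> and \<open>exp r\<close>.\<close>

definition strip :: "real \<Rightarrow> (complex \<times> complex) set" where
  "strip r = {x. \<bar>Re (fst x)\<bar> < r \<and> \<bar>Re (snd x)\<bar> < r}"

lemma wt_nonneg [simp]: "0 \<le> wt k"
  by (simp add: wt_def)

lemma wt_zero [simp]: "wt 0 = 0" "wt (0, 0) = 0"
  by (simp_all add: wt_def)

lemma wt_add_le: "wt (k + l) \<le> wt k + wt l"
  by (simp add: wt_def)

lemma wt_minus [simp]: "wt (- k) = wt k"
  by (simp add: wt_def)

lemma strip_mono: "r \<le> r' \<Longrightarrow> strip r \<subseteq> strip r'"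
  by (auto simp: strip_def)

lemma echar_zero [simp]: "echar 0 x = 1" "echar (0, 0) x = 1"
  by (simp_all add: echar_def)

lemma echar_add: "echar (k + l) x = echar k x * echar l x"
  by (simp add: echar_def algebra_simps flip: exp_add)

lemma echar_add_arg: "echar k (x + y) = echar k x * echar k y"
  by (simp add: echar_def algebra_simps flip: exp_add)

lemma abs_Re_freq_le:
  "\<bar>Re (of_int (fst k) * fst x + of_int (snd k) * snd x)\<bar> \<le> max \<bar>Re (fst x)\<bar> \<bar>Re (snd x)\<bar> * wt k"
proof -
  define M where "M = max \<bar>Re (fst x)\<bar> \<bar>Re (snd x)\<bar>"
  have "\<bar>Re (of_int (fst k) * fst x + of_int (snd k) * snd x)\<bar>
     \<le> \<bar>of_int (fst k)\<bar> * \<bar>Re (fst x)\<bar> + \<bar>of_int (snd k)\<bar> * \<bar>Re (snd x)\<bar>"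
    using abs_triangle_ineq[of "of_int (fst k) * Re (fst x)" "of_int (snd k) * Re (snd x)"]
    by (simp add: abs_mult)
  also have "\<dots> \<le> \<bar>of_int (fst k)\<bar> * M + \<bar>of_int (snd k)\<bar> * M"
    by (intro add_mono mult_left_mono) (auto simp: M_def)
  also have "\<dots> = M * wt k" by (simp add: wt_def algebra_simps)
  finally show ?thesis unfolding M_def .
qed

lemma norm_echar_le:
  assumes "x \<in> strip r"
  shows "norm (echar k x) \<le> exp (r * wt k)"
proof -
  have "Re (of_int (fst k) * fst x + of_int (snd k) * snd x) \<le> max \<bar>Re (fst x)\<bar> \<bar>Re (snd x)\<bar> * wt k"
    using abs_Re_freq_le[of k x] by linarith
  also have "\<dots> \<le> r * wt k"
    using assms by (intro mult_right_mono) (auto simp: strip_def)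
  finally show ?thesis by (simp add: echar_def)
qed

section \<open>The weighted coefficient norm and its algebra\<close>

lemma has_sum_nested:
  fixes f :: "'a \<times> 'b \<Rightarrow> 'c::banach"
  assumes "(\<lambda>z. norm (f z)) summable_on UNIV" "\<And>x. ((\<lambda>y. f (x, y)) has_sum g x) UNIV" "(g has_sum s) UNIV"
  shows "(f has_sum s) UNIV"
  using has_sum_SigmaI[where A=UNIV and f=f and g=g and B="\<lambda>_. UNIV" and S=s] assms
  by (simp add: abs_summable_summable)

text \<open>The frequencies need not be distinct, so that sums, products and series of such functions are
  obtained by merely reindexing, without collecting equal frequencies.\<close>

definition fbound :: "real \<Rightarrow> real \<Rightarrow> (complex \<times> complex \<Rightarrow> complex) \<Rightarrow> bool" where
  "fbound r N u \<longleftrightarrow> (\<exists>(a :: nat \<Rightarrow> complex) k S.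
     ((\<lambda>n. norm (a n) * exp (r * wt (k n))) has_sum S) UNIV \<and> S \<le> N \<and>
     (\<forall>x\<in>strip r. ((\<lambda>n. a n * echar (k n) x) has_sum u x) UNIV))"

lemma fboundE:
  assumes "fbound r N u"
  obtains a :: "nat \<Rightarrow> complex" and k S where
    "((\<lambda>n. norm (a n) * exp (r * wt (k n))) has_sum S) UNIV" "S \<le> N" "0 \<le> S"
    "\<And>x. x \<in> strip r \<Longrightarrow> ((\<lambda>n. a n * echar (k n) x) has_sum u x) UNIV"
proof -
  obtain a :: "nat \<Rightarrow> complex" and k S where
    *: "((\<lambda>n. norm (a n) * exp (r * wt (k n))) has_sum S) UNIV" "S \<le> N"
    "\<And>x. x \<in> strip r \<Longrightarrow> ((\<lambda>n. a n * echar (k n) x) has_sum u x) UNIV"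
    using assms unfolding fbound_def by blast
  have "0 \<le> S" by (rule has_sum_nonneg[OF *(1)]) auto
  with * show ?thesis using that by blast
qed

text \<open>Lets the coefficients be indexed by any countable type, such as pairs,
  \<open>bool\<close> or \<open>unit\<close>. They are moved to \<open>nat\<close> along
  \<open>to_nat\<close> and padded with zeros.\<close>

lemma fboundI:
  fixes a :: "'i::countable \<Rightarrow> complex"
  assumes S: "((\<lambda>i. norm (a i) * exp (r * wt (k i))) has_sum S) UNIV" "S \<le> N"
    and u: "\<And>x. x \<in> strip r \<Longrightarrow> ((\<lambda>i. a i * echar (k i) x) has_sum u x) UNIV"
  shows "fbound r N u"
proof -
  let ?R = "range (to_nat :: 'i \<Rightarrow> nat)"
  define a' where "a' n = (if n \<in> ?R then a (from_nat n) else 0)" for n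
  define k' where "k' n = k (from_nat n)" for n
  have tr: "(g has_sum s) UNIV"
    if "((\<lambda>i. g (to_nat (i :: 'i))) has_sum s) UNIV" "\<And>n. n \<notin> ?R \<Longrightarrow> g n = 0"
    for g :: "nat \<Rightarrow> 'c::{topological_comm_monoid_add,t2_space}" and s
  proof -
    have "(g has_sum s) ?R"
      using that(1) has_sum_reindex[of "to_nat :: 'i \<Rightarrow> nat" UNIV g s]
      by (simp add: o_def)
    also have "?this \<longleftrightarrow> (g has_sum s) UNIV"
      by (rule has_sum_cong_neutral) (use that(2) in auto)
    finally show ?thesis .
  qed
  show ?thesis
    unfolding fbound_def
  proof (intro exI[of _ a'] exI[of _ k'] exI[of _ S] conjI ballI)
    show "((\<lambda>n. norm (a' n) * exp (r * wt (k' n))) has_sum S) UNIV"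
      by (rule tr) (use S in \<open>auto simp: a'_def k'_def\<close>)
    show "((\<lambda>n. a' n * echar (k' n) x) has_sum u x) UNIV" if "x \<in> strip r" for x
      by (rule tr) (use u[OF that] in \<open>auto simp: a'_def k'_def\<close>)
  qed (use S in auto)
qed

lemma abs_summable_echar:
  assumes "(\<lambda>i. norm (a i) * exp (r * wt (k i))) summable_on I" "x \<in> strip r"
  shows "(\<lambda>i. norm (a i * echar (k i) x)) summable_on I"
proof (rule summable_on_comparison_test[OF assms(1)])
  show "norm (a i * echar (k i) x) \<le> norm (a i) * exp (r * wt (k i))" for i
    using norm_echar_le[OF assms(2)] by (simp add: norm_mult mult_left_mono)
qed auto

lemma fbound_mono:
  assumes "fbound r N u" "r' \<le> r" "N \<le> N'"
  shows "fbound r' N' u"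
proof -
  obtain a :: "nat \<Rightarrow> complex" and k S where
    *: "((\<lambda>n. norm (a n) * exp (r * wt (k n))) has_sum S) UNIV" "S \<le> N" "0 \<le> S"
    "\<And>x. x \<in> strip r \<Longrightarrow> ((\<lambda>n. a n * echar (k n) x) has_sum u x) UNIV"
    by (rule fboundE[OF assms(1)]) (blast intro: that)
  have le: "norm (a n) * exp (r' * wt (k n)) \<le> norm (a n) * exp (r * wt (k n))" for n
    using assms(2) by (simp add: mult_left_mono mult_right_mono)
  have "(\<lambda>n. norm (a n) * exp (r' * wt (k n))) summable_on UNIV"
    by (rule summable_on_comparison_test[OF has_sum_imp_summable[OF *(1)]]) (use le in auto)
  then obtain S' where S': "((\<lambda>n. norm (a n) * exp (r' * wt (k n))) has_sum S') UNIV"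
    by (auto simp: summable_on_def)
  have "S' \<le> S" using has_sum_mono[OF S' *(1)] le by auto
  with S' * assms show ?thesis
    using strip_mono[OF assms(2)] by (intro fboundI[of a r' k S' N' u]) (auto simp: subset_iff)
qed

lemma fbound_cong:
  assumes "\<And>x. x \<in> strip r \<Longrightarrow> u x = v x"
  shows "fbound r N u \<longleftrightarrow> fbound r N v"
  using assms unfolding fbound_def by (intro ex_cong1 conj_cong ball_cong refl) auto

lemma fbound_nonneg: "fbound r N u \<Longrightarrow> 0 \<le> N"
  by (elim fboundE) auto

lemma norm_le_fbound:
  assumes "fbound r N u" "x \<in> strip r"
  shows "norm (u x) \<le> N"
proof -
  obtain a :: "nat \<Rightarrow> complex" and k S where
    *: "((\<lambda>n. norm (a n) * exp (r * wt (k n))) has_sum S) UNIV" "S \<le> N" "0 \<le> S"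
    "\<And>x. x \<in> strip r \<Longrightarrow> ((\<lambda>n. a n * echar (k n) x) has_sum u x) UNIV"
    by (rule fboundE[OF assms(1)]) (blast intro: that)
  have "norm (u x) \<le> S"
  proof (rule norm_infsum_le[OF *(4)[OF assms(2)] *(1)])
    show "norm (a n * echar (k n) x) \<le> norm (a n) * exp (r * wt (k n))" for n
      using norm_echar_le[OF assms(2)] by (simp add: norm_mult mult_left_mono)
  qed
  with * show ?thesis by linarith
qed

lemma fbound_monomial:
  assumes "norm c * exp (r * wt k) \<le> N"
  shows "fbound r N (\<lambda>x. c * echar k x)"
  by (rule fboundI[of "\<lambda>_ :: unit. c" r "\<lambda>_. k" "norm c * exp (r * wt k)"])
     (use assms in \<open>auto intro!: has_sum_finiteI\<close>)

lemma fbound_const: "norm c \<le> N \<Longrightarrow> fbound r N (\<lambda>_. c)"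
  using fbound_monomial[of c r 0 N] by simp

text \<open>The countable triangle inequality, from which the estimates for sums, products, power
  series and the limit of the iteration follow. The bounds \<open>N m\<close> make the double family
  absolutely summable, so it can be listed as one series over pairs.\<close>

lemma fbound_series:
  fixes u :: "'i::countable \<Rightarrow> _"
  assumes u: "\<And>m. fbound r (N m) (u m)" and N: "(N has_sum T) UNIV" "T \<le> N'"
    and w: "\<And>x. x \<in> strip r \<Longrightarrow> ((\<lambda>m. u m x) has_sum w x) UNIV"
  shows "fbound r N' w"
proof -
  define Q where "Q m a k S \<longleftrightarrow>
     ((\<lambda>n. norm (a n) * exp (r * wt (k n))) has_sum S) UNIV \<and> S \<le> N m \<and>
     (\<forall>x\<in>strip r. ((\<lambda>n. a n * echar (k n) x) has_sum u m x) UNIV)"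
    for m and a :: "nat \<Rightarrow> complex" and k S
  have "\<exists>a k S. Q m a k S" for m
    using u[of m] unfolding fbound_def Q_def .
  then obtain a k S where Q: "\<And>m. Q m (a m) (k m) (S m)"
    by metis
  then have a: "\<And>m. ((\<lambda>n. norm (a m n) * exp (r * wt (k m n))) has_sum S m) UNIV" "\<And>m. S m \<le> N m"
    "\<And>m x. x \<in> strip r \<Longrightarrow> ((\<lambda>n. a m n * echar (k m n) x) has_sum u m x) UNIV"
    unfolding Q_def by blast+
  have S0: "0 \<le> S m" for m
    by (rule has_sum_nonneg[OF a(1)]) auto
  have "S summable_on UNIV"
    by (rule summable_on_comparison_test[OF has_sum_imp_summable[OF N(1)]]) (rule a(2), rule S0)
  then obtain T' where T': "(S has_sum T') UNIV" by (auto simp: summable_on_def)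
  have T'T: "T' \<le> T" using has_sum_mono[OF T' N(1)] a(2) by simp
  define A where "A = (\<lambda>(m, n). a m n)"
  define K where "K = (\<lambda>(m, n). k m n)"
  have sm: "(\<lambda>i. norm (A i) * exp (r * wt (K i))) summable_on UNIV \<times> UNIV"
  proof (rule summable_on_SigmaI[where g = S])
    show "((\<lambda>n. norm (A (m, n)) * exp (r * wt (K (m, n)))) has_sum S m) UNIV" for m
      using a(1)[of m] by (simp add: A_def K_def)
    show "S summable_on UNIV" using T' by (rule has_sum_imp_summable)
  qed auto
  show ?thesis
  proof (rule fboundI[of A r K])
    show "((\<lambda>i. norm (A i) * exp (r * wt (K i))) has_sum T') UNIV"
    proof (rule has_sum_nested[where g = S])
      show "((\<lambda>n. norm (A (m, n)) * exp (r * wt (K (m, n)))) has_sum S m) UNIV" for m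
        using a(1)[of m] by (simp add: A_def K_def)
      show "(\<lambda>i. norm (norm (A i) * exp (r * wt (K i)))) summable_on UNIV"
        using sm by simp
    qed (rule T')
    show "((\<lambda>i. A i * echar (K i) x) has_sum w x) UNIV" if x: "x \<in> strip r" for x
    proof (rule has_sum_nested[where g = "\<lambda>m. u m x"])
      show "(\<lambda>i. norm (A i * echar (K i) x)) summable_on UNIV"
        using abs_summable_echar[OF _ x, of A K UNIV] sm by simp
      show "((\<lambda>n. A (m, n) * echar (K (m, n)) x) has_sum u m x) UNIV" for m
        using a(3)[OF x, of m] by (simp add: A_def K_def)
    qed (rule w[OF x])
    show "T' \<le> N'" using T'T N(2) by simp
  qed
qed

lemma fbound_add:
  assumes "fbound r N u" "fbound r M v"
  shows "fbound r (N + M) (\<lambda>x. u x + v x)"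
proof (rule fbound_series[of r "\<lambda>b. if b then N else M" "\<lambda>b. if b then u else v"])
  show "((\<lambda>b. if b then N else M) has_sum N + M) UNIV"
    by (rule has_sum_finiteI) (auto simp: UNIV_bool)
  show "((\<lambda>b. (if b then u else v) x) has_sum u x + v x) UNIV" for x
    by (rule has_sum_finiteI) (auto simp: UNIV_bool)
qed (use assms in auto)

lemma fbound_mult:
  assumes "fbound r N u" "fbound r M v"
  shows "fbound r (N * M) (\<lambda>x. u x * v x)"
proof -
  obtain a :: "nat \<Rightarrow> complex" and k S where
    a: "((\<lambda>n. norm (a n) * exp (r * wt (k n))) has_sum S) UNIV" "S \<le> N" "0 \<le> S"
    "\<And>x. x \<in> strip r \<Longrightarrow> ((\<lambda>n. a n * echar (k n) x) has_sum u x) UNIV"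
    by (rule fboundE[OF assms(1)]) (blast intro: that)
  show ?thesis
  proof (rule fbound_series[of r "\<lambda>n. norm (a n) * exp (r * wt (k n)) * M" "\<lambda>n x. a n * echar (k n) x * v x"])
    show "((\<lambda>n. norm (a n) * exp (r * wt (k n)) * M) has_sum S * M) UNIV"
      by (rule has_sum_cmult_left[OF a(1)])
    show "S * M \<le> N * M" using a fbound_nonneg[OF assms(2)] by (simp add: mult_right_mono)
    show "((\<lambda>n. a n * echar (k n) x * v x) has_sum u x * v x) UNIV" if "x \<in> strip r" for x
      by (rule has_sum_cmult_left[OF a(4)[OF that]])
    fix n
    obtain b :: "nat \<Rightarrow> complex" and l S' where
      b: "((\<lambda>n. norm (b n) * exp (r * wt (l n))) has_sum S') UNIV" "S' \<le> M" "0 \<le> S'"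
      "\<And>x. x \<in> strip r \<Longrightarrow> ((\<lambda>n. b n * echar (l n) x) has_sum v x) UNIV"
      by (rule fboundE[OF assms(2)]) (blast intro: that)
    show "fbound r (norm (a n) * exp (r * wt (k n)) * M) (\<lambda>x. a n * echar (k n) x * v x)"
    \<comment> \<open>Subadditivity of \<open>wt\<close> makes the weights
      \<open>exp (r * wt k)\<close> submultiplicative only for nonnegative \<open>r\<close>. For
      negative \<open>r\<close> the strip is empty and any nonnegative bound holds.\<close>
    proof (cases "r \<ge> 0")
      case True
      show ?thesis
      proof (rule fbound_series[of r "\<lambda>m. norm (a n) * exp (r * wt (k n)) * (norm (b m) * exp (r * wt (l m)))"
            "\<lambda>m x. a n * echar (k n) x * (b m * echar (l m) x)"])
        show "((\<lambda>m. norm (a n) * exp (r * wt (k n)) * (norm (b m) * exp (r * wt (l m))))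
            has_sum norm (a n) * exp (r * wt (k n)) * S') UNIV"
          by (rule has_sum_cmult_right[OF b(1)])
        show "norm (a n) * exp (r * wt (k n)) * S' \<le> norm (a n) * exp (r * wt (k n)) * M"
          using b by (simp add: mult_left_mono)
        show "((\<lambda>m. a n * echar (k n) x * (b m * echar (l m) x)) has_sum a n * echar (k n) x * v x) UNIV"
          if "x \<in> strip r" for x
          by (rule has_sum_cmult_right[OF b(4)[OF that]])
        fix m
        have "exp (r * wt (k n + l m)) \<le> exp (r * wt (k n)) * exp (r * wt (l m))"
          using mult_left_mono[OF wt_add_le True, of "k n" "l m"] by (simp add: exp_add[symmetric] distrib_left)
        then have "norm (a n * b m) * exp (r * wt (k n + l m))
            \<le> norm (a n * b m) * (exp (r * wt (k n)) * exp (r * wt (l m)))"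
          by (intro mult_left_mono) auto
        also have "\<dots> = norm (a n) * exp (r * wt (k n)) * (norm (b m) * exp (r * wt (l m)))"
          by (simp add: norm_mult)
        finally have "fbound r (norm (a n) * exp (r * wt (k n)) * (norm (b m) * exp (r * wt (l m))))
           (\<lambda>x. (a n * b m) * echar (k n + l m) x)"
          by (rule fbound_monomial)
        then show "fbound r (norm (a n) * exp (r * wt (k n)) * (norm (b m) * exp (r * wt (l m))))
           (\<lambda>x. a n * echar (k n) x * (b m * echar (l m) x))"
          unfolding echar_add by (simp only: mult.assoc mult.left_commute)
      qed
    next
      case False
      have "strip r = {}" using False by (auto simp: strip_def)
      moreover have "fbound r (norm (a n) * exp (r * wt (k n)) * M) (\<lambda>_. 0)"
        using fbound_nonneg[OF assms(2)] by (intro fbound_const) auto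
      ultimately show ?thesis
        using fbound_cong[of r "\<lambda>_. 0" "\<lambda>x. a n * echar (k n) x * v x"] by simp
    qed
  qed
qed

lemma fbound_cmult: "fbound r N u \<Longrightarrow> norm c * N \<le> M \<Longrightarrow> fbound r M (\<lambda>x. c * u x)"
  using fbound_mult[OF fbound_const[of c "norm c" r]] fbound_mono[of r "norm c * N"] by auto

lemma fbound_uminus: "fbound r N u \<Longrightarrow> fbound r N (\<lambda>x. - u x)"
  using fbound_cmult[of r N u "-1" N] by simp

lemma fbound_diff: "fbound r N u \<Longrightarrow> fbound r M v \<Longrightarrow> fbound r (N + M) (\<lambda>x. u x - v x)"
  using fbound_add[OF _ fbound_uminus, of r N u M v] by simp

lemma fbound_power: "fbound r N u \<Longrightarrow> fbound r (N ^ n) (\<lambda>x. u x ^ n)"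
  by (induction n) (auto intro: fbound_const fbound_mult)

lemma fbound_translate:
  assumes "fbound r N u" "Re (fst t) = 0" "Re (snd t) = 0"
  shows "fbound r N (\<lambda>x. u (x + t))"
proof -
  obtain a :: "nat \<Rightarrow> complex" and k S where
    a: "((\<lambda>n. norm (a n) * exp (r * wt (k n))) has_sum S) UNIV" "S \<le> N" "0 \<le> S"
    "\<And>x. x \<in> strip r \<Longrightarrow> ((\<lambda>n. a n * echar (k n) x) has_sum u x) UNIV"
    by (rule fboundE[OF assms(1)]) (blast intro: that)
  have n1: "norm (echar l t) = 1" for l
    using assms by (simp add: echar_def)
  show ?thesis
  proof (rule fboundI[of "\<lambda>n. a n * echar (k n) t" r k S])
    show "((\<lambda>n. a n * echar (k n) t * echar (k n) x) has_sum u (x + t)) UNIV" if "x \<in> strip r" for x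
      using a(4)[of "x + t"] that assms by (auto simp: strip_def echar_add_arg mult_ac)
  qed (use a in \<open>auto simp: norm_mult n1\<close>)
qed

text \<open>Conjugation and reflection together send the coefficient \<open>a\<close> at frequency
  \<open>k\<close> to \<open>cnj a\<close> at frequency \<open>- k\<close>, which leaves the
  weighted sum unchanged.\<close>

lemma fbound_reflect:
  assumes "fbound r N u"
  shows "fbound r N (\<lambda>x. cnj (u (- cnj (fst x), - cnj (snd x))))"
proof -
  obtain a :: "nat \<Rightarrow> complex" and k S where
    a: "((\<lambda>n. norm (a n) * exp (r * wt (k n))) has_sum S) UNIV" "S \<le> N" "0 \<le> S"
    "\<And>x. x \<in> strip r \<Longrightarrow> ((\<lambda>n. a n * echar (k n) x) has_sum u x) UNIV"
    by (rule fboundE[OF assms(1)]) (blast intro: that)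
  have c: "cnj (echar l (- cnj (fst x), - cnj (snd x))) = echar (- l) x" for l x
    by (simp add: echar_def exp_cnj)
  show ?thesis
  proof (rule fboundI[of "\<lambda>n. cnj (a n)" r "\<lambda>n. - k n" S])
    show "((\<lambda>n. cnj (a n) * echar (- k n) x) has_sum cnj (u (- cnj (fst x), - cnj (snd x)))) UNIV"
      if "x \<in> strip r" for x
    proof -
      have "((\<lambda>n. cnj (a n * echar (k n) (- cnj (fst x), - cnj (snd x))))
         has_sum cnj (u (- cnj (fst x), - cnj (snd x)))) UNIV"
        using that by (subst has_sum_cnj_iff, intro a(4)) (auto simp: strip_def)
      then show ?thesis by (simp add: c)
    qed
  qed (use a in auto)
qed

lemma fbound_periodic:
  assumes "fbound r N u" "x \<in> strip r" "fst t = of_int m * (2 * of_real pi * \<i>)" "snd t = of_int n * (2 * of_real pi * \<i>)"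
  shows "u (x + t) = u x"
proof -
  obtain a :: "nat \<Rightarrow> complex" and k S where
    a: "((\<lambda>n. norm (a n) * exp (r * wt (k n))) has_sum S) UNIV" "S \<le> N" "0 \<le> S"
    "\<And>x. x \<in> strip r \<Longrightarrow> ((\<lambda>n. a n * echar (k n) x) has_sum u x) UNIV"
    by (rule fboundE[OF assms(1)]) (blast intro: that)
  have e: "echar l t = 1" for l
  proof -
    have "of_int (fst l) * fst t + of_int (snd l) * snd t = 2 * of_int (fst l * m + snd l * n) * of_real pi * \<i>"
      using assms by (simp add: algebra_simps)
    then show ?thesis unfolding echar_def using exp_integer_2pi[of "of_int (fst l * m + snd l * n)"]
      by simp
  qed
  have "x + t \<in> strip r" using assms by (auto simp: strip_def)
  from a(4)[OF this] a(4)[OF assms(2)] show ?thesis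
    by (intro has_sum_unique) (auto simp: echar_add_arg e)
qed

lemma has_sum_diff:
  fixes f g :: "'a \<Rightarrow> 'b::real_normed_vector"
  assumes "(f has_sum s) A" "(g has_sum t) A"
  shows "((\<lambda>i. f i - g i) has_sum s - t) A"
  using has_sum_add[OF assms(1), of "\<lambda>i. - g i" "- t"] assms(2) by (simp add: has_sum_uminus)

lemma has_sum_sums_norm:
  fixes f :: "nat \<Rightarrow> 'a::banach"
  assumes "summable (\<lambda>n. norm (f n))" "f sums s"
  shows "(f has_sum s) UNIV"
  using norm_summable_imp_has_sum[OF assms] .

text \<open>Taking \<open>N\<^sup>2\<close> out of the series leaves terms with denominator
  \<open>fact (n + 2)\<close>, dominated by those of \<open>exp N\<close>. The quadratic factor is
  what later makes the Newton iteration converge.\<close>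

lemma fbound_exp_tail:
  assumes "fbound r N u"
  shows "fbound r (N\<^sup>2 * exp N) (\<lambda>x. exp (u x) - 1 - u x)"
proof -
  have N: "0 \<le> N" using fbound_nonneg[OF assms] .
  show ?thesis
  proof (rule fbound_series[of r "\<lambda>n. N\<^sup>2 * (N ^ n / fact n)" "\<lambda>n x. (1 / fact (n + 2)) * u x ^ (n + 2)" "N\<^sup>2 * exp N"])
    have "(\<lambda>n. N ^ n / fact n) sums exp N"
      using exp_converges[of N] by (simp add: divide_inverse mult.commute)
    then have "((\<lambda>n. N ^ n / fact n) has_sum exp N) UNIV"
      using N by (intro has_sum_sums_norm) (auto simp: sums_iff)
    then show "((\<lambda>n. N\<^sup>2 * (N ^ n / fact n)) has_sum N\<^sup>2 * exp N) UNIV"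
      by (rule has_sum_cmult_right)
    show "fbound r (N\<^sup>2 * (N ^ n / fact n)) (\<lambda>x. (1 / fact (n + 2)) * u x ^ (n + 2))" for n
    proof (rule fbound_cmult[OF fbound_power[OF assms]])
      have "fact n \<le> (fact (n + 2) :: real)" by (rule fact_mono) simp
      then have "inverse (fact (n + 2)) \<le> (inverse (fact n) :: real)"
        by (intro le_imp_inverse_le) auto
      then have "inverse (fact (n + 2)) * N ^ (n + 2) \<le> inverse (fact n) * N ^ (n + 2)"
        using N by (intro mult_right_mono) auto
      also have "\<dots> = N\<^sup>2 * (N ^ n / fact n)"
        by (simp only: power_add divide_inverse mult_ac)
      finally have "inverse (fact (n + 2)) * N ^ (n + 2) \<le> N\<^sup>2 * (N ^ n / fact n)" .
      moreover have "norm (1 / fact (n + 2) :: complex) = inverse (fact (n + 2))"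
        by (metis divide_inverse mult_1 norm_divide norm_fact norm_one)
      ultimately show "norm (1 / fact (n + 2) :: complex) * N ^ (n + 2) \<le> N\<^sup>2 * (N ^ n / fact n)"
        by simp
    qed
    show "((\<lambda>n. (1 / fact (n + 2)) * u x ^ (n + 2)) has_sum exp (u x) - 1 - u x) UNIV" for x
    proof -
      have e: "(\<lambda>n. (1 / fact n) * u x ^ n) sums exp (u x)"
        using exp_converges[of "u x"] by (simp add: scaleR_conv_of_real divide_inverse)
      have "(\<lambda>n. (1 / fact (n + 2)) * u x ^ (n + 2)) sums (exp (u x) - (\<Sum>i<2. (1 / fact i) * u x ^ i))"
        using sums_split_initial_segment[OF e, of 2] by simp
      then have s: "(\<lambda>n. (1 / fact (n + 2)) * u x ^ (n + 2)) sums (exp (u x) - 1 - u x)"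
        by (simp add: numeral_2_eq_2 algebra_simps)
      have "summable (\<lambda>n. norm ((1 / fact n) * u x ^ n))"
        using summable_norm_exp[of "u x"] by (simp add: scaleR_conv_of_real divide_inverse norm_mult norm_inverse)
      then have "summable (\<lambda>n. norm ((1 / fact (n + 2)) * u x ^ (n + 2)))"
        using summable_iff_shift[of "\<lambda>n. norm ((1 / fact n) * u x ^ n)" 2] by blast
      then show ?thesis using s by (rule has_sum_sums_norm)
    qed
  qed simp
qed

text \<open>The scalar inequality is the function estimate read off at a constant function.\<close>

lemma norm_exp_tail_le: "norm (exp z - 1 - z :: complex) \<le> (norm z)\<^sup>2 * exp (norm z)"
  using norm_le_fbound[OF fbound_exp_tail[OF fbound_const[of z "norm z" 1]], of "(0, 0)"]
  by (simp add: strip_def)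

lemma fbound_exp:
  assumes "fbound r N u"
  shows "fbound r (exp N) (\<lambda>x. exp (u x))"
proof -
  have N: "0 \<le> N" using fbound_nonneg[OF assms] .
  show ?thesis
  proof (rule fbound_series[of r "\<lambda>n. N ^ n / fact n" "\<lambda>n x. (1 / fact n) * u x ^ n" "exp N"])
    have "(\<lambda>n. N ^ n / fact n) sums exp N"
      using exp_converges[of N] by (simp add: divide_inverse mult.commute)
    then show "((\<lambda>n. N ^ n / fact n) has_sum exp N) UNIV"
      using N by (intro has_sum_sums_norm) (auto simp: sums_iff)
    show "fbound r (N ^ n / fact n) (\<lambda>x. (1 / fact n) * u x ^ n)" for n
      by (rule fbound_cmult[OF fbound_power[OF assms]]) (simp add: norm_divide)
    show "((\<lambda>n. (1 / fact n) * u x ^ n) has_sum exp (u x)) UNIV" for x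
    proof (rule has_sum_sums_norm)
      show "(\<lambda>n. (1 / fact n) * u x ^ n) sums exp (u x)"
        using exp_converges[of "u x"] by (simp add: scaleR_conv_of_real divide_inverse)
      show "summable (\<lambda>n. norm ((1 / fact n) * u x ^ n))"
        using summable_norm_exp[of "u x"] by (simp add: scaleR_conv_of_real divide_inverse norm_mult norm_inverse)
    qed
  qed simp
qed

lemma fbound_inverse:
  assumes "fbound r N u" "N \<le> 1/2"
  shows "fbound r (2 * N) (\<lambda>x. 1 / (1 + u x) - 1)"
proof -
  have N: "0 \<le> N" using fbound_nonneg[OF assms(1)] .
  show ?thesis
  proof (rule fbound_series[of r "\<lambda>n. N * N ^ n" "\<lambda>n x. (- u x) ^ Suc n" "N * (1 / (1 - N))"])
    have "(\<lambda>n. N ^ n) sums (1 / (1 - N))" using N assms by (intro geometric_sums) auto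
    then have "((\<lambda>n. N ^ n) has_sum (1 / (1 - N))) UNIV"
      using N by (intro has_sum_sums_norm) (auto simp: sums_iff)
    then show "((\<lambda>n. N * N ^ n) has_sum N * (1 / (1 - N))) UNIV" by (rule has_sum_cmult_right)
    have "1 / (1 - N) \<le> 2" using assms by (simp add: divide_simps)
    then show "N * (1 / (1 - N)) \<le> 2 * N" using mult_left_mono[OF _ N, of "1 / (1 - N)" 2] by simp
    show "fbound r (N * N ^ n) (\<lambda>x. (- u x) ^ Suc n)" for n
      using fbound_power[OF fbound_uminus[OF assms(1)], of "Suc n"] by simp
    show "((\<lambda>n. (- u x) ^ Suc n) has_sum 1 / (1 + u x) - 1) UNIV" if "x \<in> strip r" for x
    proof (rule has_sum_sums_norm)
      have n: "norm (- u x) < 1" using norm_le_fbound[OF assms(1) that] assms(2) by simp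
      have nz: "1 + u x \<noteq> 0" using n by (metis add_eq_0_iff norm_minus_cancel norm_one order_less_irrefl)
      have "(\<lambda>n. (- u x) * (- u x) ^ n) sums ((- u x) * (1 / (1 - - u x)))"
        by (intro sums_mult geometric_sums n)
      also have "(- u x) * (1 / (1 - - u x)) = 1 / (1 + u x) - 1"
        using nz by (simp add: field_simps)
      finally show "(\<lambda>n. (- u x) ^ Suc n) sums (1 / (1 + u x) - 1)" by simp
      show "summable (\<lambda>n. norm ((- u x) ^ Suc n))"
        using summable_mult[OF summable_geometric[of "norm (- u x)"], of "norm (- u x)"] n
        by (simp add: norm_power norm_mult)
    qed
  qed
qed

section \<open>Trading strip width for powers of the frequency\<close>

lemma power_le_fact_exp:
  assumes "0 \<le> (x::real)"
  shows "x ^ n \<le> fact n * exp x"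
proof -
  have "x ^ n / fact n \<le> exp x"
  proof -
    have "(\<Sum>i\<in>{n}. x ^ i /\<^sub>R fact i) \<le> (\<Sum>i. x ^ i /\<^sub>R fact i)"
      by (rule sum_le_suminf[OF summable_exp_generic]) (use assms in auto)
    then show ?thesis by (simp add: exp_def divide_inverse mult.commute)
  qed
  then show ?thesis by (simp add: field_simps)
qed

text \<open>The Cauchy estimate on the level of coefficients: a power \<open>n\<close> of the
  frequency costs \<open>fact n / \<delta> ^ n\<close>, by \<open>x ^ n \<le> fact n * exp x\<close>
  at \<open>x = \<delta> * wt k\<close>. It serves derivatives and small divisors alike.\<close>

lemma power_wt_exp_le:
  assumes "0 < \<delta>"
  shows "wt k ^ n * exp ((r - \<delta>) * wt k) \<le> (fact n / \<delta> ^ n) * exp (r * wt k)"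
proof -
  have "(\<delta> * wt k) ^ n * exp ((r - \<delta>) * wt k) \<le> fact n * exp (\<delta> * wt k) * exp ((r - \<delta>) * wt k)"
    using power_le_fact_exp[of "\<delta> * wt k" n] assms by (intro mult_right_mono) auto
  also have "\<dots> = fact n * exp (r * wt k)"
    by (simp add: mult.assoc left_diff_distrib exp_diff)
  finally show ?thesis using assms by (simp add: field_simps power_mult_distrib)
qed

lemma fbound_multiplier:
  assumes "((\<lambda>n. norm (a n) * exp (r * wt (k n))) has_sum S) UNIV" "0 < \<delta>" "0 \<le> C"
    and b: "\<And>n. norm (b n) \<le> C * norm (a n) * wt (k n) ^ d"
  obtains S' where "((\<lambda>n. norm (b n) * exp ((r - \<delta>) * wt (k n))) has_sum S') UNIV"
    "S' \<le> C * fact d / \<delta> ^ d * S"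
proof -
  have le: "norm (b n) * exp ((r - \<delta>) * wt (k n)) \<le> C * fact d / \<delta> ^ d * (norm (a n) * exp (r * wt (k n)))" for n
  proof -
    have "norm (b n) * exp ((r - \<delta>) * wt (k n)) \<le> C * norm (a n) * wt (k n) ^ d * exp ((r - \<delta>) * wt (k n))"
      using b by (intro mult_right_mono) auto
    also have "\<dots> = C * norm (a n) * (wt (k n) ^ d * exp ((r - \<delta>) * wt (k n)))" by simp
    also have "\<dots> \<le> C * norm (a n) * ((fact d / \<delta> ^ d) * exp (r * wt (k n)))"
      using power_wt_exp_le[OF assms(2)] assms(3) by (intro mult_left_mono) auto
    finally show ?thesis by (simp add: mult_ac)
  qed
  have hs: "((\<lambda>n. C * fact d / \<delta> ^ d * (norm (a n) * exp (r * wt (k n)))) has_sum C * fact d / \<delta> ^ d * S) UNIV"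
    by (rule has_sum_cmult_right[OF assms(1)])
  have "(\<lambda>n. norm (b n) * exp ((r - \<delta>) * wt (k n))) summable_on UNIV"
    by (rule summable_on_comparison_test[OF has_sum_imp_summable[OF hs]]) (rule le, simp)
  then obtain S' where S': "((\<lambda>n. norm (b n) * exp ((r - \<delta>) * wt (k n))) has_sum S') UNIV"
    by (auto simp: summable_on_def)
  from has_sum_mono[OF S' hs] le have "S' \<le> C * fact d / \<delta> ^ d * S" by simp
  with S' that show ?thesis by blast
qed

lemma has_sum_echar_infsum:
  assumes "(\<lambda>n. norm (a n) * exp (r * wt (k n))) summable_on UNIV" "x \<in> strip r"
  shows "((\<lambda>n. a n * echar (k n) x) has_sum (\<Sum>\<^sub>\<infinity>n. a n * echar (k n) x)) UNIV"
  by (rule has_sum_infsum[OF abs_summable_summable[OF abs_summable_echar[OF assms]]])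

lemma norm_freq_le: "norm (of_int (fst k) * fst h + of_int (snd k) * snd h :: complex) \<le> wt k * norm h"
proof -
  have "norm (of_int (fst k) * fst h + of_int (snd k) * snd h) 
    \<le> \<bar>of_int (fst k)\<bar> * norm (fst h) + \<bar>of_int (snd k)\<bar> * norm (snd h)"
    by (rule order_trans[OF norm_triangle_ineq]) (simp add: norm_mult)
  also have "\<dots> \<le> \<bar>of_int (fst k)\<bar> * norm h + \<bar>of_int (snd k)\<bar> * norm h"
    using norm_fst_le[of "fst h" "snd h"] norm_snd_le[of "snd h" "fst h"]
    by (intro add_mono mult_left_mono) auto
  finally show ?thesis by (simp add: wt_def algebra_simps)
qed

lemma strip_room:
  assumes "x \<in> strip r"
  obtains \<delta> where "0 < \<delta>" "x \<in> strip (r - 2 * \<delta>)"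
proof
  define \<delta> where "\<delta> = (r - max \<bar>Re (fst x)\<bar> \<bar>Re (snd x)\<bar>) / 4"
  show "0 < \<delta>" "x \<in> strip (r - 2 * \<delta>)"
    using assms by (auto simp: strip_def \<delta>_def max_def field_simps split: if_splits)
qed

text \<open>Termwise differentiation multiplies each coefficient by a component of its frequency,
  and the first-order case of the Cauchy estimate gives \<open>N / \<delta>\<close>.
  Differentiability itself comes from summing the second-order Taylor remainders of the
  characters.\<close>

lemma fbound_has_derivative:
  assumes "fbound r N u"
  obtains D1 D2 where
    "\<And>x. x \<in> strip r \<Longrightarrow> (u has_derivative (\<lambda>h. D1 x * fst h + D2 x * snd h)) (at x)"
    "\<And>\<delta>. 0 < \<delta> \<Longrightarrow> fbound (r - \<delta>) (N / \<delta>) D1" "\<And>\<delta>. 0 < \<delta> \<Longrightarrow> fbound (r - \<delta>) (N / \<delta>) D2"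
proof -
  obtain a :: "nat \<Rightarrow> complex" and k S where
    a: "((\<lambda>n. norm (a n) * exp (r * wt (k n))) has_sum S) UNIV" "S \<le> N" "0 \<le> S"
    "\<And>x. x \<in> strip r \<Longrightarrow> ((\<lambda>n. a n * echar (k n) x) has_sum u x) UNIV"
    by (rule fboundE[OF assms]) (blast intro: that)
  \<comment> \<open>The series does not mention \<open>\<delta>\<close>, so one pair of derivatives
    satisfies the bounds for all \<open>\<delta>\<close> at once.\<close>
  define D where "D (p :: int \<times> int \<Rightarrow> int) x = (\<Sum>\<^sub>\<infinity>n. (a n * of_int (p (k n))) * echar (k n) x)" for p x
  have D: "fbound (r - \<delta>) (N / \<delta>) (D p)"
    "\<And>x. x \<in> strip (r - \<delta>) \<Longrightarrow> ((\<lambda>n. (a n * of_int (p (k n))) * echar (k n) x) has_sum D p x) UNIV"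
    if \<delta>: "0 < \<delta>" and p: "\<And>l. \<bar>of_int (p l)\<bar> \<le> wt l" for p \<delta>
  proof -
    have "norm (a n * of_int (p (k n))) \<le> 1 * norm (a n) * wt (k n) ^ 1" for n
      using p[of "k n"] by (simp add: norm_mult mult_left_mono)
    then obtain S' where S': "((\<lambda>n. norm (a n * of_int (p (k n))) * exp ((r - \<delta>) * wt (k n))) has_sum S') UNIV"
      "S' \<le> 1 * fact 1 / \<delta> ^ 1 * S"
      using fbound_multiplier[OF a(1) \<delta>, of 1 "\<lambda>n. a n * of_int (p (k n))" 1] by auto
    show hs: "((\<lambda>n. (a n * of_int (p (k n))) * echar (k n) x) has_sum D p x) UNIV"
      if "x \<in> strip (r - \<delta>)" for x
      unfolding D_def by (rule has_sum_echar_infsum[OF has_sum_imp_summable[OF S'(1)] that])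
    have "S' \<le> N / \<delta>" using S'(2) divide_right_mono[OF a(2), of \<delta>] \<delta> by simp
    then show "fbound (r - \<delta>) (N / \<delta>) (D p)"
      using S'(1) hs by (intro fboundI)
  qed
  have pf: "\<bar>of_int (fst l)\<bar> \<le> wt l" "\<bar>of_int (snd l)\<bar> \<le> wt l" for l by (auto simp: wt_def)
  have der: "(u has_derivative (\<lambda>h. D fst x * fst h + D snd x * snd h)) (at x)" if xr: "x \<in> strip r" for x
  proof -
    obtain \<delta> where \<delta>: "0 < \<delta>" "x \<in> strip (r - 2 * \<delta>)" by (rule strip_room[OF xr])
    have "norm (a n * of_real (wt (k n) ^ 2)) \<le> 1 * norm (a n) * wt (k n) ^ 2" for n
      by (simp add: norm_mult norm_power)
    then obtain S2 where S2: "((\<lambda>n. norm (a n * of_real (wt (k n) ^ 2)) * exp ((r - \<delta>) * wt (k n))) has_sum S2) UNIV"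
      using fbound_multiplier[OF a(1) \<delta>(1), of 1 "\<lambda>n. a n * of_real (wt (k n) ^ 2)" 2] by auto
    let ?L = "\<lambda>h. D fst x * fst h + D snd x * snd h"
    \<comment> \<open>The remainder of a character is at most its size on the strip of width
      \<open>r - 2 * \<delta>\<close> times
      \<open>(wt k * norm h)\<^sup>2 * exp (\<delta> * wt k)\<close>. The exponential uses up one
      \<open>\<delta>\<close>, and \<open>S2\<close> sums the quadratic weights at width
      \<open>r - \<delta>\<close>.\<close>
    have bound: "norm (u (x + h) - u x - ?L h) \<le> (norm h)\<^sup>2 * S2" if h: "norm h < \<delta>" for h
    proof -
      have "\<bar>Re (fst h)\<bar> < \<delta>" "\<bar>Re (snd h)\<bar> < \<delta>"
        using h norm_fst_le[of "fst h" "snd h"] norm_snd_le[of "snd h" "fst h"]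
          abs_Re_le_cmod[of "fst h"] abs_Re_le_cmod[of "snd h"]
        by auto
      then have xh: "x + h \<in> strip r" using \<delta> by (auto simp: strip_def)
      have x: "x \<in> strip r" "x \<in> strip (r - \<delta>)" using \<delta> by (auto simp: strip_def)
      let ?z = "\<lambda>n. of_int (fst (k n)) * fst h + of_int (snd (k n)) * snd h"
      have 1: "((\<lambda>n. a n * echar (k n) (x + h) - a n * echar (k n) x -
          ((a n * of_int (fst (k n))) * echar (k n) x * fst h + (a n * of_int (snd (k n))) * echar (k n) x * snd h))
          has_sum u (x + h) - u x - ?L h) UNIV"
        by (intro has_sum_diff has_sum_add has_sum_cmult_left a(4) D(2)[OF \<delta>(1)] xh x pf)
      have 2: "((\<lambda>n. (norm h)\<^sup>2 * (norm (a n * of_real (wt (k n) ^ 2)) * exp ((r - \<delta>) * wt (k n))))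
          has_sum (norm h)\<^sup>2 * S2) UNIV"
        by (rule has_sum_cmult_right[OF S2])
      show ?thesis
      proof (rule norm_infsum_le[OF 1 2])
        fix n
        have "a n * echar (k n) (x + h) - a n * echar (k n) x -
          ((a n * of_int (fst (k n))) * echar (k n) x * fst h + (a n * of_int (snd (k n))) * echar (k n) x * snd h)
          = a n * echar (k n) x * (exp (?z n) - 1 - ?z n)"
          by (simp add: echar_add_arg echar_def[of _ h] algebra_simps)
        also have "norm \<dots> \<le> norm (a n) * exp ((r - 2 * \<delta>) * wt (k n)) * ((wt (k n) * norm h)\<^sup>2 * exp (\<delta> * wt (k n)))"
          unfolding norm_mult
        proof (intro mult_mono order_refl norm_echar_le \<delta> order_trans[OF norm_exp_tail_le])
          have "wt (k n) * norm h \<le> \<delta> * wt (k n)" using h by (simp add: mult.commute mult_right_mono)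
          then show "exp (norm (?z n)) \<le> exp (\<delta> * wt (k n))"
            using norm_freq_le[of "k n" h] by simp
          show "(norm (?z n))\<^sup>2 \<le> (wt (k n) * norm h)\<^sup>2"
            using norm_freq_le[of "k n" h] by (intro power_mono) auto
        qed auto
        also have "\<dots> = (norm h)\<^sup>2 * (norm (a n * of_real (wt (k n) ^ 2)) * (exp ((r - 2 * \<delta>) * wt (k n)) * exp (\<delta> * wt (k n))))"
          by (simp add: norm_mult norm_power power_mult_distrib)
        also have "exp ((r - 2 * \<delta>) * wt (k n)) * exp (\<delta> * wt (k n)) = exp ((r - \<delta>) * wt (k n))"
          by (simp add: exp_add[symmetric] algebra_simps)
        finally show "norm (a n * echar (k n) (x + h) - a n * echar (k n) x -
          ((a n * of_int (fst (k n))) * echar (k n) x * fst h + (a n * of_int (snd (k n))) * echar (k n) x * snd h))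
          \<le> (norm h)\<^sup>2 * (norm (a n * of_real (wt (k n) ^ 2)) * exp ((r - \<delta>) * wt (k n)))" .
      qed
    qed
    show ?thesis
    proof (rule has_derivativeI)
      show "bounded_linear ?L"
        by (intro bounded_linear_add bounded_linear_const_mult bounded_linear_fst bounded_linear_snd)
      show "((\<lambda>y. (u y - u x - ?L (y - x)) /\<^sub>R norm (y - x)) \<longlongrightarrow> 0) (at x)"
      proof (rule Lim_null_comparison[where g = "\<lambda>y. norm (y - x) * S2"])
        show "((\<lambda>y. norm (y - x) * S2) \<longlongrightarrow> 0) (at x)"
          by (auto intro!: tendsto_eq_intros)
        have "eventually (\<lambda>y. y \<in> ball x \<delta>) (at x)"
          using \<delta>(1) by (intro eventually_at_in_open') auto
        then show "eventually (\<lambda>y. norm ((u y - u x - ?L (y - x)) /\<^sub>R norm (y - x)) \<le> norm (y - x) * S2) (at x)"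
        proof eventually_elim
          case (elim y)
          have "norm (u y - u x - ?L (y - x)) \<le> (norm (y - x))\<^sup>2 * S2"
            using bound[of "y - x"] elim by (simp add: dist_norm norm_minus_commute)
          then have "inverse (norm (y - x)) * norm (u y - u x - ?L (y - x))
             \<le> inverse (norm (y - x)) * ((norm (y - x))\<^sup>2 * S2)"
            by (intro mult_left_mono) auto
          also have "\<dots> = norm (y - x) * S2"
            by (cases "y = x") (auto simp: power2_eq_square field_simps)
          finally show ?case by simp
        qed
      qed
    qed
  qed
  show ?thesis
    by (rule that[of "D fst" "D snd"]) (use der D(1) pf in blast)+
qed

text \<open>The translation is imaginary, that is, a rotation of the torus. The exponent 3 is what a
  norm argument in the field of degree four generated by \<open>sqrt 2\<close> and
  \<open>sqrt 3\<close> provides.\<close>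

definition dioph :: "real \<Rightarrow> complex \<times> complex \<Rightarrow> bool" where
  "dioph c t \<longleftrightarrow> 0 < c \<and> Re (fst t) = 0 \<and> Re (snd t) = 0 \<and>
     (\<forall>k. k \<noteq> 0 \<longrightarrow> 1 \<le> c * wt k ^ 3 * norm (echar k t - 1))"

text \<open>On a character of frequency \<open>k\<close> the difference operator is multiplication
  by \<open>echar k t - 1\<close>. Dividing by it loses \<open>c * wt k ^ 3\<close>, and the factor
  6 is \<open>fact 3\<close>. Frequency 0 is the only obstruction, and it becomes the constant
  \<open>m\<close>.\<close>

lemma fbound_cohomological:
  assumes u: "fbound r N u" and t: "dioph c t" and \<delta>: "0 < \<delta>"
  obtains m v where "norm m \<le> N" "fbound (r - \<delta>) (6 * c * N / \<delta> ^ 3) v"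
    "\<And>x. x \<in> strip (r - \<delta>) \<Longrightarrow> v (x + t) - v x = u x - m"
proof -
  obtain a :: "nat \<Rightarrow> complex" and k S where
    a: "((\<lambda>n. norm (a n) * exp (r * wt (k n))) has_sum S) UNIV" "S \<le> N" "0 \<le> S"
    "\<And>x. x \<in> strip r \<Longrightarrow> ((\<lambda>n. a n * echar (k n) x) has_sum u x) UNIV"
    by (rule fboundE[OF u]) (blast intro: that)
  have c: "0 < c" "Re (fst t) = 0" "Re (snd t) = 0"
    and div: "\<And>k. k \<noteq> 0 \<Longrightarrow> 1 \<le> c * wt k ^ 3 * norm (echar k t - 1)"
    using t by (auto simp: dioph_def)
  define b where "b n = (if k n = 0 then 0 else a n / (echar (k n) t - 1))" for n
  \<comment> \<open>Several indices may carry frequency 0, so the mean value \<open>m\<close> is a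
    sum of all their coefficients.\<close>
  define a0 where "a0 n = (if k n = 0 then a n else 0)" for n
  have "norm (b n) \<le> c * norm (a n) * wt (k n) ^ 3" for n
  proof (cases "k n = 0")
    case False
    note d = div[OF False]
    then have nz: "norm (echar (k n) t - 1) > 0" by (cases "echar (k n) t = 1") auto
    have "norm (a n) * 1 \<le> norm (a n) * (c * wt (k n) ^ 3 * norm (echar (k n) t - 1))"
      by (intro mult_left_mono d) auto
    with nz show ?thesis using False
      by (simp add: b_def norm_divide divide_le_eq mult_ac)
  qed (auto simp: b_def)
  then obtain S' where S': "((\<lambda>n. norm (b n) * exp ((r - \<delta>) * wt (k n))) has_sum S') UNIV"
    "S' \<le> c * fact 3 / \<delta> ^ 3 * S"
    using fbound_multiplier[OF a(1) \<delta>, of c b 3] c by auto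
  define v where "v x = (\<Sum>\<^sub>\<infinity>n. b n * echar (k n) x)" for x
  have v: "((\<lambda>n. b n * echar (k n) x) has_sum v x) UNIV" if "x \<in> strip (r - \<delta>)" for x
    unfolding v_def by (rule has_sum_echar_infsum[OF has_sum_imp_summable[OF S'(1)] that])
  have "c * fact 3 / \<delta> ^ 3 * S \<le> c * fact 3 / \<delta> ^ 3 * N"
    using a c \<delta> by (intro mult_left_mono) auto
  then have S'N: "S' \<le> 6 * c * N / \<delta> ^ 3" using S'(2) by (simp add: fact_numeral mult_ac)
  have le: "norm (a0 n) \<le> norm (a n) * exp (r * wt (k n))" for n
    by (auto simp: a0_def)
  have "(\<lambda>n. norm (a0 n)) summable_on UNIV"
    by (rule summable_on_comparison_test[OF has_sum_imp_summable[OF a(1)]]) (rule le, simp)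
  then obtain m where m: "(a0 has_sum m) UNIV"
    using abs_summable_summable by (auto simp: summable_on_def)
  show ?thesis
  proof (rule that[of m v])
    show "norm m \<le> N" using norm_infsum_le[OF m a(1)] le a(2) by force
    show "fbound (r - \<delta>) (6 * c * N / \<delta> ^ 3) v" using fboundI[OF S'(1) S'N v] by blast
    fix x assume x: "x \<in> strip (r - \<delta>)"
    have xt: "x + t \<in> strip (r - \<delta>)" using x c by (auto simp: strip_def)
    have xr: "x \<in> strip r" using x \<delta> by (auto simp: strip_def)
    have "((\<lambda>n. b n * echar (k n) (x + t) - b n * echar (k n) x) has_sum v (x + t) - v x) UNIV"
      by (intro has_sum_diff v x xt)
    moreover have "((\<lambda>n. a n * echar (k n) x - a0 n) has_sum u x - m) UNIV"
      by (intro has_sum_diff a(4) m xr)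
    moreover have "b n * echar (k n) (x + t) - b n * echar (k n) x = a n * echar (k n) x - a0 n" for n
    proof (cases "k n = 0")
      case False
      then have "echar (k n) t - 1 \<noteq> 0" using div[OF False] by auto
      then have "b n * (echar (k n) t - 1) = a n" using False by (simp add: b_def)
      then have "b n * (echar (k n) t - 1) * echar (k n) x = a n * echar (k n) x" by simp
      then show ?thesis using False by (simp add: a0_def echar_add_arg algebra_simps)
    qed (simp add: b_def a0_def)
    ultimately show "v (x + t) - v x = u x - m" by (simp add: has_sum_unique)
  qed
qed

section \<open>A Diophantine translation\<close>

text \<open>Compares the parity of valuations: both squares have even multiplicity at
  \<open>p\<close>, whereas \<open>n\<close> has an odd one, with \<open>p = 3\<close> for
  \<open>n = 3\<close> and \<open>p = 2\<close> for \<open>n = 2\<close> and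
  \<open>n = 6\<close>.\<close>

lemma square_eq_nonsquare_multiple:
  fixes x y :: int
  assumes "x\<^sup>2 = n * y\<^sup>2" "n \<in> {2, 3, 6}"
  shows "y = 0"
proof (rule ccontr)
  assume y: "y \<noteq> 0"
  define p :: int where "p = (if n = 3 then 3 else 2)"
  have p: "prime_elem p" by (auto simp: p_def)
  have x: "x \<noteq> 0" using assms y by auto
  have n: "n \<noteq> 0" "odd (multiplicity p n)"
  proof -
    have "multiplicity 2 (2 * 3 :: int) = Suc (multiplicity 2 (3::int))"
      by (rule multiplicity_times_same) auto
    then show "odd (multiplicity p n)" "n \<noteq> 0"
      using assms(2) by (auto simp: p_def not_dvd_imp_multiplicity_0)
  qed
  have "multiplicity p (x\<^sup>2) = 2 * multiplicity p x"
    using x p by (simp add: prime_elem_multiplicity_power_distrib)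
  moreover have "multiplicity p (n * y\<^sup>2) = multiplicity p n + 2 * multiplicity p y"
    using n y p by (simp add: prime_elem_multiplicity_mult_distrib prime_elem_multiplicity_power_distrib)
  ultimately show False using n(2) assms(1)
    by (metis even_add dvd_triv_left)
qed

text \<open>The expression is the norm of \<open>m + a * sqrt 2 + b * sqrt 3\<close> down to the
  rationals. If it vanished, irrationality of \<open>sqrt 2\<close> would force
  \<open>m * a = 0\<close>, and then \<open>sqrt 3\<close> or \<open>sqrt 6\<close> would be
  rational unless \<open>a = b = 0\<close>.\<close>

lemma biquadratic_norm_nonzero:
  fixes a b m :: int
  assumes "(a, b) \<noteq> (0, 0)"
  shows "(m\<^sup>2 + 2 * a\<^sup>2 - 3 * b\<^sup>2)\<^sup>2 - 8 * m\<^sup>2 * a\<^sup>2 \<noteq> 0"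
proof
  assume "(m\<^sup>2 + 2 * a\<^sup>2 - 3 * b\<^sup>2)\<^sup>2 - 8 * m\<^sup>2 * a\<^sup>2 = 0"
  then have e: "(m\<^sup>2 + 2 * a\<^sup>2 - 3 * b\<^sup>2)\<^sup>2 = 2 * (2 * m * a)\<^sup>2"
    by (simp add: power2_eq_square algebra_simps)
  then have "2 * m * a = 0" using square_eq_nonsquare_multiple by blast
  with e have A: "m\<^sup>2 + 2 * a\<^sup>2 = 3 * b\<^sup>2" "m = 0 \<or> a = 0" by auto
  from A(2) show False
  proof
    assume "a = 0"
    then show False using A(1) square_eq_nonsquare_multiple[of m 3 b] assms by simp
  next
    assume "m = 0"
    then have "(2 * a)\<^sup>2 = 6 * b\<^sup>2" using A(1) by (simp add: power2_eq_square)
    then have "b = 0" using square_eq_nonsquare_multiple by blast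
    then show False using A(1) \<open>m = 0\<close> assms by simp
  qed
qed

text \<open>Comparison of chord and arc: near 1 the logarithm recovers the angle and is at most
  twice the chord; elsewhere the chord is at least 1/2, which bounds \<open>x\<close>
  anyway.\<close>

lemma cis_minus_one_ge:
  assumes "\<bar>x\<bar> \<le> 1/2"
  shows "\<bar>x\<bar> \<le> norm (cis (2 * pi * x) - 1)"
proof (cases "norm (cis (2 * pi * x) - 1) < 1/2")
  case True
  have "cis (2 * pi * x) \<noteq> -1"
  proof
    assume "cis (2 * pi * x) = -1"
    then show False using True by simp
  qed
  moreover have "cis (2 * pi * (1/2)) = - 1" "cis (2 * pi * (- 1/2)) = - 1" by (simp_all add: complex_eq_iff)
  ultimately have "x \<noteq> 1/2" "x \<noteq> -1/2" by metis+
  then have "\<bar>x\<bar> < 1/2" using assms by (auto simp: abs_if split: if_splits)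
  then have lt: "- pi < 2 * pi * x" "2 * pi * x \<le> pi"
    using mult_strict_left_mono[of "- (1/2)" x "2 * pi"] mult_strict_left_mono[of x "1/2" "2 * pi"]
    by (auto simp: abs_if split: if_splits)
  have "Ln (cis (2 * pi * x)) = \<i> * of_real (2 * pi * x)"
    unfolding cis_conv_exp by (rule Ln_exp) (use lt in auto)
  then have "norm (Ln (1 + (cis (2 * pi * x) - 1))) = 2 * pi * \<bar>x\<bar>"
    by (simp add: norm_mult abs_mult)
  moreover have "norm (Ln (1 + (cis (2 * pi * x) - 1))) \<le> 2 * norm (cis (2 * pi * x) - 1)"
    using True by (intro norm_Ln_le) auto
  moreover have "1 * \<bar>x\<bar> \<le> pi * \<bar>x\<bar>" using pi_gt3 by (intro mult_right_mono) auto
  ultimately show ?thesis by simp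
qed (use assms in auto)

text \<open>The distance \<open>x\<close> of the phase to the nearest integer is an algebraic
  integer whose four conjugates have a nonzero integer as product. Each of the other three is at
  most \<open>5 * wt k\<close>, hence the constant \<open>125 = 5 ^ 3\<close>.\<close>

lemma dioph_exists: "dioph 125 (\<i> * of_real (2 * pi * sqrt 2), \<i> * of_real (2 * pi * sqrt 3))"
  unfolding dioph_def
proof (intro conjI allI impI)
  fix k :: "int \<times> int" assume k: "k \<noteq> 0"
  obtain a b where kab: "k = (a, b)" by (cases k)
  have ab: "(a, b) \<noteq> (0, 0)" using k kab by (simp add: zero_prod_def)
  define \<theta> where "\<theta> = of_int a * sqrt 2 + of_int b * sqrt 3"
  define m where "m = - round \<theta>"
  define x where "x = \<theta> + of_int m"
  \<comment> \<open>The other three conjugates of \<open>x\<close>, obtained by changing the signs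
    of \<open>sqrt 2\<close> and \<open>sqrt 3\<close>.\<close>
  define y where "y = of_int m + of_int a * sqrt 2 - of_int b * sqrt 3"
  define z where "z = of_int m - of_int a * sqrt 2 + of_int b * sqrt 3"
  define w where "w = of_int m - of_int a * sqrt 2 - of_int b * sqrt 3"
  define A where "A = m\<^sup>2 + 2 * a\<^sup>2 - 3 * b\<^sup>2"
  have x: "\<bar>x\<bar> \<le> 1/2" using of_int_round_abs_le[of \<theta>] by (simp add: x_def m_def abs_minus_commute)
  have xy: "x * y = of_int A + of_int (2 * m * a) * sqrt 2"
    by (simp add: x_def y_def \<theta>_def A_def power2_eq_square algebra_simps)
  have zw: "z * w = of_int A - of_int (2 * m * a) * sqrt 2"
    by (simp add: z_def w_def A_def power2_eq_square algebra_simps)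
  have "x * y * z * w = (of_int A + of_int (2 * m * a) * sqrt 2) * (of_int A - of_int (2 * m * a) * sqrt 2)"
    using xy zw by (simp add: mult.assoc)
  also have "\<dots> = of_int (A\<^sup>2 - 8 * m\<^sup>2 * a\<^sup>2)"
    by (simp add: power2_eq_square algebra_simps)
  finally have "\<bar>x * y * z * w\<bar> = of_int \<bar>A\<^sup>2 - 8 * m\<^sup>2 * a\<^sup>2\<bar>" by simp
  moreover have "\<bar>A\<^sup>2 - 8 * m\<^sup>2 * a\<^sup>2\<bar> \<ge> 1"
    using biquadratic_norm_nonzero[OF ab, of m] unfolding A_def by linarith
  then have "1 \<le> (of_int \<bar>A\<^sup>2 - 8 * m\<^sup>2 * a\<^sup>2\<bar> :: real)" by (simp only: of_int_1_le_iff)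
  ultimately have P: "1 \<le> \<bar>x\<bar> * \<bar>y\<bar> * \<bar>z\<bar> * \<bar>w\<bar>" by (simp only: abs_mult)
  define W where "W = wt k"
  have W: "W = \<bar>of_int a\<bar> + \<bar>of_int b\<bar>" by (simp add: W_def wt_def kab)
  have W1: "1 \<le> W"
  proof -
    have "1 \<le> \<bar>a\<bar> + \<bar>b\<bar>" using ab by auto
    then have "of_int 1 \<le> (of_int (\<bar>a\<bar> + \<bar>b\<bar>) :: real)" by (simp only: of_int_le_iff)
    then show ?thesis by (simp add: W)
  qed
  have s: "sqrt 2 \<le> 2" "sqrt 3 \<le> 2" by (auto intro!: real_le_lsqrt)
  have s2: "\<bar>of_int a * sqrt 2\<bar> \<le> 2 * \<bar>of_int a\<bar>" "\<bar>of_int b * sqrt 3\<bar> \<le> 2 * \<bar>of_int b\<bar>"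
    using mult_left_mono[OF s(1), of "\<bar>of_int a\<bar>"] mult_left_mono[OF s(2), of "\<bar>of_int b\<bar>"]
    by (simp_all add: abs_mult)
  have ys: "y = x - 2 * (of_int b * sqrt 3)" "z = x - 2 * (of_int a * sqrt 2)"
    "w = x - 2 * (of_int b * sqrt 3) - 2 * (of_int a * sqrt 2)"
    by (simp_all add: x_def y_def z_def w_def \<theta>_def)
  have b5: "\<bar>y\<bar> \<le> 5 * W" "\<bar>z\<bar> \<le> 5 * W" "\<bar>w\<bar> \<le> 5 * W"
    unfolding ys using x s2 W1 W by linarith+
  have "\<bar>x\<bar> * \<bar>y\<bar> * \<bar>z\<bar> * \<bar>w\<bar> \<le> \<bar>x\<bar> * (5 * W) * (5 * W) * (5 * W)"
    using b5 W1 by (intro mult_mono) auto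
  with P have P': "1 \<le> 125 * W ^ 3 * \<bar>x\<bar>" by (simp add: power3_eq_cube mult_ac)
  have "of_int (fst k) * fst (\<i> * of_real (2 * pi * sqrt 2), \<i> * of_real (2 * pi * sqrt 3)) +
      of_int (snd k) * snd (\<i> * complex_of_real (2 * pi * sqrt 2), \<i> * complex_of_real (2 * pi * sqrt 3))
      = \<i> * of_real (2 * pi * \<theta>)"
    by (simp add: kab \<theta>_def algebra_simps)
  then have "echar k (\<i> * of_real (2 * pi * sqrt 2), \<i> * of_real (2 * pi * sqrt 3)) = cis (2 * pi * \<theta>)"
    unfolding echar_def cis_conv_exp by simp
  also have "cis (2 * pi * \<theta>) = cis (2 * pi * x)"
    using cis_multiple_2pi[of "of_int m"] by (simp add: x_def distrib_left flip: cis_mult)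
  finally have "\<bar>x\<bar> \<le> norm (echar k (\<i> * of_real (2 * pi * sqrt 2), \<i> * of_real (2 * pi * sqrt 3)) - 1)"
    using cis_minus_one_ge[OF x] by simp
  with P' show "1 \<le> 125 * wt k ^ 3 * norm (echar k (\<i> * of_real (2 * pi * sqrt 2), \<i> * of_real (2 * pi * sqrt 3)) - 1)"
    using W1 unfolding W_def by (meson mult_left_mono order_trans mult_nonneg_nonneg zero_le_power zero_le_numeral wt_nonneg)
qed auto

section \<open>The logarithm of the Blaschke quotient\<close>

text \<open>With \<open>q = p ^ 4\<close>,
  \<open>B(z) = (1 - p / z) (1 - q z) / ((1 - p z) (1 - q / z))\<close>. Expanding the four
  logarithms gives the coefficients \<open>(p ^ n - q ^ n) / n\<close> of
  \<open>z ^ n - 1 / z ^ n\<close>; the index is shifted by one. Thus \<open>slog p x\<close> is a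
  logarithm of \<open>B(exp x)\<close>.\<close>

definition scoeff :: "real \<Rightarrow> nat \<Rightarrow> real" where
  "scoeff p n = (p ^ Suc n - (p ^ 4) ^ Suc n) / real (Suc n)"

definition slog :: "real \<Rightarrow> complex \<Rightarrow> complex" where
  "slog p x = (\<Sum>\<^sub>\<infinity>n. of_real (scoeff p n) * (exp (of_nat (Suc n) * x) - exp (- (of_nat (Suc n) * x))))"

definition dslog :: "real \<Rightarrow> complex \<Rightarrow> complex" where
  "dslog p x = (\<Sum>\<^sub>\<infinity>n. of_real (scoeff p n) *
     (of_nat (Suc n) * (exp (of_nat (Suc n) * x) + exp (- (of_nat (Suc n) * x)))))"

text \<open>The exponent 4 is 3 + 1: \<open>slog\<close> is evaluated where the real part is at most
  3, and one further exponential absorbs the factors up to degree 2 from Taylor's formula. The bound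
  1/8 makes the resulting geometric sums at most 1.\<close>

definition small_param :: "real \<Rightarrow> bool" where
  "small_param p \<longleftrightarrow> 0 < p \<and> p * exp 4 \<le> 1/8"

lemma small_param_less:
  assumes "small_param p"
  shows "0 < p \<and> p < 1/8"
proof -
  have "p * 1 < p * exp 4" using assms by (intro mult_strict_left_mono) (auto simp: small_param_def)
  then show ?thesis using assms unfolding small_param_def by linarith
qed

lemma scoeff_bounds:
  assumes "small_param p"
  shows "0 \<le> scoeff p n" "scoeff p n \<le> p ^ Suc n"
proof -
  have p: "0 < p" "p < 1" using small_param_less[OF assms] by auto
  have "p ^ 4 \<le> p" using p power_decreasing[of 1 4 p] by auto
  then have le: "(p ^ 4) ^ Suc n \<le> p ^ Suc n" using p by (intro power_mono) auto
  then show "0 \<le> scoeff p n" by (simp add: scoeff_def)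
  have "scoeff p n \<le> p ^ Suc n / real (Suc n)"
    unfolding scoeff_def using p by (intro divide_right_mono) auto
  also have "\<dots> \<le> p ^ Suc n / 1" using p by (intro divide_left_mono) auto
  finally show "scoeff p n \<le> p ^ Suc n" by simp
qed

lemma scoeff_weighted_le:
  assumes "small_param p" "d \<le> 2"
  shows "scoeff p n * real (Suc n) ^ d * exp (3 * real (Suc n)) \<le> 2 * (p * exp 4) ^ Suc n"
proof -
  have "real (Suc n) ^ d \<le> real (Suc n) ^ 2" using assms(2) by (intro power_increasing) auto
  also have "\<dots> \<le> 2 * exp (real (Suc n))" using power_le_fact_exp[of "real (Suc n)" 2] by (simp add: fact_numeral)
  finally have "scoeff p n * real (Suc n) ^ d * exp (3 * real (Suc n))
      \<le> p ^ Suc n * (2 * exp (real (Suc n))) * exp (3 * real (Suc n))"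
    using scoeff_bounds[OF assms(1), of n] small_param_less[OF assms(1)]
    by (intro mult_right_mono mult_mono) auto
  also have "\<dots> = 2 * (p ^ Suc n * (exp (real (Suc n)) * exp (3 * real (Suc n))))"
    by (simp only: mult_ac)
  also have "exp (real (Suc n)) * exp (3 * real (Suc n)) = exp 4 ^ Suc n"
    by (subst exp_of_nat_mult[symmetric]) (simp add: exp_add[symmetric] algebra_simps)
  also have "p ^ Suc n * exp 4 ^ Suc n = (p * exp 4) ^ Suc n" by (rule power_mult_distrib[symmetric])
  finally show ?thesis .
qed

lemma small_param_geometric:
  assumes "small_param p"
  shows "((\<lambda>n. 4 * (p * exp 4) ^ Suc n) has_sum 4 * (p * exp 4) / (1 - p * exp 4)) UNIV"
    "4 * (p * exp 4) / (1 - p * exp 4) \<le> 8 * (p * exp 4)"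
proof -
  define P where "P = p * exp 4"
  have P: "0 < P" "P \<le> 1/8" using assms by (auto simp: small_param_def P_def)
  have "(\<lambda>n. P ^ n) sums (1 / (1 - P))" using P by (intro geometric_sums) auto
  then have "((\<lambda>n. P ^ n) has_sum (1 / (1 - P))) UNIV"
    using P by (intro has_sum_sums_norm) (auto simp: sums_iff)
  from has_sum_cmult_right[OF this, of "4 * P"]
  show "((\<lambda>n. 4 * (p * exp 4) ^ Suc n) has_sum 4 * (p * exp 4) / (1 - p * exp 4)) UNIV"
    by (simp add: P_def[symmetric] mult_ac)
  have "4 * P \<le> 8 * P * (1 - P)" using P by (simp add: algebra_simps)
  then show "4 * (p * exp 4) / (1 - p * exp 4) \<le> 8 * (p * exp 4)"
    unfolding P_def[symmetric] using P by (simp add: divide_le_eq mult_ac)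
qed

lemma norm_exp_nat_mult_le:
  assumes "\<bar>Re x\<bar> \<le> 3"
  shows "norm (exp (of_nat m * x)) \<le> exp (3 * real m)" "norm (exp (- (of_nat m * x))) \<le> exp (3 * real m)"
proof -
  have "\<bar>real m * Re x\<bar> \<le> 3 * real m" using assms by (simp add: abs_mult mult.commute mult_left_mono)
  then show "norm (exp (of_nat m * x)) \<le> exp (3 * real m)" "norm (exp (- (of_nat m * x))) \<le> exp (3 * real m)"
    by (auto simp: abs_le_iff)
qed

lemma slog_has_sum:
  assumes "small_param p" "\<bar>Re x\<bar> \<le> 3"
  shows "((\<lambda>n. of_real (scoeff p n) * (exp (of_nat (Suc n) * x) - exp (- (of_nat (Suc n) * x)))) has_sum slog p x) UNIV"
    "((\<lambda>n. of_real (scoeff p n) *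
     (of_nat (Suc n) * (exp (of_nat (Suc n) * x) + exp (- (of_nat (Suc n) * x))))) has_sum dslog p x) UNIV"
proof -
  note sm = has_sum_imp_summable[OF small_param_geometric(1)[OF assms(1)]]
  have b: "norm (exp (of_nat (Suc n) * x) - exp (- (of_nat (Suc n) * x))) \<le> 2 * exp (3 * real (Suc n))"
    "norm (exp (of_nat (Suc n) * x) + exp (- (of_nat (Suc n) * x))) \<le> 2 * exp (3 * real (Suc n))" for n
    using norm_triangle_ineq4[of "exp (of_nat (Suc n) * x)" "exp (- (of_nat (Suc n) * x))"]
      norm_triangle_ineq[of "exp (of_nat (Suc n) * x)" "exp (- (of_nat (Suc n) * x))"]
      norm_exp_nat_mult_le[OF assms(2), of "Suc n"] by linarith+
  note s0 = scoeff_bounds(1)[OF assms(1)]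
  show "((\<lambda>n. of_real (scoeff p n) * (exp (of_nat (Suc n) * x) - exp (- (of_nat (Suc n) * x)))) has_sum slog p x) UNIV"
    unfolding slog_def
  proof (rule has_sum_infsum[OF abs_summable_summable[OF summable_on_comparison_test[OF sm]]])
    fix n
    have "norm (of_real (scoeff p n) * (exp (of_nat (Suc n) * x) - exp (- (of_nat (Suc n) * x))))
      \<le> scoeff p n * (2 * exp (3 * real (Suc n)))"
      unfolding norm_mult norm_of_real abs_of_nonneg[OF s0] using b s0 by (intro mult_left_mono) auto
    also have "\<dots> \<le> 4 * (p * exp 4) ^ Suc n"
      using scoeff_weighted_le[OF assms(1), of 0 n] by simp
    finally show "norm (of_real (scoeff p n) * (exp (of_nat (Suc n) * x) - exp (- (of_nat (Suc n) * x)))) \<le> 4 * (p * exp 4) ^ Suc n" .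
  qed auto
  show "((\<lambda>n. of_real (scoeff p n) *
     (of_nat (Suc n) * (exp (of_nat (Suc n) * x) + exp (- (of_nat (Suc n) * x))))) has_sum dslog p x) UNIV"
    unfolding dslog_def
  proof (rule has_sum_infsum[OF abs_summable_summable[OF summable_on_comparison_test[OF sm]]])
    fix n
    have "norm (of_real (scoeff p n) *
       (of_nat (Suc n) * (exp (of_nat (Suc n) * x) + exp (- (of_nat (Suc n) * x)))))
      \<le> scoeff p n * (real (Suc n) * (2 * exp (3 * real (Suc n))))"
      unfolding norm_mult norm_of_real norm_of_nat abs_of_nonneg[OF s0] using b s0 by (intro mult_left_mono) auto
    also have "\<dots> \<le> 4 * (p * exp 4) ^ Suc n"
      using scoeff_weighted_le[OF assms(1), of 1 n] by simp
    finally show "norm (of_real (scoeff p n) *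
       (of_nat (Suc n) * (exp (of_nat (Suc n) * x) + exp (- (of_nat (Suc n) * x))))) \<le> 4 * (p * exp 4) ^ Suc n" .
  qed auto
qed

definition is_coord :: "(complex \<times> complex \<Rightarrow> complex) \<Rightarrow> bool" where
  "is_coord f \<longleftrightarrow> f = fst \<or> f = snd"

text \<open>The parameter \<open>b\<close> reserves width for a later factor
  \<open>exp (real m * b)\<close> coming from an increment of size \<open>b\<close>.\<close>

lemma fbound_exp_coord:
  assumes f: "is_coord f" and U: "fbound r a U" and le: "r + a + b \<le> 3" "0 \<le> b"
  shows "fbound r (exp ((3 - b) * real m)) (\<lambda>x. exp (of_nat m * (f x + U x)))"
    "fbound r (exp ((3 - b) * real m)) (\<lambda>x. exp (- (of_nat m * (f x + U x))))"
proof -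
  have *: "fbound r (exp ((3 - b) * real m)) (\<lambda>x. exp (c * (f x + U x)))" if c: "c = of_int l" "\<bar>l\<bar> = int m" for c :: complex and l
  proof -
    define k where "k = (if f = fst then (l, 0) else (0 :: int, l))"
    have wk: "wt k = real m" using c(2) by (auto simp: k_def wt_def) 
    have e: "exp (c * f x) = 1 * echar k x" for x
      using f by (auto simp: echar_def k_def c is_coord_def)
    have nc: "norm c = real m" using c by (simp add: norm_of_int)
    have "fbound r (exp (r * real m)) (\<lambda>x. exp (c * f x))"
      unfolding e by (rule fbound_monomial) (simp add: wk)
    moreover have "fbound r (exp (real m * a)) (\<lambda>x. exp (c * U x))"
      by (rule fbound_exp[OF fbound_cmult[OF U]]) (simp add: nc)
    ultimately have "fbound r (exp (r * real m) * exp (real m * a)) (\<lambda>x. exp (c * f x) * exp (c * U x))"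
      by (rule fbound_mult)
    moreover have "exp (r * real m) * exp (real m * a) \<le> exp ((3 - b) * real m)"
      using mult_right_mono[of "r + a" "3 - b" "real m"] le by (simp add: exp_add[symmetric] algebra_simps)
    ultimately show ?thesis
      by (auto simp: exp_add[symmetric] distrib_left intro: fbound_mono)
  qed
  show "fbound r (exp ((3 - b) * real m)) (\<lambda>x. exp (of_nat m * (f x + U x)))"
    using *[of "of_nat m" "int m"] by simp
  show "fbound r (exp ((3 - b) * real m)) (\<lambda>x. exp (- (of_nat m * (f x + U x))))"
    using *[of "- of_nat m" "- int m"] by simp
qed

lemma abs_Re_coord_le:
  assumes "is_coord f" "x \<in> strip r" "fbound r a U" "r + a \<le> 3"
  shows "\<bar>Re (f x + U x)\<bar> \<le> 3"
proof -
  have "\<bar>Re (U x)\<bar> \<le> a" using norm_le_fbound[OF assms(3,2)] abs_Re_le_cmod[of "U x"] by linarith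
  moreover have "\<bar>Re (f x)\<bar> < r" using assms by (auto simp: is_coord_def strip_def)
  ultimately show ?thesis using assms(4) by simp
qed

lemma fbound_slog:
  assumes p: "small_param p" and f: "is_coord f" and U: "fbound r a U" and le: "r + a \<le> 3"
  shows "fbound r (8 * (p * exp 4)) (\<lambda>x. slog p (f x + U x))"
proof (rule fbound_series[OF _ small_param_geometric[OF p]])
  show "((\<lambda>n. of_real (scoeff p n) * (exp (of_nat (Suc n) * (f x + U x)) - exp (- (of_nat (Suc n) * (f x + U x))))) 
      has_sum slog p (f x + U x)) UNIV" if "x \<in> strip r" for x
    by (rule slog_has_sum[OF p abs_Re_coord_le[OF f that U le]])
  fix n
  show "fbound r (4 * (p * exp 4) ^ Suc n) (\<lambda>x. of_real (scoeff p n) * (exp (of_nat (Suc n) * (f x + U x)) - exp (- (of_nat (Suc n) * (f x + U x)))))"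
  proof (rule fbound_cmult[OF fbound_diff[OF fbound_exp_coord[OF f U, of 0]]])
    show "norm (complex_of_real (scoeff p n)) * (exp ((3 - 0) * real (Suc n)) + exp ((3 - 0) * real (Suc n))) \<le> 4 * (p * exp 4) ^ Suc n"
      using scoeff_weighted_le[OF p, of 0 n] scoeff_bounds(1)[OF p, of n] by simp
  qed (use le in auto)
qed

text \<open>Each exponential in the series has a second-order remainder bounded by
  \<open>(m * b)\<^sup>2 * exp (m * b)\<close>. The reserved factor \<open>exp ((3 - b) * m)\<close>
  turns the exponential into \<open>exp (3 * m)\<close>, and \<open>small_param\<close> makes the
  sum of all terms at most \<open>b\<^sup>2\<close>.\<close>

lemma fbound_slog_taylor:
  assumes p: "small_param p" and f: "is_coord f" and U: "fbound r a U" and V: "fbound r b V" and le: "r + a + b \<le> 3"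
  shows "fbound r (b\<^sup>2) (\<lambda>x. slog p (f x + U x + V x) - slog p (f x + U x) - dslog p (f x + U x) * V x)"
proof -
  have b0: "0 \<le> b" using fbound_nonneg[OF V] .
  have UV: "fbound r (a + b) (\<lambda>x. U x + V x)" by (rule fbound_add[OF U V])
  define P where "P = p * exp 4"
  have P: "0 < P" "P \<le> 1/8" using p by (auto simp: small_param_def P_def)
  define E where "E n x = exp (of_nat (Suc n) * (f x + U x)) * (exp (of_nat (Suc n) * V x) - 1 - of_nat (Suc n) * V x)
      - exp (- (of_nat (Suc n) * (f x + U x))) * (exp ((- of_nat (Suc n)) * V x) - 1 - (- of_nat (Suc n)) * V x)" for n x
  show ?thesis
  proof (rule fbound_series[where u = "\<lambda>n x. of_real (scoeff p n) * E n x"])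
    show "((\<lambda>n. b\<^sup>2 * (4 * (p * exp 4) ^ Suc n)) has_sum b\<^sup>2 * (4 * (p * exp 4) / (1 - p * exp 4))) UNIV"
      by (rule has_sum_cmult_right[OF small_param_geometric(1)[OF p]])
    have "4 * (p * exp 4) / (1 - p * exp 4) \<le> 1" using small_param_geometric(2)[OF p] P unfolding P_def by simp
    then show "b\<^sup>2 * (4 * (p * exp 4) / (1 - p * exp 4)) \<le> b\<^sup>2"
      using mult_left_mono[of "4 * (p * exp 4) / (1 - p * exp 4)" 1 "b\<^sup>2"] by simp
    fix n
    define m where "m = Suc n"
    have tail: "fbound r ((real m * b)\<^sup>2 * exp (real m * b)) (\<lambda>x. exp (c * V x) - 1 - c * V x)"
      if "norm c = real m" for c
      by (rule fbound_exp_tail[OF fbound_cmult[OF V]]) (simp add: that)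
    have "fbound r (exp ((3 - b) * real m) * ((real m * b)\<^sup>2 * exp (real m * b))
        + exp ((3 - b) * real m) * ((real m * b)\<^sup>2 * exp (real m * b))) (E n)"
      unfolding E_def m_def[symmetric]
      by (intro fbound_diff fbound_mult fbound_exp_coord[OF f U le b0] tail) auto
    also have "exp ((3 - b) * real m) * ((real m * b)\<^sup>2 * exp (real m * b))
        + exp ((3 - b) * real m) * ((real m * b)\<^sup>2 * exp (real m * b)) = 2 * b\<^sup>2 * (real m ^ 2 * exp (3 * real m))"
    proof -
      have "exp ((3 - b) * real m) * exp (real m * b) = exp (3 * real m)"
        by (simp add: exp_add[symmetric] algebra_simps)
      then show ?thesis by (simp add: power_mult_distrib algebra_simps)
    qed
    finally have "fbound r (2 * b\<^sup>2 * (real m ^ 2 * exp (3 * real m))) (E n)" .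
    then show "fbound r (b\<^sup>2 * (4 * (p * exp 4) ^ Suc n)) (\<lambda>x. of_real (scoeff p n) * E n x)"
    proof (rule fbound_cmult)
      have "norm (complex_of_real (scoeff p n)) * (2 * b\<^sup>2 * (real m ^ 2 * exp (3 * real m)))
        = 2 * b\<^sup>2 * (scoeff p n * real m ^ 2 * exp (3 * real m))"
        using scoeff_bounds(1)[OF p, of n] by simp
      also have "\<dots> \<le> 2 * b\<^sup>2 * (2 * (p * exp 4) ^ Suc n)"
        unfolding m_def by (intro mult_left_mono scoeff_weighted_le[OF p]) auto
      finally show "norm (complex_of_real (scoeff p n)) * (2 * b\<^sup>2 * (real m ^ 2 * exp (3 * real m))) \<le> b\<^sup>2 * (4 * (p * exp 4) ^ Suc n)"
        by simp
    qed
  next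
    fix x assume x: "x \<in> strip r"
    have r1: "\<bar>Re (f x + U x)\<bar> \<le> 3" using abs_Re_coord_le[OF f x U] le b0 by simp
    have r2: "\<bar>Re (f x + U x + V x)\<bar> \<le> 3" using abs_Re_coord_le[OF f x UV] le by (simp add: add.assoc)
    have "((\<lambda>n. of_real (scoeff p n) * (exp (of_nat (Suc n) * (f x + U x + V x)) - exp (- (of_nat (Suc n) * (f x + U x + V x))))
       - of_real (scoeff p n) * (exp (of_nat (Suc n) * (f x + U x)) - exp (- (of_nat (Suc n) * (f x + U x))))
       - of_real (scoeff p n) * (of_nat (Suc n) * (exp (of_nat (Suc n) * (f x + U x)) + exp (- (of_nat (Suc n) * (f x + U x))))) * V x)
      has_sum slog p (f x + U x + V x) - slog p (f x + U x) - dslog p (f x + U x) * V x) UNIV"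
      by (intro has_sum_diff has_sum_cmult_left slog_has_sum[OF p] r1 r2)
    also have "(\<lambda>n. of_real (scoeff p n) * (exp (of_nat (Suc n) * (f x + U x + V x)) - exp (- (of_nat (Suc n) * (f x + U x + V x))))
       - of_real (scoeff p n) * (exp (of_nat (Suc n) * (f x + U x)) - exp (- (of_nat (Suc n) * (f x + U x))))
       - of_real (scoeff p n) * (of_nat (Suc n) * (exp (of_nat (Suc n) * (f x + U x)) + exp (- (of_nat (Suc n) * (f x + U x))))) * V x)
      = (\<lambda>n. of_real (scoeff p n) * E n x)"
    proof
      fix n
      define y where "y = f x + U x"
      define c :: complex where "c = of_nat (Suc n)"
      have e: "exp (c * (y + V x)) = exp (c * y) * exp (c * V x)"
        "exp (- (c * (y + V x))) = exp (- (c * y)) * exp ((- c) * V x)"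
        by (simp_all add: exp_add[symmetric] algebra_simps)
      show "of_real (scoeff p n) * (exp (of_nat (Suc n) * (f x + U x + V x)) - exp (- (of_nat (Suc n) * (f x + U x + V x))))
       - of_real (scoeff p n) * (exp (of_nat (Suc n) * (f x + U x)) - exp (- (of_nat (Suc n) * (f x + U x))))
       - of_real (scoeff p n) * (of_nat (Suc n) * (exp (of_nat (Suc n) * (f x + U x)) + exp (- (of_nat (Suc n) * (f x + U x))))) * V x
       = of_real (scoeff p n) * E n x"
        unfolding E_def y_def[symmetric] c_def[symmetric] e by (simp add: algebra_simps)
    qed
    finally show "((\<lambda>n. of_real (scoeff p n) * E n x) has_sum
      slog p (f x + U x + V x) - slog p (f x + U x) - dslog p (f x + U x) * V x) UNIV" .
  qed
qed

lemma slog_has_field_derivative: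
  assumes p: "small_param p" and x: "\<bar>Re x\<bar> \<le> 3/2"
  shows "(slog p has_field_derivative dslog p x) (at x)"
proof -
  have b: "norm (slog p (x + h) - slog p x - dslog p x * h) \<le> (norm h)\<^sup>2" if "norm h \<le> 1" for h
  proof -
    \<comment> \<open>The real part of \<open>x\<close> enters as a constant perturbation and its
      imaginary part as the point of evaluation, so a thin strip is enough: 1/4 + 3/2 + 1 stays
      below 3.\<close>
    have "fbound (1/4) ((norm h)\<^sup>2) (\<lambda>y. slog p (fst y + of_real (Re x) + h) - slog p (fst y + of_real (Re x)) - dslog p (fst y + of_real (Re x)) * h)"
      by (rule fbound_slog_taylor[OF p _ fbound_const[OF order_refl] fbound_const[OF order_refl]])
        (use that x in \<open>auto simp: is_coord_def\<close>)
    from norm_le_fbound[OF this, of "(\<i> * of_real (Im x), 0)"] show ?thesis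
      by (simp add: strip_def complex_eq[symmetric] add.commute[of "\<i> * _"])
  qed
  show ?thesis
    unfolding has_field_derivative_def
  proof (rule has_derivativeI)
    show "bounded_linear ((*) (dslog p x))" by (rule bounded_linear_mult_right)
    show "((\<lambda>y. (slog p y - slog p x - dslog p x * (y - x)) /\<^sub>R norm (y - x)) \<longlongrightarrow> 0) (at x)"
    proof (rule Lim_null_comparison[where g = "\<lambda>y. norm (y - x)"])
      show "((\<lambda>y. norm (y - x)) \<longlongrightarrow> 0) (at x)"
        by (auto intro!: tendsto_eq_intros)
      have "eventually (\<lambda>y. y \<in> ball x 1) (at x)"
        by (intro eventually_at_in_open') auto
      then show "eventually (\<lambda>y. norm ((slog p y - slog p x - dslog p x * (y - x)) /\<^sub>R norm (y - x)) \<le> norm (y - x)) (at x)"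
      proof eventually_elim
        case (elim y)
        have "norm (slog p y - slog p x - dslog p x * (y - x)) \<le> (norm (y - x))\<^sup>2"
          using b[of "y - x"] elim by (simp add: dist_norm norm_minus_commute)
        then have "inverse (norm (y - x)) * norm (slog p y - slog p x - dslog p x * (y - x))
           \<le> inverse (norm (y - x)) * (norm (y - x))\<^sup>2"
          by (intro mult_left_mono) auto
        also have "\<dots> = norm (y - x)"
          by (cases "y = x") (auto simp: power2_eq_square field_simps)
        finally show ?case by simp
      qed
    qed
  qed
qed

text \<open>The logarithmic form of \<open>B(1 / cnj z) = 1 / cnj (B z)\<close>, which holds because
  the coefficients are real and odd under inversion of \<open>z\<close>.\<close>

lemma slog_reflect: "slog p (- cnj x) = - cnj (slog p x)"
proof -
  have "of_real (scoeff p n) * (exp (of_nat (Suc n) * (- cnj x)) - exp (- (of_nat (Suc n) * (- cnj x))))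
    = - cnj (of_real (scoeff p n) * (exp (of_nat (Suc n) * x) - exp (- (of_nat (Suc n) * x))))" for n
    by (simp add: exp_cnj algebra_simps)
  then show ?thesis unfolding slog_def by (simp only: infsum_uminus infsum_cnj)
qed

section \<open>The Newton step\<close>

text \<open>In logarithmic coordinates this is the inversion in the unit circle on both factors,
  whose fixed points form the torus modulo periods.\<close>

definition refl :: "complex \<times> complex \<Rightarrow> complex \<times> complex" where
  "refl x = (- cnj (fst x), - cnj (snd x))"

lemma refl_refl [simp]: "refl (refl x) = x"
  by (simp add: refl_def)

lemma refl_strip [simp]: "refl x \<in> strip r \<longleftrightarrow> x \<in> strip r"
  by (simp add: refl_def strip_def)

lemma refl_translate: "Re (fst t) = 0 \<Longrightarrow> Re (snd t) = 0 \<Longrightarrow> refl (x + t) = refl x + t"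
  by (simp add: refl_def prod_eq_iff complex_eq_iff)

lemma fbound_refl: "fbound r N u \<Longrightarrow> fbound r N (\<lambda>x. cnj (u (refl x)))"
  unfolding refl_def by (rule fbound_reflect)

text \<open>Forces \<open>u\<close> to be imaginary at imaginary arguments, so that the conjugacy
  keeps the torus in place.\<close>

definition odd_sym :: "real \<Rightarrow> (complex \<times> complex \<Rightarrow> complex) \<Rightarrow> bool" where
  "odd_sym r u \<longleftrightarrow> (\<forall>x\<in>strip r. u (refl x) = - cnj (u x))"

definition pders :: "real \<Rightarrow> (complex \<times> complex \<Rightarrow> complex) \<Rightarrow>
    (complex \<times> complex \<Rightarrow> complex) \<Rightarrow> (complex \<times> complex \<Rightarrow> complex) \<Rightarrow> bool" where
  "pders r u D1 D2 \<longleftrightarrow> (\<forall>x\<in>strip r. (u has_derivative (\<lambda>h. D1 x * fst h + D2 x * snd h)) (at x))"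

lemma pders_unique:
  assumes "(u has_derivative (\<lambda>h. a * fst h + b * snd h)) (at x)"
    "(u has_derivative (\<lambda>h. c * fst h + d * snd h)) (at x)"
  shows "a = (c::complex)" "b = (d::complex)"
proof -
  have "(\<lambda>h. a * fst h + b * snd h) = (\<lambda>h. c * fst h + d * snd h)"
    by (rule has_derivative_unique[OF assms])
  from fun_cong[OF this, of "(1, 0)"] fun_cong[OF this, of "(0, 1)"]
  show "a = c" "b = d" by simp_all
qed

lemma open_strip: "open (strip r)"
  unfolding strip_def Collect_conj_eq
  by (intro open_Int open_Collect_less continuous_intros)

lemma pders_odd_sym:
  assumes u: "odd_sym r u" and D: "pders r u D1 D2" and x: "x \<in> strip r"
  shows "D1 (refl x) = cnj (D1 x)" "D2 (refl x) = cnj (D2 x)"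
proof -
  have bl: "bounded_linear refl"
    unfolding refl_def by (intro bounded_linear_Pair bounded_linear_minus bounded_linear_cnj[THEN bounded_linear_compose]
      bounded_linear_fst bounded_linear_snd)
  have "(u has_derivative (\<lambda>h. D1 x * fst h + D2 x * snd h)) (at (refl (refl x)))"
    using D x by (simp add: pders_def)
  then have "(u \<circ> refl has_derivative (\<lambda>h. D1 x * fst h + D2 x * snd h) \<circ> refl) (at (refl x))"
    by (intro diff_chain_at bounded_linear_imp_has_derivative[OF bl])
  then have "((\<lambda>y. - cnj (u (refl y))) has_derivative (\<lambda>h. - cnj (D1 x * fst (refl h) + D2 x * snd (refl h)))) (at (refl x))"
    unfolding o_def by (intro has_derivative_minus has_derivative_cnj)
  then have 1: "((\<lambda>y. - cnj (u (refl y))) has_derivative (\<lambda>h. cnj (D1 x) * fst h + cnj (D2 x) * snd h)) (at (refl x))"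
    by (simp add: refl_def algebra_simps)
  have 2: "(u has_derivative (\<lambda>h. cnj (D1 x) * fst h + cnj (D2 x) * snd h)) (at (refl x))"
  proof (rule has_derivative_transform_within_open[OF 1 open_strip])
    show "refl x \<in> strip r" using x by simp
    show "- cnj (u (refl y)) = u y" if "y \<in> strip r" for y
    proof -
      have "u (refl (refl y)) = - cnj (u (refl y))" using u that unfolding odd_sym_def by (metis refl_strip)
      then show ?thesis by simp
    qed
  qed
  have 3: "(u has_derivative (\<lambda>h. D1 (refl x) * fst h + D2 (refl x) * snd h)) (at (refl x))"
    using D x by (simp add: pders_def)
  from pders_unique[OF 3 2] show "D1 (refl x) = cnj (D1 x)" "D2 (refl x) = cnj (D2 x)" by auto
qed

text \<open>Existence is Cramer's rule. The bound comes from putting the solution back into the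
  equations: adding the two estimates gives \<open>norm x + norm y \<le> 5/2 * K\<close>.\<close>

lemma near_identity_2x2_solve:
  fixes a b c d e f :: complex
  assumes "norm a \<le> 1/10" "norm b \<le> 1/10" "norm c \<le> 1/10" "norm d \<le> 1/10" "norm e \<le> K" "norm f \<le> K"
  obtains x y where "(1 + a) * x + b * y = e" "c * x + (1 + d) * y = f" "norm x \<le> 5/4 * K" "norm y \<le> 5/4 * K"
proof -
  define D where "D = (1 + a) * (1 + d) - b * c"
  have "D \<noteq> 0"
  proof
    assume "D = 0"
    then have "1 = b * c - a * d - a - d" by (simp add: D_def algebra_simps)
    then have "norm (b * c - a * d - a - d) = 1" by (metis norm_one)
    then have "1 \<le> norm (b * c) + norm (a * d) + norm a + norm d"
      using norm_triangle_ineq4[of "b * c - a * d - a" d] norm_triangle_ineq4[of "b * c - a * d" a]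
        norm_triangle_ineq4[of "b * c" "a * d"] by linarith
    moreover have "norm (b * c) \<le> 1/10 * (1/10)" "norm (a * d) \<le> 1/10 * (1/10)"
      unfolding norm_mult using assms by (intro mult_mono; simp)+
    ultimately show False using assms by simp
  qed
  define x where "x = ((1 + d) * e - b * f) / D"
  define y where "y = ((1 + a) * f - c * e) / D"
  have 1: "(1 + a) * x + b * y = e" 
  proof -
    have "(1 + a) * x + b * y = ((1 + a) * ((1 + d) * e - b * f) + b * ((1 + a) * f - c * e)) / D"
      by (simp add: x_def y_def add_divide_distrib)
    also have "\<dots> = D * e / D" by (simp add: D_def algebra_simps)
    finally show ?thesis using \<open>D \<noteq> 0\<close> by simp
  qed
  have 2: "c * x + (1 + d) * y = f"
  proof -
    have "c * x + (1 + d) * y = (c * ((1 + d) * e - b * f) + (1 + d) * ((1 + a) * f - c * e)) / D"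
      by (simp add: x_def y_def add_divide_distrib)
    also have "\<dots> = D * f / D" by (simp add: D_def algebra_simps)
    finally show ?thesis using \<open>D \<noteq> 0\<close> by simp
  qed
  have xy: "x = e - a * x - b * y" "y = f - c * x - d * y" using 1 2 by (simp_all add: algebra_simps)
  have "norm x \<le> norm e + norm (a * x) + norm (b * y)"
    using norm_triangle_ineq4[of "e - a * x" "b * y"] norm_triangle_ineq4[of e "a * x"]
    unfolding xy(1)[symmetric] by linarith
  moreover have "norm y \<le> norm f + norm (c * x) + norm (d * y)"
    using norm_triangle_ineq4[of "f - c * x" "d * y"] norm_triangle_ineq4[of f "c * x"]
    unfolding xy(2)[symmetric] by linarith
  moreover have "norm (a * x) \<le> 1/10 * norm x" "norm (b * y) \<le> 1/10 * norm y"
    "norm (c * x) \<le> 1/10 * norm x" "norm (d * y) \<le> 1/10 * norm y"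
    unfolding norm_mult using assms by (intro mult_right_mono; simp)+
  ultimately have "norm x \<le> K + 1/10 * norm x + 1/10 * norm y" "norm y \<le> K + 1/10 * norm x + 1/10 * norm y"
    using assms by linarith+
  then have "norm x \<le> 5/4 * K" "norm y \<le> 5/4 * K" by linarith+
  with 1 2 that show ?thesis by blast
qed

text \<open>The entries are those of the inverse matrix by Cramer's rule, minus the identity. The
  determinant is within 1/30 of 1, so its reciprocal \<open>z\<close> is within 1/15 by the Neumann
  series.\<close>

lemma near_identity_inverse_fbound:
  fixes D11 D12 D21 D22 :: "complex \<times> complex \<Rightarrow> complex"
  assumes D: "fbound r (1/64) D11" "fbound r (1/64) D12" "fbound r (1/64) D21" "fbound r (1/64) D22"
  defines "z \<equiv> \<lambda>x. 1 / ((1 + D11 x) * (1 + D22 x) - D12 x * D21 x)"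
  shows "fbound r (1/10) (\<lambda>x. z x * (1 + D22 x) - 1)" "fbound r (1/10) (\<lambda>x. - (z x * D12 x))"
    "fbound r (1/10) (\<lambda>x. - (z x * D21 x))" "fbound r (1/10) (\<lambda>x. z x * (1 + D11 x) - 1)"
    "\<And>x. x \<in> strip r \<Longrightarrow> z x * ((1 + D11 x) * (1 + D22 x) - D12 x * D21 x) = 1"
proof -
  define y where "y x = D11 x + D22 x + D11 x * D22 x - D12 x * D21 x" for x
  have "fbound r (1/64 + 1/64 + 1/64 * (1/64) + 1/64 * (1/64)) y"
    unfolding y_def by (intro fbound_add fbound_diff fbound_mult D)
  then have y: "fbound r (1/30) y" by (rule fbound_mono) auto
  have zy: "z x = 1 / (1 + y x)" for x
    by (simp add: z_def y_def algebra_simps)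
  have z1: "fbound r (1/15) (\<lambda>x. z x - 1)"
    using fbound_inverse[OF y] unfolding zy by simp
  have z: "fbound r (1 + 1/15) z"
    using fbound_add[OF fbound_const[of 1 1 r] z1] by simp
  have diag: "fbound r (1/10) (\<lambda>x. z x * (1 + d x) - 1)" if "fbound r (1/64) d" for d
  proof -
    have "fbound r (1/15 + (1 + 1/15) * (1/64)) (\<lambda>x. (z x - 1) + z x * d x)"
      by (intro fbound_add fbound_mult z z1 that)
    then have "fbound r (1/10) (\<lambda>x. (z x - 1) + z x * d x)" by (rule fbound_mono) auto
    then show ?thesis by (simp add: algebra_simps)
  qed
  have off: "fbound r (1/10) (\<lambda>x. - (z x * d x))" if "fbound r (1/64) d" for d
    by (rule fbound_mono[OF fbound_uminus[OF fbound_mult[OF z that]]]) auto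
  show "fbound r (1/10) (\<lambda>x. z x * (1 + D22 x) - 1)" "fbound r (1/10) (\<lambda>x. - (z x * D12 x))"
    "fbound r (1/10) (\<lambda>x. - (z x * D21 x))" "fbound r (1/10) (\<lambda>x. z x * (1 + D11 x) - 1)"
    by (intro diag off D)+
  show "z x * ((1 + D11 x) * (1 + D22 x) - D12 x * D21 x) = 1" if "x \<in> strip r" for x
  proof -
    have "norm (y x) \<le> 1/30" by (rule norm_le_fbound[OF y that])
    then have "1 + y x \<noteq> 0" using norm_minus_cancel[of "1::complex"] by (auto simp: add_eq_0_iff)
    moreover have "(1 + D11 x) * (1 + D22 x) - D12 x * D21 x = 1 + y x" by (simp add: y_def algebra_simps)
    ultimately show ?thesis by (simp add: zy)
  qed
qed

text \<open>Solves \<open>M \<Delta>w = d - E\<close> with \<open>M = 1 + (D\<^sub>i\<^sub>j)\<close>; the constants \<open>d\<close> absorb the mean values, and \<open>w\<close> is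
  antisymmetrised at the end, which preserves the equation because all data are symmetric.\<close>

lemma linearized_equation:
  assumes t: "dioph c t" and \<delta>: "0 < \<delta>"
    and D: "fbound r (1/64) D11" "fbound r (1/64) D12" "fbound r (1/64) D21" "fbound r (1/64) D22"
    and E: "fbound r \<epsilon> E1" "fbound r \<epsilon> E2" and symE: "odd_sym r E1" "odd_sym r E2"
    and symD: "\<And>x. x \<in> strip r \<Longrightarrow> D11 (refl x) = cnj (D11 x)" "\<And>x. x \<in> strip r \<Longrightarrow> D12 (refl x) = cnj (D12 x)"
      "\<And>x. x \<in> strip r \<Longrightarrow> D21 (refl x) = cnj (D21 x)" "\<And>x. x \<in> strip r \<Longrightarrow> D22 (refl x) = cnj (D22 x)"
  obtains w1 w2 d1 d2 where "fbound (r - \<delta>) (10 * c * \<epsilon> / \<delta> ^ 3) w1" "fbound (r - \<delta>) (10 * c * \<epsilon> / \<delta> ^ 3) w2"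
    "odd_sym (r - \<delta>) w1" "odd_sym (r - \<delta>) w2" "norm d1 \<le> 2 * \<epsilon>" "norm d2 \<le> 2 * \<epsilon>" "Re d1 = 0" "Re d2 = 0"
    "\<forall>x\<in>strip (r - \<delta>). (1 + D11 x) * (w1 (x + t) - w1 x) + D12 x * (w2 (x + t) - w2 x) = d1 - E1 x"
    "\<forall>x\<in>strip (r - \<delta>). D21 x * (w1 (x + t) - w1 x) + (1 + D22 x) * (w2 (x + t) - w2 x) = d2 - E2 x"
proof -
  have c: "0 < c" and t0: "Re (fst t) = 0" "Re (snd t) = 0" using t by (auto simp: dioph_def)
  have \<epsilon>: "0 \<le> \<epsilon>" using fbound_nonneg[OF E(1)] .
  define z where "z x = 1 / ((1 + D11 x) * (1 + D22 x) - D12 x * D21 x)" for x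
  define A11 where "A11 x = z x * (1 + D22 x)" for x
  define A12 where "A12 x = - (z x * D12 x)" for x
  define A21 where "A21 x = - (z x * D21 x)" for x
  define A22 where "A22 x = z x * (1 + D11 x)" for x
  note I = near_identity_inverse_fbound[OF D, folded z_def, folded A11_def A12_def A21_def A22_def]
  have Ab: "fbound r (11/10) A11" "fbound r (11/10) A22"
    using fbound_add[OF fbound_const[of 1 1 r] I(1)] fbound_add[OF fbound_const[of 1 1 r] I(4)] by simp_all
  have Asym: "A11 (refl x) = cnj (A11 x)" "A12 (refl x) = cnj (A12 x)" "A21 (refl x) = cnj (A21 x)" "A22 (refl x) = cnj (A22 x)"
    if "x \<in> strip r" for x
    using symD[OF that] by (simp_all add: A11_def A12_def A21_def A22_def z_def)
  have H: "fbound r (12/10 * \<epsilon>) (\<lambda>x. A11 x * E1 x + A12 x * E2 x)" "fbound r (12/10 * \<epsilon>) (\<lambda>x. A21 x * E1 x + A22 x * E2 x)"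
    using fbound_add[OF fbound_mult[OF Ab(1) E(1)] fbound_mult[OF I(2) E(2)]]
      fbound_add[OF fbound_mult[OF I(3) E(1)] fbound_mult[OF Ab(2) E(2)]] by (simp_all add: algebra_simps)
  \<comment> \<open>The equation is solved separately for every entry of the inverse matrix and for
    its product with \<open>E\<close>, because the constants to be subtracted depend on all of these
    mean values.\<close>
  let ?G = "6 * c * (1/10) / \<delta> ^ 3"
  obtain m11 v11 where v11: "norm m11 \<le> 1/10" "fbound (r - \<delta>) ?G v11"
    "\<And>x. x \<in> strip (r - \<delta>) \<Longrightarrow> v11 (x + t) - v11 x = A11 x - 1 - m11" by (rule fbound_cohomological[OF I(1) t \<delta>]) (blast intro: that)
  obtain m12 v12 where v12: "norm m12 \<le> 1/10" "fbound (r - \<delta>) ?G v12"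
    "\<And>x. x \<in> strip (r - \<delta>) \<Longrightarrow> v12 (x + t) - v12 x = A12 x - m12" by (rule fbound_cohomological[OF I(2) t \<delta>]) (blast intro: that)
  obtain m21 v21 where v21: "norm m21 \<le> 1/10" "fbound (r - \<delta>) ?G v21"
    "\<And>x. x \<in> strip (r - \<delta>) \<Longrightarrow> v21 (x + t) - v21 x = A21 x - m21" by (rule fbound_cohomological[OF I(3) t \<delta>]) (blast intro: that)
  obtain m22 v22 where v22: "norm m22 \<le> 1/10" "fbound (r - \<delta>) ?G v22"
    "\<And>x. x \<in> strip (r - \<delta>) \<Longrightarrow> v22 (x + t) - v22 x = A22 x - 1 - m22" by (rule fbound_cohomological[OF I(4) t \<delta>]) (blast intro: that)
  obtain n1 h1 where h1: "norm n1 \<le> 12/10 * \<epsilon>" "fbound (r - \<delta>) (6 * c * (12/10 * \<epsilon>) / \<delta> ^ 3) h1"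
    "\<And>x. x \<in> strip (r - \<delta>) \<Longrightarrow> h1 (x + t) - h1 x = A11 x * E1 x + A12 x * E2 x - n1" by (rule fbound_cohomological[OF H(1) t \<delta>]) (blast intro: that)
  obtain n2 h2 where h2: "norm n2 \<le> 12/10 * \<epsilon>" "fbound (r - \<delta>) (6 * c * (12/10 * \<epsilon>) / \<delta> ^ 3) h2"
    "\<And>x. x \<in> strip (r - \<delta>) \<Longrightarrow> h2 (x + t) - h2 x = A21 x * E1 x + A22 x * E2 x - n2" by (rule fbound_cohomological[OF H(2) t \<delta>]) (blast intro: that)
  \<comment> \<open>The constants that give the inverse matrix applied to
    \<open>(e1 - E1, e2 - E2)\<close> mean value 0. By linearity the separate solutions then combine
    into \<open>k1\<close> and \<open>k2\<close>.\<close>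
  obtain e1 e2 where e: "(1 + m11) * e1 + m12 * e2 = n1" "m21 * e1 + (1 + m22) * e2 = n2"
    "norm e1 \<le> 5/4 * (12/10 * \<epsilon>)" "norm e2 \<le> 5/4 * (12/10 * \<epsilon>)"
    using near_identity_2x2_solve[OF v11(1) v12(1) v21(1) v22(1) h1(1) h2(1)] by blast
  have e2: "norm e1 \<le> 2 * \<epsilon>" "norm e2 \<le> 2 * \<epsilon>" using e(3,4) \<epsilon> by auto
  define k1 where "k1 x = v11 x * e1 + v12 x * e2 - h1 x" for x
  define k2 where "k2 x = v21 x * e1 + v22 x * e2 - h2 x" for x
  have kb: "fbound (r - \<delta>) (10 * c * \<epsilon> / \<delta> ^ 3) k1" "fbound (r - \<delta>) (10 * c * \<epsilon> / \<delta> ^ 3) k2"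
  proof -
    have le: "?G * (2 * \<epsilon>) + ?G * (2 * \<epsilon>) + 6 * c * (12/10 * \<epsilon>) / \<delta> ^ 3 \<le> 10 * c * \<epsilon> / \<delta> ^ 3"
      using c \<epsilon> \<delta> by (simp add: field_simps)
    have "fbound (r - \<delta>) (?G * (2 * \<epsilon>) + ?G * (2 * \<epsilon>) + 6 * c * (12/10 * \<epsilon>) / \<delta> ^ 3) k1"
      unfolding k1_def by (intro fbound_add fbound_diff fbound_mult v11 v12 h1 fbound_const e2)
    then show "fbound (r - \<delta>) (10 * c * \<epsilon> / \<delta> ^ 3) k1" using le by (rule fbound_mono[OF _ order_refl])
    have "fbound (r - \<delta>) (?G * (2 * \<epsilon>) + ?G * (2 * \<epsilon>) + 6 * c * (12/10 * \<epsilon>) / \<delta> ^ 3) k2"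
      unfolding k2_def by (intro fbound_add fbound_diff fbound_mult v21 v22 h2 fbound_const e2)
    then show "fbound (r - \<delta>) (10 * c * \<epsilon> / \<delta> ^ 3) k2" using le by (rule fbound_mono[OF _ order_refl])
  qed
  have keq: "k1 (x + t) - k1 x = A11 x * (e1 - E1 x) + A12 x * (e2 - E2 x)"
    "k2 (x + t) - k2 x = A21 x * (e1 - E1 x) + A22 x * (e2 - E2 x)" if x: "x \<in> strip (r - \<delta>)" for x
  proof -
    have "k1 (x + t) - k1 x = (v11 (x + t) - v11 x) * e1 + (v12 (x + t) - v12 x) * e2 - (h1 (x + t) - h1 x)"
      by (simp add: k1_def algebra_simps)
    also have "\<dots> = A11 x * (e1 - E1 x) + A12 x * (e2 - E2 x) + (n1 - ((1 + m11) * e1 + m12 * e2))"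
      unfolding v11(3)[OF x] v12(3)[OF x] h1(3)[OF x] by (simp add: algebra_simps)
    finally show "k1 (x + t) - k1 x = A11 x * (e1 - E1 x) + A12 x * (e2 - E2 x)" by (simp add: e)
    have "k2 (x + t) - k2 x = (v21 (x + t) - v21 x) * e1 + (v22 (x + t) - v22 x) * e2 - (h2 (x + t) - h2 x)"
      by (simp add: k2_def algebra_simps)
    also have "\<dots> = A21 x * (e1 - E1 x) + A22 x * (e2 - E2 x) + (n2 - (m21 * e1 + (1 + m22) * e2))"
      unfolding v21(3)[OF x] v22(3)[OF x] h2(3)[OF x] by (simp add: algebra_simps)
    finally show "k2 (x + t) - k2 x = A21 x * (e1 - E1 x) + A22 x * (e2 - E2 x)" by (simp add: e)
  qed
  \<comment> \<open>Projection onto the functions with \<open>odd_sym\<close>. On the constants it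
    keeps just the imaginary part.\<close>
  define anti where "anti k x = (1/2) * (k x - cnj (k (refl x)))" for k :: "complex \<times> complex \<Rightarrow> complex" and x
  define d1 where "d1 = (1/2) * (e1 - cnj e1)"
  define d2 where "d2 = (1/2) * (e2 - cnj e2)"
  have antib: "fbound (r - \<delta>) N (anti k)" if "fbound (r - \<delta>) N k" for N k
    unfolding anti_def by (rule fbound_cmult[OF fbound_diff[OF that fbound_refl[OF that]]]) auto
  have antis: "odd_sym (r - \<delta>) (anti k)" for k by (auto simp: odd_sym_def anti_def algebra_simps)
  have dn: "norm ((1/2) * (e - cnj e)) \<le> K" if "norm e \<le> K" for e :: complex and K
    using norm_triangle_ineq4[of e "cnj e"] that by (simp add: norm_mult)
  have delta: "anti k (x + t) - anti k x = (1/2) * ((k (x + t) - k x) - cnj (k (refl x + t) - k (refl x)))" for k x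
    unfolding anti_def refl_translate[OF t0] by (simp add: algebra_simps)
  have weq: "anti k1 (x + t) - anti k1 x = A11 x * (d1 - E1 x) + A12 x * (d2 - E2 x)"
    "anti k2 (x + t) - anti k2 x = A21 x * (d1 - E1 x) + A22 x * (d2 - E2 x)" if x: "x \<in> strip (r - \<delta>)" for x
  proof -
    have rx: "refl x \<in> strip (r - \<delta>)" using x by simp
    have xr: "x \<in> strip r" using x \<delta> strip_mono[of "r - \<delta>" r] by auto
    have Er: "E1 (refl x) = - cnj (E1 x)" "E2 (refl x) = - cnj (E2 x)"
      using symE xr by (auto simp: odd_sym_def)
    show "anti k1 (x + t) - anti k1 x = A11 x * (d1 - E1 x) + A12 x * (d2 - E2 x)"
      "anti k2 (x + t) - anti k2 x = A21 x * (d1 - E1 x) + A22 x * (d2 - E2 x)"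
      unfolding delta keq[OF x] keq[OF rx] Asym[OF xr] Er d1_def d2_def
      by (simp_all add: algebra_simps) (simp_all add: field_simps)
  qed
  show ?thesis
  proof (rule that[of "anti k1" "anti k2" d1 d2])
    have main: "(1 + D11 x) * (anti k1 (x + t) - anti k1 x) + D12 x * (anti k2 (x + t) - anti k2 x) = d1 - E1 x"
      "D21 x * (anti k1 (x + t) - anti k1 x) + (1 + D22 x) * (anti k2 (x + t) - anti k2 x) = d2 - E2 x"
      if x: "x \<in> strip (r - \<delta>)" for x
    proof -
      have xr: "x \<in> strip r" using x \<delta> strip_mono[of "r - \<delta>" r] by auto
      note zi = I(5)[OF xr]
      have "(1 + D11 x) * (anti k1 (x + t) - anti k1 x) + D12 x * (anti k2 (x + t) - anti k2 x)
        = z x * ((1 + D11 x) * (1 + D22 x) - D12 x * D21 x) * (d1 - E1 x)"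
        unfolding weq[OF x] A11_def A12_def A21_def A22_def by (simp add: algebra_simps)
      then show "(1 + D11 x) * (anti k1 (x + t) - anti k1 x) + D12 x * (anti k2 (x + t) - anti k2 x) = d1 - E1 x"
        by (simp add: zi)
      have "D21 x * (anti k1 (x + t) - anti k1 x) + (1 + D22 x) * (anti k2 (x + t) - anti k2 x)
        = z x * ((1 + D11 x) * (1 + D22 x) - D12 x * D21 x) * (d2 - E2 x)"
        unfolding weq[OF x] A11_def A12_def A21_def A22_def by (simp add: algebra_simps)
      then show "D21 x * (anti k1 (x + t) - anti k1 x) + (1 + D22 x) * (anti k2 (x + t) - anti k2 x) = d2 - E2 x"
        by (simp add: zi)
    qed
    show "\<forall>x\<in>strip (r - \<delta>). (1 + D11 x) * (anti k1 (x + t) - anti k1 x) + D12 x * (anti k2 (x + t) - anti k2 x) = d1 - E1 x"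
      "\<forall>x\<in>strip (r - \<delta>). D21 x * (anti k1 (x + t) - anti k1 x) + (1 + D22 x) * (anti k2 (x + t) - anti k2 x) = d2 - E2 x"
      using main by blast+
    show "norm d1 \<le> 2 * \<epsilon>" "norm d2 \<le> 2 * \<epsilon>" unfolding d1_def d2_def by (rule dn[OF e2(1)], rule dn[OF e2(2)])
    show "Re d1 = 0" "Re d2 = 0" by (simp_all add: d1_def d2_def)
  qed (intro antib antis kb)+
qed

text \<open>The defect of \<open>x \<mapsto> x + u x\<close> as a conjugacy from the translation by
  \<open>t\<close> to the logarithm of the map with factors
  \<open>exp (t\<^sub>i + c\<^sub>i)\<close>. The second coordinate is updated first, so
  \<open>res2\<close> reads \<open>u1\<close> at \<open>x\<close> whereas \<open>res1\<close> reads
  \<open>u2\<close> at \<open>x + t\<close>.\<close>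

definition res1 :: "real \<Rightarrow> complex \<times> complex \<Rightarrow> (complex \<times> complex \<Rightarrow> complex) \<Rightarrow> (complex \<times> complex \<Rightarrow> complex) \<Rightarrow> complex \<Rightarrow> complex \<times> complex \<Rightarrow> complex" where
  "res1 p t u1 u2 c1 x = u1 (x + t) - u1 x - c1 - slog p (snd (x + t) + u2 (x + t))"

definition res2 :: "real \<Rightarrow> complex \<times> complex \<Rightarrow> (complex \<times> complex \<Rightarrow> complex) \<Rightarrow> (complex \<times> complex \<Rightarrow> complex) \<Rightarrow> complex \<Rightarrow> complex \<times> complex \<Rightarrow> complex" where
  "res2 p t u1 u2 c2 x = u2 (x + t) - u2 x - c2 - slog p (fst x + u1 x)"

lemma pders_translate:
  assumes "pders r u D1 D2" "Re (fst t) = 0" "Re (snd t) = 0"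
  shows "pders r (\<lambda>x. u (x + t)) (\<lambda>x. D1 (x + t)) (\<lambda>x. D2 (x + t))"
  unfolding pders_def
proof
  fix x assume "x \<in> strip r"
  then have "x + t \<in> strip r" using assms by (simp add: strip_def)
  then have "(u has_derivative (\<lambda>h. D1 (x + t) * fst h + D2 (x + t) * snd h)) (at (x + t))"
    using assms by (simp add: pders_def)
  moreover have "((\<lambda>x. x + t) has_derivative (\<lambda>h. h)) (at x)" by (auto intro!: derivative_eq_intros)
  ultimately show "((\<lambda>x. u (x + t)) has_derivative (\<lambda>h. D1 (x + t) * fst h + D2 (x + t) * snd h)) (at x)"
    using diff_chain_at[of "\<lambda>x. x + t" "\<lambda>h. h" x u] by (simp add: o_def)
qed

lemma slog_compose_has_derivative:
  assumes p: "small_param p" and g: "(g has_derivative (\<lambda>h. a * fst h + b * snd h)) (at x)"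
    and re: "\<bar>Re (g x)\<bar> \<le> 3/2"
  shows "((\<lambda>x. slog p (g x)) has_derivative (\<lambda>h. dslog p (g x) * a * fst h + dslog p (g x) * b * snd h)) (at x)"
proof -
  have "(slog p has_derivative (\<lambda>h. dslog p (g x) * h)) (at (g x))"
    using slog_has_field_derivative[OF p re] by (simp add: has_field_derivative_def)
  from diff_chain_at[OF g this] show ?thesis
    by (simp add: o_def algebra_simps)
qed

text \<open>These derivatives are the coefficients left over in the Newton step. That they are
  derivatives of the residual is what makes them small.\<close>

lemma pders_res:
  assumes p: "small_param p" and t: "Re (fst t) = 0" "Re (snd t) = 0" and r: "r \<le> 1"
    and u: "fbound r (1/2) u1" "fbound r (1/2) u2" and D: "pders r u1 D11 D12" "pders r u2 D21 D22"
  shows "pders r (res1 p t u1 u2 c1)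
      (\<lambda>x. D11 (x + t) - D11 x - dslog p (snd (x + t) + u2 (x + t)) * D21 (x + t))
      (\<lambda>x. D12 (x + t) - D12 x - dslog p (snd (x + t) + u2 (x + t)) * (1 + D22 (x + t)))"
    "pders r (res2 p t u1 u2 c2)
      (\<lambda>x. D21 (x + t) - D21 x - dslog p (fst x + u1 x) * (1 + D11 x))
      (\<lambda>x. D22 (x + t) - D22 x - dslog p (fst x + u1 x) * D12 x)"
proof -
  note Dt = pders_translate[OF D(1) t] pders_translate[OF D(2) t]
  note d = D[unfolded pders_def, rule_format] Dt[unfolded pders_def, rule_format]
  have re: "\<bar>Re (f x + v x)\<bar> \<le> 3/2" if "is_coord f" "x \<in> strip r" "fbound r (1/2) v" for f v x
  proof -
    have "\<bar>Re (v x)\<bar> \<le> 1/2" using norm_le_fbound[OF that(3,2)] abs_Re_le_cmod[of "v x"] by linarith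
    moreover have "\<bar>Re (f x)\<bar> < r" using that by (auto simp: is_coord_def strip_def)
    ultimately show ?thesis using r abs_triangle_ineq[of "Re (f x)" "Re (v x)"] by simp
  qed
  show "pders r (res1 p t u1 u2 c1)
      (\<lambda>x. D11 (x + t) - D11 x - dslog p (snd (x + t) + u2 (x + t)) * D21 (x + t))
      (\<lambda>x. D12 (x + t) - D12 x - dslog p (snd (x + t) + u2 (x + t)) * (1 + D22 (x + t)))"
    unfolding pders_def
  proof
    fix x assume x: "x \<in> strip r"
    have xt: "x + t \<in> strip r" using x t by (simp add: strip_def)
    have g: "((\<lambda>x. snd (x + t) + u2 (x + t)) has_derivative (\<lambda>h. D21 (x + t) * fst h + (1 + D22 (x + t)) * snd h)) (at x)"
      by (rule derivative_eq_intros d(4)[OF x] refl)+ (simp add: algebra_simps)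
    have "\<bar>Re (snd (x + t) + u2 (x + t))\<bar> \<le> 3/2" by (rule re[OF _ xt u(2)]) (simp add: is_coord_def)
    note s = slog_compose_has_derivative[OF p g this]
    show "(res1 p t u1 u2 c1 has_derivative
      (\<lambda>h. (D11 (x + t) - D11 x - dslog p (snd (x + t) + u2 (x + t)) * D21 (x + t)) * fst h +
           (D12 (x + t) - D12 x - dslog p (snd (x + t) + u2 (x + t)) * (1 + D22 (x + t))) * snd h)) (at x)"
      unfolding res1_def
      by (rule has_derivative_eq_rhs[OF has_derivative_diff[OF has_derivative_diff[OF has_derivative_diff[OF d(3)[OF x] d(1)[OF x]] has_derivative_const] s]])
        (auto simp: algebra_simps)
  qed
  show "pders r (res2 p t u1 u2 c2)
      (\<lambda>x. D21 (x + t) - D21 x - dslog p (fst x + u1 x) * (1 + D11 x))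
      (\<lambda>x. D22 (x + t) - D22 x - dslog p (fst x + u1 x) * D12 x)"
    unfolding pders_def
  proof
    fix x assume x: "x \<in> strip r"
    have g: "((\<lambda>x. fst x + u1 x) has_derivative (\<lambda>h. (1 + D11 x) * fst h + D12 x * snd h)) (at x)"
      by (rule derivative_eq_intros d(1)[OF x] refl)+ (simp add: algebra_simps)
    have "\<bar>Re (fst x + u1 x)\<bar> \<le> 3/2" by (rule re[OF _ x u(1)]) (simp add: is_coord_def)
    note s = slog_compose_has_derivative[OF p g this]
    show "(res2 p t u1 u2 c2 has_derivative
      (\<lambda>h. (D21 (x + t) - D21 x - dslog p (fst x + u1 x) * (1 + D11 x)) * fst h +
           (D22 (x + t) - D22 x - dslog p (fst x + u1 x) * D12 x) * snd h)) (at x)"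
      unfolding res2_def
      by (rule has_derivative_eq_rhs[OF has_derivative_diff[OF has_derivative_diff[OF has_derivative_diff[OF d(4)[OF x] d(2)[OF x]] has_derivative_const] s]])
        (auto simp: algebra_simps)
  qed
qed

lemma odd_sym_res:
  assumes t: "Re (fst t) = 0" "Re (snd t) = 0" and u: "odd_sym r u1" "odd_sym r u2" and c: "Re c1 = 0" "Re c2 = 0"
  shows "odd_sym r (res1 p t u1 u2 c1)" "odd_sym r (res2 p t u1 u2 c2)"
proof -
  have cc: "cnj c1 = - c1" "cnj c2 = - c2" using c by (auto simp: complex_eq_iff)
  have sr: "fst (refl x) = - cnj (fst x)" "snd (refl x) = - cnj (snd x)" for x by (simp_all add: refl_def)
  have s: "slog p (- cnj a + - cnj b) = - cnj (slog p (a + b))" for a b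
    using slog_reflect[of p "a + b"] by simp
  have tt: "x + t \<in> strip r" if "x \<in> strip r" for x using that t by (simp add: strip_def)
  have us: "u1 (refl x) = - cnj (u1 x)" "u2 (refl x) = - cnj (u2 x)" if "x \<in> strip r" for x
    using u that by (auto simp: odd_sym_def)
  show "odd_sym r (res1 p t u1 u2 c1)"
    unfolding odd_sym_def res1_def refl_translate[OF t, symmetric]
  proof
    fix x assume x: "x \<in> strip r"
    show "u1 (refl (x + t)) - u1 (refl x) - c1 - slog p (snd (refl (x + t)) + u2 (refl (x + t)))
      = - cnj (u1 (x + t) - u1 x - c1 - slog p (snd (x + t) + u2 (x + t)))"
      unfolding us[OF x] us[OF tt[OF x]] sr s using cc by (simp add: algebra_simps)
  qed
  show "odd_sym r (res2 p t u1 u2 c2)"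
    unfolding odd_sym_def res2_def refl_translate[OF t, symmetric]
  proof
    fix x assume x: "x \<in> strip r"
    show "u2 (refl (x + t)) - u2 (refl x) - c2 - slog p (fst (refl x) + u1 (refl x))
      = - cnj (u2 (x + t) - u2 x - c2 - slog p (fst x + u1 x))"
      unfolding us[OF x] us[OF tt[OF x]] sr s using cc by (simp add: algebra_simps)
  qed
qed

text \<open>Partial derivatives are unique, so any given pair inherits the Cauchy estimate of the
  termwise ones.\<close>

lemma fbound_pders:
  assumes "fbound r N u" "pders r u D1 D2" "0 < \<delta>"
  shows "fbound (r - \<delta>) (N / \<delta>) D1" "fbound (r - \<delta>) (N / \<delta>) D2"
proof -
  obtain F1 F2 where F: "\<And>x. x \<in> strip r \<Longrightarrow> (u has_derivative (\<lambda>h. F1 x * fst h + F2 x * snd h)) (at x)"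
    "\<And>\<delta>. 0 < \<delta> \<Longrightarrow> fbound (r - \<delta>) (N / \<delta>) F1" "\<And>\<delta>. 0 < \<delta> \<Longrightarrow> fbound (r - \<delta>) (N / \<delta>) F2"
    by (rule fbound_has_derivative[OF assms(1)]) (blast intro: that)
  have "F1 x = D1 x" "F2 x = D2 x" if "x \<in> strip (r - \<delta>)" for x
  proof -
    have x: "x \<in> strip r" using that assms(3) strip_mono[of "r - \<delta>" r] by auto
    show "F1 x = D1 x" "F2 x = D2 x"
      using pders_unique[OF F(1)[OF x] assms(2)[unfolded pders_def, rule_format, OF x]] by auto
  qed
  then show "fbound (r - \<delta>) (N / \<delta>) D1" "fbound (r - \<delta>) (N / \<delta>) D2"
    using F(2,3)[OF assms(3)] fbound_cong[of "r - \<delta>" F1 D1] fbound_cong[of "r - \<delta>" F2 D2] by auto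
qed

text \<open>The residual after the correction is \<open>DE w\<close> plus the Taylor remainder of
  \<open>slog\<close>. The first is at most of order
  \<open>(\<epsilon> / \<delta>) * (\<epsilon> / \<delta> ^ 3)\<close> and the second of order
  \<open>(\<epsilon> / \<delta> ^ 3)\<^sup>2\<close>.\<close>

lemma newton_step:
  assumes p: "small_param p" and t: "dioph c t" and c: "1 \<le> c" and \<delta>: "0 < \<delta>" "\<delta> \<le> 1" and r: "r \<le> 1"
    and u: "fbound r (1/2) u1" "fbound r (1/2) u2" and sym: "odd_sym r u1" "odd_sym r u2"
    and D: "pders r u1 D11 D12" "pders r u2 D21 D22"
    and Db: "fbound r (1/64) D11" "fbound r (1/64) D12" "fbound r (1/64) D21" "fbound r (1/64) D22"
    and c0: "Re c1 = 0" "Re c2 = 0"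
    and E: "fbound r \<epsilon> (res1 p t u1 u2 c1)" "fbound r \<epsilon> (res2 p t u1 u2 c2)"
    and small: "11 * c * \<epsilon> / \<delta> ^ 3 \<le> 1/2"
  obtains v1 v2 d1 d2 where "fbound (r - \<delta>) (11 * c * \<epsilon> / \<delta> ^ 3) v1" "fbound (r - \<delta>) (11 * c * \<epsilon> / \<delta> ^ 3) v2"
    "odd_sym (r - \<delta>) v1" "odd_sym (r - \<delta>) v2" "norm d1 \<le> 2 * \<epsilon>" "norm d2 \<le> 2 * \<epsilon>" "Re d1 = 0" "Re d2 = 0"
    "fbound (r - \<delta>) (141 * c\<^sup>2 * \<epsilon>\<^sup>2 / \<delta> ^ 6) (res1 p t (\<lambda>x. u1 x + v1 x) (\<lambda>x. u2 x + v2 x) (c1 + d1))"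
    "fbound (r - \<delta>) (141 * c\<^sup>2 * \<epsilon>\<^sup>2 / \<delta> ^ 6) (res2 p t (\<lambda>x. u1 x + v1 x) (\<lambda>x. u2 x + v2 x) (c2 + d2))"
proof -
  have t0: "Re (fst t) = 0" "Re (snd t) = 0" using t by (auto simp: dioph_def)
  have \<epsilon>: "0 \<le> \<epsilon>" using fbound_nonneg[OF E(1)] .
  have xt: "x + t \<in> strip s" if "x \<in> strip s" for x s using that t0 by (simp add: strip_def)
  have rd: "r - \<delta> \<le> r" using \<delta> by simp
  have sub: "x \<in> strip r" if "x \<in> strip (r - \<delta>)" for x using that strip_mono[OF rd] by auto
  note symE = odd_sym_res[OF t0 sym c0, of p]
  have symD: "D11 (refl x) = cnj (D11 x)" "D12 (refl x) = cnj (D12 x)" "D21 (refl x) = cnj (D21 x)" "D22 (refl x) = cnj (D22 x)"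
    if "x \<in> strip r" for x
    using pders_odd_sym[OF sym(1) D(1) that] pders_odd_sym[OF sym(2) D(2) that] by auto
  note Dbt = fbound_translate[OF Db(3) t0] fbound_translate[OF Db(4) t0]
  have symDt: "D21 (refl x + t) = cnj (D21 (x + t))" "D22 (refl x + t) = cnj (D22 (x + t))" if "x \<in> strip r" for x
    using symD(3,4)[OF xt[OF that]] by (simp_all add: refl_translate[OF t0])
  \<comment> \<open>The first row of the matrix is taken at \<open>x\<close> and the second at
    \<open>x + t\<close>: in \<open>res1\<close> the nonlinear term sees the correction at
    \<open>x + t\<close>, so the leftover must be written with \<open>w (x + t)\<close>, and in
    \<open>res2\<close> with \<open>w x\<close>.\<close>
  obtain w1 w2 d1 d2 where w: "fbound (r - \<delta>) (10 * c * \<epsilon> / \<delta> ^ 3) w1" "fbound (r - \<delta>) (10 * c * \<epsilon> / \<delta> ^ 3) w2"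
    "odd_sym (r - \<delta>) w1" "odd_sym (r - \<delta>) w2" "norm d1 \<le> 2 * \<epsilon>" "norm d2 \<le> 2 * \<epsilon>" "Re d1 = 0" "Re d2 = 0"
    "\<forall>x\<in>strip (r - \<delta>). (1 + D11 x) * (w1 (x + t) - w1 x) + D12 x * (w2 (x + t) - w2 x) = d1 - res1 p t u1 u2 c1 x"
    "\<forall>x\<in>strip (r - \<delta>). D21 (x + t) * (w1 (x + t) - w1 x) + (1 + D22 (x + t)) * (w2 (x + t) - w2 x) = d2 - res2 p t u1 u2 c2 x"
    by (rule linearized_equation[where ?D11.0 = D11 and ?D12.0 = D12 and ?D21.0 = "\<lambda>x. D21 (x + t)"
      and ?D22.0 = "\<lambda>x. D22 (x + t)", OF t \<delta>(1) Db(1,2) Dbt E symE symD(1,2) symDt])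
      (assumption | rule that)+
  \<comment> \<open>The correction \<open>w\<close> is applied in the source:
    \<open>v = w + Du w\<close> is the first-order effect of composing \<open>x + u x\<close> with
    \<open>x + w x\<close>. The factor 11 exceeds \<open>10 * (1 + 2/64)\<close>.\<close>
  define v1 where "v1 x = w1 x + (D11 x * w1 x + D12 x * w2 x)" for x
  define v2 where "v2 x = w2 x + (D21 x * w1 x + D22 x * w2 x)" for x
  let ?B = "10 * c * \<epsilon> / \<delta> ^ 3"
  have B0: "0 \<le> ?B" using c \<epsilon> \<delta> by simp
  note Dr = Db[THEN fbound_mono, OF rd order_refl]
  have vb: "fbound (r - \<delta>) (11 * c * \<epsilon> / \<delta> ^ 3) v1" "fbound (r - \<delta>) (11 * c * \<epsilon> / \<delta> ^ 3) v2"
  proof -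
    have le: "?B + (1/64 * ?B + 1/64 * ?B) \<le> 11 * c * \<epsilon> / \<delta> ^ 3"
    proof -
      have "11/10 * ?B = 11 * c * \<epsilon> / \<delta> ^ 3" by simp
      moreover have "?B + (1/64 * ?B + 1/64 * ?B) = 33/32 * ?B" by simp
      moreover have "33/32 * ?B \<le> 11/10 * ?B" by (intro mult_right_mono B0) simp
      ultimately show ?thesis by (simp only:)
    qed
    have "fbound (r - \<delta>) (?B + (1/64 * ?B + 1/64 * ?B)) v1" "fbound (r - \<delta>) (?B + (1/64 * ?B + 1/64 * ?B)) v2"
      unfolding v1_def v2_def by (intro fbound_add fbound_mult w(1,2) Dr)+
    then show "fbound (r - \<delta>) (11 * c * \<epsilon> / \<delta> ^ 3) v1" "fbound (r - \<delta>) (11 * c * \<epsilon> / \<delta> ^ 3) v2"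
      by (auto intro: fbound_mono[OF _ order_refl le])
  qed
  have vsym: "odd_sym (r - \<delta>) v1" "odd_sym (r - \<delta>) v2"
  proof -
    have "v1 (refl x) = - cnj (v1 x) \<and> v2 (refl x) = - cnj (v2 x)" if x: "x \<in> strip (r - \<delta>)" for x
    proof -
      have "w1 (refl x) = - cnj (w1 x)" "w2 (refl x) = - cnj (w2 x)"
        using w(3,4) x by (auto simp: odd_sym_def)
      then show ?thesis unfolding v1_def v2_def symD[OF sub[OF x]] by simp
    qed
    then show "odd_sym (r - \<delta>) v1" "odd_sym (r - \<delta>) v2" by (auto simp: odd_sym_def)
  qed
  \<comment> \<open>The partial derivatives of the current residuals, of size
    \<open>\<epsilon> / \<delta>\<close> by the Cauchy estimate.\<close>
  define F11 where "F11 x = D11 (x + t) - D11 x - dslog p (snd (x + t) + u2 (x + t)) * D21 (x + t)" for x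
  define F12 where "F12 x = D12 (x + t) - D12 x - dslog p (snd (x + t) + u2 (x + t)) * (1 + D22 (x + t))" for x
  define F21 where "F21 x = D21 (x + t) - D21 x - dslog p (fst x + u1 x) * (1 + D11 x)" for x
  define F22 where "F22 x = D22 (x + t) - D22 x - dslog p (fst x + u1 x) * D12 x" for x
  note F = pders_res[OF p t0 r u D, folded F11_def F12_def F21_def F22_def]
  note Fb = fbound_pders[OF E(1) F(1) \<delta>(1)] fbound_pders[OF E(2) F(2) \<delta>(1)]
  define Q1 where "Q1 x = slog p (fst x + u1 x + v1 x) - slog p (fst x + u1 x) - dslog p (fst x + u1 x) * v1 x" for x
  define Q2 where "Q2 x = slog p (snd x + u2 x + v2 x) - slog p (snd x + u2 x) - dslog p (snd x + u2 x) * v2 x" for x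
  note ur = u[THEN fbound_mono, OF rd order_refl]
  have Qb: "fbound (r - \<delta>) ((11 * c * \<epsilon> / \<delta> ^ 3)\<^sup>2) Q1" "fbound (r - \<delta>) ((11 * c * \<epsilon> / \<delta> ^ 3)\<^sup>2) Q2"
  proof -
    have le3: "r - \<delta> + 1 / 2 + 11 * c * \<epsilon> / \<delta> ^ 3 \<le> 3" using r \<delta> small by linarith
    show "fbound (r - \<delta>) ((11 * c * \<epsilon> / \<delta> ^ 3)\<^sup>2) Q1" "fbound (r - \<delta>) ((11 * c * \<epsilon> / \<delta> ^ 3)\<^sup>2) Q2"
      unfolding Q1_def Q2_def
      by (rule fbound_slog_taylor[OF p _ ur(1) vb(1) le3] fbound_slog_taylor[OF p _ ur(2) vb(2) le3], simp add: is_coord_def)+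
  qed
  have new2: "res2 p t (\<lambda>x. u1 x + v1 x) (\<lambda>x. u2 x + v2 x) (c2 + d2) x = F21 x * w1 x + F22 x * w2 x - Q1 x"
    if x: "x \<in> strip (r - \<delta>)" for x
  proof -
    have "res2 p t (\<lambda>x. u1 x + v1 x) (\<lambda>x. u2 x + v2 x) (c2 + d2) x
      = res2 p t u1 u2 c2 x + (v2 (x + t) - v2 x) - d2 - dslog p (fst x + u1 x) * v1 x - Q1 x"
      by (simp add: res2_def Q1_def algebra_simps)
    also have "v2 (x + t) - v2 x - dslog p (fst x + u1 x) * v1 x
      = (D21 (x + t) * (w1 (x + t) - w1 x) + (1 + D22 (x + t)) * (w2 (x + t) - w2 x)) + F21 x * w1 x + F22 x * w2 x"
      unfolding F21_def F22_def v1_def v2_def by (simp add: algebra_simps)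
    then have "res2 p t u1 u2 c2 x + (v2 (x + t) - v2 x) - d2 - dslog p (fst x + u1 x) * v1 x - Q1 x
      = F21 x * w1 x + F22 x * w2 x - Q1 x"
      unfolding bspec[OF w(10) x] by algebra
    finally show ?thesis .
  qed
  have new1: "res1 p t (\<lambda>x. u1 x + v1 x) (\<lambda>x. u2 x + v2 x) (c1 + d1) x
      = F11 x * w1 (x + t) + F12 x * w2 (x + t) - Q2 (x + t)"
    if x: "x \<in> strip (r - \<delta>)" for x
  proof -
    have "res1 p t (\<lambda>x. u1 x + v1 x) (\<lambda>x. u2 x + v2 x) (c1 + d1) x
      = res1 p t u1 u2 c1 x + (v1 (x + t) - v1 x) - d1 - dslog p (snd (x + t) + u2 (x + t)) * v2 (x + t) - Q2 (x + t)"
      by (simp add: res1_def Q2_def algebra_simps)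
    also have "v1 (x + t) - v1 x - dslog p (snd (x + t) + u2 (x + t)) * v2 (x + t)
      = ((1 + D11 x) * (w1 (x + t) - w1 x) + D12 x * (w2 (x + t) - w2 x)) + F11 x * w1 (x + t) + F12 x * w2 (x + t)"
      unfolding F11_def F12_def v1_def v2_def by (simp add: algebra_simps)
    then have "res1 p t u1 u2 c1 x + (v1 (x + t) - v1 x) - d1 - dslog p (snd (x + t) + u2 (x + t)) * v2 (x + t) - Q2 (x + t)
      = F11 x * w1 (x + t) + F12 x * w2 (x + t) - Q2 (x + t)"
      unfolding bspec[OF w(9) x] by algebra
    finally show ?thesis .
  qed
  \<comment> \<open>The constant 141 is 10 + 10 from the two products with \<open>w\<close> and
    \<open>11\<^sup>2\<close> from the Taylor remainder.\<close>
  have le: "\<epsilon> / \<delta> * ?B + \<epsilon> / \<delta> * ?B + (11 * c * \<epsilon> / \<delta> ^ 3)\<^sup>2 \<le> 141 * c\<^sup>2 * \<epsilon>\<^sup>2 / \<delta> ^ 6"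
  proof -
    have "\<epsilon> / \<delta> * ?B = 10 * c * \<epsilon>\<^sup>2 / \<delta> ^ 4" by (simp add: power2_eq_square power_numeral_reduce)
    also have "\<dots> \<le> 10 * c\<^sup>2 * \<epsilon>\<^sup>2 / \<delta> ^ 6"
    proof (intro frac_le mult_right_mono)
      show "10 * c \<le> 10 * c\<^sup>2" using c by (simp add: power2_eq_square)
      show "\<delta> ^ 6 \<le> \<delta> ^ 4" using \<delta> by (intro power_decreasing) auto
    qed (use \<delta> c in auto)
    finally have "\<epsilon> / \<delta> * ?B \<le> 10 * c\<^sup>2 * \<epsilon>\<^sup>2 / \<delta> ^ 6" .
    moreover have "(11 * c * \<epsilon> / \<delta> ^ 3)\<^sup>2 = 121 * c\<^sup>2 * \<epsilon>\<^sup>2 / \<delta> ^ 6"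
      by (simp add: power_divide power_mult_distrib flip: power_mult)
    moreover have "141 * c\<^sup>2 * \<epsilon>\<^sup>2 / \<delta> ^ 6
        = 10 * c\<^sup>2 * \<epsilon>\<^sup>2 / \<delta> ^ 6 + 10 * c\<^sup>2 * \<epsilon>\<^sup>2 / \<delta> ^ 6 + 121 * c\<^sup>2 * \<epsilon>\<^sup>2 / \<delta> ^ 6"
      by (simp add: add_divide_distrib[symmetric])
    ultimately show ?thesis by linarith
  qed
  have "fbound (r - \<delta>) (\<epsilon> / \<delta> * ?B + \<epsilon> / \<delta> * ?B + (11 * c * \<epsilon> / \<delta> ^ 3)\<^sup>2)
      (\<lambda>x. F11 x * w1 (x + t) + F12 x * w2 (x + t) - Q2 (x + t))"
    "fbound (r - \<delta>) (\<epsilon> / \<delta> * ?B + \<epsilon> / \<delta> * ?B + (11 * c * \<epsilon> / \<delta> ^ 3)\<^sup>2)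
      (\<lambda>x. F21 x * w1 x + F22 x * w2 x - Q1 x)"
    by (intro fbound_add fbound_diff fbound_mult Fb w(1,2) Qb fbound_translate t0)+
  note res_b = this[THEN fbound_mono, OF order_refl le]
  have "fbound (r - \<delta>) (141 * c\<^sup>2 * \<epsilon>\<^sup>2 / \<delta> ^ 6) (res1 p t (\<lambda>x. u1 x + v1 x) (\<lambda>x. u2 x + v2 x) (c1 + d1))"
    using res_b(1) fbound_cong[of "r - \<delta>" "res1 p t (\<lambda>x. u1 x + v1 x) (\<lambda>x. u2 x + v2 x) (c1 + d1)"
        "\<lambda>x. F11 x * w1 (x + t) + F12 x * w2 (x + t) - Q2 (x + t)", OF new1] by simp
  moreover have "fbound (r - \<delta>) (141 * c\<^sup>2 * \<epsilon>\<^sup>2 / \<delta> ^ 6) (res2 p t (\<lambda>x. u1 x + v1 x) (\<lambda>x. u2 x + v2 x) (c2 + d2))"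
    using res_b(2) fbound_cong[of "r - \<delta>" "res2 p t (\<lambda>x. u1 x + v1 x) (\<lambda>x. u2 x + v2 x) (c2 + d2)"
        "\<lambda>x. F21 x * w1 x + F22 x * w2 x - Q1 x", OF new2] by simp
  ultimately show ?thesis by (rule that[OF vb vsym w(5-8)])
qed

section \<open>Convergence of the Newton iteration\<close>

text \<open>Each step uses the width \<open>kd n\<close> twice, for the correction and for its
  derivatives, so the strips shrink from 1 to 3/4. The error decreases like
  \<open>((1/2) ^ n) ^ 6\<close>, matching the denominator \<open>kd n ^ 6\<close>;
  \<open>ktheta\<close> is chosen so that a quadratic step gains exactly the factor 1/64.\<close>

definition kr :: "nat \<Rightarrow> real" where "kr n = 3/4 + (1/4) * (1/2) ^ n"
definition kd :: "nat \<Rightarrow> real" where "kd n = (1/16) * (1/2) ^ n"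
definition ktheta :: "real \<Rightarrow> real" where "ktheta c = 1 / (141 * 64 * 16 ^ 6 * c\<^sup>2)"
definition keps :: "real \<Rightarrow> nat \<Rightarrow> real" where "keps c n = ktheta c * (1/64) ^ n"

lemma kr_bounds: "kr n \<le> 1" "1/2 \<le> kr n"
  using power_le_one[of "1/2::real" n] zero_le_power[of "1/2::real" n] unfolding kr_def by - linarith+

lemma kd_bounds: "0 < kd n" "kd n \<le> 1"
  using power_le_one[of "1/2::real" n] by (auto simp: kd_def)

lemma kr_Suc: "kr (Suc n) = kr n - 2 * kd n" "kr n - kd n - kd n = kr (Suc n)"
  by (simp_all add: kr_def kd_def)

lemma half_powers: "(1/8) ^ n = ((1/2::real) ^ n) ^ 3" "(1/64) ^ n = ((1/2::real) ^ n) ^ 6"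
  "(1/4) ^ n = ((1/2::real) ^ n) ^ 2"
  unfolding power_mult[symmetric] mult.commute[of n] unfolding power_mult
  by (simp_all add: power_divide)

lemma kstep_bounds:
  assumes c: "1 \<le> c"
  shows "0 < ktheta c" "11 * c * keps c n / kd n ^ 3 \<le> (1/128) * (1/2) ^ Suc n"
    "11 * c * keps c n / kd n ^ 3 / kd n \<le> (1/64) * (1/2) ^ Suc n"
    "141 * c\<^sup>2 * (keps c n)\<^sup>2 / kd n ^ 6 \<le> keps c (Suc n)"
proof -
  define h where "h = (1/2::real) ^ n"
  have h: "0 < h" "h \<le> 1" using power_le_one[of "1/2::real" n] by (auto simp: h_def)
  show th: "0 < ktheta c" using c by (simp add: ktheta_def)
  have cth: "c * ktheta c \<le> 1 / (141 * 64 * 16 ^ 6)"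
  proof -
    have "c * ktheta c = (1 / c) * (1 / (141 * 64 * 16 ^ 6))" using c by (simp add: ktheta_def power2_eq_square)
    also have "\<dots> \<le> 1 * (1 / (141 * 64 * 16 ^ 6))" using c by (intro mult_right_mono) auto
    finally show ?thesis by simp
  qed
  have 1: "keps c n = ktheta c * h ^ 6" "kd n = h / 16" by (simp_all add: keps_def kd_def half_powers h_def)
  have e3: "11 * c * keps c n / kd n ^ 3 = 11 * 16 ^ 3 * (c * ktheta c) * h ^ 3"
    unfolding 1 using h by (simp add: field_simps power_numeral_reduce)
  have h3: "h ^ 3 \<le> h" using power_decreasing[of 1 3 h] h by simp
  have h2: "h ^ 2 \<le> h" using power_decreasing[of 1 2 h] h by simp
  have "11 * 16 ^ 3 * (c * ktheta c) * h ^ 3 \<le> 11 * 16 ^ 3 * (1 / (141 * 64 * 16 ^ 6)) * h"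
    by (intro mult_mono mult_left_mono cth h3) (use h c th in auto)
  also have "\<dots> \<le> (1/128) * (1/2) * h" by (intro mult_right_mono) (use h in auto)
  finally show "11 * c * keps c n / kd n ^ 3 \<le> (1/128) * (1/2) ^ Suc n"
    unfolding e3 by (simp add: h_def)
  have e4: "11 * c * keps c n / kd n ^ 3 / kd n = 11 * 16 ^ 4 * (c * ktheta c) * h ^ 2"
    unfolding 1 using h by (simp add: field_simps power_numeral_reduce)
  have "11 * 16 ^ 4 * (c * ktheta c) * h ^ 2 \<le> 11 * 16 ^ 4 * (1 / (141 * 64 * 16 ^ 6)) * h"
    by (intro mult_mono mult_left_mono cth h2) (use h c th in auto)
  also have "\<dots> \<le> (1/64) * (1/2) * h" by (intro mult_right_mono) (use h in auto)
  finally show "11 * c * keps c n / kd n ^ 3 / kd n \<le> (1/64) * (1/2) ^ Suc n"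
    unfolding e4 by (simp add: h_def)
  have "141 * c\<^sup>2 * (keps c n)\<^sup>2 / kd n ^ 6 = (141 * 16 ^ 6 * c\<^sup>2 * ktheta c) * ktheta c * h ^ 6"
    unfolding 1 using h by (simp add: field_simps power_numeral_reduce)
  also have "141 * 16 ^ 6 * c\<^sup>2 * ktheta c = 1/64" using c by (simp add: ktheta_def)
  also have "1/64 * ktheta c * h ^ 6 = keps c (Suc n)"
    by (simp add: keps_def half_powers h_def)
  finally show "141 * c\<^sup>2 * (keps c n)\<^sup>2 / kd n ^ 6 \<le> keps c (Suc n)" by simp
qed

type_synonym kstate = "(complex \<times> complex \<Rightarrow> complex) \<times> (complex \<times> complex \<Rightarrow> complex) \<times> complex \<times> complex"

text \<open>The bounds are partial sums of geometric series and hence never exceed 1/128 and 1/64.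
  At stage 0 they force the function to vanish on the strip.\<close>

definition good_fun :: "nat \<Rightarrow> (complex \<times> complex \<Rightarrow> complex) \<Rightarrow> bool" where
  "good_fun n u \<longleftrightarrow> odd_sym (kr n) u \<and> fbound (kr n) ((1/128) * (1 - (1/2) ^ n)) u \<and>
     (\<exists>D1 D2. pders (kr n) u D1 D2 \<and> fbound (kr n) ((1/64) * (1 - (1/2) ^ n)) D1 \<and>
        fbound (kr n) ((1/64) * (1 - (1/2) ^ n)) D2)"

definition kam_inv :: "real \<Rightarrow> complex \<times> complex \<Rightarrow> real \<Rightarrow> nat \<Rightarrow> kstate \<Rightarrow> bool" where
  "kam_inv p t c n = (\<lambda>(u1, u2, c1, c2). good_fun n u1 \<and> good_fun n u2 \<and> Re c1 = 0 \<and> Re c2 = 0 \<and>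
     fbound (kr n) (keps c n) (res1 p t u1 u2 c1) \<and> fbound (kr n) (keps c n) (res2 p t u1 u2 c2))"

text \<open>Measured on a fixed strip contained in all the shrinking ones, so that the increments
  can be summed there.\<close>

definition kam_close :: "real \<Rightarrow> nat \<Rightarrow> kstate \<Rightarrow> kstate \<Rightarrow> bool" where
  "kam_close c n = (\<lambda>(u1, u2, c1, c2) (v1, v2, d1, d2).
     fbound (1/2) ((1/128) * (1/2) ^ Suc n) (\<lambda>x. v1 x - u1 x) \<and>
     fbound (1/2) ((1/128) * (1/2) ^ Suc n) (\<lambda>x. v2 x - u2 x) \<and>
     norm (d1 - c1) \<le> 2 * keps c n \<and> norm (d2 - c2) \<le> 2 * keps c n)"

text \<open>The two bounds on the correction are kept apart because its derivatives are estimated on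
  a strip that is narrower by a further \<open>kd n\<close>.\<close>

lemma good_fun_add:
  assumes u: "good_fun n u" and v: "fbound (kr n - kd n) ((1/128) * (1/2) ^ Suc n) v"
    and v': "fbound (kr n - kd n) N v" "N / kd n \<le> (1/64) * (1/2) ^ Suc n" and sv: "odd_sym (kr n - kd n) v"
  shows "good_fun (Suc n) (\<lambda>x. u x + v x)"
proof -
  have le: "kr (Suc n) \<le> kr n - kd n" "kr (Suc n) \<le> kr n"
    using kr_Suc[of n] kd_bounds[of n] by auto
  note sub = subsetD[OF strip_mono[OF le(1)]] subsetD[OF strip_mono[OF le(2)]]
  have ar: "a * (1 - (1/2) ^ n) + a * (1/2) ^ Suc n = a * (1 - (1/2) ^ Suc n)" for a :: real
    by (simp add: algebra_simps)
  obtain D1 D2 where D: "pders (kr n) u D1 D2" "fbound (kr n) ((1/64) * (1 - (1/2) ^ n)) D1"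
    "fbound (kr n) ((1/64) * (1 - (1/2) ^ n)) D2"
    using u unfolding good_fun_def by blast
  obtain F1 F2 where F: "\<And>x. x \<in> strip (kr n - kd n) \<Longrightarrow> (v has_derivative (\<lambda>h. F1 x * fst h + F2 x * snd h)) (at x)"
    "\<And>\<delta>. 0 < \<delta> \<Longrightarrow> fbound (kr n - kd n - \<delta>) (N / \<delta>) F1" "\<And>\<delta>. 0 < \<delta> \<Longrightarrow> fbound (kr n - kd n - \<delta>) (N / \<delta>) F2"
    by (rule fbound_has_derivative[OF v'(1)]) (blast intro: that)
  have Fb: "fbound (kr (Suc n)) ((1/64) * (1/2) ^ Suc n) F1" "fbound (kr (Suc n)) ((1/64) * (1/2) ^ Suc n) F2"
    using F(2,3)[OF kd_bounds(1), of n] v'(2) kr_Suc(2)[of n] by (auto intro: fbound_mono)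
  show ?thesis
    unfolding good_fun_def
  proof (intro conjI exI)
    show "odd_sym (kr (Suc n)) (\<lambda>x. u x + v x)"
      using u sv sub by (simp add: good_fun_def odd_sym_def)
    show "fbound (kr (Suc n)) (1 / 128 * (1 - (1 / 2) ^ Suc n)) (\<lambda>x. u x + v x)"
      unfolding ar[symmetric] using u v le
      by (intro fbound_add) (auto simp: good_fun_def intro: fbound_mono)
    show "pders (kr (Suc n)) (\<lambda>x. u x + v x) (\<lambda>x. D1 x + F1 x) (\<lambda>x. D2 x + F2 x)"
      unfolding pders_def
    proof
      fix x assume x: "x \<in> strip (kr (Suc n))"
      have "((\<lambda>x. u x + v x) has_derivative (\<lambda>h. (D1 x * fst h + D2 x * snd h) + (F1 x * fst h + F2 x * snd h))) (at x)"
        by (intro has_derivative_add F(1) sub(1)[OF x]) (use D(1) sub(2)[OF x] in \<open>simp add: pders_def\<close>)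
      then show "((\<lambda>x. u x + v x) has_derivative (\<lambda>h. (D1 x + F1 x) * fst h + (D2 x + F2 x) * snd h)) (at x)"
        by (simp add: algebra_simps)
    qed
    show "fbound (kr (Suc n)) (1 / 64 * (1 - (1 / 2) ^ Suc n)) (\<lambda>x. D1 x + F1 x)"
      "fbound (kr (Suc n)) (1 / 64 * (1 - (1 / 2) ^ Suc n)) (\<lambda>x. D2 x + F2 x)"
      unfolding ar[symmetric] by (intro fbound_add Fb fbound_mono[OF D(2) le(2)] fbound_mono[OF D(3) le(2)] order_refl)+
  qed
qed

lemma kam_step:
  assumes p: "small_param p" and t: "dioph c t" and c: "1 \<le> c" and inv: "kam_inv p t c n s"
  shows "\<exists>s'. kam_inv p t c (Suc n) s' \<and> kam_close c n s s'"
proof -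
  obtain u1 u2 c1 c2 where s: "s = (u1, u2, c1, c2)" by (cases s)
  have g: "good_fun n u1" "good_fun n u2" and cc: "Re c1 = 0" "Re c2 = 0"
    and E: "fbound (kr n) (keps c n) (res1 p t u1 u2 c1)" "fbound (kr n) (keps c n) (res2 p t u1 u2 c2)"
    using inv by (auto simp: s kam_inv_def)
  have h1: "(1/2::real) ^ n \<le> 1" "0 < (1/2::real) ^ n" using power_le_one[of "1/2::real" n] by auto
  have "1/128 * (1 - h) \<le> 1/2 \<and> 1/64 * (1 - h) \<le> 1/64" if "0 < h" for h :: real
    using that by simp
  from this[OF h1(2)] have le1: "1/128 * (1 - (1/2::real) ^ n) \<le> 1/2" "1/64 * (1 - (1/2::real) ^ n) \<le> 1/64" by blast+
  have ub: "fbound (kr n) (1/2) u1" "fbound (kr n) (1/2) u2" and sy: "odd_sym (kr n) u1" "odd_sym (kr n) u2"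
    using g fbound_mono[OF _ order_refl le1(1)] unfolding good_fun_def by blast+
  obtain D11 D12 where D1: "pders (kr n) u1 D11 D12" "fbound (kr n) (1/64) D11" "fbound (kr n) (1/64) D12"
    using g(1) fbound_mono[OF _ order_refl le1(2)] unfolding good_fun_def by blast
  obtain D21 D22 where D2: "pders (kr n) u2 D21 D22" "fbound (kr n) (1/64) D21" "fbound (kr n) (1/64) D22"
    using g(2) fbound_mono[OF _ order_refl le1(2)] unfolding good_fun_def by blast
  note kb = kstep_bounds(2-4)[OF c, of n]
  have small: "11 * c * keps c n / kd n ^ 3 \<le> 1/2" using kb(1) h1 by (simp only: power_Suc)
  obtain v1 v2 d1 d2 where v: "fbound (kr n - kd n) (11 * c * keps c n / kd n ^ 3) v1" "fbound (kr n - kd n) (11 * c * keps c n / kd n ^ 3) v2"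
    "odd_sym (kr n - kd n) v1" "odd_sym (kr n - kd n) v2" "norm d1 \<le> 2 * keps c n" "norm d2 \<le> 2 * keps c n" "Re d1 = 0" "Re d2 = 0"
    "fbound (kr n - kd n) (141 * c\<^sup>2 * (keps c n)\<^sup>2 / kd n ^ 6) (res1 p t (\<lambda>x. u1 x + v1 x) (\<lambda>x. u2 x + v2 x) (c1 + d1))"
    "fbound (kr n - kd n) (141 * c\<^sup>2 * (keps c n)\<^sup>2 / kd n ^ 6) (res2 p t (\<lambda>x. u1 x + v1 x) (\<lambda>x. u2 x + v2 x) (c2 + d2))"
    by (rule newton_step[OF p t c kd_bounds(1,2)[of n] kr_bounds(1)[of n] ub sy D1(1) D2(1) D1(2,3) D2(2,3) cc E small]) (rule that)
  have le: "kr (Suc n) \<le> kr n - kd n" using kr_Suc[of n] kd_bounds[of n] by auto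
  show ?thesis
  proof (intro exI conjI)
    show "kam_inv p t c (Suc n) (\<lambda>x. u1 x + v1 x, \<lambda>x. u2 x + v2 x, c1 + d1, c2 + d2)"
      unfolding kam_inv_def prod.case
    proof (intro conjI)
      show "good_fun (Suc n) (\<lambda>x. u1 x + v1 x)"
        by (rule good_fun_add[OF g(1) fbound_mono[OF v(1) order_refl kb(1)] v(1) kb(2) v(3)])
      show "good_fun (Suc n) (\<lambda>x. u2 x + v2 x)"
        by (rule good_fun_add[OF g(2) fbound_mono[OF v(2) order_refl kb(1)] v(2) kb(2) v(4)])
      show "fbound (kr (Suc n)) (keps c (Suc n)) (res1 p t (\<lambda>x. u1 x + v1 x) (\<lambda>x. u2 x + v2 x) (c1 + d1))"
        by (rule fbound_mono[OF v(9) le kb(3)])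
      show "fbound (kr (Suc n)) (keps c (Suc n)) (res2 p t (\<lambda>x. u1 x + v1 x) (\<lambda>x. u2 x + v2 x) (c2 + d2))"
        by (rule fbound_mono[OF v(10) le kb(3)])
    qed (use cc v in auto)
    have le2: "1/2 \<le> kr n - kd n" using kr_bounds(2)[of "Suc n"] le by simp
    show "kam_close c n s (\<lambda>x. u1 x + v1 x, \<lambda>x. u2 x + v2 x, c1 + d1, c2 + d2)"
      unfolding kam_close_def s prod.case
      using fbound_mono[OF v(1) le2 kb(1)] fbound_mono[OF v(2) le2 kb(1)] v(5,6) by simp
  qed
qed

lemma kam_start:
  assumes p: "small_param p" "8 * (p * exp 4) \<le> ktheta c" and t: "dioph c t"
  shows "kam_inv p t c 0 (\<lambda>_. 0, \<lambda>_. 0, 0, 0)"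
proof -
  have t0: "Re (fst t) = 0" "Re (snd t) = 0" using t by (auto simp: dioph_def)
  have z: "fbound 1 0 (\<lambda>_. 0)" by (rule fbound_const) simp
  have g: "good_fun 0 (\<lambda>_. 0)"
    unfolding good_fun_def
    by (intro conjI exI[of _ "\<lambda>_. 0"]) (use z in \<open>auto simp: odd_sym_def pders_def kr_def\<close>)
  have "fbound 1 (8 * (p * exp 4)) (\<lambda>x. - slog p (snd (x + t) + 0))"
    using fbound_uminus[OF fbound_translate[OF fbound_slog[OF p(1) _ z, of snd] t0]] by (simp add: is_coord_def)
  then have r1: "fbound 1 (ktheta c) (res1 p t (\<lambda>_. 0) (\<lambda>_. 0) 0)"
    unfolding res1_def using p(2) by (auto intro: fbound_mono)
  have "fbound 1 (8 * (p * exp 4)) (\<lambda>x. - slog p (fst x + 0))"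
    using fbound_uminus[OF fbound_slog[OF p(1) _ z, of fst]] by (simp add: is_coord_def)
  then have r2: "fbound 1 (ktheta c) (res2 p t (\<lambda>_. 0) (\<lambda>_. 0) 0)"
    unfolding res2_def using p(2) by (auto intro: fbound_mono)
  show ?thesis using g r1 r2 by (simp add: kam_inv_def kr_def keps_def)
qed

lemma telescope_limit:
  fixes f :: "nat \<Rightarrow> 'a::banach"
  assumes "\<And>n. norm (f (Suc n) - f n) \<le> B n" "summable B"
  shows "(\<lambda>n. f (Suc n) - f n) sums (lim f - f 0)" "f \<longlonglongrightarrow> lim f"
proof -
  have "summable (\<lambda>n. f (Suc n) - f n)"
    by (rule summable_comparison_test'[OF assms(2), of 0]) (rule assms(1))
  then have s0: "(\<lambda>n. f (Suc n) - f n) sums (\<Sum>n. f (Suc n) - f n)" by (rule summable_sums)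
  define S where "S = (\<Sum>n. f (Suc n) - f n)"
  have "(\<lambda>n. f n - f 0) \<longlonglongrightarrow> S"
    using s0 unfolding sums_def sum_lessThan_telescope S_def .
  from tendsto_add[OF this tendsto_const[of "f 0"]] have f: "f \<longlonglongrightarrow> S + f 0" by simp
  have l: "lim f = S + f 0" by (rule limI[OF f])
  show "f \<longlonglongrightarrow> lim f" using f unfolding l .
  show "(\<lambda>n. f (Suc n) - f n) sums (lim f - f 0)"
    using s0 unfolding l S_def by simp
qed

theorem kam_conjugacy:
  assumes t: "dioph c t" and c: "1 \<le> c"
  obtains p u1 u2 c1 c2 where "small_param p" "fbound (1/2) (1/128) u1" "fbound (1/2) (1/128) u2"
    "odd_sym (1/2) u1" "odd_sym (1/2) u2" "Re c1 = 0" "Re c2 = 0"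
    "\<And>x. x \<in> strip (1/2) \<Longrightarrow> res1 p t u1 u2 c1 x = 0" "\<And>x. x \<in> strip (1/2) \<Longrightarrow> res2 p t u1 u2 c2 x = 0"
proof -
  have t0: "Re (fst t) = 0" "Re (snd t) = 0" using t by (auto simp: dioph_def)
  \<comment> \<open>Makes the bound \<open>8 * (p * exp 4)\<close> on the residual of the zero guess
    equal to the admissible initial error \<open>ktheta c\<close>.\<close>
  define p where "p = ktheta c / (8 * exp 4)"
  have th: "0 < ktheta c" using kstep_bounds[OF c] by blast
  have th1: "ktheta c \<le> 1"
  proof -
    have "1 \<le> c\<^sup>2" using c by simp
    then have "1 \<le> 141 * 64 * 16 ^ 6 * c\<^sup>2" using mult_mono[of 1 "141 * 64 * 16 ^ 6" 1 "c\<^sup>2"] by simp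
    then show ?thesis unfolding ktheta_def by (simp only: divide_le_eq_1) simp
  qed
  have p: "small_param p" "8 * (p * exp 4) \<le> ktheta c"
    using th th1 by (auto simp: small_param_def p_def)
  have "\<exists>f. \<forall>n. kam_inv p t c n (f n) \<and> kam_close c n (f n) (f (Suc n))"
    using dependent_nat_choice[of "kam_inv p t c" "kam_close c"] kam_start[OF p t] kam_step[OF p(1) t c] by blast
  then obtain f where f: "\<And>n. kam_inv p t c n (f n)" "\<And>n. kam_close c n (f n) (f (Suc n))" by blast
  define v1 where "v1 n = fst (f n)" for n
  define v2 where "v2 n = fst (snd (f n))" for n
  define e1 where "e1 n = fst (snd (snd (f n)))" for n
  define e2 where "e2 n = snd (snd (snd (f n)))" for n
  have fe: "f n = (v1 n, v2 n, e1 n, e2 n)" for n by (simp add: v1_def v2_def e1_def e2_def)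
  have inv: "good_fun n (v1 n)" "good_fun n (v2 n)" "Re (e1 n) = 0" "Re (e2 n) = 0"
     "fbound (kr n) (keps c n) (res1 p t (v1 n) (v2 n) (e1 n))" "fbound (kr n) (keps c n) (res2 p t (v1 n) (v2 n) (e2 n))" for n
    using f(1)[of n] by (auto simp: fe kam_inv_def)
  have cl: "fbound (1/2) ((1/128) * (1/2) ^ Suc n) (\<lambda>x. v1 (Suc n) x - v1 n x)"
     "fbound (1/2) ((1/128) * (1/2) ^ Suc n) (\<lambda>x. v2 (Suc n) x - v2 n x)"
     "norm (e1 (Suc n) - e1 n) \<le> 2 * keps c n" "norm (e2 (Suc n) - e2 n) \<le> 2 * keps c n" for n
    using f(2)[of n] by (auto simp: fe kam_close_def)
  have sub: "x \<in> strip (kr n)" if "x \<in> strip (1/2)" for x n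
    using strip_mono[OF kr_bounds(2)] that by blast
  have geo: "(\<lambda>n. (1/128::real) * (1/2) ^ Suc n) sums (1/128)"
    using sums_mult[OF geometric_sums[of "1/2::real"], of "1/256"] by (simp add: field_simps)
  have skeps: "summable (\<lambda>n. 2 * keps c n)"
    unfolding keps_def by (intro summable_mult summable_geometric) simp
  have keps0: "keps c \<longlonglongrightarrow> 0" using summable_LIMSEQ_zero[OF skeps]
    by (simp add: tendsto_mult_left_iff)
  have lime: "e1 \<longlonglongrightarrow> lim e1" "e2 \<longlonglongrightarrow> lim e2"
    using telescope_limit(2)[OF cl(3) skeps] telescope_limit(2)[OF cl(4) skeps] by auto
  have limRe: "Re (lim e) = 0" if "e \<longlonglongrightarrow> lim e" "\<And>n. Re (e n) = 0" for e :: "nat \<Rightarrow> complex"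
  proof -
    have "(\<lambda>n. Re (e n)) \<longlonglongrightarrow> Re (lim e)" by (intro tendsto_Re that)
    then show ?thesis using that(2) by (simp add: LIMSEQ_const_iff)
  qed
  have fun_limit: "fbound (1/2) (1/128) (\<lambda>x. lim (\<lambda>n. v n x)) \<and> odd_sym (1/2) (\<lambda>x. lim (\<lambda>n. v n x)) \<and>
     (\<forall>x\<in>strip (1/2). (\<lambda>n. v n x) \<longlonglongrightarrow> lim (\<lambda>n. v n x))"
    if g: "\<And>n. good_fun n (v n)" and d: "\<And>n. fbound (1/2) ((1/128) * (1/2) ^ Suc n) (\<lambda>x. v (Suc n) x - v n x)" for v
  proof -
    have v0: "v 0 x = 0" if "x \<in> strip (1/2)" for x
      using norm_le_fbound[of "kr 0" 0 "v 0" x] g[of 0] sub[OF that] by (simp add: good_fun_def)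
    have tl: "(\<lambda>n. v (Suc n) x - v n x) sums (lim (\<lambda>n. v n x))" "(\<lambda>n. v n x) \<longlonglongrightarrow> lim (\<lambda>n. v n x)"
      if x: "x \<in> strip (1/2)" for x
      using telescope_limit[of "\<lambda>n. v n x", OF norm_le_fbound[OF d x] sums_summable[OF geo]] v0[OF x] by auto
    \<comment> \<open>A bound \<open>fbound\<close> asks for a series representation. The limit
      obtains one from the telescoping series of increments, starting at the zero function.\<close>
    have b: "fbound (1/2) (1/128) (\<lambda>x. lim (\<lambda>n. v n x))"
    proof (rule fbound_series[OF d])
      show "((\<lambda>n. (1/128::real) * (1/2) ^ Suc n) has_sum (1/128)) UNIV"
        by (rule has_sum_sums_norm[OF _ geo]) (use sums_summable[OF geo] in simp)
      show "((\<lambda>n. v (Suc n) x - v n x) has_sum lim (\<lambda>n. v n x)) UNIV" if x: "x \<in> strip (1/2)" for x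
        by (rule has_sum_sums_norm[OF _ tl(1)[OF x]], rule summable_comparison_test'[OF sums_summable[OF geo], of 0])
          (use norm_le_fbound[OF d x] in auto)
    qed simp
    have "odd_sym (1/2) (\<lambda>x. lim (\<lambda>n. v n x))"
      unfolding odd_sym_def
    proof
      fix x assume x: "x \<in> strip (1/2)"
      have rx: "refl x \<in> strip (1/2)" using x by simp
      have "v n (refl x) = - cnj (v n x)" for n
        using g[of n] sub[OF x, of n] by (auto simp: good_fun_def odd_sym_def)
      then have "(\<lambda>n. v n (refl x)) = (\<lambda>n. - cnj (v n x))" by blast
      moreover have "(\<lambda>n. - cnj (v n x)) \<longlonglongrightarrow> - cnj (lim (\<lambda>n. v n x))"
        by (intro tendsto_minus tendsto_cnj tl(2)[OF x])
      ultimately show "lim (\<lambda>n. v n (refl x)) = - cnj (lim (\<lambda>n. v n x))"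
        by (simp add: limI)
    qed
    with b tl(2) show ?thesis by blast
  qed
  define u1 where "u1 x = lim (\<lambda>n. v1 n x)" for x
  define u2 where "u2 x = lim (\<lambda>n. v2 n x)" for x
  have U1: "fbound (1/2) (1/128) u1" "odd_sym (1/2) u1" "\<And>x. x \<in> strip (1/2) \<Longrightarrow> (\<lambda>n. v1 n x) \<longlonglongrightarrow> u1 x"
    using fun_limit[OF inv(1) cl(1)] unfolding u1_def by blast+
  have U2: "fbound (1/2) (1/128) u2" "odd_sym (1/2) u2" "\<And>x. x \<in> strip (1/2) \<Longrightarrow> (\<lambda>n. v2 n x) \<longlonglongrightarrow> u2 x"
    using fun_limit[OF inv(2) cl(2)] unfolding u2_def by blast+
  have slim: "(\<lambda>n. slog p (a + v n)) \<longlonglongrightarrow> slog p (a + l)" if "v \<longlonglongrightarrow> l" "\<bar>Re a\<bar> < 1/2" "norm l \<le> 1/128" for a v l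
  proof (rule isCont_tendsto_compose[where f = "\<lambda>n. a + v n"])
    have "\<bar>Re (a + l)\<bar> \<le> 3/2" using that abs_Re_le_cmod[of l] abs_triangle_ineq[of "Re a" "Re l"] by simp
    then show "isCont (slog p) (a + l)" by (rule DERIV_isCont[OF slog_has_field_derivative[OF p(1)]])
    show "(\<lambda>n. a + v n) \<longlonglongrightarrow> a + l" by (intro tendsto_add tendsto_const that)
  qed
  have zero: "l = 0" if "(\<lambda>n. g n) \<longlonglongrightarrow> l" "\<And>n. norm (g n) \<le> keps c n" for g and l :: complex
  proof -
    have "(\<lambda>n. g n) \<longlonglongrightarrow> 0" by (rule Lim_null_comparison[OF _ keps0]) (use that(2) in auto)
    then show ?thesis using that(1) LIMSEQ_unique by blast
  qed
  show ?thesis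
  proof (rule that[OF p(1) U1(1) U2(1) U1(2) U2(2) limRe[OF lime(1) inv(3)] limRe[OF lime(2) inv(4)]])
    fix x assume x: "x \<in> strip (1/2)"
    have xt: "x + t \<in> strip (1/2)" using x t0 by (simp add: strip_def)
    show "res1 p t u1 u2 (lim e1) x = 0"
    proof (rule zero)
      show "(\<lambda>n. res1 p t (v1 n) (v2 n) (e1 n) x) \<longlonglongrightarrow> res1 p t u1 u2 (lim e1) x"
        unfolding res1_def using xt
        by (intro tendsto_diff U1 lime slim U2 x xt norm_le_fbound[OF U2(1)]) (auto simp: strip_def)
      show "norm (res1 p t (v1 n) (v2 n) (e1 n) x) \<le> keps c n" for n
        by (rule norm_le_fbound[OF inv(5) sub[OF x]])
    qed
    show "res2 p t u1 u2 (lim e2) x = 0"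
    proof (rule zero)
      show "(\<lambda>n. res2 p t (v1 n) (v2 n) (e2 n) x) \<longlonglongrightarrow> res2 p t u1 u2 (lim e2) x"
        unfolding res2_def using x
        by (intro tendsto_diff U1 lime slim U2 x xt norm_le_fbound[OF U1(1)]) (auto simp: strip_def)
      show "norm (res2 p t (v1 n) (v2 n) (e2 n) x) \<le> keps c n" for n
        by (rule norm_le_fbound[OF inv(6) sub[OF x]])
    qed
  qed
qed

section \<open>Bihomogeneous forms\<close>

abbreviation vec2 :: "complex \<Rightarrow> complex \<Rightarrow> complex^2" where
  "vec2 a b \<equiv> vector [a, b]"

lemma vec2_eq_0_iff [simp]: "vec2 a b = 0 \<longleftrightarrow> a = 0 \<and> b = 0"
  by (auto simp: vec_eq_iff forall_2)

lemma vec2_collapse [simp]: "vec2 (x$1) (x$2) = x"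
  by (simp add: vec_eq_iff forall_2)

lemma vec2_eq_iff: "(x :: complex^2) = y \<longleftrightarrow> x$1 = y$1 \<and> x$2 = y$2"
  by (simp add: vec_eq_iff forall_2)

lemma bihom_monomial:
  assumes "i \<le> a" "j \<le> b"
  shows "bihom a b (\<lambda>x y. k * (x$1) ^ i * (x$2) ^ (a - i) * (y$1) ^ j * (y$2) ^ (b - j))"
  unfolding bihom_def
proof (intro exI allI)
  fix x y :: "complex^2"
  let ?K = "k * (x$1) ^ i * (x$2) ^ (a - i) * (y$1) ^ j * (y$2) ^ (b - j)"
  have "(\<Sum>i'\<le>a. \<Sum>j'\<le>b. (if i' = i \<and> j' = j then k else 0) * (x$1) ^ i' * (x$2) ^ (a - i') * (y$1) ^ j' * (y$2) ^ (b - j'))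
    = (\<Sum>i'\<le>a. \<Sum>j'\<le>b. if i' = i \<and> j' = j then ?K else 0)"
    by (intro sum.cong refl) auto
  also have "\<dots> = (\<Sum>i'\<le>a. if i' = i then ?K else 0)"
    by (intro sum.cong refl) (use assms in \<open>auto simp: sum.neutral\<close>)
  finally show "?K = (\<Sum>i'\<le>a. \<Sum>j'\<le>b. (if i' = i \<and> j' = j then k else 0) * (x$1) ^ i' * (x$2) ^ (a - i') * (y$1) ^ j' * (y$2) ^ (b - j'))"
    using assms by simp
qed

lemma bihom_add:
  assumes "bihom a b P" "bihom a b Q"
  shows "bihom a b (\<lambda>x y. P x y + Q x y)"
proof -
  obtain c d where "\<forall>x y. P x y = (\<Sum>i\<le>a. \<Sum>j\<le>b. c i j * (x$1) ^ i * (x$2) ^ (a - i) * (y$1) ^ j * (y$2) ^ (b - j))"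
    "\<forall>x y. Q x y = (\<Sum>i\<le>a. \<Sum>j\<le>b. d i j * (x$1) ^ i * (x$2) ^ (a - i) * (y$1) ^ j * (y$2) ^ (b - j))"
    using assms unfolding bihom_def by blast
  then show ?thesis
    unfolding bihom_def
    by (intro exI[of _ "\<lambda>i j. c i j + d i j"]) (simp add: sum.distrib distrib_right)
qed

lemma bihom_zero: "bihom a b (\<lambda>_ _. 0)"
  unfolding bihom_def by (intro exI[of _ "\<lambda>_ _. 0"]) simp

lemma bihom_sum:
  assumes "\<And>i. i \<in> I \<Longrightarrow> bihom a b (P i)"
  shows "bihom a b (\<lambda>x y. \<Sum>i\<in>I. P i x y)"
proof (cases "finite I")
  case True
  then show ?thesis using assms
    by (induction I rule: finite_induct) (auto intro: bihom_zero bihom_add)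
qed (simp add: bihom_zero)

lemma bihom_mult:
  assumes P: "bihom a b P" and Q: "bihom a' b' Q"
  shows "bihom (a + a') (b + b') (\<lambda>x y. P x y * Q x y)"
proof -
  obtain c where c: "\<And>x y. P x y = (\<Sum>i\<le>a. \<Sum>j\<le>b. c i j * (x$1) ^ i * (x$2) ^ (a - i) * (y$1) ^ j * (y$2) ^ (b - j))"
    using P unfolding bihom_def by blast
  obtain d where d: "\<And>x y. Q x y = (\<Sum>i\<le>a'. \<Sum>j\<le>b'. d i j * (x$1) ^ i * (x$2) ^ (a' - i) * (y$1) ^ j * (y$2) ^ (b' - j))"
    using Q unfolding bihom_def by blast
  have "P x y * Q x y = (\<Sum>i\<le>a. \<Sum>j\<le>b. \<Sum>i'\<le>a'. \<Sum>j'\<le>b'.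
      (c i j * d i' j') * (x$1) ^ (i + i') * (x$2) ^ (a + a' - (i + i')) * (y$1) ^ (j + j') * (y$2) ^ (b + b' - (j + j')))" for x y
    unfolding c sum_distrib_right unfolding d sum_distrib_left
  proof (intro sum.cong refl)
    fix i j i' j' assume "i \<in> {..a}" "j \<in> {..b}" "i' \<in> {..a'}" "j' \<in> {..b'}"
    then have e: "a + a' - (i + i') = (a - i) + (a' - i')" "b + b' - (j + j') = (b - j) + (b' - j')" by auto
    show "c i j * (x$1) ^ i * (x$2) ^ (a - i) * (y$1) ^ j * (y$2) ^ (b - j) *
        (d i' j' * (x$1) ^ i' * (x$2) ^ (a' - i') * (y$1) ^ j' * (y$2) ^ (b' - j')) =
      (c i j * d i' j') * (x$1) ^ (i + i') * (x$2) ^ (a + a' - (i + i')) * (y$1) ^ (j + j') * (y$2) ^ (b + b' - (j + j'))"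
      unfolding e power_add by (simp only: mult_ac)
  qed
  then show ?thesis
    by (simp only:) (intro bihom_sum bihom_monomial; simp)
qed

lemma bihom_const: "bihom 0 0 (\<lambda>_ _. k)"
  using bihom_monomial[of 0 0 0 0 k] by simp

lemma bihom_cmult: "bihom a b P \<Longrightarrow> bihom a b (\<lambda>x y. k * P x y)"
  using bihom_mult[OF bihom_const[of k]] by fastforce

lemma bihom_diff: "bihom a b P \<Longrightarrow> bihom a b Q \<Longrightarrow> bihom a b (\<lambda>x y. P x y - Q x y)"
  using bihom_add[of a b P "\<lambda>x y. (-1) * Q x y"] bihom_cmult[of a b Q "-1"] by simp

lemma bihom_coord: "bihom 1 0 (\<lambda>x y. x$i)" "bihom 0 1 (\<lambda>x y. y$i)"
proof -
  have "i = 1 \<or> i = 2" using exhaust_2 by blast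
  then show "bihom 1 0 (\<lambda>x y. x$i)" "bihom 0 1 (\<lambda>x y. y$i)"
    using bihom_monomial[of 1 1 0 0 1] bihom_monomial[of 0 1 0 0 1]
      bihom_monomial[of 0 0 1 1 1] bihom_monomial[of 0 0 0 1 1] by auto
qed

lemma bihom_power: "bihom a b P \<Longrightarrow> bihom (n * a) (n * b) (\<lambda>x y. P x y ^ n)"
proof (induction n)
  case (Suc n)
  from bihom_mult[OF Suc.prems Suc.IH[OF Suc.prems]] show ?case by simp
qed (simp add: bihom_const)

lemma bihom_compose:
  assumes P: "bihom k l P" and F: "\<And>i. bihom a b (\<lambda>x y. F x y $ i)" and G: "\<And>i. bihom a' b' (\<lambda>x y. G x y $ i)"
  shows "bihom (k * a + l * a') (k * b + l * b') (\<lambda>x y. P (F x y) (G x y))"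
proof -
  obtain c where c: "\<And>x y. P x y = (\<Sum>i\<le>k. \<Sum>j\<le>l. c i j * (x$1) ^ i * (x$2) ^ (k - i) * (y$1) ^ j * (y$2) ^ (l - j))"
    using P unfolding bihom_def by blast
  show ?thesis
    unfolding c
  proof (intro bihom_sum)
    fix i j assume "i \<in> {..k}" "j \<in> {..l}"
    then have e: "0 + i * a + (k - i) * a + j * a' + (l - j) * a' = k * a + l * a'"
      "0 + i * b + (k - i) * b + j * b' + (l - j) * b' = k * b + l * b'"
      by (simp_all add: add.assoc flip: distrib_right)
    show "bihom (k * a + l * a') (k * b + l * b')
      (\<lambda>x y. c i j * (F x y $ 1) ^ i * (F x y $ 2) ^ (k - i) * (G x y $ 1) ^ j * (G x y $ 2) ^ (l - j))"
      unfolding e[symmetric] by (intro bihom_mult bihom_const bihom_power F G)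
  qed
qed

lemma bihom_scale:
  assumes "bihom a b P"
  shows "P (c *s x) (d *s y) = c ^ a * d ^ b * P x y"
proof -
  obtain e where e: "\<And>x y. P x y = (\<Sum>i\<le>a. \<Sum>j\<le>b. e i j * (x$1) ^ i * (x$2) ^ (a - i) * (y$1) ^ j * (y$2) ^ (b - j))"
    using assms unfolding bihom_def by blast
  show ?thesis
    unfolding e sum_distrib_left
  proof (intro sum.cong refl)
    fix i j assume ij: "i \<in> {..a}" "j \<in> {..b}"
    have "c ^ a = c ^ i * c ^ (a - i)" "d ^ b = d ^ j * d ^ (b - j)"
      using ij by (simp_all flip: power_add)
    then show "e i j * ((c *s x)$1) ^ i * ((c *s x)$2) ^ (a - i) * ((d *s y)$1) ^ j * ((d *s y)$2) ^ (b - j) =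
       c ^ a * d ^ b * (e i j * (x$1) ^ i * (x$2) ^ (a - i) * (y$1) ^ j * (y$2) ^ (b - j))"
      by (simp add: power_mult_distrib mult_ac)
  qed
qed

text \<open>Doubling one pair of coordinates multiplies the value by 2 to the corresponding degree,
  which can be read off at a point where the form does not vanish.\<close>

lemma bidegree_unique:
  assumes "bihom a b P" "bihom a' b' P" "P x y \<noteq> 0"
  shows "a = a' \<and> b = b'"
proof -
  have "(2::complex) ^ a * 1 ^ b * P x y = 2 ^ a' * 1 ^ b' * P x y" "(1::complex) ^ a * 2 ^ b * P x y = 1 ^ a' * 2 ^ b' * P x y"
    using bihom_scale[OF assms(1)] bihom_scale[OF assms(2)] by metis+
  then have "(2::complex) ^ a = 2 ^ a'" "(2::complex) ^ b = 2 ^ b'" using assms(3) by auto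
  then have "(2::real) ^ a = 2 ^ a'" "(2::real) ^ b = 2 ^ b'"
    by (metis norm_numeral norm_power)+
  then show ?thesis by simp
qed

lemma divisor_class_eq:
  assumes "bihom a b P" "P x y \<noteq> 0"
  shows "divisor_class P = (real a, real b)"
  unfolding divisor_class_def
proof (rule the_equality)
  show "\<exists>a' b'. bihom a' b' P \<and> (real a, real b) = (real a', real b')" using assms(1) by blast
  show "v = (real a, real b)" if "\<exists>a b. bihom a b P \<and> v = (real a, real b)" for v
    using that bidegree_unique[OF assms(1) _ assms(2)] by blast
qed

lemma bihom_swap:
  assumes "bihom a b P"
  shows "bihom b a (\<lambda>x y. P y x)"
proof -
  have "bihom (a * 0 + b * 1) (a * 1 + b * 0) (\<lambda>x y. P y x)"
    by (rule bihom_compose[OF assms, of 0 1 "\<lambda>x y. y" 1 0 "\<lambda>x y. x"]) (rule bihom_coord)+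
  then show ?thesis by simp
qed

section \<open>Generic nonvanishing and one-variable slices\<close>

lemma bihom_generic_nonzero:
  assumes "bihom a b P" "P x y \<noteq> 0"
  obtains T where "finite T" "\<And>t. t \<notin> T \<Longrightarrow> finite {s. P (vec2 s 1) (vec2 t 1) = 0}"
proof -
  obtain c where c: "\<And>x y. P x y = (\<Sum>i\<le>a. \<Sum>j\<le>b. c i j * (x$1) ^ i * (x$2) ^ (a - i) * (y$1) ^ j * (y$2) ^ (b - j))"
    using assms unfolding bihom_def by blast
  have "\<exists>i\<le>a. \<exists>j\<le>b. c i j \<noteq> 0"
  proof (rule ccontr)
    assume "\<not> (\<exists>i\<le>a. \<exists>j\<le>b. c i j \<noteq> 0)"
    then have "P x y = 0" unfolding c by (intro sum.neutral ballI) auto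
    with assms show False by simp
  qed
  then obtain i0 j0 where ij: "i0 \<le> a" "j0 \<le> b" "c i0 j0 \<noteq> 0" by blast
  let ?T = "{t. (\<Sum>j\<le>b. c i0 j * t ^ j) = 0}"
  show ?thesis
  proof (rule that[of ?T])
    show "finite ?T" unfolding Transcendental.polyfun_finite_roots using ij by blast
    fix t assume t: "t \<notin> ?T"
    have "P (vec2 s 1) (vec2 t 1) = (\<Sum>i\<le>a. (\<Sum>j\<le>b. c i j * t ^ j) * s ^ i)" for s
      unfolding c by (simp add: sum_distrib_left mult_ac)
    then show "finite {s. P (vec2 s 1) (vec2 t 1) = 0}"
      using t ij by (simp only: Transcendental.polyfun_finite_roots) blast
  qed
qed

lemma infinite_of_real: "infinite (range (of_real :: real \<Rightarrow> complex))"
  by (simp add: finite_image_iff inj_def infinite_UNIV_char_0)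

lemma exists_real_notin: "finite (T :: complex set) \<Longrightarrow> \<exists>r. of_real r \<notin> T"
  using infinite_of_real by (metis finite_subset image_subsetI)

text \<open>Zariski density of the real affine points: finitely many bad second coordinates, and for
  any other one finitely many bad first coordinates, cannot exhaust the reals.\<close>

lemma bihom_mult_nonzero_real:
  assumes "bihom a b P" "P x y \<noteq> 0" "bihom a' b' Q" "Q x' y' \<noteq> 0"
  shows "\<exists>s t :: real. P (vec2 (of_real s) 1) (vec2 (of_real t) 1) * Q (vec2 (of_real s) 1) (vec2 (of_real t) 1) \<noteq> 0"
proof -
  obtain T where T: "finite T" "\<And>t. t \<notin> T \<Longrightarrow> finite {s. P (vec2 s 1) (vec2 t 1) = 0}"
    using bihom_generic_nonzero[OF assms(1,2)] by blast
  obtain T' where T': "finite T'" "\<And>t. t \<notin> T' \<Longrightarrow> finite {s. Q (vec2 s 1) (vec2 t 1) = 0}"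
    using bihom_generic_nonzero[OF assms(3,4)] by blast
  obtain t :: real where t: "of_real t \<notin> T \<union> T'" using exists_real_notin[of "T \<union> T'"] T(1) T'(1) by blast
  then have "finite ({s. P (vec2 s 1) (vec2 (of_real t) 1) = 0} \<union> {s. Q (vec2 s 1) (vec2 (of_real t) 1) = 0})"
    using T(2) T'(2) by auto
  from exists_real_notin[OF this] show ?thesis by auto
qed

lemma bihom_zero_if_generically_zero:
  assumes "bihom a b P" "finite S" "\<And>s t. s \<notin> S \<Longrightarrow> P (vec2 s 1) (vec2 t 1) = 0"
  shows "P x y = 0"
proof (rule ccontr)
  assume "P x y \<noteq> 0"
  then obtain T where T: "finite T" "\<And>t. t \<notin> T \<Longrightarrow> finite {s. P (vec2 s 1) (vec2 t 1) = 0}"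
    using bihom_generic_nonzero[OF assms(1)] by blast
  obtain t where "t \<notin> T" using exists_real_notin[OF T(1)] by blast
  then have "finite (S \<union> {s. P (vec2 s 1) (vec2 t 1) = 0})" using T(2) assms(2) by blast
  moreover have "S \<union> {s. P (vec2 s 1) (vec2 t 1) = 0} = UNIV" using assms(3) by blast
  ultimately show False using infinite_UNIV_char_0 by metis
qed

text \<open>The coefficient of index \<open>a\<close> is the value at the point at infinity, so a
  drop of the degree records a zero there.\<close>

lemma bihom_slice:
  assumes "bihom a b P"
  obtains p where "degree p \<le> a" "\<forall>s. P (vec2 s 1) y = poly p s" "coeff p a = P (vec2 1 0) y"
proof -
  obtain c where c: "\<And>x y. P x y = (\<Sum>i\<le>a. \<Sum>j\<le>b. c i j * (x$1) ^ i * (x$2) ^ (a - i) * (y$1) ^ j * (y$2) ^ (b - j))"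
    using assms unfolding bihom_def by blast
  define d where "d i = (\<Sum>j\<le>b. c i j * (y$1) ^ j * (y$2) ^ (b - j))" for i
  have P: "P x y = (\<Sum>i\<le>a. d i * (x$1) ^ i * (x$2) ^ (a - i))" for x
    unfolding c d_def sum_distrib_right by (simp add: mult_ac)
  define p where "p = (\<Sum>i\<le>a. monom (d i) i)"
  show ?thesis
  proof (rule that[of p])
    show "degree p \<le> a" unfolding p_def by (intro degree_sum_le) (auto intro: order_trans[OF degree_monom_le])
    show "\<forall>s. P (vec2 s 1) y = poly p s"
      by (simp add: P p_def poly_sum poly_monom)
    have "P (vec2 1 0) y = (\<Sum>i\<le>a. if i = a then d a else 0)"
      unfolding P by (intro sum.cong) (auto simp: power_0_left)
    then show "coeff p a = P (vec2 1 0) y" by (simp add: p_def coeff_sum coeff_monom)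
  qed
qed

definition hform :: "nat \<Rightarrow> complex poly \<Rightarrow> complex^2 \<Rightarrow> complex" where
  "hform k p x = (\<Sum>i\<le>k. coeff p i * (x$1) ^ i * (x$2) ^ (k - i))"

lemma hform_affine: "degree p \<le> k \<Longrightarrow> hform k p (vec2 s 1) = poly p s"
  unfolding hform_def poly_altdef by (simp, intro sum.mono_neutral_right) (auto simp: coeff_eq_0)

lemma bihom_hform: "bihom k l (\<lambda>x y. hform k p x * hform l q y)"
proof -
  have "hform k p x * hform l q y = (\<Sum>i\<le>k. \<Sum>j\<le>l. (coeff p i * coeff q j) * (x$1) ^ i * (x$2) ^ (k - i) * (y$1) ^ j * (y$2) ^ (l - j))" for x y
    unfolding hform_def sum_distrib_left sum_distrib_right by (rule trans[OF sum.swap]) (simp add: mult_ac)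
  then show ?thesis unfolding bihom_def by (intro exI[of _ "\<lambda>i j. coeff p i * coeff q j"]) simp
qed

lemma lagrange_interpolation:
  fixes A :: "'a::field set"
  assumes "finite A" "card A = Suc m"
  obtains L where "\<And>j. j \<in> A \<Longrightarrow> degree (L j) \<le> m"
    "\<And>q t. degree q \<le> m \<Longrightarrow> poly q t = (\<Sum>j\<in>A. poly q j * poly (L j) t)"
proof -
  define L where "L j = (\<Prod>k\<in>A - {j}. smult (1 / (j - k)) [:- k, 1:])" for j :: 'a
  have dL: "degree (L j) \<le> m" if "j \<in> A" for j
  proof -
    have "degree (L j) \<le> sum (degree \<circ> (\<lambda>k. smult (1 / (j - k)) [:- k, 1:])) (A - {j})"
      unfolding L_def by (intro degree_prod_sum_le) (use assms in auto)
    also have "\<dots> \<le> (\<Sum>k\<in>A - {j}. 1)" by (intro sum_mono) (auto intro: order_trans[OF degree_smult_le])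
    also have "\<dots> = m" using that assms by simp
    finally show ?thesis .
  qed
  have Lj: "poly (L j) k = (if k = j then 1 else 0)" if "j \<in> A" "k \<in> A" for j k
    using that assms by (auto simp: L_def poly_prod diff_divide_distrib[symmetric] intro!: prod.neutral)
  have "poly q t = (\<Sum>j\<in>A. poly q j * poly (L j) t)" if q: "degree q \<le> m" for q t
  proof -
    let ?r = "\<Sum>j\<in>A. smult (poly q j) (L j)"
    have "q = ?r"
    proof (rule poly_eqI_degree[of A])
      show "poly q x = poly ?r x" if "x \<in> A" for x
      proof -
        have "poly ?r x = (\<Sum>j\<in>A. if x = j then poly q x else 0)"
          unfolding poly_sum by (intro sum.cong refl) (use Lj that in auto)
        then show ?thesis using that assms by simp
      qed
      have "degree ?r \<le> m"
        by (intro degree_sum_le assms) (auto intro: order_trans[OF degree_smult_le] dL)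
      then show "degree ?r < card A" "degree q < card A" using assms q by auto
    qed
    then show ?thesis by (metis (mono_tags, lifting) poly_smult poly_sum sum.cong)
  qed
  with dL that show ?thesis by blast
qed

text \<open>Without a common root the greatest common divisor has no root and is constant by the
  fundamental theorem of algebra. A Bezout relation then yields the multiplier.\<close>

lemma proportional_polys:
  fixes p1 p2 q1 q2 :: "complex poly"
  assumes nr: "\<And>s. poly p1 s \<noteq> 0 \<or> poly p2 s \<noteq> 0" and e: "q1 * p2 = q2 * p1"
  obtains h where "q1 = h * p1" "q2 = h * p2"
proof -
  define g where "g = gcd p1 p2"
  have g: "g dvd p1" "g dvd p2" by (auto simp: g_def)
  have "\<not> (\<exists>z. poly g z = 0)" using nr g by (metis dvdE mult_zero_left poly_mult)
  then have "\<exists>a l. a \<noteq> 0 \<and> l = 0 \<and> g = pCons a l" using fundamental_theorem_of_algebra_alt by blast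
  then obtain c where c: "c \<noteq> 0" "g = [:c:]" by blast
  obtain u v where uv: "u * p1 + v * p2 = g"
    using bezout_coefficients_fst_snd unfolding g_def by blast
  define h where "h = smult (1 / c) (u * q1 + v * q2)"
  have "(u * q1 + v * q2) * p1 = q1 * g" "(u * q1 + v * q2) * p2 = q2 * g"
    unfolding uv[symmetric] using e by (simp_all add: algebra_simps)
  then have "h * p1 = q1" "h * p2 = q2" using c by (simp_all add: h_def)
  then show ?thesis using that by metis
qed

subsection \<open>Forms with finitely many common zeros\<close>

definition zero_set :: "(complex^2 \<Rightarrow> complex^2 \<Rightarrow> complex^2) \<Rightarrow> X set" where
  "zero_set F = {(proj x, proj y) |x y. x \<noteq> 0 \<and> y \<noteq> 0 \<and> F x y = 0}"

lemma zero_setI: "x \<noteq> 0 \<Longrightarrow> y \<noteq> 0 \<Longrightarrow> F x y = 0 \<Longrightarrow> (proj x, proj y) \<in> zero_set F"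
  unfolding zero_set_def by blast

definition bihom_map :: "nat \<Rightarrow> nat \<Rightarrow> (complex^2 \<Rightarrow> complex^2 \<Rightarrow> complex^2) \<Rightarrow> bool" where
  "bihom_map a b F \<longleftrightarrow> (\<forall>i. bihom a b (\<lambda>x y. F x y $ i))"

lemma bihom_mapD: "bihom_map a b F \<Longrightarrow> bihom a b (\<lambda>x y. F x y $ i)"
  by (simp add: bihom_map_def)

lemma bihom_map_scale: "bihom_map a b F \<Longrightarrow> F (c *s x) (d *s y) = (c ^ a * d ^ b) *s F x y"
  using bihom_scale[where P = "\<lambda>x y. F x y $ _" and x = x and y = y and c = c and d = d] by (simp add: bihom_map_def vec_eq_iff)

lemma bihom_map_compose:
  assumes "bihom_map k l P" "bihom_map a b F" "bihom_map a' b' G"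
  shows "bihom_map (k * a + l * a') (k * b + l * b') (\<lambda>x y. P (F x y) (G x y))"
  using assms bihom_compose unfolding bihom_map_def by blast

lemma proj_affine_inject: "proj (vec2 s 1) = proj (vec2 t 1) \<longleftrightarrow> s = t"
  by (subst proj_eq_iff) (auto simp: vec_eq_iff forall_2 intro!: exI[of _ 1])

text \<open>Every line with fixed second coordinate meets the curve: a slice of full degree
  \<open>k > 0\<close> has a root, and otherwise the point at infinity is a zero.\<close>

lemma infinite_zeros_aux:
  assumes "bihom k l H" "0 < k"
  shows "infinite {(proj x, proj y) |x y. x \<noteq> 0 \<and> y \<noteq> 0 \<and> H x y = 0}"
proof
  assume fin: "finite {(proj x, proj y) |x y. x \<noteq> 0 \<and> y \<noteq> 0 \<and> H x y = 0}" (is "finite ?Z")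
  have "\<exists>x. x \<noteq> 0 \<and> H x (vec2 t 1) = 0" for t
  proof -
    obtain p where p: "degree p \<le> k" "\<forall>s. H (vec2 s 1) (vec2 t 1) = poly p s" "coeff p k = H (vec2 1 0) (vec2 t 1)"
      using bihom_slice[OF assms(1)] by blast
    show ?thesis
    proof (cases "coeff p k = 0")
      case True
      then show ?thesis using p(3) by (intro exI[of _ "vec2 1 0"]) auto
    next
      case False
      then have "degree p = k" using p(1) le_degree le_antisym by blast
      then have "\<exists>z. poly p z = 0" using fundamental_theorem_of_algebra_alt[of p] assms(2) by force
      then show ?thesis using p(2) by (metis vec2_eq_0_iff zero_neq_one)
    qed
  qed
  then have "range (\<lambda>t. proj (vec2 t 1)) \<subseteq> snd ` ?Z" by force
  then have "finite (range (\<lambda>t. proj (vec2 t 1)))" using fin finite_subset by blast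
  then show False
    using proj_affine_inject by (simp add: finite_image_iff inj_def infinite_UNIV_char_0)
qed

lemma zero_pairs_swap:
  "{(proj x, proj y) |x y. x \<noteq> 0 \<and> y \<noteq> 0 \<and> Q y x} = prod.swap ` {(proj x, proj y) |x y. x \<noteq> 0 \<and> y \<noteq> 0 \<and> Q x y}"
proof (intro equalityI subsetI)
  fix z assume "z \<in> {(proj x, proj y) |x y. x \<noteq> 0 \<and> y \<noteq> 0 \<and> Q y x}"
  then obtain x y where "z = prod.swap (proj y, proj x)" "x \<noteq> 0" "y \<noteq> 0" "Q y x" by auto
  then show "z \<in> prod.swap ` {(proj x, proj y) |x y. x \<noteq> 0 \<and> y \<noteq> 0 \<and> Q x y}" by blast
next
  fix z assume "z \<in> prod.swap ` {(proj x, proj y) |x y. x \<noteq> 0 \<and> y \<noteq> 0 \<and> Q x y}"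
  then obtain x y where "z = (proj y, proj x)" "x \<noteq> 0" "y \<noteq> 0" "Q x y" by auto
  then show "z \<in> {(proj x, proj y) |x y. x \<noteq> 0 \<and> y \<noteq> 0 \<and> Q y x}" by blast
qed

lemma infinite_zeros:
  assumes H: "bihom k l H" and kl: "k \<noteq> 0 \<or> l \<noteq> 0"
  shows "infinite {(proj x, proj y) |x y. x \<noteq> 0 \<and> y \<noteq> 0 \<and> H x y = 0}"
proof (cases "k = 0")
  case True
  have "infinite {(proj x, proj y) |x y. x \<noteq> 0 \<and> y \<noteq> 0 \<and> H y x = 0}" (is "infinite ?A")
    by (rule infinite_zeros_aux[OF bihom_swap[OF H]]) (use True kl in auto)
  then show ?thesis unfolding zero_pairs_swap[of "\<lambda>x y. H x y = 0"] by (meson finite_imageI)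
qed (use infinite_zeros_aux[OF H] in auto)

text \<open>A common factor of positive bidegree would vanish on a whole curve. This replaces the
  check of all possible factors by a count of points.\<close>

lemma coprime_formsI:
  assumes "bihom_map a b F" "finite (zero_set F)"
  shows "coprime_forms F"
  unfolding coprime_forms_def
proof (intro conjI allI impI)
  show "\<exists>a b. \<forall>i. bihom a b (\<lambda>x y. F x y $ i)" using assms(1) by (auto simp: bihom_map_def)
  fix k l H assume H: "bihom k l H \<and> (\<forall>i. bihom_dvd H (\<lambda>x y. F x y $ i))"
  have "{(proj x, proj y) |x y. x \<noteq> 0 \<and> y \<noteq> 0 \<and> H x y = 0} \<subseteq> zero_set F"
  proof -
    have "F x y = 0" if "H x y = 0" for x y
    proof -
      have "F x y $ i = 0" for i
      proof -
        obtain R where "F x y $ i = H x y * R" using H unfolding bihom_dvd_def by blast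
        then show ?thesis using that by simp
      qed
      then show ?thesis by (simp add: vec_eq_iff)
    qed
    then show ?thesis unfolding zero_set_def by blast
  qed
  then have "finite {(proj x, proj y) |x y. x \<noteq> 0 \<and> y \<noteq> 0 \<and> H x y = 0}" using assms(2) finite_subset by blast
  then show "k = 0" "l = 0" using infinite_zeros H by blast+
qed

lemma coprime_forms_nonzero:
  assumes "coprime_forms F"
  obtains x y where "F x y \<noteq> 0"
proof (rule ccontr)
  assume "\<not> thesis"
  then have z: "F x y = 0" for x y using that by blast
  have "bihom_dvd (\<lambda>x y. x$1) (\<lambda>x y. F x y $ i)" for i
    unfolding bihom_dvd_def by (rule exI, rule exI, rule exI[of _ "\<lambda>_ _. 0"]) (auto simp: z intro: bihom_zero)
  then show False using assms bihom_coord(1)[of 1] unfolding coprime_forms_def by (metis zero_neq_one)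
qed

text \<open>Away from the finitely many \<open>t\<close> over which \<open>F\<close> has a zero, the
  slices of its components have no common root, so the slice of \<open>F'\<close> is a polynomial
  multiple \<open>h\<close> of that of \<open>F\<close>. Since \<open>F\<close> does not vanish at
  infinity either, one component has full degree \<open>a\<close>, which bounds the degree of
  \<open>h\<close>.\<close>

lemma proportional_slices:
  assumes F: "bihom_map a b F" and fin: "finite (zero_set F)" and F': "bihom_map a' b' F'"
    and par: "\<And>x y. F' x y $ 1 * F x y $ 2 = F' x y $ 2 * F x y $ 1"
  obtains T where "finite T" "\<forall>t s. t \<notin> T \<longrightarrow> F (vec2 s 1) (vec2 t 1) \<noteq> 0"
    "\<forall>t. \<exists>h. t \<notin> T \<longrightarrow> (h \<noteq> 0 \<longrightarrow> degree h + a \<le> a') \<and> (\<forall>s. F' (vec2 s 1) (vec2 t 1) = poly h s *s F (vec2 s 1) (vec2 t 1))"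
proof -
  define T where "T = {t. \<exists>x. x \<noteq> 0 \<and> F x (vec2 t 1) = 0}"
  have "(\<lambda>t. proj (vec2 t 1)) ` T \<subseteq> snd ` zero_set F"
  proof (rule image_subsetI)
    fix t assume "t \<in> T"
    then obtain x where "x \<noteq> 0" "F x (vec2 t 1) = 0" by (auto simp: T_def)
    then have "(proj x, proj (vec2 t 1)) \<in> zero_set F" by (intro zero_setI) auto
    then show "proj (vec2 t 1) \<in> snd ` zero_set F" by (rule image_eqI[rotated]) simp
  qed
  then have "finite ((\<lambda>t. proj (vec2 t 1)) ` T)" by (rule finite_subset) (rule finite_imageI[OF fin])
  then have "finite T" by (rule finite_imageD) (simp add: inj_on_def proj_affine_inject)
  moreover have "\<forall>t s. t \<notin> T \<longrightarrow> F (vec2 s 1) (vec2 t 1) \<noteq> 0"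
    unfolding T_def by (metis (mono_tags, lifting) mem_Collect_eq vec2_eq_0_iff zero_neq_one)
  moreover have "\<forall>t. \<exists>h. t \<notin> T \<longrightarrow> (h \<noteq> 0 \<longrightarrow> degree h + a \<le> a') \<and> (\<forall>s. F' (vec2 s 1) (vec2 t 1) = poly h s *s F (vec2 s 1) (vec2 t 1))"
  proof -
   have "\<exists>h. (h \<noteq> 0 \<longrightarrow> degree h + a \<le> a') \<and> (\<forall>s. F' (vec2 s 1) (vec2 t 1) = poly h s *s F (vec2 s 1) (vec2 t 1))"
    if t: "t \<notin> T" for t
  proof -
    define y where "y = vec2 t 1"
    have nz: "F x y \<noteq> 0" if "x \<noteq> 0" for x using t that by (auto simp: T_def y_def)
    note Fb = bihom_mapD[OF F] bihom_mapD[OF F']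
    obtain p1 where p1: "degree p1 \<le> a" "\<forall>s. F (vec2 s 1) y $ 1 = poly p1 s" "coeff p1 a = F (vec2 1 0) y $ 1"
      by (rule bihom_slice[OF Fb(1)[of 1], of y]) (rule that)
    obtain p2 where p2: "degree p2 \<le> a" "\<forall>s. F (vec2 s 1) y $ 2 = poly p2 s" "coeff p2 a = F (vec2 1 0) y $ 2"
      by (rule bihom_slice[OF Fb(1)[of 2], of y]) (rule that)
    obtain q1 where q1: "degree q1 \<le> a'" "\<forall>s. F' (vec2 s 1) y $ 1 = poly q1 s" "coeff q1 a' = F' (vec2 1 0) y $ 1"
      by (rule bihom_slice[OF Fb(2)[of 1], of y]) (rule that)
    obtain q2 where q2: "degree q2 \<le> a'" "\<forall>s. F' (vec2 s 1) y $ 2 = poly q2 s" "coeff q2 a' = F' (vec2 1 0) y $ 2"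
      by (rule bihom_slice[OF Fb(2)[of 2], of y]) (rule that)
    have nr: "poly p1 s \<noteq> 0 \<or> poly p2 s \<noteq> 0" for s
      using nz[of "vec2 s 1"] p1(2) p2(2) by (auto simp: vec2_eq_iff)
    have "q1 * p2 = q2 * p1"
    proof -
      have "poly (q1 * p2) = poly (q2 * p1)"
        using par[of "vec2 _ 1" y] by (intro ext) (simp add: p1(2)[rule_format] p2(2)[rule_format] q1(2)[rule_format] q2(2)[rule_format])
      then show ?thesis by (simp only: poly_eq_poly_eq_iff)
    qed
    then obtain h where h: "q1 = h * p1" "q2 = h * p2" using proportional_polys[OF nr] by blast
    have "coeff p1 a \<noteq> 0 \<or> coeff p2 a \<noteq> 0"
      using nz[of "vec2 1 0"] p1(3) p2(3) by (auto simp: vec2_eq_iff)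
    then have "degree p1 = a \<and> p1 \<noteq> 0 \<or> degree p2 = a \<and> p2 \<noteq> 0"
      using p1(1) p2(1) le_degree[of p1 a] le_degree[of p2 a] by auto
    then have "degree h + a \<le> a'" if "h \<noteq> 0"
      using q1(1) q2(1) that by (auto simp: h degree_mult_eq)
    moreover have "F' (vec2 s 1) y = poly h s *s F (vec2 s 1) y" for s
      by (simp add: vec2_eq_iff p1(2) p2(2) q1(2) q2(2) h)
    ultimately show ?thesis unfolding y_def by blast
  qed
   then show ?thesis by blast
  qed
  ultimately show ?thesis by (rule that)
qed

text \<open>The quotient of the two pairs is a polynomial in each variable separately, hence a polynomial.\<close>

lemma proportional_coprime_forms:
  assumes F: "bihom_map a b F" and fin: "finite (zero_set F)" and F': "coprime_forms F'"
    and par: "\<And>x y. F' x y $ 1 * F x y $ 2 = F' x y $ 2 * F x y $ 1"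
  obtains c where "c \<noteq> 0" "\<And>x y. F' x y = c *s F x y"
proof -
  obtain a' b' where F'b: "bihom_map a' b' F'" using F' unfolding coprime_forms_def bihom_map_def by blast
  obtain x0 y0 where nz: "F' x0 y0 \<noteq> 0" using coprime_forms_nonzero[OF F'] .
  obtain T where T: "finite T" "\<forall>t s. t \<notin> T \<longrightarrow> F (vec2 s 1) (vec2 t 1) \<noteq> 0"
    "\<forall>t. \<exists>h. t \<notin> T \<longrightarrow> (h \<noteq> 0 \<longrightarrow> degree h + a \<le> a') \<and> (\<forall>s. F' (vec2 s 1) (vec2 t 1) = poly h s *s F (vec2 s 1) (vec2 t 1))"
    by (rule proportional_slices[OF F fin F'b par]) (rule that)
  have Fs: "bihom_map b a (\<lambda>x y. F y x)" "bihom_map b' a' (\<lambda>x y. F' y x)"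
    using F F'b bihom_swap unfolding bihom_map_def by blast+
  have zs: "finite (zero_set (\<lambda>x y. F y x))"
  proof -
    have "zero_set (\<lambda>x y. F y x) = prod.swap ` zero_set F"
      unfolding zero_set_def by (rule zero_pairs_swap)
    then show ?thesis using fin by simp
  qed
  obtain S where S: "finite S" "\<forall>s t. s \<notin> S \<longrightarrow> F (vec2 s 1) (vec2 t 1) \<noteq> 0"
    "\<forall>s. \<exists>h. s \<notin> S \<longrightarrow> (h \<noteq> 0 \<longrightarrow> degree h + b \<le> b') \<and> (\<forall>t. F' (vec2 s 1) (vec2 t 1) = poly h t *s F (vec2 s 1) (vec2 t 1))"
    by (rule proportional_slices[OF Fs(1) zs Fs(2) par]) (rule that)
  from choice[OF T(3)] obtain h where h: "\<And>t. t \<notin> T \<Longrightarrow> h t \<noteq> 0 \<longrightarrow> degree (h t) + a \<le> a'"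
    "\<And>t s. t \<notin> T \<Longrightarrow> F' (vec2 s 1) (vec2 t 1) = poly (h t) s *s F (vec2 s 1) (vec2 t 1)"
    by blast
  from choice[OF S(3)] obtain g where g: "\<And>s. s \<notin> S \<Longrightarrow> g s \<noteq> 0 \<longrightarrow> degree (g s) + b \<le> b'"
    "\<And>t s. s \<notin> S \<Longrightarrow> F' (vec2 s 1) (vec2 t 1) = poly (g s) t *s F (vec2 s 1) (vec2 t 1)"
    by blast
  obtain i0 where i0: "F' x0 y0 $ i0 \<noteq> 0" using nz by (auto simp: vec_eq_iff)
  have F'i: "bihom a' b' (\<lambda>x y. F' x y $ i)" for i using F'b by (simp add: bihom_map_def)
  have ex: "\<exists>s t. s \<notin> S \<and> t \<notin> T \<and> F' (vec2 s 1) (vec2 t 1) $ i0 \<noteq> 0"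
  proof -
    obtain T' where T': "finite T'" "\<And>t. t \<notin> T' \<Longrightarrow> finite {s. F' (vec2 s 1) (vec2 t 1) $ i0 = 0}"
      using bihom_generic_nonzero[OF F'i i0] by blast
    obtain t where t: "t \<notin> T \<union> T'" using exists_real_notin[of "T \<union> T'"] T(1) T'(1) by blast
    then have "finite (S \<union> {s. F' (vec2 s 1) (vec2 t 1) $ i0 = 0})" using T'(2) S(1) by blast
    then show ?thesis using exists_real_notin t by blast
  qed
  then obtain s1 t1 where st: "s1 \<notin> S" "t1 \<notin> T" "F' (vec2 s1 1) (vec2 t1 1) $ i0 \<noteq> 0" by blast
  have "h t1 \<noteq> 0" "g s1 \<noteq> 0" using st(3) h(2)[OF st(2), of s1] g(2)[OF st(1), of t1] by auto
  then have ab: "a \<le> a'" "b \<le> b'" using h(1)[OF st(2)] g(1)[OF st(1)] by auto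
  define m where "m = b' - b"
  have dh: "degree (h t) \<le> a' - a" if "t \<notin> T" for t using h(1)[OF that] by (cases "h t = 0") auto
  have dg: "degree (g s) \<le> m" if "s \<notin> S" for s using g(1)[OF that] by (cases "g s = 0") (auto simp: m_def)
  have "infinite (- T)" using T(1) by (simp add: finite_compl infinite_UNIV_char_0)
  then obtain A where A: "A \<subseteq> - T" "finite A" "card A = Suc m" using infinite_arbitrarily_large by metis
  obtain L where L: "\<And>j. j \<in> A \<Longrightarrow> degree (L j) \<le> m"
    "\<And>q t. degree q \<le> m \<Longrightarrow> poly q t = (\<Sum>j\<in>A. poly q j * poly (L j) t)"
    using lagrange_interpolation[OF A(2,3)] by metis
  \<comment> \<open>Lagrange interpolation in the second variable through the multipliers
    \<open>h j\<close> at \<open>m + 1\<close> good nodes, homogenised in both variables. For good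
    \<open>s\<close> it agrees with the multiplier \<open>g s\<close>, whose degree is at most
    \<open>m\<close>.\<close>
  define H where "H x y = (\<Sum>j\<in>A. hform (a' - a) (h j) x * hform m (L j) y)" for x y
  have Hb: "bihom (a' - a) m H" unfolding H_def by (intro bihom_sum bihom_hform)
  have gH: "poly (g s) t = H (vec2 s 1) (vec2 t 1)" if s: "s \<notin> S" for s t
  proof -
    have e: "poly (g s) j = poly (h j) s" if "j \<in> A" for j
    proof -
      have "j \<notin> T" using that A by blast
      then have "poly (g s) j *s F (vec2 s 1) (vec2 j 1) = poly (h j) s *s F (vec2 s 1) (vec2 j 1)"
        using g(2)[OF s] h(2) by metis
      then show ?thesis using S(2) s by (simp add: vec_eq_iff) (metis vec_eq_iff zero_index)
    qed
    have "poly (g s) t = (\<Sum>j\<in>A. poly (g s) j * poly (L j) t)" by (rule L(2)[OF dg[OF s]])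
    also have "\<dots> = H (vec2 s 1) (vec2 t 1)"
      unfolding H_def using A dh L(1) by (intro sum.cong refl) (auto simp: hform_affine e subset_iff)
    finally show ?thesis .
  qed
  have eq: "F' x y $ i = H x y * F x y $ i" for x y i
  proof -
    have Fi: "bihom (a' - a + a) (m + b) (\<lambda>x y. H x y * F x y $ i)"
      by (intro bihom_mult Hb) (use F in \<open>simp add: bihom_map_def\<close>)
    have "F' x y $ i - H x y * F x y $ i = 0"
    proof (rule bihom_zero_if_generically_zero[OF bihom_diff[OF F'i] S(1)])
      show "bihom a' b' (\<lambda>x y. H x y * F x y $ i)" using Fi ab by (simp add: m_def)
      show "F' (vec2 s 1) (vec2 t 1) $ i - H (vec2 s 1) (vec2 t 1) * F (vec2 s 1) (vec2 t 1) $ i = 0" if "s \<notin> S" for s t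
        using g(2)[OF that, of t] gH[OF that] by simp
    qed
    then show ?thesis by simp
  qed
  have "bihom_dvd H (\<lambda>x y. F' x y $ i)" for i
    unfolding bihom_dvd_def using F eq by (auto simp: bihom_map_def)
  \<comment> \<open>The quotient \<open>H\<close> divides both components of \<open>F'\<close>, so
    coprimality forces it to have bidegree (0, 0).\<close>
  then have "a' - a = 0" "m = 0" using F' Hb unfolding coprime_forms_def by blast+
  then have "bihom 0 0 H" using Hb by simp
  then obtain c where c: "\<And>x y. H x y = c" unfolding bihom_def by auto
  have Fc: "F' x y = c *s F x y" for x y by (simp add: vec_eq_iff eq c)
  moreover have "c \<noteq> 0" using nz Fc by auto
  ultimately show ?thesis using that by blast
qed

section \<open>Rational maps given by lifts\<close>

lemma rep_P1_props [simp]: "proj (rep_P1 p) = p" "rep_P1 p \<noteq> 0"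
  using Quotient3_abs_rep[OF Quotient3_P1] Quotient3_rep_reflp[OF Quotient3_P1, of p]
  by (auto simp: proj_rel_def)

lemma proj_scale: "c \<noteq> 0 \<Longrightarrow> x \<noteq> 0 \<Longrightarrow> proj (c *s x) = proj x"
  by (subst proj_eq_iff) (auto intro!: exI[of _ "inverse c"] simp: vec_eq_iff)

definition lmap :: "(complex^2 \<Rightarrow> complex^2 \<Rightarrow> complex^2) \<Rightarrow> (complex^2 \<Rightarrow> complex^2 \<Rightarrow> complex^2) \<Rightarrow> X \<rightharpoonup> X" where
  "lmap F G p = (let x = rep_P1 (fst p); y = rep_P1 (snd p)
     in if F x y = 0 \<or> G x y = 0 then None else Some (proj (F x y), proj (G x y)))"

lemma lmap_proj:
  assumes "bihom_map a b F" "bihom_map a' b' G" "x \<noteq> 0" "y \<noteq> 0"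
  shows "lmap F G (proj x, proj y) =
    (if F x y = 0 \<or> G x y = 0 then None else Some (proj (F x y), proj (G x y)))"
proof -
  obtain c where c: "c \<noteq> 0" "rep_P1 (proj x) = c *s x"
    using proj_eq_iff[of x "rep_P1 (proj x)"] assms by auto
  obtain d where d: "d \<noteq> 0" "rep_P1 (proj y) = d *s y"
    using proj_eq_iff[of y "rep_P1 (proj y)"] assms by auto
  note s = bihom_map_scale[OF assms(1), of c x d y] bihom_map_scale[OF assms(2), of c x d y]
  have nz: "c ^ a * d ^ b \<noteq> 0" "c ^ a' * d ^ b' \<noteq> 0" using c d by auto
  show ?thesis
    using nz by (auto simp: lmap_def c(2) d(2) s proj_scale)
qed

text \<open>Lifts with finitely many common zeros: a form of coprimality that can be verified for
  iterates by counting undefined points.\<close>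

definition nice :: "nat \<Rightarrow> nat \<Rightarrow> nat \<Rightarrow> nat \<Rightarrow> (complex^2 \<Rightarrow> complex^2 \<Rightarrow> complex^2) \<Rightarrow>
    (complex^2 \<Rightarrow> complex^2 \<Rightarrow> complex^2) \<Rightarrow> bool" where
  "nice a b a' b' F G \<longleftrightarrow> bihom_map a b F \<and> bihom_map a' b' G \<and> finite (zero_set F) \<and> finite (zero_set G)"

lemma nice_is_lift: "nice a b a' b' F G \<Longrightarrow> is_lift (lmap F G) F G"
  unfolding nice_def is_lift_def using coprime_formsI lmap_proj by blast

lemma nice_rational: "nice a b a' b' F G \<Longrightarrow> rational_map (lmap F G)"
  unfolding rational_map_def using nice_is_lift by blast

lemma nonzero_component:
  assumes "coprime_forms F"
  obtains a b i x y where "bihom a b (\<lambda>x y. F x y $ i)" "F x y $ i \<noteq> 0"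
proof -
  obtain x y where "F x y \<noteq> 0" using coprime_forms_nonzero[OF assms] .
  then obtain i where "F x y $ i \<noteq> 0" by (auto simp: vec_eq_iff)
  moreover obtain a b where "\<forall>i. bihom a b (\<lambda>x y. F x y $ i)" using assms unfolding coprime_forms_def by blast
  ultimately show ?thesis using that by blast
qed

lemma proj_parallel:
  assumes "x \<noteq> 0" "y \<noteq> 0" "proj x = proj y"
  shows "x $ 1 * y $ 2 = x $ 2 * y $ 1"
  using proj_eq_iff[OF assms(1,2)] assms(3) by auto

lemma proj_real_affine: "proj (vec2 (of_real s) 1) \<in> P1_real"
  unfolding P1_real_def by (auto intro!: exI[of _ "vec2 (of_real s) 1"] simp: forall_2)

section \<open>Uniqueness of rational maps and the pull-back matrix\<close>

lemma real_agreement_parallel: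
  assumes F: "bihom_map a b F" and cF': "coprime_forms F'" and cG: "coprime_forms G" and cG': "coprime_forms G'"
    and agree: "\<And>x y. x \<noteq> 0 \<Longrightarrow> y \<noteq> 0 \<Longrightarrow> (proj x, proj y) \<in> X_real \<Longrightarrow> F x y \<noteq> 0 \<Longrightarrow> F' x y \<noteq> 0 \<Longrightarrow>
      G x y \<noteq> 0 \<Longrightarrow> G' x y \<noteq> 0 \<Longrightarrow> proj (F' x y) = proj (F x y)"
  shows "F' x y $ 1 * F x y $ 2 = F' x y $ 2 * F x y $ 1"
proof -
  obtain a' b' where F': "bihom_map a' b' F'" using cF' unfolding coprime_forms_def bihom_map_def by blast
  define P where "P x y = F' x y $ 1 * F x y $ 2 - F' x y $ 2 * F x y $ 1" for x y
  have Pb: "bihom (a' + a) (b' + b) P"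
    unfolding P_def by (intro bihom_diff bihom_mult bihom_mapD[OF F] bihom_mapD[OF F'])
  have "P x y = 0"
  proof (rule ccontr)
    \<comment> \<open>The form \<open>P\<close> measures the failure of proportionality. A real
      point where neither \<open>P\<close> nor chosen components of \<open>G\<close> and
      \<open>G'\<close> vanish would be a point of both domains at which the maps must
      agree.\<close>
    assume P: "P x y \<noteq> 0"
    obtain k l i x1 y1 where g: "bihom k l (\<lambda>x y. G x y $ i)" "G x1 y1 $ i \<noteq> 0" using nonzero_component[OF cG] .
    obtain k' l' i' x2 y2 where g': "bihom k' l' (\<lambda>x y. G' x y $ i')" "G' x2 y2 $ i' \<noteq> 0" using nonzero_component[OF cG'] .
    obtain x3 y3 where Q: "G x3 y3 $ i * G' x3 y3 $ i' \<noteq> 0"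
      using bihom_mult_nonzero_real[OF g g'] by blast
    obtain s t :: real where st: "P (vec2 (of_real s) 1) (vec2 (of_real t) 1) *
        (G (vec2 (of_real s) 1) (vec2 (of_real t) 1) $ i * G' (vec2 (of_real s) 1) (vec2 (of_real t) 1) $ i') \<noteq> 0"
      using bihom_mult_nonzero_real[OF Pb P bihom_mult[OF g(1) g'(1)] Q] by blast
    define x0 where "x0 = vec2 (of_real s) 1"
    define y0 where "y0 = vec2 (of_real t) 1"
    have x0: "x0 \<noteq> 0" "y0 \<noteq> 0" "(proj x0, proj y0) \<in> X_real"
      by (simp_all add: x0_def y0_def X_real_def proj_real_affine)
    have nz: "P x0 y0 \<noteq> 0" "G x0 y0 \<noteq> 0" "G' x0 y0 \<noteq> 0" using st unfolding x0_def y0_def by auto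
    then have Fn: "F x0 y0 \<noteq> 0" "F' x0 y0 \<noteq> 0" by (auto simp: P_def)
    have "P x0 y0 = 0"
      using proj_parallel[OF Fn(2,1) agree[OF x0 Fn nz(2,3)]] by (simp add: P_def)
    with nz show False by simp
  qed
  then show ?thesis by (simp add: P_def)
qed

text \<open>The uniqueness behind the definite descriptions of composition, inverse and pull-back.
  Comparing on the real locus is convenient because all iterates of the map and its inverse are
  defined there.\<close>

lemma rational_map_eq_lmap:
  assumes n: "nice a b a' b' F G" and l: "is_lift h F' G'"
    and agree: "\<And>p q r. p \<in> X_real \<Longrightarrow> h p = Some q \<Longrightarrow> lmap F G p = Some r \<Longrightarrow> q = r"
  shows "h = lmap F G" "\<exists>c. c \<noteq> 0 \<and> (\<forall>x y. F' x y = c *s F x y)" "\<exists>c. c \<noteq> 0 \<and> (\<forall>x y. G' x y = c *s G x y)"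
proof -
  have F: "bihom_map a b F" and G: "bihom_map a' b' G" and fin: "finite (zero_set F)" "finite (zero_set G)"
    using n by (auto simp: nice_def)
  have cF: "coprime_forms F" and cG: "coprime_forms G" using coprime_formsI F G fin by blast+
  have cF': "coprime_forms F'" and cG': "coprime_forms G'"
    and h: "\<And>x y. x \<noteq> 0 \<Longrightarrow> y \<noteq> 0 \<Longrightarrow> h (proj x, proj y) =
          (if F' x y = 0 \<or> G' x y = 0 then None else Some (proj (F' x y), proj (G' x y)))"
    using l by (auto simp: is_lift_def)
  have ag: "proj (F' x y) = proj (F x y) \<and> proj (G' x y) = proj (G x y)"
    if "x \<noteq> 0" "y \<noteq> 0" "(proj x, proj y) \<in> X_real" "F x y \<noteq> 0" "F' x y \<noteq> 0" "G x y \<noteq> 0" "G' x y \<noteq> 0" for x y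
    using agree[OF that(3)] h[OF that(1,2)] lmap_proj[OF F G that(1,2)] that by auto
  have pF: "F' x y $ 1 * F x y $ 2 = F' x y $ 2 * F x y $ 1" for x y
    by (rule real_agreement_parallel[OF F cF' cG cG']) (use ag in blast)
  have pG: "G' x y $ 1 * G x y $ 2 = G' x y $ 2 * G x y $ 1" for x y
    by (rule real_agreement_parallel[OF G cG' cF cF']) (use ag in blast)
  obtain c where c: "c \<noteq> 0" "\<And>x y. F' x y = c *s F x y" using proportional_coprime_forms[OF F fin(1) cF' pF] by blast
  obtain d where d: "d \<noteq> 0" "\<And>x y. G' x y = d *s G x y" using proportional_coprime_forms[OF G fin(2) cG' pG] by blast
  show "\<exists>c. c \<noteq> 0 \<and> (\<forall>x y. F' x y = c *s F x y)" "\<exists>c. c \<noteq> 0 \<and> (\<forall>x y. G' x y = c *s G x y)"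
    using c d by blast+
  show "h = lmap F G"
  proof
    fix p
    obtain x y where p: "p = (proj x, proj y)" "x \<noteq> 0" "y \<noteq> 0" by (metis prod.collapse proj_cases)
    show "h p = lmap F G p"
      unfolding p(1) using c(1) d(1) by (auto simp: h[OF p(2,3)] lmap_proj[OF F G p(2,3)] c(2) d(2) proj_scale)
  qed
qed

text \<open>Lifts are unique up to scalars, so substitution acts on bidegrees through the bidegrees
  of \<open>F\<close> and \<open>G\<close>. Conversely the coordinate forms have the classes (1, 0)
  and (0, 1), which determine a linear map.\<close>

lemma pullback_nice:
  assumes n: "nice a b a' b' F G"
  shows "pullback (lmap F G) = (\<lambda>v. (fst v * real a + snd v * real a', fst v * real b + snd v * real b'))"
    (is "_ = ?M")
  unfolding pullback_def
proof (rule the_equality)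
  have F: "bihom_map a b F" and G: "bihom_map a' b' G" and fin: "finite (zero_set F)" "finite (zero_set G)"
    using n by (auto simp: nice_def)
  have linM: "linear ?M"
    by (rule linearI) (auto simp: algebra_simps)
  show "linear ?M \<and> (\<forall>F' G' P. is_lift (lmap F G) F' G' \<and> effective_divisor P \<and>
        effective_divisor (\<lambda>x y. P (F' x y) (G' x y)) \<longrightarrow>
        ?M (divisor_class P) = divisor_class (\<lambda>x y. P (F' x y) (G' x y)))"
  proof (intro conjI linM allI impI)
    fix F' G' P
    assume *: "is_lift (lmap F G) F' G' \<and> effective_divisor P \<and> effective_divisor (\<lambda>x y. P (F' x y) (G' x y))"
    then obtain k l x y where P: "bihom k l P" "P x y \<noteq> 0" unfolding effective_divisor_def by blast
    obtain x' y' where nz: "P (F' x' y') (G' x' y') \<noteq> 0" using * unfolding effective_divisor_def by blast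
    obtain c where c: "\<forall>x y. F' x y = c *s F x y"
      using rational_map_eq_lmap(2)[OF n, of "lmap F G" F' G'] * by auto
    obtain d where d: "\<forall>x y. G' x y = d *s G x y"
      using rational_map_eq_lmap(3)[OF n, of "lmap F G" F' G'] * by auto
    have F': "bihom_map a b F'" "bihom_map a' b' G'"
      using F G c d by (simp_all add: bihom_map_def bihom_cmult)
    have PFG: "bihom (k * a + l * a') (k * b + l * b') (\<lambda>x y. P (F' x y) (G' x y))"
      by (rule bihom_compose[OF P(1)]) (rule bihom_mapD[OF F'(1)], rule bihom_mapD[OF F'(2)])
    show "?M (divisor_class P) = divisor_class (\<lambda>x y. P (F' x y) (G' x y))"
      using divisor_class_eq[OF P] divisor_class_eq[OF PFG nz] by simp
  qed
  fix L assume L: "linear L \<and> (\<forall>F' G' P. is_lift (lmap F G) F' G' \<and> effective_divisor P \<and>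
        effective_divisor (\<lambda>x y. P (F' x y) (G' x y)) \<longrightarrow>
        L (divisor_class P) = divisor_class (\<lambda>x y. P (F' x y) (G' x y)))"
  have Lc: "L (divisor_class P) = divisor_class (\<lambda>x y. P (F x y) (G x y))"
    if "effective_divisor P" "effective_divisor (\<lambda>x y. P (F x y) (G x y))" for P
    using L that nice_is_lift[OF n] by blast
  have nzc: "vec2 1 1 $ i \<noteq> 0" for i
    using exhaust_2[of i] by auto
  have "L (1, 0) = (real a, real b)"
  proof -
    obtain x y i where nz: "F x y $ i \<noteq> 0" using nonzero_component[OF coprime_formsI[OF F fin(1)]] .
    have 1: "effective_divisor (\<lambda>x y. x $ i)" unfolding effective_divisor_def using bihom_coord(1) nzc by blast
    have 2: "effective_divisor (\<lambda>x y. F x y $ i)" unfolding effective_divisor_def using bihom_mapD[OF F] nz by blast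
    have "divisor_class (\<lambda>x y. x $ i) = (real 1, real 0)" by (rule divisor_class_eq[OF bihom_coord(1) nzc])
    then show ?thesis using Lc[OF 1 2] divisor_class_eq[OF bihom_mapD[OF F] nz] by simp
  qed
  moreover have "L (0, 1) = (real a', real b')"
  proof -
    obtain x y i where nz: "G x y $ i \<noteq> 0" using nonzero_component[OF coprime_formsI[OF G fin(2)]] .
    have 1: "effective_divisor (\<lambda>x y. y $ i)" unfolding effective_divisor_def using bihom_coord(2) nzc by blast
    have 2: "effective_divisor (\<lambda>x y. G x y $ i)" unfolding effective_divisor_def using bihom_mapD[OF G] nz by blast
    have "divisor_class (\<lambda>x y. y $ i) = (real 0, real 1)" by (rule divisor_class_eq[OF bihom_coord(2) nzc])
    then show ?thesis using Lc[OF 1 2] divisor_class_eq[OF bihom_mapD[OF G] nz] by simp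
  qed
  ultimately have "L v = fst v *\<^sub>R (real a, real b) + snd v *\<^sub>R (real a', real b')" for v
  proof -
    assume l: "L (1, 0) = (real a, real b)" "L (0, 1) = (real a', real b')"
    have "v = fst v *\<^sub>R (1, 0) + snd v *\<^sub>R (0, 1)" by (simp add: prod_eq_iff)
    then have "L v = L (fst v *\<^sub>R (1, 0) + snd v *\<^sub>R (0, 1))" by simp
    also have "\<dots> = fst v *\<^sub>R L (1, 0) + snd v *\<^sub>R L (0, 1)"
      using L by (simp only: linear_add linear_cmul)
    finally show ?thesis using l by simp
  qed
  then show "L = ?M" by (simp add: fun_eq_iff)
qed

section \<open>Iteration without cancellation\<close>

primrec ppow :: "(X \<rightharpoonup> X) \<Rightarrow> nat \<Rightarrow> X \<rightharpoonup> X" where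
  "ppow f 0 = Some"
| "ppow f (Suc n) = f \<circ>\<^sub>m ppow f n"

lemma ppow_add: "ppow f (m + n) = ppow f m \<circ>\<^sub>m ppow f n"
  by (induction m) (auto simp: fun_eq_iff map_comp_def split: option.splits)

text \<open>The last assumption is algebraic stability: a common factor of a composed lift would
  make the naive iterate undefined along a curve. Positivity of the degrees makes a lift vanish as
  soon as one argument does.\<close>

locale stable_lift =
  fixes F G :: "complex^2 \<Rightarrow> complex^2 \<Rightarrow> complex^2" and a b a' b' :: nat
  assumes F: "bihom_map a b F" and G: "bihom_map a' b' G"
    and pos: "0 < a" "0 < b" "0 < a'" "0 < b'"
    and finite_undefined: "\<And>n. finite {p. ppow (lmap F G) n p = None}"
begin

primrec iter :: "nat \<Rightarrow> (complex^2 \<Rightarrow> complex^2 \<Rightarrow> complex^2) \<times> (complex^2 \<Rightarrow> complex^2 \<Rightarrow> complex^2)" where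
  "iter 0 = (\<lambda>x y. x, \<lambda>x y. y)"
| "iter (Suc n) = (\<lambda>x y. F (fst (iter n) x y) (snd (iter n) x y), \<lambda>x y. G (fst (iter n) x y) (snd (iter n) x y))"

primrec degs :: "nat \<Rightarrow> (nat \<times> nat) \<times> (nat \<times> nat)" where
  "degs 0 = ((1, 0), (0, 1))"
| "degs (Suc n) = (case degs n of ((k, l), (k', l')) \<Rightarrow>
     ((a * k + b * k', a * l + b * l'), (a' * k + b' * k', a' * l + b' * l')))"

lemma bihom_iter:
  "bihom_map (fst (fst (degs n))) (snd (fst (degs n))) (fst (iter n))"
  "bihom_map (fst (snd (degs n))) (snd (snd (degs n))) (snd (iter n))"
proof (induction n)
  case 0
  {
    case 1 show ?case using bihom_coord by (simp add: bihom_map_def)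
  next
    case 2 show ?case using bihom_coord by (simp add: bihom_map_def)
  }
next
  case (Suc n)
  {
    case 1 show ?case using bihom_map_compose[OF F Suc] by (simp add: case_prod_beta)
  next
    case 2 show ?case using bihom_map_compose[OF G Suc] by (simp add: case_prod_beta)
  }
qed

lemma vanish_zero: "F 0 y = 0" "F x 0 = 0" "G 0 y = 0" "G x 0 = 0"
  using bihom_map_scale[OF F, of 0 0 1 y] bihom_map_scale[OF F, of 1 x 0 0]
    bihom_map_scale[OF G, of 0 0 1 y] bihom_map_scale[OF G, of 1 x 0 0] pos by (simp_all add: power_0_left)

text \<open>Once a component of the composed lift vanishes, all later ones do, exactly as an
  undefined partial iterate stays undefined.\<close>

lemma ppow_eq_lmap: "ppow (lmap F G) n = lmap (fst (iter n)) (snd (iter n))"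
proof (induction n)
  case 0
  show ?case by (rule ext) (simp add: lmap_def)
next
  case (Suc n)
  show ?case
  proof
    fix p :: X
    define x where "x = rep_P1 (fst p)"
    define y where "y = rep_P1 (snd p)"
    have l: "lmap F' G' p = (if F' x y = 0 \<or> G' x y = 0 then None else Some (proj (F' x y), proj (G' x y)))" for F' G'
      by (simp add: lmap_def x_def y_def Let_def)
    show "ppow (lmap F G) (Suc n) p = lmap (fst (iter (Suc n))) (snd (iter (Suc n))) p"
    proof (cases "fst (iter n) x y = 0 \<or> snd (iter n) x y = 0")
      case True
      then show ?thesis by (auto simp: Suc.IH l map_comp_def vanish_zero)
    next
      case False
      then have "ppow (lmap F G) (Suc n) p = lmap F G (proj (fst (iter n) x y), proj (snd (iter n) x y))"
        by (simp add: Suc.IH l map_comp_def)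
      also have "\<dots> = lmap (fst (iter (Suc n))) (snd (iter (Suc n))) p"
        using False by (simp add: lmap_proj[OF F G] l)
      finally show ?thesis .
    qed
  qed
qed

lemma nice_iter:
  "nice (fst (fst (degs n))) (snd (fst (degs n))) (fst (snd (degs n))) (snd (snd (degs n))) (fst (iter n)) (snd (iter n))"
proof -
  have "zero_set (fst (iter n)) \<subseteq> {p. ppow (lmap F G) n p = None}"
    "zero_set (snd (iter n)) \<subseteq> {p. ppow (lmap F G) n p = None}"
    unfolding ppow_eq_lmap zero_set_def using lmap_proj[OF bihom_iter] by auto
  then show ?thesis
    unfolding nice_def using bihom_iter finite_undefined finite_subset by blast
qed

lemma rational_ppow: "rational_map (ppow (lmap F G) n)"
  unfolding ppow_eq_lmap by (rule nice_rational[OF nice_iter])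

lemma rational_eq_ppow:
  assumes "rational_map h" "\<And>p q r. p \<in> X_real \<Longrightarrow> h p = Some q \<Longrightarrow> ppow (lmap F G) n p = Some r \<Longrightarrow> q = r"
  shows "h = ppow (lmap F G) n"
proof -
  obtain F' G' where "is_lift h F' G'" using assms(1) unfolding rational_map_def by blast
  then show ?thesis unfolding ppow_eq_lmap
    by (rule rational_map_eq_lmap(1)[OF nice_iter]) (use assms(2) in \<open>auto simp: ppow_eq_lmap\<close>)
qed

text \<open>Since the naive composition is already in lowest terms, it is itself the unique rational
  map extending it.\<close>

lemma rat_pow_eq_ppow: "rat_pow (lmap F G) n = ppow (lmap F G) n"
proof (induction n)
  case (Suc n)
  have "rat_comp (lmap F G) (ppow (lmap F G) n) = ppow (lmap F G) (Suc n)"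
    unfolding rat_comp_def
  proof (rule the_equality)
    show "rational_map (ppow (lmap F G) (Suc n)) \<and> lmap F G \<circ>\<^sub>m ppow (lmap F G) n \<subseteq>\<^sub>m ppow (lmap F G) (Suc n)"
      using rational_ppow[of "Suc n"] by simp
    fix h assume h: "rational_map h \<and> lmap F G \<circ>\<^sub>m ppow (lmap F G) n \<subseteq>\<^sub>m h"
    show "h = ppow (lmap F G) (Suc n)"
    proof (rule rational_eq_ppow)
      fix p q r assume "h p = Some q" "ppow (lmap F G) (Suc n) p = Some r"
      then have "h p = Some r" using h unfolding map_le_def by (metis domI ppow.simps(2))
      with \<open>h p = Some q\<close> show "q = r" by simp
    qed (use h in simp)
  qed
  then show ?case using Suc by simp
qed simp

lemma pullback_ppow:
  "pullback (ppow (lmap F G) n) = ((\<lambda>v. (fst v * real a + snd v * real a', fst v * real b + snd v * real b')) ^^ n)"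
proof -
  have "(\<lambda>v. (fst v * real (fst (fst (degs n))) + snd v * real (fst (snd (degs n))), fst v * real (snd (fst (degs n))) + snd v * real (snd (snd (degs n)))))
    = ((\<lambda>v. (fst v * real a + snd v * real a', fst v * real b + snd v * real b')) ^^ n)"
  proof (induction n)
    case 0
    show ?case by (simp add: fun_eq_iff)
  next
    case (Suc n)
    show ?case unfolding funpow_Suc_right Suc.IH[symmetric]
      by (auto simp: fun_eq_iff case_prod_beta algebra_simps)
  qed
  then show ?thesis unfolding ppow_eq_lmap pullback_nice[OF nice_iter] .
qed

end

section \<open>The birational map\<close>

text \<open>In the coordinate \<open>z = (x - \<i>) / (x + \<i>)\<close> the real projective line is the unit circle.\<close>

definition cay :: "complex^2 \<Rightarrow> complex^2" where
  "cay x = vec2 (x$1 - \<i> * x$2) (x$1 + \<i> * x$2)"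

definition ucay :: "complex^2 \<Rightarrow> complex^2" where
  "ucay z = vec2 (\<i> * (z$1 + z$2)) (z$2 - z$1)"

definition pt :: "complex^2 \<Rightarrow> P1" where
  "pt z = proj (ucay z)"

lemma cay_ucay: "cay (ucay z) = (2 * \<i>) *s z"
  by (simp add: cay_def ucay_def vec2_eq_iff algebra_simps)

lemma ucay_cay: "ucay (cay x) = (2 * \<i>) *s x"
  by (simp add: cay_def ucay_def vec2_eq_iff algebra_simps)

lemma ucay_scale: "ucay (c *s z) = c *s ucay z"
  by (simp add: ucay_def vec2_eq_iff algebra_simps)

lemma ucay_eq_0_iff [simp]: "ucay z = 0 \<longleftrightarrow> z = 0"
proof
  assume "ucay z = 0"
  then have "(2 * \<i>) *s z = 0" using cay_ucay[of z] by (simp add: cay_def vec2_eq_iff)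
  then show "z = 0" by simp
qed (simp add: ucay_def vec2_eq_iff)

lemma cay_eq_0_iff [simp]: "cay x = 0 \<longleftrightarrow> x = 0"
proof
  assume "cay x = 0"
  then have "(2 * \<i>) *s x = 0" using ucay_cay[of x] ucay_eq_0_iff[of 0] by simp
  then show "x = 0" by simp
qed (simp add: cay_def vec2_eq_iff)

lemma pt_scale: "c \<noteq> 0 \<Longrightarrow> z \<noteq> 0 \<Longrightarrow> pt (c *s z) = pt z"
  by (simp add: pt_def ucay_scale proj_scale)

lemma proj_eq_pt: "x \<noteq> 0 \<Longrightarrow> proj x = pt (cay x)"
  by (simp add: pt_def ucay_cay proj_scale)

lemma pt_cases: obtains z where "z \<noteq> 0" "p = pt z"
  using proj_cases[of p] proj_eq_pt cay_eq_0_iff by metis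

definition parallel :: "complex^2 \<Rightarrow> complex^2 \<Rightarrow> bool" where
  "parallel x y \<longleftrightarrow> x$1 * y$2 = x$2 * y$1"

lemma parallelD:
  assumes "parallel x y" "x \<noteq> 0" "y \<noteq> 0"
  obtains c where "c \<noteq> 0" "y = c *s x"
proof (cases "x$1 = 0")
  case True
  then have "x$2 \<noteq> 0" "y$1 = 0" using assms by (auto simp: parallel_def vec2_eq_iff)
  then have "y = (y$2 / x$2) *s x" "y$2 \<noteq> 0" using True assms by (auto simp: vec2_eq_iff)
  then show ?thesis using that[of "y$2 / x$2"] \<open>x$2 \<noteq> 0\<close> by simp
next
  case False
  then have "y = (y$1 / x$1) *s x" using assms by (auto simp: vec2_eq_iff parallel_def field_simps)
  moreover have "y$1 \<noteq> 0"
  proof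
    assume "y$1 = 0"
    then have "y$2 = 0" using assms(1) False by (simp add: parallel_def)
    then show False using assms(3) \<open>y$1 = 0\<close> by (simp add: vec2_eq_iff)
  qed
  ultimately show ?thesis using that[of "y$1 / x$1"] False by simp
qed

lemma pt_eq_iff:
  assumes "x \<noteq> 0" "y \<noteq> 0"
  shows "pt x = pt y \<longleftrightarrow> parallel x y"
proof
  assume "pt x = pt y"
  then obtain c where "c \<noteq> 0" "ucay y = c *s ucay x" using assms by (auto simp: pt_def proj_eq_iff)
  then have "cay (ucay y) = c *s cay (ucay x)" by (simp add: cay_def vec2_eq_iff algebra_simps)
  then have "y = c *s x" unfolding cay_ucay by (simp add: vec2_eq_iff)
  then show "parallel x y" by (simp add: parallel_def)
next
  assume "parallel x y"
  then obtain c where "c \<noteq> 0" "y = c *s x" using parallelD assms by blast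
  then show "pt x = pt y" using pt_scale[of c x] assms by simp
qed

text \<open>In homogeneous coordinates, \<open>B = bl p q / bl q p\<close>.\<close>

definition bl :: "real \<Rightarrow> real \<Rightarrow> complex^2 \<Rightarrow> complex" where
  "bl p q z = (z$1 - of_real p * z$2) * (z$2 - of_real q * z$1)"

lemma bl_scale: "bl p q (c *s z) = c\<^sup>2 * bl p q z"
  by (simp add: bl_def power2_eq_square algebra_simps)

text \<open>The half step \<open>w \<mapsto> m w B(z)\<close>. Exchanging \<open>p\<close> and
  \<open>q\<close> inverts \<open>B\<close>, so the same formula with inverted factor undoes a half
  step; \<open>gz\<close> and \<open>gw\<close> do this in the opposite order.\<close>

definition fw :: "real \<Rightarrow> real \<Rightarrow> complex \<Rightarrow> complex^2 \<Rightarrow> complex^2 \<Rightarrow> complex^2" where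
  "fw p q m z w = vec2 (m * w$1 * bl p q z) (w$2 * bl q p z)"

definition fz :: "real \<Rightarrow> real \<Rightarrow> complex \<Rightarrow> complex \<Rightarrow> complex^2 \<Rightarrow> complex^2 \<Rightarrow> complex^2" where
  "fz p q m1 m2 z w = fw p q m1 (fw p q m2 z w) z"

definition gz :: "real \<Rightarrow> real \<Rightarrow> complex \<Rightarrow> complex^2 \<Rightarrow> complex^2 \<Rightarrow> complex^2" where
  "gz p q m1 z w = fw q p (inverse m1) w z"

definition gw :: "real \<Rightarrow> real \<Rightarrow> complex \<Rightarrow> complex \<Rightarrow> complex^2 \<Rightarrow> complex^2 \<Rightarrow> complex^2" where
  "gw p q m1 m2 z w = fw q p (inverse m2) (gz p q m1 z w) w"

text \<open>Returns from the circle coordinates to the original ones, in which lifts and the real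
  structure are defined. The changes of coordinates are linear, so bidegrees are preserved.\<close>

definition xlift :: "(complex^2 \<Rightarrow> complex^2 \<Rightarrow> complex^2) \<Rightarrow> complex^2 \<Rightarrow> complex^2 \<Rightarrow> complex^2" where
  "xlift F x y = ucay (F (cay x) (cay y))"

definition fmap :: "real \<Rightarrow> real \<Rightarrow> complex \<Rightarrow> complex \<Rightarrow> X \<rightharpoonup> X" where
  "fmap p q m1 m2 = lmap (xlift (fz p q m1 m2)) (xlift (fw p q m2))"

definition gmap :: "real \<Rightarrow> real \<Rightarrow> complex \<Rightarrow> complex \<Rightarrow> X \<rightharpoonup> X" where
  "gmap p q m1 m2 = lmap (xlift (gz p q m1)) (xlift (gw p q m1 m2))"

lemma fw_scale: "fw p q m (c *s z) (d *s w) = (c\<^sup>2 * d) *s fw p q m z w"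
  by (simp add: fw_def bl_scale vec2_eq_iff mult_ac)

lemma bihom_map_vec2: "bihom a b A \<Longrightarrow> bihom a b B \<Longrightarrow> bihom_map a b (\<lambda>x y. vec2 (A x y) (B x y))"
  unfolding bihom_map_def
proof
  fix i :: 2 assume "bihom a b A" "bihom a b B"
  then show "bihom a b (\<lambda>x y. vec2 (A x y) (B x y) $ i)" using exhaust_2[of i] by auto
qed

lemma bihom_map_cay: "bihom_map 1 0 (\<lambda>x y. cay x)" "bihom_map 0 1 (\<lambda>x y. cay y)"
  unfolding cay_def by (intro bihom_map_vec2 bihom_add bihom_diff bihom_cmult bihom_coord)+

lemma bihom_bl: "bihom_map a b U \<Longrightarrow> bihom (a + a) (b + b) (\<lambda>x y. bl p q (U x y))"
  unfolding bl_def by (intro bihom_mult bihom_diff bihom_cmult bihom_mapD)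

lemma bihom_map_fw:
  assumes "bihom_map a b U" "bihom_map a' b' V"
  shows "bihom_map (a' + (a + a)) (b' + (b + b)) (\<lambda>x y. fw p q m (U x y) (V x y))"
  unfolding fw_def mult.assoc[of m]
  by (intro bihom_map_vec2 bihom_cmult bihom_mult bihom_bl bihom_mapD assms)

lemma bihom_map_ucay: "bihom_map a b U \<Longrightarrow> bihom_map a b (\<lambda>x y. ucay (U x y))"
  unfolding ucay_def by (intro bihom_map_vec2 bihom_add bihom_diff bihom_cmult bihom_mapD)

text \<open>A half step adds twice the bidegree of the argument of \<open>B\<close> to that of the
  other one: (0, 1) + 2 (1, 0) = (2, 1), and then (1, 0) + 2 (2, 1) = (5, 2).\<close>

lemma bihom_f: "bihom_map 5 2 (xlift (fz p q m1 m2))" "bihom_map 2 1 (xlift (fw p q m2))"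
proof -
  have 1: "bihom_map (0 + (1 + 1)) (1 + (0 + 0)) (\<lambda>x y. fw p q m2 (cay x) (cay y))"
    by (intro bihom_map_fw bihom_map_cay)
  then show "bihom_map 2 1 (xlift (fw p q m2))"
    unfolding xlift_def by (intro bihom_map_ucay) (simp add: numeral_eq_Suc)
  have "bihom_map (1 + ((0 + (1 + 1)) + (0 + (1 + 1)))) (0 + ((1 + (0 + 0)) + (1 + (0 + 0)))) (\<lambda>x y. fz p q m1 m2 (cay x) (cay y))"
    unfolding fz_def by (intro bihom_map_fw[OF 1] bihom_map_cay)
  then show "bihom_map 5 2 (xlift (fz p q m1 m2))"
    unfolding xlift_def by (intro bihom_map_ucay) (simp add: numeral_eq_Suc)
qed

lemma bihom_g: "bihom_map 1 2 (xlift (gz p q m1))" "bihom_map 2 5 (xlift (gw p q m1 m2))"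
proof -
  have 1: "bihom_map (1 + (0 + 0)) (0 + (1 + 1)) (\<lambda>x y. gz p q m1 (cay x) (cay y))"
    unfolding gz_def by (intro bihom_map_fw bihom_map_cay)
  then show "bihom_map 1 2 (xlift (gz p q m1))"
    unfolding xlift_def by (intro bihom_map_ucay) (simp add: numeral_eq_Suc)
  have "bihom_map (0 + ((1 + (0 + 0)) + (1 + (0 + 0)))) (1 + ((0 + (1 + 1)) + (0 + (1 + 1)))) (\<lambda>x y. gw p q m1 m2 (cay x) (cay y))"
    unfolding gw_def by (intro bihom_map_fw[OF 1] bihom_map_cay)
  then show "bihom_map 2 5 (xlift (gw p q m1 m2))"
    unfolding xlift_def by (intro bihom_map_ucay) (simp add: numeral_eq_Suc)
qed

text \<open>Allows computing in circle coordinates; the scalar \<open>2 * \<i>\<close> left by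
  \<open>cay_ucay\<close> is absorbed by homogeneity.\<close>

lemma lmap_xlift_pt:
  assumes F: "bihom_map a b (xlift F)" and G: "bihom_map a' b' (xlift G)" and zw: "z \<noteq> 0" "w \<noteq> 0"
    and sF: "\<And>c d. c \<noteq> 0 \<Longrightarrow> d \<noteq> 0 \<Longrightarrow> \<exists>e. e \<noteq> 0 \<and> F (c *s z) (d *s w) = e *s F z w"
    and sG: "\<And>c d. c \<noteq> 0 \<Longrightarrow> d \<noteq> 0 \<Longrightarrow> \<exists>e. e \<noteq> 0 \<and> G (c *s z) (d *s w) = e *s G z w"
  shows "lmap (xlift F) (xlift G) (pt z, pt w) =
    (if F z w = 0 \<or> G z w = 0 then None else Some (pt (F z w), pt (G z w)))"
proof -
  obtain e where e: "e \<noteq> 0" "F ((2 * \<i>) *s z) ((2 * \<i>) *s w) = e *s F z w" using sF[of "2 * \<i>" "2 * \<i>"] by auto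
  obtain e' where e': "e' \<noteq> 0" "G ((2 * \<i>) *s z) ((2 * \<i>) *s w) = e' *s G z w" using sG[of "2 * \<i>" "2 * \<i>"] by auto
  have l: "lmap (xlift F) (xlift G) (pt z, pt w) = (if xlift F (ucay z) (ucay w) = 0 \<or> xlift G (ucay z) (ucay w) = 0 then None
      else Some (proj (xlift F (ucay z) (ucay w)), proj (xlift G (ucay z) (ucay w))))"
    unfolding pt_def by (rule lmap_proj[OF F G]) (use zw in auto)
  have x: "xlift F (ucay z) (ucay w) = e *s ucay (F z w)" "xlift G (ucay z) (ucay w) = e' *s ucay (G z w)"
    unfolding xlift_def cay_ucay e e' ucay_scale by simp_all
  show ?thesis unfolding l x using e(1) e'(1) by (auto simp: pt_def proj_scale)
qed

lemma fz_scale: "fz p q m1 m2 (c *s z) (d *s w) = ((c\<^sup>2 * d)\<^sup>2 * c) *s fz p q m1 m2 z w"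
  unfolding fz_def fw_scale ..

lemma gz_scale: "gz p q m1 (c *s z) (d *s w) = (d\<^sup>2 * c) *s gz p q m1 z w"
  unfolding gz_def fw_scale ..

lemma gw_scale: "gw p q m1 m2 (c *s z) (d *s w) = ((d\<^sup>2 * c)\<^sup>2 * d) *s gw p q m1 m2 z w"
  unfolding gw_def gz_scale fw_scale ..

lemma fmap_pt:
  assumes "z \<noteq> 0" "w \<noteq> 0"
  shows "fmap p q m1 m2 (pt z, pt w) = (if fz p q m1 m2 z w = 0 \<or> fw p q m2 z w = 0 then None
    else Some (pt (fz p q m1 m2 z w), pt (fw p q m2 z w)))"
  unfolding fmap_def
proof (rule lmap_xlift_pt[OF bihom_f assms])
  fix c d :: complex assume "c \<noteq> 0" "d \<noteq> 0"
  then show "\<exists>e. e \<noteq> 0 \<and> fz p q m1 m2 (c *s z) (d *s w) = e *s fz p q m1 m2 z w"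
    "\<exists>e. e \<noteq> 0 \<and> fw p q m2 (c *s z) (d *s w) = e *s fw p q m2 z w"
    using fz_scale fw_scale by (metis mult_eq_0_iff power_eq_0_iff)+
qed

lemma gmap_pt:
  assumes "z \<noteq> 0" "w \<noteq> 0"
  shows "gmap p q m1 m2 (pt z, pt w) = (if gz p q m1 z w = 0 \<or> gw p q m1 m2 z w = 0 then None
    else Some (pt (gz p q m1 z w), pt (gw p q m1 m2 z w)))"
  unfolding gmap_def
proof (rule lmap_xlift_pt[OF bihom_g assms])
  fix c d :: complex assume "c \<noteq> 0" "d \<noteq> 0"
  then show "\<exists>e. e \<noteq> 0 \<and> gz p q m1 (c *s z) (d *s w) = e *s gz p q m1 z w"
    "\<exists>e. e \<noteq> 0 \<and> gw p q m1 m2 (c *s z) (d *s w) = e *s gw p q m1 m2 z w"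
    using gz_scale gw_scale by (metis mult_eq_0_iff power_eq_0_iff)+
qed

subsection \<open>Contracted curves never meet the indeterminacy set\<close>

text \<open>The contracted curves \<open>B(z) \<in> {0, \<infinity>}\<close> and \<open>B(w') \<in> {0, \<infinity>}\<close> are sent into the four
  invariant lines. On these the dynamics multiplies the modulus by \<open>(p / q)\<^sup>\<plusminus>\<^sup>1\<close>, whatever the rotation
  factors are, and \<open>q < p\<^sup>3\<close> makes the following regions of them forward invariant.\<close>

definition trapped :: "real \<Rightarrow> complex^2 \<Rightarrow> complex^2 \<Rightarrow> bool" where
  "trapped p z w \<longleftrightarrow> w$1 = 0 \<and> norm (z$2) < p * norm (z$1) \<or> w$2 = 0 \<and> norm (z$1) < p * norm (z$2) \<or>
     z$1 = 0 \<and> w$2 \<noteq> 0 \<and> p * norm (w$2) \<le> norm (w$1) \<or> z$2 = 0 \<and> w$1 \<noteq> 0 \<and> p * norm (w$1) \<le> norm (w$2)"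

lemma trapped_scale: "c \<noteq> 0 \<Longrightarrow> d \<noteq> 0 \<Longrightarrow> trapped p (c *s z) (d *s w) \<longleftrightarrow> trapped p z w"
  by (simp add: trapped_def norm_mult mult.left_commute[of p] mult_less_cancel_left mult_le_cancel_left)

definition trap_set :: "real \<Rightarrow> X set" where
  "trap_set p = {(pt z, pt w) |z w. z \<noteq> 0 \<and> w \<noteq> 0 \<and> trapped p z w}"

lemma trap_set_iff:
  assumes "z \<noteq> 0" "w \<noteq> 0"
  shows "(pt z, pt w) \<in> trap_set p \<longleftrightarrow> trapped p z w"
proof
  assume "(pt z, pt w) \<in> trap_set p"
  then obtain z' w' where *: "pt z' = pt z" "pt w' = pt w" "z' \<noteq> 0" "w' \<noteq> 0" "trapped p z' w'"
    unfolding trap_set_def by auto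
  obtain c where "c \<noteq> 0" "z = c *s z'" using * assms pt_eq_iff parallelD by metis
  moreover obtain d where "d \<noteq> 0" "w = d *s w'" using * assms pt_eq_iff parallelD by metis
  ultimately show "trapped p z w" using * trapped_scale by simp
qed (use assms in \<open>auto simp: trap_set_def\<close>)

context
  fixes p q :: real
  assumes q: "0 < q" "q < p ^ 3" and p: "0 < p" "p < 1"
begin

lemma pq_ineqs: "q < p\<^sup>2" "q < p" "q * q < p * p" "q < 1" "q * p < 1"
proof -
  have d: "p ^ 3 \<le> p\<^sup>2" "p\<^sup>2 \<le> p"
    using power_decreasing[of 2 3 p] power_decreasing[of 1 2 p] p by simp_all
  show "q < p\<^sup>2" using q(2) d by linarith
  then show "q < p" using d by linarith
  then show "q * q < p * p" "q < 1" using q p mult_strict_mono[of q p q p] by auto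
  then show "q * p < 1" using p q mult_strict_mono[of q 1 p 1] by simp
qed

lemma bl_eq_0_cases:
  assumes "bl p q z = 0" "z \<noteq> 0"
  shows "z$1 \<noteq> 0" "z$2 \<noteq> 0" "norm (z$1) = p * norm (z$2) \<or> norm (z$2) = q * norm (z$1)" "bl q p z \<noteq> 0"
proof -
  have c: "z$1 = of_real p * z$2 \<or> z$2 = of_real q * z$1" using assms by (simp add: bl_def)
  show nz: "z$1 \<noteq> 0" "z$2 \<noteq> 0" using c assms(2) p q by (auto simp: vec2_eq_iff)
  show "norm (z$1) = p * norm (z$2) \<or> norm (z$2) = q * norm (z$1)"
    using c p q by (auto simp: norm_mult)
  have pq1: "p * p < 1" "q * q < 1" using p q pq_ineqs mult_strict_mono[of p 1 p 1] mult_strict_mono[of q 1 q 1] by simp_all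
  have o: "complex_of_real p * of_real p \<noteq> 1" "complex_of_real q * of_real q \<noteq> 1" "complex_of_real p \<noteq> of_real q"
    using pq1 pq_ineqs by (auto simp flip: of_real_mult)
  show "bl q p z \<noteq> 0"
    using c
  proof
    assume z1: "z$1 = of_real p * z$2"
    have "bl q p z = (of_real p - of_real q) * (1 - of_real p * of_real p) * (z$2 * z$2)"
      unfolding bl_def z1 by (simp add: algebra_simps)
    then show ?thesis using o nz by auto
  next
    assume z2: "z$2 = of_real q * z$1"
    have "bl q p z = (1 - of_real q * of_real q) * (of_real q - of_real p) * (z$1 * z$1)"
      unfolding bl_def z2 by (simp add: algebra_simps)
    then show ?thesis using o nz by auto
  qed
qed

lemma bl_inv_eq_0_cases:
  assumes "bl q p z = 0" "z \<noteq> 0"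
  shows "z$1 \<noteq> 0" "z$2 \<noteq> 0" "norm (z$1) = q * norm (z$2) \<or> norm (z$2) = p * norm (z$1)"
proof -
  have c: "z$1 = of_real q * z$2 \<or> z$2 = of_real p * z$1" using assms by (simp add: bl_def)
  show "z$1 \<noteq> 0" "z$2 \<noteq> 0" using c assms(2) p q by (auto simp: vec2_eq_iff)
  show "norm (z$1) = q * norm (z$2) \<or> norm (z$2) = p * norm (z$1)"
    using c p q by (auto simp: norm_mult)
qed

lemma bl_axis:
  "z$1 = 0 \<Longrightarrow> bl p q z = - (of_real p * (z$2)\<^sup>2)" "z$1 = 0 \<Longrightarrow> bl q p z = - (of_real q * (z$2)\<^sup>2)"
  "z$2 = 0 \<Longrightarrow> bl p q z = - (of_real q * (z$1)\<^sup>2)" "z$2 = 0 \<Longrightarrow> bl q p z = - (of_real p * (z$1)\<^sup>2)"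
  by (simp_all add: bl_def power2_eq_square)

lemma fw_eq_0_iff:
  assumes "z \<noteq> 0" "w \<noteq> 0" "m \<noteq> 0"
  shows "fw p q m z w = 0 \<longleftrightarrow> w$1 = 0 \<and> bl q p z = 0 \<or> w$2 = 0 \<and> bl p q z = 0"
  using assms bl_eq_0_cases(4)[OF _ assms(1)] by (auto simp: fw_def vec2_eq_iff)

text \<open>The values of \<open>B\<close> at 0 and at infinity are \<open>p / q\<close> and
  \<open>q / p\<close>. So on the lines through 0 moduli grow, on those through infinity they
  shrink, and each region lies beyond the indeterminacy points of its line in the direction of
  motion.\<close>

lemma trapped_step:
  assumes z: "z \<noteq> 0" "w \<noteq> 0" and m: "norm m1 = 1" "norm m2 = 1" and tr: "trapped p z w"
  shows "fw p q m2 z w \<noteq> 0" "fz p q m1 m2 z w \<noteq> 0" "trapped p (fz p q m1 m2 z w) (fw p q m2 z w)"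
proof -
  define w' where "w' = fw p q m2 z w"
  have m0: "m1 \<noteq> 0" "m2 \<noteq> 0" using m by auto
  have fz: "fz p q m1 m2 z w = vec2 (m1 * z$1 * bl p q w') (z$2 * bl q p w')"
    unfolding fz_def w'_def[symmetric] by (simp add: fw_def)
  have w': "w'$1 = m2 * w$1 * bl p q z" "w'$2 = w$2 * bl q p z" by (simp_all add: w'_def fw_def)
  have "w' \<noteq> 0 \<and> fz p q m1 m2 z w \<noteq> 0 \<and> trapped p (fz p q m1 m2 z w) w'"
    using tr unfolding trapped_def[of p z w]
  proof (elim disjE conjE)
    assume 1: "w$1 = 0" "norm (z$2) < p * norm (z$1)"
    have w2: "w$2 \<noteq> 0" using 1 z by (auto simp: vec2_eq_iff)
    have "0 < p * norm (z$1)" using 1(2) norm_ge_zero[of "z$2"] by linarith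
    then have z1: "0 < norm (z$1)" using p by (simp add: zero_less_mult_iff)
    have "bl q p z \<noteq> 0"
    proof
      assume "bl q p z = 0"
      then consider "norm (z$1) = q * norm (z$2)" | "norm (z$2) = p * norm (z$1)" using bl_inv_eq_0_cases z by blast
      then show False
      proof cases
        case 1
        then have "norm (z$1) < q * (p * norm (z$1))" using \<open>norm (z$2) < p * norm (z$1)\<close> q by simp
        also have "\<dots> = (q * p) * norm (z$1)" by simp
        also have "\<dots> < 1 * norm (z$1)" using z1 pq_ineqs by (intro mult_strict_right_mono) auto
        finally show False by simp
      qed (use 1 in simp)
    qed
    then have v: "w'$1 = 0" "w'$2 \<noteq> 0" using w' 1 w2 by auto
    have f: "fz p q m1 m2 z w = vec2 (- (m1 * z$1 * (of_real p * (w'$2)\<^sup>2))) (- (z$2 * (of_real q * (w'$2)\<^sup>2)))"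
      unfolding fz bl_axis(1,2)[OF v(1)] by simp
    have "q * norm (z$2) \<le> p * norm (z$2)" using pq_ineqs by (intro mult_right_mono) auto
    also have "\<dots> < p * (p * norm (z$1))" using 1(2) p by simp
    finally have "q * norm (z$2) * norm (w'$2) ^ 2 < p * (p * norm (z$1)) * norm (w'$2) ^ 2"
      using v(2) by (intro mult_strict_right_mono) auto
    then have "trapped p (fz p q m1 m2 z w) w'"
      unfolding trapped_def f using v(1) m p q by (simp add: norm_mult norm_power mult_ac)
    moreover have "fz p q m1 m2 z w \<noteq> 0" unfolding f using v z1 m0 p by auto
    moreover have "w' \<noteq> 0" using v(2) by auto
    ultimately show ?thesis by blast
  next
    assume 1: "w$2 = 0" "norm (z$1) < p * norm (z$2)"
    have w2: "w$1 \<noteq> 0" using 1 z by (auto simp: vec2_eq_iff)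
    have "0 < p * norm (z$2)" using 1(2) norm_ge_zero[of "z$1"] by linarith
    then have z1: "0 < norm (z$2)" using p by (simp add: zero_less_mult_iff)
    have "bl p q z \<noteq> 0"
    proof
      assume "bl p q z = 0"
      then consider "norm (z$2) = q * norm (z$1)" | "norm (z$1) = p * norm (z$2)" using bl_eq_0_cases z by blast
      then show False
      proof cases
        case 1
        then have "norm (z$2) < q * (p * norm (z$2))" using \<open>norm (z$1) < p * norm (z$2)\<close> q by simp
        also have "\<dots> = (q * p) * norm (z$2)" by simp
        also have "\<dots> < 1 * norm (z$2)" using z1 pq_ineqs by (intro mult_strict_right_mono) auto
        finally show False by simp
      qed (use 1 in simp)
    qed
    then have v: "w'$2 = 0" "w'$1 \<noteq> 0" using w' 1 w2 m0 by auto
    have f: "fz p q m1 m2 z w = vec2 (- (m1 * z$1 * (of_real q * (w'$1)\<^sup>2))) (- (z$2 * (of_real p * (w'$1)\<^sup>2)))"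
      unfolding fz bl_axis(3,4)[OF v(1)] by simp
    have "q * norm (z$1) \<le> p * norm (z$1)" using pq_ineqs by (intro mult_right_mono) auto
    also have "\<dots> < p * (p * norm (z$2))" using 1(2) p by simp
    finally have "q * norm (z$1) * norm (w'$1) ^ 2 < p * (p * norm (z$2)) * norm (w'$1) ^ 2"
      using v(2) by (intro mult_strict_right_mono) auto
    then have "trapped p (fz p q m1 m2 z w) w'"
      unfolding trapped_def f using v(1) m p q by (simp add: norm_mult norm_power mult_ac)
    moreover have "fz p q m1 m2 z w \<noteq> 0" unfolding f using v z1 m0 p by auto
    moreover have "w' \<noteq> 0" using v(2) by auto
    ultimately show ?thesis by blast
  next
    assume 1: "z$1 = 0" "w$2 \<noteq> 0" "p * norm (w$2) \<le> norm (w$1)"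
    have z2: "z$2 \<noteq> 0" using 1 z by (auto simp: vec2_eq_iff)
    define s where "s = norm (z$2) ^ 2"
    have s: "0 < s" using z2 by (simp add: s_def)
    have n: "norm (w'$1) = p * norm (w$1) * s" "norm (w'$2) = q * norm (w$2) * s"
      unfolding w' bl_axis(1,2)[OF 1(1)] using m p q by (simp_all add: norm_mult norm_power s_def)
    have w2: "0 < norm (w$2)" using 1 by simp
    have v2: "w'$2 \<noteq> 0" using n(2) q s w2 by (metis mult_eq_0_iff norm_eq_zero less_irrefl)
    then have v0: "w' \<noteq> 0" by auto
    have le: "p * (p * norm (w$2)) \<le> p * norm (w$1)" using 1(3) p by simp
    \<comment> \<open>Here \<open>q < p ^ 3\<close> enters: the modulus of \<open>w'\<close> is
      \<open>p / q\<close> times that of \<open>w\<close>, hence at least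
      \<open>p\<^sup>2 / q > 1 / p\<close>, beyond both zeros \<open>q\<close> and
      \<open>1 / p\<close> of \<open>bl q p\<close>.\<close>
    have "bl q p w' \<noteq> 0"
    proof
      assume "bl q p w' = 0"
      then consider "norm (w'$1) = q * norm (w'$2)" | "norm (w'$2) = p * norm (w'$1)" using bl_inv_eq_0_cases v0 by blast
      then show False
      proof cases
        case 1
        then have "p * norm (w$1) = q * (q * norm (w$2))" using s by (simp add: n)
        then have "(p * p) * norm (w$2) \<le> (q * q) * norm (w$2)" using le by simp
        then show False using w2 pq_ineqs by simp
      next
        case 2
        then have "q * norm (w$2) = p * (p * norm (w$1))" using s by (simp add: n)
        moreover have "p * (p * (p * norm (w$2))) \<le> p * (p * norm (w$1))" using le p by simp
        ultimately have "p ^ 3 * norm (w$2) \<le> q * norm (w$2)" by (simp add: power3_eq_cube)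
        then show False using w2 q by simp
      qed
    qed
    moreover have "p * norm (w'$2) \<le> norm (w'$1)"
    proof -
      have "p * (q * norm (w$2)) \<le> p * (1 * norm (w$2))" using p pq_ineqs by (intro mult_left_mono mult_right_mono) auto
      also have "\<dots> \<le> norm (w$1)" using 1(3) by simp
      finally have "p * (q * norm (w$2)) \<le> norm (w$1)" .
      moreover have "p * (q * norm (w$2)) \<le> p * (p * norm (w$2))" using p pq_ineqs by (intro mult_left_mono mult_right_mono) auto
      ultimately have "p * (q * norm (w$2)) \<le> p * norm (w$1)" using le by linarith
      then have "p * (q * norm (w$2)) * s \<le> p * norm (w$1) * s" using s by (intro mult_right_mono) auto
      then show ?thesis by (simp add: n mult_ac)
    qed
    ultimately show ?thesis using z2 v0 v2 1(1) by (auto simp: fz trapped_def vec2_eq_iff)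
  next
    assume 1: "z$2 = 0" "w$1 \<noteq> 0" "p * norm (w$1) \<le> norm (w$2)"
    have z2: "z$1 \<noteq> 0" using 1 z by (auto simp: vec2_eq_iff)
    define s where "s = norm (z$1) ^ 2"
    have s: "0 < s" using z2 by (simp add: s_def)
    have n: "norm (w'$1) = q * norm (w$1) * s" "norm (w'$2) = p * norm (w$2) * s"
      unfolding w' bl_axis(3,4)[OF 1(1)] using m p q by (simp_all add: norm_mult norm_power s_def)
    have w2: "0 < norm (w$1)" using 1 by simp
    have v2: "w'$1 \<noteq> 0" using n(1) q s w2 by (metis mult_eq_0_iff norm_eq_zero less_irrefl)
    then have v0: "w' \<noteq> 0" by auto
    have le: "p * (p * norm (w$1)) \<le> p * norm (w$2)" using 1(3) p by simp
    have "bl p q w' \<noteq> 0"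
    proof
      assume "bl p q w' = 0"
      then consider "norm (w'$2) = q * norm (w'$1)" | "norm (w'$1) = p * norm (w'$2)" using bl_eq_0_cases v0 by blast
      then show False
      proof cases
        case 1
        then have "p * norm (w$2) = q * (q * norm (w$1))" using s by (simp add: n)
        then have "(p * p) * norm (w$1) \<le> (q * q) * norm (w$1)" using le by simp
        then show False using w2 pq_ineqs by simp
      next
        case 2
        then have "q * norm (w$1) = p * (p * norm (w$2))" using s by (simp add: n)
        moreover have "p * (p * (p * norm (w$1))) \<le> p * (p * norm (w$2))" using le p by simp
        ultimately have "p ^ 3 * norm (w$1) \<le> q * norm (w$1)" by (simp add: power3_eq_cube)
        then show False using w2 q by simp
      qed
    qed
    moreover have "p * norm (w'$1) \<le> norm (w'$2)"
    proof -
      have "p * (q * norm (w$1)) \<le> p * (p * norm (w$1))" using p pq_ineqs by (intro mult_left_mono mult_right_mono) auto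
      then have "p * (q * norm (w$1)) \<le> p * norm (w$2)" using le by linarith
      then have "p * (q * norm (w$1)) * s \<le> p * norm (w$2) * s" using s by (intro mult_right_mono) auto
      then show ?thesis by (simp add: n mult_ac)
    qed
    ultimately show ?thesis using z2 v0 v2 1(1) m0 by (auto simp: fz trapped_def vec2_eq_iff)
  qed
  then show "fw p q m2 z w \<noteq> 0" "fz p q m1 m2 z w \<noteq> 0" "trapped p (fz p q m1 m2 z w) (fw p q m2 z w)"
    by (auto simp: w'_def)
qed

text \<open>If \<open>B\<close> took the value 0 or infinity in either half step, the image would be
  trapped. Otherwise both half steps can be undone, the one for \<open>z\<close> first and then the
  one for \<open>w\<close>.\<close>

lemma not_trapped_injective:
  assumes z: "z \<noteq> 0" "w \<noteq> 0" "y \<noteq> 0" "v \<noteq> 0" and m: "norm m1 = 1" "norm m2 = 1"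
    and nz: "fw p q m2 z w \<noteq> 0" "fz p q m1 m2 z w \<noteq> 0" "fw p q m2 y v \<noteq> 0" "fz p q m1 m2 y v \<noteq> 0"
    and par: "parallel (fw p q m2 z w) (fw p q m2 y v)" "parallel (fz p q m1 m2 z w) (fz p q m1 m2 y v)"
    and nt: "\<not> trapped p (fz p q m1 m2 z w) (fw p q m2 z w)"
  shows "parallel z y" "parallel w v"
proof -
  have m0: "m1 \<noteq> 0" "m2 \<noteq> 0" using m by auto
  define w' where "w' = fw p q m2 z w"
  define v' where "v' = fw p q m2 y v"
  have w'c: "w'$1 = m2 * w$1 * bl p q z" "w'$2 = w$2 * bl q p z" by (simp_all add: w'_def fw_def)
  have v'c: "v'$1 = m2 * v$1 * bl p q y" "v'$2 = v$2 * bl q p y" by (simp_all add: v'_def fw_def)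
  have w'0: "w' \<noteq> 0" using nz by (simp add: w'_def)
  have fz: "fz p q m1 m2 z w = vec2 (m1 * z$1 * bl p q w') (z$2 * bl q p w')"
    "fz p q m1 m2 y v = vec2 (m1 * y$1 * bl p q v') (y$2 * bl q p v')"
    unfolding fz_def w'_def[symmetric] v'_def[symmetric] by (simp_all add: fw_def)
  obtain c where c: "c \<noteq> 0" "v' = c *s w'" using parallelD[OF par(1) nz(1,3)] by (auto simp: w'_def v'_def)
  \<comment> \<open>The zeros of \<open>bl p q\<close> are \<open>p\<close> and
    \<open>1 / q\<close>. The first lies on the boundary of the trapped part of the line
    \<open>z = 0\<close>, which is why that region is closed there.\<close>
  have B1: "bl p q w' \<noteq> 0"
  proof
    assume b: "bl p q w' = 0"
    note k = bl_eq_0_cases[OF b w'0]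
    have "p * norm (w'$2) \<le> norm (w'$1)"
      using k(3)
    proof
      assume e: "norm (w'$2) = q * norm (w'$1)"
      have "p * q * norm (w'$1) \<le> 1 * norm (w'$1)" using pq_ineqs by (intro mult_right_mono) (auto simp: mult.commute)
      then show ?thesis by (simp add: e)
    qed simp
    then have "trapped p (fz p q m1 m2 z w) w'" using k by (simp add: trapped_def fz b)
    then show False using nt by (simp add: w'_def)
  qed
  have B2: "bl q p w' \<noteq> 0"
  proof
    assume b: "bl q p w' = 0"
    note k = bl_inv_eq_0_cases[OF b w'0]
    have "p * norm (w'$1) \<le> norm (w'$2)"
      using k(3)
    proof
      assume e: "norm (w'$1) = q * norm (w'$2)"
      have "p * q * norm (w'$2) \<le> 1 * norm (w'$2)" using pq_ineqs by (intro mult_right_mono) (auto simp: mult.commute)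
      then show ?thesis by (simp add: e)
    qed simp
    then have "trapped p (fz p q m1 m2 z w) w'" using k by (simp add: trapped_def fz b)
    then show False using nt by (simp add: w'_def)
  qed
  have "m1 * z$1 * bl p q w' * (y$2 * bl q p v') = z$2 * bl q p w' * (m1 * y$1 * bl p q v')"
    using par(2) by (simp add: fz parallel_def)
  then have "(m1 * bl p q w' * bl q p w' * c\<^sup>2) * (z$1 * y$2) = (m1 * bl p q w' * bl q p w' * c\<^sup>2) * (z$2 * y$1)"
    unfolding c(2) bl_scale by (simp add: mult_ac)
  then show zy: "parallel z y" using m0 B1 B2 c(1) by (simp add: parallel_def)
  obtain d where d: "d \<noteq> 0" "y = d *s z" using parallelD[OF zy z(1,3)] .
  have C1: "bl p q z \<noteq> 0"
  proof
    assume b: "bl p q z = 0"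
    note k = bl_eq_0_cases[OF b z(1)]
    have v1: "w'$1 = 0" by (simp add: w'c b)
    then have v2: "0 < norm (w'$2) ^ 2" using w'0 by (auto simp: vec2_eq_iff)
    have f: "fz p q m1 m2 z w = vec2 (- (m1 * z$1 * (of_real p * (w'$2)\<^sup>2))) (- (z$2 * (of_real q * (w'$2)\<^sup>2)))"
      unfolding fz bl_axis(1,2)[OF v1] by simp
    \<comment> \<open>For \<open>z = p\<close> the image has modulus \<open>p\<^sup>2 / q\<close>,
      and \<open>q < p ^ 3\<close> places it strictly beyond the indeterminacy point
      \<open>1 / p\<close>.\<close>
    have "q * norm (z$2) < p * (p * norm (z$1))"
      using k(3)
    proof
      assume e: "norm (z$1) = p * norm (z$2)"
      have "q * norm (z$2) < p ^ 3 * norm (z$2)" using q k(2) by simp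
      then show ?thesis by (simp add: e power3_eq_cube)
    next
      assume e: "norm (z$2) = q * norm (z$1)"
      have "(q * q) * norm (z$1) < (p * p) * norm (z$1)" using pq_ineqs k(1) by simp
      then show ?thesis by (simp add: e)
    qed
    then have "q * norm (z$2) * norm (w'$2) ^ 2 < p * (p * norm (z$1)) * norm (w'$2) ^ 2"
      using v2 by (intro mult_strict_right_mono) auto
    then have "trapped p (fz p q m1 m2 z w) w'"
      unfolding trapped_def f using v1 m p q by (simp add: norm_mult norm_power mult_ac)
    then show False using nt by (simp add: w'_def)
  qed
  have C2: "bl q p z \<noteq> 0"
  proof
    assume b: "bl q p z = 0"
    note k = bl_inv_eq_0_cases[OF b z(1)]
    have v1: "w'$2 = 0" by (simp add: w'c b)
    then have v2: "0 < norm (w'$1) ^ 2" using w'0 by (auto simp: vec2_eq_iff)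
    have f: "fz p q m1 m2 z w = vec2 (- (m1 * z$1 * (of_real q * (w'$1)\<^sup>2))) (- (z$2 * (of_real p * (w'$1)\<^sup>2)))"
      unfolding fz bl_axis(3,4)[OF v1] by simp
    have "q * norm (z$1) < p * (p * norm (z$2))"
      using k(3)
    proof
      assume e: "norm (z$2) = p * norm (z$1)"
      have "q * norm (z$1) < p ^ 3 * norm (z$1)" using q k(1) by simp
      then show ?thesis by (simp add: e power3_eq_cube)
    next
      assume e: "norm (z$1) = q * norm (z$2)"
      have "(q * q) * norm (z$2) < (p * p) * norm (z$2)" using pq_ineqs k(2) by simp
      then show ?thesis by (simp add: e)
    qed
    then have "q * norm (z$1) * norm (w'$1) ^ 2 < p * (p * norm (z$2)) * norm (w'$1) ^ 2"
      using v2 by (intro mult_strict_right_mono) auto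
    then have "trapped p (fz p q m1 m2 z w) w'"
      unfolding trapped_def f using v1 m p q by (simp add: norm_mult norm_power mult_ac)
    then show False using nt by (simp add: w'_def)
  qed
  have "m2 * w$1 * bl p q z * (v$2 * bl q p y) = w$2 * bl q p z * (m2 * v$1 * bl p q y)"
    using par(1) unfolding w'_def[symmetric] v'_def[symmetric] by (simp add: parallel_def w'c v'c)
  then have "(m2 * bl p q z * bl q p z * d\<^sup>2) * (w$1 * v$2) = (m2 * bl p q z * bl q p z * d\<^sup>2) * (w$2 * v$1)"
    unfolding d(2) bl_scale by (simp add: mult_ac)
  then show "parallel w v" using m0 C1 C2 d(1) by (simp add: parallel_def)
qed

end

text \<open>Undefined points of \<open>f\<close> lie outside \<open>B\<close>. Points outside
  \<open>B\<close> have at most one preimage, again outside \<open>B\<close> by forward invariance,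
  so pulling back finitely many undefined points leaves finitely many.\<close>

lemma finite_undefined_ppow:
  fixes f :: "X \<rightharpoonup> X"
  assumes fin: "finite {r. f r = None}" and def: "\<And>r. r \<in> B \<Longrightarrow> f r \<noteq> None"
    and inv: "\<And>r s. r \<in> B \<Longrightarrow> f r = Some s \<Longrightarrow> s \<in> B"
    and inj: "\<And>r r' s. s \<notin> B \<Longrightarrow> f r = Some s \<Longrightarrow> f r' = Some s \<Longrightarrow> r = r'"
  shows "finite {r. ppow f n r = None}"
proof (induction n)
  case (Suc n)
  have fib: "finite {r. ppow f n r = Some s}" if "s \<notin> B" for s n
    using that
  proof (induction n arbitrary: s)
    case (Suc n)
    show ?case
    proof (cases "\<exists>t. f t = Some s")
      case True
      then obtain t where t: "f t = Some s" by blast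
      then have "t \<notin> B" using inv Suc.prems by blast
      moreover have "{r. ppow f (Suc n) r = Some s} \<subseteq> {r. ppow f n r = Some t}"
        using inj[OF Suc.prems _ t] by (auto simp: map_comp_Some_iff)
      ultimately show ?thesis using Suc.IH finite_subset by blast
    next
      case False
      then have "{r. ppow f (Suc n) r = Some s} = {}" by (auto simp: map_comp_Some_iff)
      then show ?thesis by (metis finite.emptyI)
    qed
  qed simp
  have "{r. ppow f (Suc n) r = None} = {r. ppow f n r = None} \<union> (\<Union>s\<in>{s. f s = None}. {r. ppow f n r = Some s})"
  proof (rule set_eqI)
    fix r
    show "r \<in> {r. ppow f (Suc n) r = None} \<longleftrightarrow> r \<in> {r. ppow f n r = None} \<union> (\<Union>s\<in>{s. f s = None}. {r. ppow f n r = Some s})"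
      by (cases "ppow f n r") (auto simp: map_comp_def)
  qed
  moreover have "finite {r. ppow f n r = Some s}" if "f s = None" for s
    using fib def that by blast
  ultimately show ?case using Suc fin by simp
qed simp

definition zline :: "complex \<Rightarrow> complex \<Rightarrow> P1 set" where
  "zline a b = {pt z |z. z \<noteq> 0 \<and> a * z$1 + b * z$2 = 0}"

lemma finite_zline:
  assumes "a \<noteq> 0 \<or> b \<noteq> 0"
  shows "finite (zline a b)"
proof -
  have "zline a b \<subseteq> {pt (vec2 b (- a))}"
  proof
    fix r assume "r \<in> zline a b"
    then obtain z where z: "r = pt z" "z \<noteq> 0" "a * z$1 + b * z$2 = 0" unfolding zline_def by blast
    have "z$1 * a = - (z$2 * b)" using z(3) by (simp add: mult.commute add_eq_0_iff)
    then have "parallel z (vec2 b (- a))" by (simp add: parallel_def)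
    moreover have "vec2 b (- a) \<noteq> 0" using assms by auto
    ultimately show "r \<in> {pt (vec2 b (- a))}" using z(1) pt_eq_iff[OF z(2)] by blast
  qed
  then show ?thesis using finite_subset by blast
qed

lemma zlineI: "z \<noteq> 0 \<Longrightarrow> a * z$1 + b * z$2 = 0 \<Longrightarrow> pt z \<in> zline a b"
  unfolding zline_def by blast

locale torus_map =
  fixes p q :: real and m1 m2 :: complex
  assumes q: "0 < q" "q < p ^ 3" and p: "0 < p" "p < 1" and m: "norm m1 = 1" "norm m2 = 1"
begin

lemmas hyps = q p

lemma m0: "m1 \<noteq> 0" "m2 \<noteq> 0"
  using m by auto

lemma finite_undefined_fmap: "finite {r. fmap p q m1 m2 r = None}"
proof -
  \<comment> \<open>A finite grid containing all undefined points. \<open>A\<close> collects 0,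
    infinity and the zeros and poles of \<open>B\<close>; \<open>B\<close> collects 0, infinity and
    those \<open>w\<close> for which \<open>w'\<close> is a zero or pole when \<open>z\<close> is 0
    or infinity.\<close>
  define A where "A = zline 1 0 \<union> zline 0 1 \<union> zline 1 (- of_real p) \<union> zline (- of_real q) 1 \<union> zline 1 (- of_real q) \<union> zline (- of_real p) 1"
  define B where "B = zline 1 0 \<union> zline 0 1 \<union> zline (- (m2 * of_real p)) ((of_real q)\<^sup>2) \<union> zline ((of_real p)\<^sup>2 * m2) (- of_real q)
     \<union> zline (- (m2 * of_real q)) ((of_real p)\<^sup>2) \<union> zline ((of_real q)\<^sup>2 * m2) (- of_real p)"
  have fin: "finite (A \<times> B)"
    unfolding A_def B_def using m0 p q by (intro finite_cartesian_product finite_UnI finite_zline) auto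
  have blA: "pt z \<in> A" if "z \<noteq> 0" "bl p q z = 0 \<or> bl q p z = 0" for z
    using that unfolding A_def bl_def by (auto intro!: zlineI)
  have "r \<in> A \<times> B" if r: "fmap p q m1 m2 r = None" for r
  proof -
    obtain z w where zw: "r = (pt z, pt w)" "z \<noteq> 0" "w \<noteq> 0" by (metis prod.collapse pt_cases)
    define w' where "w' = fw p q m2 z w"
    have w': "w'$1 = m2 * w$1 * bl p q z" "w'$2 = w$2 * bl q p z" by (simp_all add: w'_def fw_def)
    have "w' = 0 \<or> fw p q m1 w' z = 0"
      using r zw by (auto simp: fmap_pt fz_def w'_def split: if_splits)
    then consider "w' = 0" | "w' \<noteq> 0" "z$1 = 0" "bl q p w' = 0" | "w' \<noteq> 0" "z$2 = 0" "bl p q w' = 0"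
      using fw_eq_0_iff[OF hyps _ zw(2) m0(1), of w'] by blast
    then show ?thesis
    proof cases
      case 1
      then have "w$1 = 0 \<and> bl q p z = 0 \<or> w$2 = 0 \<and> bl p q z = 0"
        using fw_eq_0_iff[OF hyps zw(2,3) m0(2)] by (simp add: w'_def)
      then have "pt z \<in> A" "pt w \<in> B" using blA zw by (auto simp: B_def intro!: zlineI)
      then show ?thesis by (simp add: zw)
    next
      case 2
      have z2: "z$2 \<noteq> 0" using 2 zw by (auto simp: vec2_eq_iff)
      have "w'$1 = of_real q * w'$2 \<or> w'$2 = of_real p * w'$1" using 2(3) by (simp add: bl_def)
      then have "(z$2)\<^sup>2 * (- (m2 * of_real p) * w$1 + (of_real q)\<^sup>2 * w$2) = 0 \<or> (z$2)\<^sup>2 * (((of_real p)\<^sup>2 * m2) * w$1 + (- of_real q) * w$2) = 0"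
        unfolding w' bl_axis(1,2)[OF hyps 2(2)] by (auto simp: power2_eq_square algebra_simps)
      then have "- (m2 * of_real p) * w$1 + (of_real q)\<^sup>2 * w$2 = 0 \<or> ((of_real p)\<^sup>2 * m2) * w$1 + (- of_real q) * w$2 = 0"
        using z2 by (simp only: mult_eq_0_iff power_eq_0_iff) auto
      then have "pt w \<in> B" unfolding B_def using zlineI[OF zw(3)] by blast
      moreover have "pt z \<in> A" using 2 zw by (auto simp: A_def intro!: zlineI)
      ultimately show ?thesis by (simp add: zw)
    next
      case 3
      have z2: "z$1 \<noteq> 0" using 3 zw by (auto simp: vec2_eq_iff)
      have "w'$1 = of_real p * w'$2 \<or> w'$2 = of_real q * w'$1" using 3(3) by (simp add: bl_def)
      then have "(z$1)\<^sup>2 * (- (m2 * of_real q) * w$1 + (of_real p)\<^sup>2 * w$2) = 0 \<or> (z$1)\<^sup>2 * (((of_real q)\<^sup>2 * m2) * w$1 + (- of_real p) * w$2) = 0"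
        unfolding w' bl_axis(3,4)[OF hyps 3(2)] by (auto simp: power2_eq_square algebra_simps)
      then have "- (m2 * of_real q) * w$1 + (of_real p)\<^sup>2 * w$2 = 0 \<or> ((of_real q)\<^sup>2 * m2) * w$1 + (- of_real p) * w$2 = 0"
        using z2 by (simp only: mult_eq_0_iff power_eq_0_iff) auto
      then have "pt w \<in> B" unfolding B_def using zlineI[OF zw(3)] by blast
      moreover have "pt z \<in> A" using 3 zw by (auto simp: A_def intro!: zlineI)
      ultimately show ?thesis by (simp add: zw)
    qed
  qed
  then have "{r. fmap p q m1 m2 r = None} \<subseteq> A \<times> B" by blast
  then show ?thesis using fin finite_subset by blast
qed

lemma fmap_trap_set:
  assumes "r \<in> trap_set p"
  obtains s where "fmap p q m1 m2 r = Some s" "s \<in> trap_set p"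
proof -
  obtain z w where zw: "r = (pt z, pt w)" "z \<noteq> 0" "w \<noteq> 0" "trapped p z w" using assms unfolding trap_set_def by blast
  note t = trapped_step[OF hyps zw(2,3) m zw(4)]
  have "fmap p q m1 m2 r = Some (pt (fz p q m1 m2 z w), pt (fw p q m2 z w))"
    using t zw by (simp add: fmap_pt)
  moreover have "(pt (fz p q m1 m2 z w), pt (fw p q m2 z w)) \<in> trap_set p"
    using t by (simp add: trap_set_iff)
  ultimately show ?thesis using that by blast
qed

lemma fmap_inj_off_trap_set:
  assumes "s \<notin> trap_set p" "fmap p q m1 m2 r = Some s" "fmap p q m1 m2 r' = Some s"
  shows "r = r'"
proof -
  obtain z w where zw: "r = (pt z, pt w)" "z \<noteq> 0" "w \<noteq> 0" by (metis prod.collapse pt_cases)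
  obtain y v where yv: "r' = (pt y, pt v)" "y \<noteq> 0" "v \<noteq> 0" by (metis prod.collapse pt_cases)
  have nz: "fw p q m2 z w \<noteq> 0" "fz p q m1 m2 z w \<noteq> 0" "fw p q m2 y v \<noteq> 0" "fz p q m1 m2 y v \<noteq> 0"
    and s: "s = (pt (fz p q m1 m2 z w), pt (fw p q m2 z w))" "s = (pt (fz p q m1 m2 y v), pt (fw p q m2 y v))"
    using assms(2,3) zw yv by (auto simp: fmap_pt split: if_splits)
  have par: "parallel (fw p q m2 z w) (fw p q m2 y v)" "parallel (fz p q m1 m2 z w) (fz p q m1 m2 y v)"
  proof -
    have "pt (fw p q m2 z w) = pt (fw p q m2 y v)" "pt (fz p q m1 m2 z w) = pt (fz p q m1 m2 y v)"
      using s by simp_all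
    then show "parallel (fw p q m2 z w) (fw p q m2 y v)" "parallel (fz p q m1 m2 z w) (fz p q m1 m2 y v)"
      by (simp_all only: pt_eq_iff[OF nz(1,3)] pt_eq_iff[OF nz(2,4)])
  qed
  have nt: "\<not> trapped p (fz p q m1 m2 z w) (fw p q m2 z w)"
    using assms(1) s(1) trap_set_iff[OF nz(2,1)] by simp
  from not_trapped_injective[OF hyps zw(2,3) yv(2,3) m nz par nt] show ?thesis
    using zw yv by (simp add: pt_eq_iff)
qed

lemma finite_undefined_ppow_fmap: "finite {r. ppow (fmap p q m1 m2) n r = None}"
proof (rule finite_undefined_ppow[OF finite_undefined_fmap, of "trap_set p"])
  show "fmap p q m1 m2 r \<noteq> None" if "r \<in> trap_set p" for r by (rule fmap_trap_set[OF that]) simp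
  show "s \<in> trap_set p" if "r \<in> trap_set p" "fmap p q m1 m2 r = Some s" for r s
    by (rule fmap_trap_set[OF that(1)]) (use that(2) in simp)
qed (rule fmap_inj_off_trap_set)

lemma stable_lift_f: "stable_lift (xlift (fz p q m1 m2)) (xlift (fw p q m2)) 5 2 2 1"
  by unfold_locales (use finite_undefined_ppow_fmap bihom_f in \<open>auto simp: fmap_def\<close>)

end

subsection \<open>The inverse map\<close>

text \<open>\<open>fmap\<close> and \<open>gmap\<close> are conjugate by \<open>(z, w) \<mapsto> (1 / w, z)\<close>, up to changing the rotation factors.\<close>

definition flip :: "complex^2 \<Rightarrow> complex^2" where
  "flip z = vec2 (z$2) (z$1)"

lemma flip_props [simp]: "flip (flip z) = z" "flip z = 0 \<longleftrightarrow> z = 0" "flip (c *s z) = c *s flip z"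
  by (auto simp: flip_def vec2_eq_iff)

lemma bl_flip: "bl p q (flip z) = bl q p z"
  by (simp add: bl_def flip_def)

definition flipP :: "P1 \<Rightarrow> P1" where
  "flipP r = pt (flip (cay (rep_P1 r)))"

lemma flipP_pt: "z \<noteq> 0 \<Longrightarrow> flipP (pt z) = pt (flip z)"
proof -
  assume z: "z \<noteq> 0"
  have "pt (cay (rep_P1 (pt z))) = pt z" by (simp flip: proj_eq_pt)
  then have "parallel (cay (rep_P1 (pt z))) z" using z pt_eq_iff by simp
  then have "parallel (flip (cay (rep_P1 (pt z)))) (flip z)" by (simp add: parallel_def flip_def mult.commute)
  then show ?thesis unfolding flipP_def using z by (subst pt_eq_iff) auto
qed

lemma flipP_flipP [simp]: "flipP (flipP r) = r"
  by (rule pt_cases[of r]) (auto simp: flipP_pt)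

definition conjJ :: "X \<Rightarrow> X" where "conjJ r = (flipP (snd r), fst r)"
definition conjJ' :: "X \<Rightarrow> X" where "conjJ' r = (snd r, flipP (fst r))"

lemma conjJ_inverse [simp]: "conjJ (conjJ' r) = r" "conjJ' (conjJ r) = r"
  by (simp_all add: conjJ_def conjJ'_def)

lemma gmap_conj:
  assumes m: "m1 \<noteq> 0" "m2 \<noteq> 0"
  shows "gmap p q m1 m2 r = map_option conjJ' (fmap p q m2 (inverse m1) (conjJ r))"
proof -
  obtain z w where zw: "r = (pt z, pt w)" "z \<noteq> 0" "w \<noteq> 0" by (metis prod.collapse pt_cases)
  have 1: "fw p q (inverse m1) (flip w) z = gz p q m1 z w"
    by (simp add: gz_def fw_def bl_flip)
  have 2: "fz p q m2 (inverse m1) (flip w) z = m2 *s flip (gw p q m1 m2 z w)"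
    unfolding fz_def 1 gw_def using m by (simp add: fw_def flip_def vec2_eq_iff)
  have "fmap p q m2 (inverse m1) (conjJ r) = fmap p q m2 (inverse m1) (pt (flip w), pt z)"
    using zw by (simp add: conjJ_def flipP_pt)
  also have "\<dots> = (if gw p q m1 m2 z w = 0 \<or> gz p q m1 z w = 0 then None
      else Some (pt (flip (gw p q m1 m2 z w)), pt (gz p q m1 z w)))"
    using zw m by (subst fmap_pt) (auto simp: 1 2 pt_scale)
  finally show ?thesis using zw m by (auto simp: gmap_pt conjJ'_def flipP_pt)
qed

lemma ppow_one [simp]: "ppow f (Suc 0) = f"
  by (simp add: fun_eq_iff map_comp_def)

lemma ppow_conj:
  assumes "\<And>r. g r = map_option K (f (J r))" "\<And>r. J (K r) = r" "\<And>r. K (J r) = r"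
  shows "ppow g n r = map_option K (ppow f n (J r))"
  by (induction n) (use assms in \<open>auto simp: map_comp_def split: option.splits\<close>)

context torus_map
begin

text \<open>The conjugacy with a map of the same family spares a second analysis of contracted
  curves for the inverse.\<close>

lemma stable_lift_g: "stable_lift (xlift (gz p q m1)) (xlift (gw p q m1 m2)) 1 2 2 5"
proof
  interpret d: torus_map p q m2 "inverse m1"
    by unfold_locales (use q p m in \<open>auto simp: norm_inverse\<close>)
  fix n
  have e: "ppow (gmap p q m1 m2) n r = map_option conjJ' (ppow (fmap p q m2 (inverse m1)) n (conjJ r))" for r
    by (rule ppow_conj) (auto simp: gmap_conj[OF m0])
  have "{r. ppow (gmap p q m1 m2) n r = None} = conjJ -` {r. ppow (fmap p q m2 (inverse m1)) n r = None}"
    by (auto simp: e)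
  moreover have "inj conjJ" by (metis conjJ_inverse(2) injI)
  ultimately show "finite {r. ppow (lmap (xlift (gz p q m1)) (xlift (gw p q m1 m2))) n r = None}"
    using finite_vimageI[OF d.finite_undefined_ppow_fmap] by (simp add: gmap_def)
qed (use bihom_g in auto)

text \<open>On lifts the composition multiplies \<open>z\<close> and \<open>w\<close> by products of
  values of \<open>bl\<close>, which cannot vanish where both maps are defined.\<close>

lemma gmap_fmap:
  assumes "fmap p q m1 m2 r = Some s" "gmap p q m1 m2 s = Some t"
  shows "t = r"
proof -
  obtain z w where zw: "r = (pt z, pt w)" "z \<noteq> 0" "w \<noteq> 0" by (metis prod.collapse pt_cases)
  define w' where "w' = fw p q m2 z w"
  define z' where "z' = fz p q m1 m2 z w"
  have nz: "w' \<noteq> 0" "z' \<noteq> 0" and s: "s = (pt z', pt w')"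
    using assms(1) zw by (auto simp: fmap_pt w'_def z'_def split: if_splits)
  have t: "gz p q m1 z' w' \<noteq> 0" "gw p q m1 m2 z' w' \<noteq> 0" "t = (pt (gz p q m1 z' w'), pt (gw p q m1 m2 z' w'))"
    using assms(2) nz by (auto simp: gmap_pt s split: if_splits)
  have z': "z'$1 = m1 * z$1 * bl p q w'" "z'$2 = z$2 * bl q p w'"
    by (simp_all add: z'_def fz_def w'_def) (simp_all add: fw_def)
  have w': "w'$1 = m2 * w$1 * bl p q z" "w'$2 = w$2 * bl q p z"
    by (simp_all add: w'_def fw_def)
  have 1: "gz p q m1 z' w' = (bl p q w' * bl q p w') *s z"
    using m0 by (simp add: gz_def fw_def z' vec2_eq_iff)
  have 2: "gw p q m1 m2 z' w' = ((bl p q w' * bl q p w')\<^sup>2 * (bl p q z * bl q p z)) *s w"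
    unfolding gw_def 1 using m0 by (simp add: fw_def bl_scale vec2_eq_iff w')
  show ?thesis using t zw by (simp add: 1 2 pt_scale)
qed

lemma fmap_gmap:
  assumes "gmap p q m1 m2 r = Some s" "fmap p q m1 m2 s = Some t"
  shows "t = r"
proof -
  obtain z w where zw: "r = (pt z, pt w)" "z \<noteq> 0" "w \<noteq> 0" by (metis prod.collapse pt_cases)
  define z' where "z' = gz p q m1 z w"
  define w' where "w' = gw p q m1 m2 z w"
  have nz: "w' \<noteq> 0" "z' \<noteq> 0" and s: "s = (pt z', pt w')"
    using assms(1) zw by (auto simp: gmap_pt w'_def z'_def split: if_splits)
  have t: "fz p q m1 m2 z' w' \<noteq> 0" "fw p q m2 z' w' \<noteq> 0" "t = (pt (fz p q m1 m2 z' w'), pt (fw p q m2 z' w'))"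
    using assms(2) nz by (auto simp: fmap_pt s split: if_splits)
  have w': "w'$1 = inverse m2 * w$1 * bl q p z'" "w'$2 = w$2 * bl p q z'"
    by (simp_all add: w'_def gw_def z'_def) (simp_all add: fw_def)
  have z': "z'$1 = inverse m1 * z$1 * bl q p w" "z'$2 = z$2 * bl p q w"
    by (simp_all add: z'_def gz_def fw_def)
  have 1: "fw p q m2 z' w' = (bl p q z' * bl q p z') *s w"
    using m0 by (simp add: fw_def w' vec2_eq_iff)
  have 2: "fz p q m1 m2 z' w' = ((bl p q z' * bl q p z')\<^sup>2 * (bl p q w * bl q p w)) *s z"
    unfolding fz_def 1 using m0 by (simp add: fw_def bl_scale vec2_eq_iff z')
  show ?thesis using t zw by (simp add: 1 2 pt_scale)
qed

definition bq :: "complex \<Rightarrow> complex" where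
  "bq a = bl p q (vec2 a 1) / bl q p (vec2 a 1)"

lemma affine_step:
  assumes a: "a \<noteq> 0" "bl p q (vec2 a 1) \<noteq> 0" "bl q p (vec2 a 1) \<noteq> 0" and b: "b \<noteq> 0"
    and b': "b' = m2 * b * bq a" "bl p q (vec2 b' 1) \<noteq> 0" "bl q p (vec2 b' 1) \<noteq> 0" and a': "a' = m1 * a * bq b'"
  shows "fmap p q m1 m2 (pt (vec2 a 1), pt (vec2 b 1)) = Some (pt (vec2 a' 1), pt (vec2 b' 1))"
    "gmap p q m1 m2 (pt (vec2 a' 1), pt (vec2 b' 1)) = Some (pt (vec2 a 1), pt (vec2 b 1))"
proof -
  have 1: "fw p q m2 (vec2 a 1) (vec2 b 1) = bl q p (vec2 a 1) *s vec2 b' 1"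
    using a by (simp add: fw_def b'(1) bq_def vec2_eq_iff)
  have 2: "fz p q m1 m2 (vec2 a 1) (vec2 b 1) = ((bl q p (vec2 a 1))\<^sup>2 * bl q p (vec2 b' 1)) *s vec2 a' 1"
    unfolding fz_def 1 using b' by (simp add: fw_def bl_scale a' bq_def vec2_eq_iff)
  show "fmap p q m1 m2 (pt (vec2 a 1), pt (vec2 b 1)) = Some (pt (vec2 a' 1), pt (vec2 b' 1))"
    using a b'(2,3) by (simp add: fmap_pt 1 2 pt_scale)
  have 3: "gz p q m1 (vec2 a' 1) (vec2 b' 1) = bl p q (vec2 b' 1) *s vec2 a 1"
    using b' m0 by (simp add: gz_def fw_def a' bq_def vec2_eq_iff)
  have 4: "gw p q m1 m2 (vec2 a' 1) (vec2 b' 1) = ((bl p q (vec2 b' 1))\<^sup>2 * bl p q (vec2 a 1)) *s vec2 b 1"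
    unfolding gw_def 3 using a m0 by (simp add: fw_def bl_scale b'(1) bq_def vec2_eq_iff)
  show "gmap p q m1 m2 (pt (vec2 a' 1), pt (vec2 b' 1)) = Some (pt (vec2 a 1), pt (vec2 b 1))"
    using a b'(2,3) by (simp add: gmap_pt 3 4 pt_scale)
qed

lemma bl_circle:
  assumes "norm a = 1"
  shows "bl p q (vec2 a 1) \<noteq> 0" "bl q p (vec2 a 1) \<noteq> 0" "norm (bq a) = 1"
proof -
  have q1: "q < 1" using pq_ineqs[OF hyps] by simp
  have ne: "a \<noteq> of_real s" "1 - of_real s * a \<noteq> 0" if "0 < s" "s < 1" for s
  proof -
    show "a \<noteq> of_real s" using assms that by auto
    have "norm (of_real s * a) < 1" using assms that by (simp add: norm_mult)
    then show "1 - of_real s * a \<noteq> 0" by auto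
  qed
  show 1: "bl p q (vec2 a 1) \<noteq> 0" "bl q p (vec2 a 1) \<noteq> 0"
    using ne[OF p] ne[OF q(1) q1] by (auto simp: bl_def)
  \<comment> \<open>For \<open>a\<close> on the unit circle
    \<open>1 - s * a = a * cnj (a - s)\<close>, so numerator and denominator of \<open>B\<close>
    have equal modulus.\<close>
  have e: "norm (1 - of_real s * a) = norm (a - of_real s)" for s :: real
  proof -
    have "a * cnj a = 1" using complex_norm_square[of a] assms by simp
    then have "1 - of_real s * a = a * cnj (a - of_real s)" by (simp add: algebra_simps)
    then show ?thesis using assms by (simp add: norm_mult flip: complex_cnj_diff)
  qed
  show "norm (bq a) = 1"
    using 1 unfolding bq_def bl_def norm_divide norm_mult by (simp add: e)
qed

end

subsection \<open>The real torus\<close>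

lemma pt_cis: "pt (vec2 (cis t) 1) = proj (vec2 (of_real (cos (t / 2))) (of_real (- sin (t / 2))))"
proof -
  have "pt (vec2 (cis t) 1) = pt (cis (- (t / 2)) *s vec2 (cis t) 1)"
    by (rule pt_scale[symmetric]) auto
  also have "cis (- (t / 2)) *s vec2 (cis t) 1 = vec2 (cis (t / 2)) (cis (- (t / 2)))"
    by (simp add: vec2_eq_iff cis_mult)
  also have "pt (vec2 (cis (t / 2)) (cis (- (t / 2)))) = proj ((2 * \<i>) *s vec2 (of_real (cos (t / 2))) (of_real (- sin (t / 2))))"
    unfolding pt_def ucay_def by (rule arg_cong[of _ _ proj]) (simp add: vec2_eq_iff complex_eq_iff)
  also have "\<dots> = proj (vec2 (of_real (cos (t / 2))) (of_real (- sin (t / 2))))"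
    using sin_zero_abs_cos_one[of "t / 2"] by (intro proj_scale) auto
  finally show ?thesis .
qed

lemma pt_circle_real:
  assumes "norm a = 1"
  shows "pt (vec2 a 1) \<in> P1_real"
proof -
  obtain t where a: "a = cis t" using assms by (metis complex_norm_eq_1_exp cis_conv_exp)
  show ?thesis
    unfolding a pt_cis P1_real_def mem_Collect_eq
    using sin_zero_abs_cos_one[of "t / 2"] by (intro exI[of _ "vec2 (of_real (cos (t / 2))) (of_real (- sin (t / 2)))"]) (auto simp: forall_2)
qed

lemma P1_real_cases:
  assumes "r \<in> P1_real"
  obtains a where "norm a = 1" "r = pt (vec2 a 1)"
proof -
  obtain x where x: "r = proj x" "x \<noteq> 0" "x$1 \<in> \<real>" "x$2 \<in> \<real>"
    using assms unfolding P1_real_def by auto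
  define z where "z = cay x"
  have c: "z$1 = cnj (z$2)" using x(3,4) by (simp add: z_def cay_def Reals_cnj_iff)
  have z0: "z \<noteq> 0" using x(2) by (simp add: z_def)
  then have z2: "z$2 \<noteq> 0" using c by (auto simp: vec2_eq_iff)
  have "r = pt z" using x by (simp add: proj_eq_pt z_def)
  also have "\<dots> = pt (vec2 (z$1 / z$2) 1)" using z0 z2 by (subst pt_eq_iff) (auto simp: parallel_def)
  finally have "r = pt (vec2 (z$1 / z$2) 1)" .
  moreover have "norm (z$1 / z$2) = 1" using z2 by (simp add: c norm_divide)
  ultimately show ?thesis using that by blast
qed

section \<open>Iterates, inverses and degree growth\<close>

context torus_map
begin

lemma X_real_total:
  assumes "r \<in> X_real"
  shows "\<exists>s\<in>X_real. fmap p q m1 m2 r = Some s" "\<exists>s\<in>X_real. gmap p q m1 m2 r = Some s"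
proof -
  obtain a b where ab: "norm a = 1" "norm b = 1" "r = (pt (vec2 a 1), pt (vec2 b 1))"
    using assms unfolding X_real_def by (auto elim!: P1_real_cases)
  have nz: "x \<noteq> 0" if "norm x = 1" for x :: complex using that by auto
  define b' where "b' = m2 * b * bq a"
  define a' where "a' = m1 * a * bq b'"
  have n: "norm b' = 1" using ab m bl_circle by (simp add: b'_def norm_mult)
  then have n': "norm a' = 1" using ab m bl_circle by (simp add: a'_def norm_mult)
  have "fmap p q m1 m2 r = Some (pt (vec2 a' 1), pt (vec2 b' 1))"
    unfolding ab by (rule affine_step(1)[OF nz[OF ab(1)] bl_circle(1,2)[OF ab(1)] nz[OF ab(2)] b'_def bl_circle(1,2)[OF n] a'_def])
  then show "\<exists>s\<in>X_real. fmap p q m1 m2 r = Some s" using n n' pt_circle_real by (auto simp: X_real_def)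
  \<comment> \<open>The half steps are undone explicitly, \<open>a0\<close> first because the last
    half step of the map changes the first coordinate.\<close>
  define a0 where "a0 = a / (m1 * bq b)"
  define b0 where "b0 = b / (m2 * bq a0)"
  have n0: "norm a0 = 1" using ab m bl_circle by (simp add: a0_def norm_mult norm_divide)
  then have n0': "norm b0 = 1" using ab m bl_circle by (simp add: b0_def norm_mult norm_divide)
  have "m2 * bq a0 \<noteq> 0" "m1 * bq b \<noteq> 0" using m0 bl_circle(3)[OF n0] bl_circle(3)[OF ab(2)] by auto
  then have e: "b = m2 * b0 * bq a0" "a = m1 * a0 * bq b" by (simp_all add: b0_def a0_def)
  have "gmap p q m1 m2 r = Some (pt (vec2 a0 1), pt (vec2 b0 1))"
    unfolding ab by (rule affine_step(2)[OF nz[OF n0] bl_circle(1,2)[OF n0] nz[OF n0'] e(1) bl_circle(1,2)[OF ab(2)] e(2)])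
  then show "\<exists>s\<in>X_real. gmap p q m1 m2 r = Some s" using n0 n0' pt_circle_real by (auto simp: X_real_def)
qed

lemma X_real_ppow:
  assumes "r \<in> X_real"
  shows "\<exists>s\<in>X_real. ppow (fmap p q m1 m2) n r = Some s" "\<exists>s\<in>X_real. ppow (gmap p q m1 m2) n r = Some s"
  using assms X_real_total by (induction n) (auto simp: map_comp_def)

lemma ppow_inverse:
  assumes "\<And>r s t. f r = Some s \<Longrightarrow> g s = Some t \<Longrightarrow> t = r"
    "ppow f n r = Some s" "ppow g n s = Some t"
  shows "t = r"
  using assms(2,3)
proof (induction n arbitrary: r s t)
  case (Suc n)
  obtain u where u: "ppow f n r = Some u" "f u = Some s" using Suc.prems(1) by (auto simp: map_comp_Some_iff)
  have "ppow g (Suc n) s = (ppow g n \<circ>\<^sub>m ppow g 1) s" using ppow_add[of g n 1] by simp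
  then obtain v where v: "g s = Some v" "ppow g n v = Some t" using Suc.prems(2) by (auto simp: map_comp_Some_iff)
  have "v = u" using assms(1)[OF u(2) v(1)] .
  then show ?case using Suc.IH u(1) v(2) by simp
qed simp

lemma map_comp_le_Some:
  assumes "\<And>r s t. f r = Some s \<Longrightarrow> g s = Some t \<Longrightarrow> t = r"
  shows "g \<circ>\<^sub>m f \<subseteq>\<^sub>m Some"
  unfolding map_le_def
proof
  fix r assume "r \<in> dom (g \<circ>\<^sub>m f)"
  then obtain t where t: "(g \<circ>\<^sub>m f) r = Some t" by blast
  then obtain s where "f r = Some s" "g s = Some t" by (auto simp: map_comp_Some_iff)
  then show "(g \<circ>\<^sub>m f) r = Some r" using t assms by simp
qed

lemma ppow_rat_inverse: "rat_inverse (ppow (fmap p q m1 m2) n) (ppow (gmap p q m1 m2) n)"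
proof -
  interpret f: stable_lift "xlift (fz p q m1 m2)" "xlift (fw p q m2)" 5 2 2 1 by (rule stable_lift_f)
  interpret g: stable_lift "xlift (gz p q m1)" "xlift (gw p q m1 m2)" 1 2 2 5 by (rule stable_lift_g)
  have "(pt (vec2 1 1), pt (vec2 1 1)) \<in> X_real" by (simp add: X_real_def pt_circle_real)
  then obtain r where r: "r \<in> X_real" by blast
  obtain s where s: "s \<in> X_real" "ppow (fmap p q m1 m2) n r = Some s" using X_real_ppow(1)[OF r] by blast
  obtain t where t: "ppow (gmap p q m1 m2) n s = Some t" using X_real_ppow(2)[OF s(1)] by blast
  obtain s' where s': "s' \<in> X_real" "ppow (gmap p q m1 m2) n r = Some s'" using X_real_ppow(2)[OF r] by blast
  obtain t' where t': "ppow (fmap p q m1 m2) n s' = Some t'" using X_real_ppow(1)[OF s'(1)] by blast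
  show ?thesis
    unfolding rat_inverse_def
  proof (intro conjI)
    show "rational_map (ppow (fmap p q m1 m2) n)" "rational_map (ppow (gmap p q m1 m2) n)"
      using f.rational_ppow g.rational_ppow by (simp_all add: fmap_def gmap_def)
    have "r \<in> dom (ppow (gmap p q m1 m2) n \<circ>\<^sub>m ppow (fmap p q m1 m2) n)" using s t by (simp add: map_comp_def dom_def)
    then show "dom (ppow (gmap p q m1 m2) n \<circ>\<^sub>m ppow (fmap p q m1 m2) n) \<noteq> {}" by blast
    have "r \<in> dom (ppow (fmap p q m1 m2) n \<circ>\<^sub>m ppow (gmap p q m1 m2) n)" using s' t' by (simp add: map_comp_def dom_def)
    then show "dom (ppow (fmap p q m1 m2) n \<circ>\<^sub>m ppow (gmap p q m1 m2) n) \<noteq> {}" by blast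
    show "ppow (gmap p q m1 m2) n \<circ>\<^sub>m ppow (fmap p q m1 m2) n \<subseteq>\<^sub>m Some"
      by (rule map_comp_le_Some[OF ppow_inverse[OF gmap_fmap]])
    show "ppow (fmap p q m1 m2) n \<circ>\<^sub>m ppow (gmap p q m1 m2) n \<subseteq>\<^sub>m Some"
      by (rule map_comp_le_Some[OF ppow_inverse[OF fmap_gmap]])
  qed
qed

text \<open>Every real point \<open>r\<close> is the image under the iterate of the real point
  \<open>t\<close> given by \<open>gmap\<close>, so a rational inverse has a prescribed value at
  \<open>r\<close>; agreement on the real locus suffices.\<close>

lemma rat_inv_ppow: "rat_inv (ppow (fmap p q m1 m2) n) = ppow (gmap p q m1 m2) n"
  unfolding rat_inv_def
proof (rule the_equality[of "rat_inverse (ppow (fmap p q m1 m2) n)", OF ppow_rat_inverse])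
  interpret g: stable_lift "xlift (gz p q m1)" "xlift (gw p q m1 m2)" 1 2 2 5 by (rule stable_lift_g)
  fix h assume h: "rat_inverse (ppow (fmap p q m1 m2) n) h"
  show "h = ppow (gmap p q m1 m2) n"
    unfolding gmap_def
  proof (rule g.rational_eq_ppow, fold gmap_def)
    show "rational_map h" using h by (simp add: rat_inverse_def)
    fix r s t assume r: "r \<in> X_real" "h r = Some s" "ppow (gmap p q m1 m2) n r = Some t"
    obtain t' where t': "t' \<in> X_real" "ppow (gmap p q m1 m2) n r = Some t'" using X_real_ppow(2)[OF r(1)] by blast
    then have "t \<in> X_real" using r(3) by simp
    then obtain u where u: "ppow (fmap p q m1 m2) n t = Some u" using X_real_ppow(1) by blast
    have "u = r" using ppow_inverse[OF fmap_gmap r(3) u] .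
    then have "(h \<circ>\<^sub>m ppow (fmap p q m1 m2) n) t = Some s" using u r(2) by (simp add: map_comp_def)
    then have "Some t = Some s" using h unfolding rat_inverse_def map_le_def by (metis domI)
    then show "s = t" by simp
  qed
qed

lemma birational_fmap: "birational_map (fmap p q m1 m2)"
  using ppow_rat_inverse[of 1] unfolding birational_map_def One_nat_def ppow_one by blast

lemma rat_zpow_fmap:
  "rat_zpow (fmap p q m1 m2) k = (if 0 \<le> k then ppow (fmap p q m1 m2) (nat k) else ppow (gmap p q m1 m2) (nat (- k)))"
proof -
  interpret f: stable_lift "xlift (fz p q m1 m2)" "xlift (fw p q m2)" 5 2 2 1 by (rule stable_lift_f)
  interpret g: stable_lift "xlift (gz p q m1)" "xlift (gw p q m1 m2)" 1 2 2 5 by (rule stable_lift_g)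
  have "rat_inv (fmap p q m1 m2) = gmap p q m1 m2" using rat_inv_ppow[of 1] unfolding One_nat_def ppow_one .
  then show ?thesis
    using f.rat_pow_eq_ppow g.rat_pow_eq_ppow by (simp add: rat_zpow_def fmap_def gmap_def)
qed

lemma pushforward_fmap:
  "pushforward (rat_pow (fmap p q m1 m2) n) = ((\<lambda>v. (fst v + snd v * 2, fst v * 2 + snd v * 5)) ^^ n)"
proof -
  interpret f: stable_lift "xlift (fz p q m1 m2)" "xlift (fw p q m2)" 5 2 2 1 by (rule stable_lift_f)
  interpret g: stable_lift "xlift (gz p q m1)" "xlift (gw p q m1 m2)" 1 2 2 5 by (rule stable_lift_g)
  have "rat_pow (fmap p q m1 m2) n = ppow (fmap p q m1 m2) n" using f.rat_pow_eq_ppow by (simp add: fmap_def)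
  then show ?thesis
    using g.pullback_ppow[of n] unfolding pushforward_def by (simp add: rat_inv_ppow gmap_def)
qed

end

text \<open>The matrix is symmetric with largest eigenvalue \<open>3 + 2 * sqrt 2\<close>, so the
  norm of its powers is exact and no asymptotic argument is needed.\<close>

lemma symmetric_matrix_power_onorm:
  fixes M :: "real \<times> real \<Rightarrow> real \<times> real"
  defines "M \<equiv> (\<lambda>v. (fst v + snd v * 2, fst v * 2 + snd v * 5))"
  shows "onorm (M ^^ n) = (3 + 2 * sqrt 2) ^ n"
proof -
  define L where "L = 3 + 2 * sqrt 2"
  have L0: "0 < L" by (simp add: L_def add_pos_pos)
  have s2: "sqrt 2 * sqrt 2 = 2" by simp
  have L2: "L\<^sup>2 = 17 + 12 * sqrt 2" by (simp add: L_def power2_eq_square algebra_simps)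
  have le1: "norm (M v) \<le> L * norm v" for v
  proof -
    obtain k l where v: "v = (k, l)" by (cases v)
    \<comment> \<open>The matrix \<open>L\<^sup>2 - M\<^sup>2\<close> is positive semidefinite of
      rank one, hence its quadratic form is a positive multiple of a square.\<close>
    have "0 \<le> 12 * (sqrt 2 - 1) * ((sqrt 2 + 1) * k - l)\<^sup>2" by (intro mult_nonneg_nonneg) auto
    also have "\<dots> = 12 * ((sqrt 2 + 1) * k\<^sup>2 - 2 * k * l + (sqrt 2 - 1) * l\<^sup>2)"
    proof -
      have "(sqrt 2 - 1) * (sqrt 2 + 1) = 1" using s2 by (simp add: algebra_simps)
      then have e: "(sqrt 2 - 1) * ((sqrt 2 + 1) * k - l)\<^sup>2 = (sqrt 2 + 1) * k\<^sup>2 - 2 * k * l + (sqrt 2 - 1) * l\<^sup>2" by algebra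
      show ?thesis by (simp only: mult.assoc[of 12 "sqrt 2 - 1"] e)
    qed
    also have "\<dots> = L\<^sup>2 * (k\<^sup>2 + l\<^sup>2) - ((k + l * 2)\<^sup>2 + (k * 2 + l * 5)\<^sup>2)"
      unfolding L2 by (simp add: power2_eq_square algebra_simps)
    finally have "(norm (M v))\<^sup>2 \<le> (L * norm v)\<^sup>2"
      by (simp add: M_def v norm_Pair power_mult_distrib)
    then show ?thesis by (rule power2_le_imp_le) (use L0 in simp)
  qed
  have le: "norm ((M ^^ n) v) \<le> L ^ n * norm v" for v n
  proof (induction n)
    case (Suc n)
    have "norm ((M ^^ Suc n) v) \<le> L * norm ((M ^^ n) v)" using le1 by simp
    also have "\<dots> \<le> L * (L ^ n * norm v)" using Suc L0 by (intro mult_left_mono) auto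
    finally show ?case by (simp add: mult.assoc)
  qed simp
  define e :: "real \<times> real" where "e = (1, 1 + sqrt 2)"
  have Mc: "M (c *\<^sub>R v) = c *\<^sub>R M v" for c v by (simp add: M_def algebra_simps)
  have "M e = L *\<^sub>R e" using s2 by (simp add: M_def e_def L_def algebra_simps)
  then have eig: "(M ^^ n) e = L ^ n *\<^sub>R e" for n
    by (induction n) (simp_all add: Mc)
  have e0: "norm e \<noteq> 0" by (simp add: e_def zero_prod_def)
  show ?thesis
    unfolding L_def[symmetric]
  proof (rule antisym)
    show "onorm (M ^^ n) \<le> L ^ n" by (rule onorm_bound) (use le L0 in auto)
    have "bounded_linear (M ^^ n)"
    proof (rule bounded_linear_intro[where K = "L ^ n"])
      show "(M ^^ n) (x + y) = (M ^^ n) x + (M ^^ n) y" for x y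
        by (induction n) (auto simp: M_def algebra_simps)
      show "(M ^^ n) (c *\<^sub>R x) = c *\<^sub>R (M ^^ n) x" for c x
        by (induction n) (simp_all add: Mc)
      show "norm ((M ^^ n) x) \<le> norm x * L ^ n" for x using le[of n x] by (simp add: mult.commute)
    qed
    from onorm[OF this, of e] have "L ^ n * norm e \<le> onorm (M ^^ n) * norm e"
      using L0 by (simp add: eig)
    then show "L ^ n \<le> onorm (M ^^ n)" using e0 by simp
  qed
qed

lemma (in torus_map) dynamical_degree_fmap: "dynamical_degree (fmap p q m1 m2) = 3 + 2 * sqrt 2"
proof -
  have "(\<lambda>n. root n (onorm (pushforward (rat_pow (fmap p q m1 m2) n)))) \<longlonglongrightarrow> 3 + 2 * sqrt 2"
  \<comment> \<open>The root of index 0 is 0 by convention, so the sequence is constant only from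
    index 1 on.\<close>
  proof (rule tendsto_eventually, rule eventually_sequentiallyI[of 1])
    fix n :: nat assume "1 \<le> n"
    then show "root n (onorm (pushforward (rat_pow (fmap p q m1 m2) n))) = 3 + 2 * sqrt 2"
      unfolding pushforward_fmap symmetric_matrix_power_onorm by (intro real_root_power_cancel) auto
  qed
  then show ?thesis unfolding dynamical_degree_def by (rule limI)
qed

subsection \<open>Reality\<close>

text \<open>Complex conjugation of the original coordinate, seen in the circle coordinate: the
  inversion \<open>z \<mapsto> 1 / cnj z\<close>.\<close>

definition cflip :: "complex^2 \<Rightarrow> complex^2" where
  "cflip z = vec2 (cnj (z$2)) (cnj (z$1))"

lemma cflip_eq_0_iff [simp]: "cflip z = 0 \<longleftrightarrow> z = 0"
  by (auto simp: cflip_def vec2_eq_iff)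

lemma cnj_P1_pt:
  assumes "z \<noteq> 0"
  shows "cnj_P1 (pt z) = pt (cflip z)"
proof -
  have "cnj_P1 (proj x) = proj (\<chi> i. cnj (x$i))" if "x \<noteq> 0" for x
    using that by (intro cnj_P1.abs_eq) (auto simp: proj_rel_def eq_onp_def intro!: exI[of _ 1])
  then have "cnj_P1 (pt z) = proj (\<chi> i. cnj (ucay z $ i))" using assms by (simp add: pt_def)
  also have "(\<chi> i. cnj (ucay z $ i)) = (- 1) *s ucay (cflip z)"
    by (simp add: vec2_eq_iff ucay_def cflip_def algebra_simps)
  also have "proj \<dots> = pt (cflip z)" unfolding pt_def
    by (rule proj_scale) (use assms in simp_all)
  finally show ?thesis .
qed

lemma bl_cflip: "bl p q (cflip z) = cnj (bl q p z)"
  by (simp add: bl_def cflip_def)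

text \<open>Reality of the half step relies on \<open>norm m = 1\<close>: conjugation followed by
  inversion fixes exactly the unimodular factors.\<close>

lemma fw_cflip:
  assumes "norm m = 1"
  shows "fw p q m (cflip z) (cflip w) = m *s cflip (fw p q m z w)"
proof -
  have "m * cnj m = 1" using complex_norm_square[of m] assms by simp
  then show ?thesis
    by (simp add: fw_def bl_cflip vec2_eq_iff) (simp add: cflip_def bl_cflip mult.assoc[symmetric] del: mult.assoc)
qed

lemma (in torus_map) real_map_fmap: "real_map (fmap p q m1 m2)"
  unfolding real_map_def
proof
  fix r
  obtain z w where zw: "r = (pt z, pt w)" "z \<noteq> 0" "w \<noteq> 0" by (metis prod.collapse pt_cases)
  have 1: "fw p q m2 (cflip z) (cflip w) = m2 *s cflip (fw p q m2 z w)" by (rule fw_cflip[OF m(2)])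
  have "fz p q m1 m2 (cflip z) (cflip w) = fw p q m1 (m2 *s cflip (fw p q m2 z w)) (1 *s cflip z)"
    by (simp add: fz_def 1)
  also have "\<dots> = (m2\<^sup>2 * m1) *s cflip (fz p q m1 m2 z w)"
    unfolding fw_scale fw_cflip[OF m(1)] by (simp add: fz_def vec2_eq_iff)
  finally have 2: "fz p q m1 m2 (cflip z) (cflip w) = (m2\<^sup>2 * m1) *s cflip (fz p q m1 m2 z w)" .
  have "fmap p q m1 m2 (conj_X r) = fmap p q m1 m2 (pt (cflip z), pt (cflip w))"
    using zw by (simp add: conj_X_def cnj_P1_pt)
  also have "\<dots> = map_option conj_X (fmap p q m1 m2 r)"
    using zw m0 by (auto simp: fmap_pt 1 2 pt_scale conj_X_def cnj_P1_pt)
  finally show "fmap p q m1 m2 (conj_X r) = map_option conj_X (fmap p q m1 m2 r)" .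
qed

section \<open>The topology of the projective line\<close>

lemma continuous_on_proj: "continuous_on {x. x \<noteq> 0} proj"
  unfolding continuous_on_def
proof
  fix x :: "complex^2" assume x: "x \<in> {x. x \<noteq> 0}"
  have "((\<lambda>y. norm (y$1 * x$2 - y$2 * x$1) / (norm y * norm x)) \<longlongrightarrow> norm (x$1 * x$2 - x$2 * x$1) / (norm x * norm x)) (at x within {x. x \<noteq> 0})"
    using x by (intro tendsto_intros) auto
  then have "((\<lambda>y. norm (y$1 * x$2 - y$2 * x$1) / (norm y * norm x)) \<longlongrightarrow> 0) (at x within {x. x \<noteq> 0})"
    by (simp add: mult.commute)
  moreover have "eventually (\<lambda>y. norm (y$1 * x$2 - y$2 * x$1) / (norm y * norm x) = dist (proj y) (proj x)) (at x within {x. x \<noteq> 0})"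
    unfolding eventually_at_filter using x by (intro always_eventually allI impI) (simp add: dist_proj chordal_def)
  ultimately have "((\<lambda>y. dist (proj y) (proj x)) \<longlongrightarrow> 0) (at x within {x. x \<noteq> 0})"
    by (rule Lim_transform_eventually)
  then show "(proj \<longlongrightarrow> proj x) (at x within {x. x \<noteq> 0})" by (rule tendsto_dist_iff[THEN iffD2])
qed

text \<open>The orthogonal projection of \<open>x\<close> to the line \<open>r\<close> is a representative of \<open>r\<close> close to \<open>x\<close>.\<close>

lemma close_representative:
  assumes x: "x \<noteq> 0" and d: "norm x * dist (proj x) r < e" "e \<le> norm x"
  obtains y where "y \<noteq> 0" "r = proj y" "norm (y - x) < e"
proof -
  obtain w where w: "w \<noteq> 0" "r = proj w" using proj_cases by blast
  define c where "c = (x$1 * cnj (w$1) + x$2 * cnj (w$2)) / of_real ((norm w)\<^sup>2)"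
  define y where "y = c *s w"
  define E where "E = x$1 * w$2 - x$2 * w$1"
  have nw: "complex_of_real ((norm w)\<^sup>2) = w$1 * cnj (w$1) + w$2 * cnj (w$2)"
    unfolding norm_sq_C2 by (simp add: complex_norm_square del: of_real_power)
  have nw0: "complex_of_real ((norm w)\<^sup>2) \<noteq> 0" using w(1) by simp
  have e1: "of_real ((norm w)\<^sup>2) * (x$1 - y$1) = E * cnj (w$2)"
  proof -
    have "of_real ((norm w)\<^sup>2) * y$1 = (x$1 * cnj (w$1) + x$2 * cnj (w$2)) * w$1"
      using nw0 by (simp add: y_def c_def)
    then have "of_real ((norm w)\<^sup>2) * (x$1 - y$1) = (w$1 * cnj (w$1) + w$2 * cnj (w$2)) * x$1 - (x$1 * cnj (w$1) + x$2 * cnj (w$2)) * w$1"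
      unfolding right_diff_distrib nw by simp
    then show ?thesis by (simp add: E_def algebra_simps)
  qed
  have e2: "of_real ((norm w)\<^sup>2) * (x$2 - y$2) = - E * cnj (w$1)"
  proof -
    have "of_real ((norm w)\<^sup>2) * y$2 = (x$1 * cnj (w$1) + x$2 * cnj (w$2)) * w$2"
      using nw0 by (simp add: y_def c_def)
    then have "of_real ((norm w)\<^sup>2) * (x$2 - y$2) = (w$1 * cnj (w$1) + w$2 * cnj (w$2)) * x$2 - (x$1 * cnj (w$1) + x$2 * cnj (w$2)) * w$2"
      unfolding right_diff_distrib nw by simp
    then show ?thesis by (simp add: E_def algebra_simps)
  qed
  have n12: "(norm w)\<^sup>2 * norm (x$1 - y$1) = norm E * norm (w$2)" "(norm w)\<^sup>2 * norm (x$2 - y$2) = norm E * norm (w$1)"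
    using arg_cong[OF e1, of norm] arg_cong[OF e2, of norm] by (simp_all add: norm_mult norm_power)
  have "((norm w)\<^sup>2 * norm (x - y))\<^sup>2 = ((norm w)\<^sup>2 * norm (x$1 - y$1))\<^sup>2 + ((norm w)\<^sup>2 * norm (x$2 - y$2))\<^sup>2"
    by (simp add: power_mult_distrib norm_sq_C2[of "x - y"] distrib_left)
  also have "\<dots> = (norm E * norm w)\<^sup>2"
    unfolding n12 by (simp add: power_mult_distrib norm_sq_C2[of w] distrib_left)
  finally have "(norm w)\<^sup>2 * norm (x - y) = norm E * norm w"
    by (simp add: power2_eq_iff_nonneg)
  then have "norm (x - y) = norm E / norm w" using w(1) by (simp add: field_simps power2_eq_square)
  also have "\<dots> = norm x * dist (proj x) r"
    using x w by (simp add: dist_proj chordal_def E_def)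
  finally have lt: "norm (y - x) < e" using d(1) by (simp add: norm_minus_commute)
  have y0: "y \<noteq> 0" using lt d(2) by auto
  then have "c \<noteq> 0" by (auto simp: y_def)
  then have "r = proj y" using w by (simp add: y_def proj_scale)
  then show ?thesis using that y0 lt by blast
qed

lemma open_proj_image:
  assumes A: "open A" "0 \<notin> A"
  shows "open (proj ` A)"
  unfolding open_dist
proof (intro ballI)
  fix r assume "r \<in> proj ` A"
  then obtain x where x: "x \<in> A" "r = proj x" by blast
  have x0: "x \<noteq> 0" using x A by auto
  obtain e where e: "0 < e" "ball x e \<subseteq> A" using A x open_contains_ball by blast
  define e' where "e' = min e (norm x)"
  have e': "0 < e'" "e' \<le> norm x" using e x0 by (auto simp: e'_def)
  show "\<exists>d>0. \<forall>s. dist s r < d \<longrightarrow> s \<in> proj ` A"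
  proof (intro exI conjI allI impI)
    show "0 < e' / norm x" using e' x0 by simp
    fix s assume "dist s r < e' / norm x"
    then have "norm x * dist (proj x) s < e'" using x0 x(2) by (simp add: dist_commute field_simps)
    then obtain y where y: "s = proj y" "norm (y - x) < e'" using close_representative[OF x0 _ e'(2)] by blast
    then have "y \<in> A" using e by (auto simp: e'_def dist_norm norm_minus_commute)
    then show "s \<in> proj ` A" using y by blast
  qed
qed

subsection \<open>The real locus is a torus\<close>

definition apt :: "complex \<Rightarrow> P1" where
  "apt a = pt (vec2 a 1)"

lemma apt_inject [simp]: "apt a = apt b \<longleftrightarrow> a = b"
  unfolding apt_def by (subst pt_eq_iff) (auto simp: parallel_def)

lemma continuous_on_vec2:
  assumes "continuous_on S f" "continuous_on S g"
  shows "continuous_on S (\<lambda>x. vec2 (f x) (g x))"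
proof -
  have "continuous_on S (\<lambda>x. if i = 1 then f x else g x)" for i :: 2
    using assms by (cases "i = 1") simp_all
  then have "continuous_on S (\<lambda>x. \<chi> i::2. if i = 1 then f x else g x)"
    by (rule continuous_on_vec_lambda)
  also have "(\<lambda>x. \<chi> i::2. if i = 1 then f x else g x) = (\<lambda>x. vec2 (f x) (g x))"
    by (rule ext) (simp add: vec2_eq_iff)
  finally show ?thesis .
qed

lemma continuous_on_apt:
  assumes "continuous_on S f"
  shows "continuous_on S (\<lambda>x. apt (f x))"
proof -
  have "continuous_on S (\<lambda>x. ucay (vec2 (f x) 1))"
    unfolding ucay_def by (intro continuous_on_vec2 continuous_intros) (auto intro!: continuous_intros assms)
  then show ?thesis unfolding apt_def pt_def
    by (rule continuous_on_compose2[OF continuous_on_proj]) auto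
qed

lemma torus_quotient_map:
  "\<exists>q :: real^2 \<Rightarrow> X. quotient_map euclidean (top_of_set X_real) q \<and>
     (\<forall>u v. q u = q v \<longleftrightarrow> (\<forall>i. u$i - v$i \<in> \<int>))"
proof -
  define q :: "real^2 \<Rightarrow> X" where "q u = (apt (cis (2 * pi * u$1)), apt (cis (2 * pi * u$2)))" for u
  have ceq: "cis (2 * pi * a) = cis (2 * pi * b) \<longleftrightarrow> a - b \<in> \<int>" for a b :: real
  proof -
    have "cis (2 * pi * a) = cis (2 * pi * b) \<longleftrightarrow> sin (2 * pi * a) = sin (2 * pi * b) \<and> cos (2 * pi * a) = cos (2 * pi * b)"
      by (auto simp: complex_eq_iff)
    also have "\<dots> \<longleftrightarrow> (\<exists>n::int. 2 * pi * a = 2 * pi * b + 2 * pi * of_int n)"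
      by (subst sin_cos_eq_iff) (simp add: mult_ac)
    also have "\<dots> \<longleftrightarrow> (\<exists>n::int. a = b + of_int n)"
      by (simp flip: distrib_left)
    also have "\<dots> \<longleftrightarrow> a - b \<in> \<int>" unfolding Ints_def by (auto simp: algebra_simps)
    finally show ?thesis .
  qed
  have qeq: "q u = q v \<longleftrightarrow> (\<forall>i. u$i - v$i \<in> \<int>)" for u v
    by (simp add: q_def ceq forall_2)
  have cont: "continuous_on UNIV q"
    unfolding q_def by (intro continuous_on_Pair continuous_on_apt continuous_on_cis continuous_intros)
  have onto: "\<exists>u\<in>cbox 0 1. q u = r" if "r \<in> X_real" for r
  proof -
    have *: "\<exists>s\<in>{0..1}. apt (cis (2 * pi * s)) = r" if rr: "r \<in> P1_real" for r
    proof -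
      obtain a where a: "norm a = 1" "r = apt a" using P1_real_cases[OF rr] unfolding apt_def by blast
      then obtain t where t: "a = cis t" by (metis complex_norm_eq_1_exp cis_conv_exp)
      define s where "s = frac (t / (2 * pi))"
      have "t / (2 * pi) - s \<in> \<int>" by (simp add: s_def frac_def)
      then have "cis (2 * pi * (t / (2 * pi))) = cis (2 * pi * s)" using ceq by blast
      then have "a = cis (2 * pi * s)" by (simp add: t)
      moreover have "s \<in> {0..1}" using frac_ge_0[of "t / (2 * pi)"] frac_lt_1[of "t / (2 * pi)"] by (simp add: s_def)
      ultimately show ?thesis using a by blast
    qed
    obtain r1 r2 where r: "r = (r1, r2)" "r1 \<in> P1_real" "r2 \<in> P1_real" using \<open>r \<in> X_real\<close> by (auto simp: X_real_def)
    obtain s1 s2 where s: "s1 \<in> {0..1}" "apt (cis (2 * pi * s1)) = r1" "s2 \<in> {0..1}" "apt (cis (2 * pi * s2)) = r2"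
      using *[OF r(2)] *[OF r(3)] by blast
    show ?thesis
      by (rule bexI[of _ "vector [s1, s2]"]) (use s r in \<open>auto simp: q_def mem_box_cart forall_2\<close>)
  qed
  have into: "q u \<in> X_real" for u
    by (simp add: q_def X_real_def apt_def pt_circle_real)
  have "quotient_map euclidean (top_of_set X_real) q"
    unfolding quotient_map_def
  proof (intro conjI allI impI)
    have "q ` UNIV = X_real" using onto into by blast
    then show "q ` topspace euclidean = topspace (top_of_set X_real)" by simp
    fix U assume "U \<subseteq> topspace (top_of_set X_real)"
    then have U: "U \<subseteq> X_real" by simp
    show "openin euclidean {x \<in> topspace euclidean. q x \<in> U} = openin (top_of_set X_real) U"
    proof
      assume "openin (top_of_set X_real) U"
      then obtain V where V: "open V" "U = X_real \<inter> V" by (auto simp: openin_open)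
      then have "{x. q x \<in> U} = q -` V" using into by auto
      moreover have "open (q -` V)" using open_vimage[OF V(1) cont] .
      ultimately show "openin euclidean {x \<in> topspace euclidean. q x \<in> U}" by (simp add: vimage_def)
    next
      assume "openin euclidean {x \<in> topspace euclidean. q x \<in> U}"
      then have o: "open (q -` U)" by (simp add: vimage_def)
      \<comment> \<open>The unit cube maps onto the torus. The part of it outside the preimage of
        \<open>U\<close> is compact, so its image, the complement of \<open>U\<close> in the torus,
        is closed.\<close>
      define C where "C = q ` (cbox 0 1 - q -` U)"
      have "compact (cbox 0 1 - q -` U)" by (intro compact_diff compact_cbox o)
      then have "compact C" unfolding C_def by (intro compact_continuous_image continuous_on_subset[OF cont]) auto
      then have "closed C" by (rule compact_imp_closed)
      moreover have "U = X_real \<inter> - C"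
      proof (intro equalityI subsetI)
        fix r assume "r \<in> U"
        then show "r \<in> X_real \<inter> - C" using U by (auto simp: C_def)
      next
        fix r assume r: "r \<in> X_real \<inter> - C"
        then obtain u where "u \<in> cbox 0 1" "q u = r" using onto by blast
        then show "r \<in> U" using r by (auto simp: C_def)
      qed
      ultimately show "openin (top_of_set X_real) U" by (metis open_Compl openin_open_Int)
    qed
  qed
  with qeq show ?thesis by blast
qed

section \<open>The logarithm of the Blaschke quotient as a power series\<close>

lemma ln_one_minus_sums:
  assumes "norm (w::complex) < 1"
  shows "(\<lambda>n. w ^ Suc n / of_nat (Suc n)) sums (- Ln (1 - w))"
proof -
  have "(\<lambda>n. (- 1) ^ Suc n / of_nat n * (- w) ^ n) sums Ln (1 + (- w))"
    by (rule Ln_series) (use assms in simp)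
  then have "(\<lambda>n. - ((- 1) ^ Suc n / of_nat n * (- w) ^ n)) sums (- Ln (1 - w))" by (intro sums_minus) simp
  moreover have "(\<lambda>n. - ((- 1) ^ Suc n / of_nat n * (- w) ^ n)) = (\<lambda>n. w ^ n / of_nat n)"
  proof
    fix n
    have "(- 1) ^ n * (- w) ^ n = w ^ n" by (simp flip: power_mult_distrib)
    then show "- ((- 1) ^ Suc n / of_nat n * (- w) ^ n) = w ^ n / of_nat n" by simp
  qed
  ultimately have "(\<lambda>n. w ^ n / of_nat n) sums (- Ln (1 - w))" by (simp only:)
  then show ?thesis using sums_Suc_iff[of "\<lambda>n. w ^ n / of_nat n" "- Ln (1 - w)"] by simp
qed

lemma exp_slog:
  assumes p: "small_param p" and y: "\<bar>Re y\<bar> \<le> 1"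
  shows "bl p (p ^ 4) (vec2 (exp y) 1) \<noteq> 0" "bl (p ^ 4) p (vec2 (exp y) 1) \<noteq> 0"
    "exp (slog p y) = bl p (p ^ 4) (vec2 (exp y) 1) / bl (p ^ 4) p (vec2 (exp y) 1)"
proof -
  define q where "q = p ^ 4"
  define w where "w = exp y"
  have w0: "w \<noteq> 0" by (simp add: w_def)
  have p0: "0 < p" "p < 1/8" using small_param_less[OF p] by auto
  have e3: "exp (1::real) \<le> 3" using exp_le by simp
  have nw: "norm w \<le> 3" "norm (inverse w) \<le> 3"
  proof -
    have "norm w \<le> exp 1" "norm (inverse w) \<le> exp 1"
      using y by (auto simp: w_def exp_minus[symmetric] abs_le_iff)
    then show "norm w \<le> 3" "norm (inverse w) \<le> 3" using e3 by linarith+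
  qed
  have qp: "0 < q" "q \<le> p" using p0 power_decreasing[of 1 4 p] by (auto simp: q_def)
  have lt: "norm (of_real s * v) < 1" if "0 < s" "s \<le> p" "norm v \<le> 3" for s and v :: complex
  proof -
    have "norm (of_real s * v) \<le> p * 3" unfolding norm_mult using that by (intro mult_mono) auto
    then show ?thesis using p0 by simp
  qed
  have n: "norm (of_real p * w) < 1" "norm (of_real q * w) < 1" "norm (of_real p * inverse w) < 1" "norm (of_real q * inverse w) < 1"
    using p0 qp nw by (auto intro!: lt)
  have nz: "1 - v \<noteq> 0" if "norm v < 1" for v :: complex using that by auto
  have "(\<lambda>n. (of_real p * w) ^ Suc n / of_nat (Suc n) - (of_real q * w) ^ Suc n / of_nat (Suc n)
      - ((of_real p * inverse w) ^ Suc n / of_nat (Suc n) - (of_real q * inverse w) ^ Suc n / of_nat (Suc n)))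
    sums (- Ln (1 - of_real p * w) - - Ln (1 - of_real q * w) - (- Ln (1 - of_real p * inverse w) - - Ln (1 - of_real q * inverse w)))"
    by (intro sums_diff ln_one_minus_sums n)
  moreover have "(of_real p * w) ^ Suc n / of_nat (Suc n) - (of_real q * w) ^ Suc n / of_nat (Suc n)
      - ((of_real p * inverse w) ^ Suc n / of_nat (Suc n) - (of_real q * inverse w) ^ Suc n / of_nat (Suc n))
    = of_real (scoeff p n) * (exp (of_nat (Suc n) * y) - exp (- (of_nat (Suc n) * y)))" for n
  proof -
    have e: "exp (of_nat (Suc n) * y) = w ^ Suc n" "exp (- (of_nat (Suc n) * y)) = inverse w ^ Suc n"
      unfolding w_def exp_of_nat_mult exp_minus by (simp_all only: power_inverse)
    have "of_real (scoeff p n) = (of_real p ^ Suc n - of_real q ^ Suc n) / (of_nat (Suc n) :: complex)"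
      by (simp add: scoeff_def q_def)
    then show ?thesis unfolding e power_mult_distrib
      by (simp only: diff_divide_distrib left_diff_distrib right_diff_distrib times_divide_eq_left)
  qed
  moreover have "(\<lambda>n. of_real (scoeff p n) * (exp (of_nat (Suc n) * y) - exp (- (of_nat (Suc n) * y)))) sums slog p y"
    by (rule has_sum_imp_sums[OF slog_has_sum(1)[OF p]]) (use y in auto)
  ultimately have s: "slog p y = - Ln (1 - of_real p * w) - - Ln (1 - of_real q * w) - (- Ln (1 - of_real p * inverse w) - - Ln (1 - of_real q * inverse w))"
    by (simp only:) (rule sums_unique2)
  \<comment> \<open>After the common factor \<open>w\<close> is taken out, all factors have the form
    1 minus a number of modulus below 1, which the logarithmic series covers.\<close>
  have b: "bl p q (vec2 w 1) = w * ((1 - of_real p * inverse w) * (1 - of_real q * w))"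
    "bl q p (vec2 w 1) = w * ((1 - of_real q * inverse w) * (1 - of_real p * w))"
    using w0 by (simp_all add: bl_def field_simps)
  show "bl p (p ^ 4) (vec2 (exp y) 1) \<noteq> 0" "bl (p ^ 4) p (vec2 (exp y) 1) \<noteq> 0"
    unfolding q_def[symmetric] w_def[symmetric] b using w0 n nz by simp_all
  have "exp (slog p y) = (1 - of_real p * inverse w) * (1 - of_real q * w) / ((1 - of_real q * inverse w) * (1 - of_real p * w))"
    unfolding s using nz[OF n(1)] nz[OF n(2)] nz[OF n(3)] nz[OF n(4)] by (simp add: exp_add exp_diff exp_minus divide_inverse)
  then show "exp (slog p y) = bl p (p ^ 4) (vec2 (exp y) 1) / bl (p ^ 4) p (vec2 (exp y) 1)"
    unfolding q_def[symmetric] w_def[symmetric] b using w0 by simp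
qed

section \<open>Holomorphic maps of two variables\<close>

lemma has_derivative_vec2:
  assumes "(f has_derivative f') (at z within S)" "(g has_derivative g') (at z within S)"
  shows "((\<lambda>x. vec2 (f x) (g x)) has_derivative (\<lambda>v. vec2 (f' v) (g' v))) (at z within S)"
proof -
  have "linear (\<lambda>p :: complex \<times> complex. vec2 (fst p) (snd p))"
    by (rule linearI) (simp_all add: vec2_eq_iff)
  then have "bounded_linear (\<lambda>p :: complex \<times> complex. vec2 (fst p) (snd p))"
    by (simp add: linear_conv_bounded_linear)
  from bounded_linear.has_derivative[OF this has_derivative_Pair[OF assms]] show ?thesis by simp
qed

lemma matrix_vector_2: "(vector [vec2 a b, vec2 c d] :: complex^2^2) *v v = vec2 (a * v$1 + b * v$2) (c * v$1 + d * v$2)"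
  by (simp add: matrix_vector_mult_def vec2_eq_iff sum_2)

lemma has_derivative_matrix2:
  fixes f g :: "complex^2 \<Rightarrow> complex"
  assumes "(f has_derivative (\<lambda>v. a * v$1 + b * v$2)) (at z within S)" "(g has_derivative (\<lambda>v. c * v$1 + d * v$2)) (at z within S)"
  shows "((\<lambda>z. vec2 (f z) (g z)) has_derivative (\<lambda>v. (vector [vec2 a b, vec2 c d] :: complex^2^2) *v v)) (at z within S)"
  unfolding matrix_vector_2 by (rule has_derivative_vec2[OF assms])

lemma has_derivative_diagonal:
  assumes "(k1 has_field_derivative d1) (at (z$1))" "(k2 has_field_derivative d2) (at (z$2))"
  shows "((\<lambda>z :: complex^2. vec2 (k1 (z$1)) (k2 (z$2))) has_derivative (\<lambda>v. (vector [vec2 d1 0, vec2 0 d2] :: complex^2^2) *v v)) (at z)"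
proof -
  have c: "((\<lambda>z :: complex^2. z$i) has_derivative (\<lambda>v. v$i)) (at z)" for i
    by (rule bounded_linear.has_derivative[OF bounded_linear_vec_nth has_derivative_ident])
  have "((\<lambda>z :: complex^2. k1 (z$1)) has_derivative (\<lambda>v. d1 * v$1)) (at z)"
    by (rule has_derivative_compose[OF c assms(1)[unfolded has_field_derivative_def]])
  moreover have "((\<lambda>z :: complex^2. k2 (z$2)) has_derivative (\<lambda>v. d2 * v$2)) (at z)"
    by (rule has_derivative_compose[OF c assms(2)[unfolded has_field_derivative_def]])
  ultimately show ?thesis by (intro has_derivative_matrix2) simp_all
qed

lemma has_derivative_matrix_compose:
  fixes f g :: "complex^2 \<Rightarrow> complex^2"
  assumes "(f has_derivative (\<lambda>v. A *v v)) (at z)" "(g has_derivative (\<lambda>v. B *v v)) (at (f z))"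
  shows "((\<lambda>z. g (f z)) has_derivative (\<lambda>v. (B ** A) *v v)) (at z)"
  using has_derivative_compose[OF assms] by (simp add: matrix_vector_mul_assoc)

text \<open>An injective square matrix has a two-sided inverse, so a differentiable inverse exists
  and its derivative is again complex linear.\<close>

lemma inv_into_has_derivative:
  fixes f :: "complex^2 \<Rightarrow> complex^2"
  assumes S: "open S" "z \<in> S" "continuous_on S f" "inj_on f S"
    and d: "(f has_derivative (\<lambda>v. A *v v)) (at z)" and inj: "\<And>v. A *v v = 0 \<Longrightarrow> v = 0"
  obtains B :: "complex^2^2" where "(inv_into S f has_derivative (\<lambda>v. B *v v)) (at (f z))"
proof -
  have "inj ((*v) A)" using inj by (simp add: vec.inj_iff_eq_0)
  then obtain B where "B ** A = mat 1" using matrix_left_invertible_injective by blast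
  then have "A ** B = mat 1" by (rule matrix_left_right_inverse[THEN iffD1])
  then have "(\<lambda>v. A *v v) \<circ> (\<lambda>v. B *v v) = id" by (auto simp: matrix_vector_mul_assoc)
  then have "(inv_into S f has_derivative (\<lambda>v. B *v v)) (at (f z))"
    by (intro has_derivative_inverse_strong[OF S(1-3) _ d]) (use S(4) in auto)
  then show ?thesis by (rule that)
qed

section \<open>The conjugacy on the annuli\<close>

definition cexp2 :: "complex \<times> complex \<Rightarrow> complex^2" where
  "cexp2 x = vec2 (exp (fst x)) (exp (snd x))"

definition cln2 :: "complex^2 \<Rightarrow> complex \<times> complex" where
  "cln2 z = (Ln (z$1), Ln (z$2))"

text \<open>The image of \<open>strip (1/4)\<close>, half the width on which the solution is
  controlled. The remaining quarter turns the bound 1/128 into 1/32 for the derivatives.\<close>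

definition annuli :: "(complex^2) set" where
  "annuli = {z. exp (-1/4) < norm (z$1) \<and> norm (z$1) < exp (1/4) \<and> exp (-1/4) < norm (z$2) \<and> norm (z$2) < exp (1/4)}"

lemma annuli_nonzero: "z \<in> annuli \<Longrightarrow> z$1 \<noteq> 0 \<and> z$2 \<noteq> 0"
  unfolding annuli_def using exp_gt_zero[of "-1/4::real"] by auto

lemma cexp2_cln2: "z \<in> annuli \<Longrightarrow> cexp2 (cln2 z) = z"
  using annuli_nonzero by (simp add: cexp2_def cln2_def)

lemma cexp2_in_annuli_iff: "cexp2 x \<in> annuli \<longleftrightarrow> x \<in> strip (1/4)"
  by (auto simp: cexp2_def annuli_def strip_def)

lemma cln2_in_strip: "z \<in> annuli \<Longrightarrow> cln2 z \<in> strip (1/4)"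
  using cexp2_in_annuli_iff cexp2_cln2 by metis

lemma annuli_eq_image: "annuli = cexp2 ` strip (1/4)"
  using cexp2_in_annuli_iff cexp2_cln2 cln2_in_strip by force

lemma open_annuli: "open annuli"
  unfolding annuli_def Collect_conj_eq
  by (intro open_Int open_Collect_less continuous_intros)

lemma convex_strip: "convex (strip r)"
proof -
  have eq: "strip r = ((\<lambda>x. Re (fst x)) -` {-r<..<r}) \<inter> ((\<lambda>x. Re (snd x)) -` {-r<..<r})"
    by (auto simp: strip_def)
  have "linear (\<lambda>x :: complex \<times> complex. Re (fst x))" "linear (\<lambda>x :: complex \<times> complex. Re (snd x))"
    by (auto intro!: linearI)
  then show ?thesis unfolding eq by (intro convex_Int convex_linear_vimage) auto
qed

lemma connected_annuli: "connected annuli"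
proof -
  have "continuous_on (strip (1/4)) cexp2"
    unfolding cexp2_def by (intro continuous_on_vec2 continuous_intros)
  then show ?thesis unfolding annuli_eq_image
    by (rule connected_continuous_image) (rule convex_connected[OF convex_strip])
qed

lemma exp_eqE:
  assumes "exp w = exp (z::complex)"
  obtains n :: int where "w = z + of_int n * (2 * of_real pi * \<i>)"
  using assms by (auto simp: exp_eq mult_ac)

lemma cexp2_eqE:
  assumes "cexp2 x = cexp2 y"
  obtains t and m n :: int where "x = y + t" "fst t = of_int m * (2 * of_real pi * \<i>)" "snd t = of_int n * (2 * of_real pi * \<i>)"
proof -
  have "exp (fst x) = exp (fst y)" "exp (snd x) = exp (snd y)" using assms by (simp_all add: cexp2_def vec2_eq_iff)
  then obtain m n :: int where mn: "fst x = fst y + of_int m * (2 * of_real pi * \<i>)" "snd x = snd y + of_int n * (2 * of_real pi * \<i>)"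
    by (elim exp_eqE)
  show ?thesis
    by (rule that[of "x - y" m n]) (use mn in auto)
qed

locale near_identity =
  fixes u1 u2 :: "complex \<times> complex \<Rightarrow> complex"
  assumes fb: "fbound (1/2) (1/128) u1" "fbound (1/2) (1/128) u2"
    and odd: "odd_sym (1/2) u1" "odd_sym (1/2) u2"
begin

definition hl :: "complex \<times> complex \<Rightarrow> complex \<times> complex" where
  "hl x = (fst x + u1 x, snd x + u2 x)"

definition hmap :: "complex^2 \<Rightarrow> complex^2" where
  "hmap z = cexp2 (hl (cln2 z))"

lemma strip_mem: "x \<in> strip (1/4) \<Longrightarrow> x \<in> strip (1/2)"
  using strip_mono[of "1/4" "1/2"] by auto

lemma hl_translate:
  assumes "x \<in> strip (1/4)" "fst t = of_int m * (2 * of_real pi * \<i>)" "snd t = of_int n * (2 * of_real pi * \<i>)"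
  shows "hl (x + t) = hl x + t"
  using fbound_periodic[OF fb(1) strip_mem[OF assms(1)] assms(2,3)] fbound_periodic[OF fb(2) strip_mem[OF assms(1)] assms(2,3)]
  by (simp add: hl_def prod_eq_iff)

lemma cexp2_translate:
  assumes "fst t = of_int m * (2 * of_real pi * \<i>)" "snd t = of_int n * (2 * of_real pi * \<i>)"
  shows "cexp2 (x + t) = cexp2 x"
proof -
  have "exp (of_int k * (2 * of_real pi * \<i>)) = 1" for k :: int
    using exp_eq[of "of_int k * (2 * of_real pi * \<i>)" 0] by (auto simp: mult_ac)
  then show ?thesis using assms by (simp add: cexp2_def exp_add)
qed

text \<open>Another logarithm differs from the principal one by a period, with which
  \<open>hl\<close> commutes. Hence \<open>hmap\<close> may be computed with any branch.\<close>

lemma hmap_cexp2: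
  assumes "x \<in> strip (1/4)"
  shows "hmap (cexp2 x) = cexp2 (hl x)"
proof -
  have "cexp2 (cln2 (cexp2 x)) = cexp2 x" using assms by (simp add: cexp2_cln2 cexp2_in_annuli_iff)
  then obtain t and m n :: int where t: "cln2 (cexp2 x) = x + t" "fst t = of_int m * (2 * of_real pi * \<i>)" "snd t = of_int n * (2 * of_real pi * \<i>)"
    by (rule cexp2_eqE)
  show ?thesis unfolding hmap_def t(1) hl_translate[OF assms t(2,3)] by (rule cexp2_translate[OF t(2,3)])
qed

lemma u_derivatives:
  assumes "fbound (1/2) (1/128) u"
  obtains D1 D2 where "\<And>x. x \<in> strip (1/4) \<Longrightarrow> (u has_derivative (\<lambda>h. D1 x * fst h + D2 x * snd h)) (at x)"
    "\<And>x. x \<in> strip (1/4) \<Longrightarrow> norm (D1 x) \<le> 1/32" "\<And>x. x \<in> strip (1/4) \<Longrightarrow> norm (D2 x) \<le> 1/32"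
proof (rule fbound_has_derivative[OF assms])
  fix D1 D2
  assume d: "\<And>x. x \<in> strip (1/2) \<Longrightarrow> (u has_derivative (\<lambda>h. D1 x * fst h + D2 x * snd h)) (at x)"
    and b: "\<And>\<delta>. 0 < \<delta> \<Longrightarrow> fbound (1/2 - \<delta>) (1/128 / \<delta>) D1" "\<And>\<delta>. 0 < \<delta> \<Longrightarrow> fbound (1/2 - \<delta>) (1/128 / \<delta>) D2"
  have b': "fbound (1/4) (1/32) D1" "fbound (1/4) (1/32) D2" using b[of "1/4"] by simp_all
  show thesis
    by (rule that[of D1 D2]) (use d strip_mem norm_le_fbound[OF b'(1)] norm_le_fbound[OF b'(2)] in blast)+
qed

lemma u_lipschitz:
  assumes u: "fbound (1/2) (1/128) u" and xy: "x \<in> strip (1/4)" "y \<in> strip (1/4)"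
  shows "norm (u x - u y) \<le> 1/16 * norm (x - y)"
proof (rule u_derivatives[OF u])
  fix D1 D2
  assume d: "\<And>x. x \<in> strip (1/4) \<Longrightarrow> (u has_derivative (\<lambda>h. D1 x * fst h + D2 x * snd h)) (at x)"
    and b: "\<And>x. x \<in> strip (1/4) \<Longrightarrow> norm (D1 x) \<le> 1/32" "\<And>x. x \<in> strip (1/4) \<Longrightarrow> norm (D2 x) \<le> 1/32"
  show ?thesis
  proof (rule differentiable_bound[OF convex_strip _ _ xy])
    fix x assume x: "x \<in> strip (1/4)"
    show "(u has_derivative (\<lambda>h. D1 x * fst h + D2 x * snd h)) (at x within strip (1/4))"
      using d[OF x] by (rule has_derivative_at_withinI)
    show "onorm (\<lambda>h. D1 x * fst h + D2 x * snd h) \<le> 1/16"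
    proof (rule onorm_le)
      fix h :: "complex \<times> complex"
      have "norm (D1 x * fst h + D2 x * snd h) \<le> norm (D1 x) * norm (fst h) + norm (D2 x) * norm (snd h)"
        using norm_triangle_ineq[of "D1 x * fst h" "D2 x * snd h"] by (simp add: norm_mult)
      also have "\<dots> \<le> 1/32 * norm h + 1/32 * norm h"
        using b[OF x] norm_fst_le[of "fst h" "snd h"] norm_snd_le[of "snd h" "fst h"] by (intro add_mono mult_mono) auto
      finally show "norm (D1 x * fst h + D2 x * snd h) \<le> 1/16 * norm h" by simp
    qed
  qed
qed

lemma hl_inject:
  assumes "x \<in> strip (1/4)" "y \<in> strip (1/4)" "hl x = hl y"
  shows "x = y"
proof -
  have "fst x - fst y = u1 y - u1 x" "snd x - snd y = u2 y - u2 x"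
    using assms(3) by (auto simp: hl_def algebra_simps)
  then have "norm (fst x - fst y) \<le> 1/16 * norm (x - y)" "norm (snd x - snd y) \<le> 1/16 * norm (x - y)"
    using u_lipschitz[OF fb(1) assms(2,1)] u_lipschitz[OF fb(2) assms(2,1)] by (simp_all add: norm_minus_commute)
  moreover have "norm (x - y) \<le> norm (fst x - fst y) + norm (snd x - snd y)"
    using norm_Pair_le[of "fst (x - y)" "snd (x - y)"] unfolding prod.collapse by simp
  moreover have "0 \<le> norm (x - y)" by simp
  ultimately have "norm (x - y) = 0" by linarith
  then show ?thesis by simp
qed

lemma inj_on_hmap: "inj_on hmap annuli"
proof (rule inj_onI)
  fix z w assume zw: "z \<in> annuli" "w \<in> annuli" "hmap z = hmap w"
  define x y where "x = cln2 z" and "y = cln2 w"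
  have x: "x \<in> strip (1/4)" "y \<in> strip (1/4)" "cexp2 x = z" "cexp2 y = w"
    unfolding x_def y_def using zw cln2_in_strip cexp2_cln2 by blast+
  have "cexp2 (hl x) = cexp2 (hl y)" using zw(3) hmap_cexp2 x by metis
  then obtain t and m n :: int where t: "hl x = hl y + t" "fst t = of_int m * (2 * of_real pi * \<i>)" "snd t = of_int n * (2 * of_real pi * \<i>)"
    by (rule cexp2_eqE)
  have s: "y + t \<in> strip (1/4)" using x(2) t by (simp add: strip_def)
  have "x = y + t" by (rule hl_inject[OF x(1) s]) (simp add: hl_translate[OF x(2) t(2,3)] t(1))
  then show "z = w" using cexp2_translate[OF t(2,3)] x by metis
qed

lemma hmap_has_derivative:
  assumes z: "z \<in> annuli"
  obtains A :: "complex^2^2" where "(hmap has_derivative (\<lambda>v. A *v v)) (at z)" "\<And>v. A *v v = 0 \<Longrightarrow> v = 0"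
proof -
  note result = that
  define x where "x = cln2 z"
  have xs: "x \<in> strip (1/4)" and zx: "z$1 = exp (fst x)" "z$2 = exp (snd x)"
    using cln2_in_strip[OF z] annuli_nonzero[OF z] by (simp_all add: x_def cln2_def)
  have z0: "z$1 \<noteq> 0" "z$2 \<noteq> 0" using annuli_nonzero[OF z] by auto
  \<comment> \<open>The principal branch in \<open>cln2\<close> is discontinuous on the negative
    axis. This local branch is differentiable at \<open>z\<close>, since the quotient there is
    1.\<close>
  define l where "l w = (fst x + Ln (w$1 / z$1), snd x + Ln (w$2 / z$2))" for w :: "complex^2"
  have lz: "l z = x" using z0 by (simp add: l_def)
  have lw: "l w \<in> strip (1/4)" "cexp2 (l w) = w" if "w \<in> annuli" for w
  proof -
    show e: "cexp2 (l w) = w" using annuli_nonzero[OF that] z0 zx by (simp add: l_def cexp2_def exp_add)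
    show "l w \<in> strip (1/4)" using cexp2_in_annuli_iff that e by metis
  qed
  have c: "((\<lambda>z :: complex^2. z$i) has_derivative (\<lambda>v. v$i)) (at z)" for i
    by (rule bounded_linear.has_derivative[OF bounded_linear_vec_nth has_derivative_ident])
  have d1: "((\<lambda>w. fst x + Ln (w$1 / z$1)) has_derivative (\<lambda>v. v$1 / z$1)) (at z)"
  proof -
    have "((\<lambda>a. fst x + Ln (a / z$1)) has_field_derivative inverse (z$1)) (at (z$1))"
      using z0 by (auto intro!: derivative_eq_intros simp: field_simps)
    from has_derivative_compose[OF c this[unfolded has_field_derivative_def]]
    show ?thesis by (simp add: field_simps)
  qed
  have d2: "((\<lambda>w. snd x + Ln (w$2 / z$2)) has_derivative (\<lambda>v. v$2 / z$2)) (at z)"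
  proof -
    have "((\<lambda>a. snd x + Ln (a / z$2)) has_field_derivative inverse (z$2)) (at (z$2))"
      using z0 by (auto intro!: derivative_eq_intros simp: field_simps)
    from has_derivative_compose[OF c this[unfolded has_field_derivative_def]]
    show ?thesis by (simp add: field_simps)
  qed
  have dl: "(l has_derivative (\<lambda>v. (v$1 / z$1, v$2 / z$2))) (at z)"
    unfolding l_def by (rule has_derivative_Pair[OF d1 d2])
  have key: thesis
    if D: "(u1 has_derivative (\<lambda>h. a * fst h + b * snd h)) (at x)" "norm a \<le> 1/32" "norm b \<le> 1/32"
      and D': "(u2 has_derivative (\<lambda>h. c * fst h + d * snd h)) (at x)" "norm c \<le> 1/32" "norm d \<le> 1/32" for a b c d
  proof -
    have e1: "((\<lambda>w. u1 (l w)) has_derivative (\<lambda>v. a * (v$1 / z$1) + b * (v$2 / z$2))) (at z)"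
      using has_derivative_compose[OF dl D(1)[folded lz]] by simp
    have e2: "((\<lambda>w. u2 (l w)) has_derivative (\<lambda>v. c * (v$1 / z$1) + d * (v$2 / z$2))) (at z)"
      using has_derivative_compose[OF dl D'(1)[folded lz]] by simp
    define E1 E2 where "E1 = exp (fst (l z) + u1 (l z))" and "E2 = exp (snd (l z) + u2 (l z))"
    have "((\<lambda>w. fst (l w) + u1 (l w)) has_derivative (\<lambda>v. v$1 / z$1 + (a * (v$1 / z$1) + b * (v$2 / z$2)))) (at z)"
      by (rule has_derivative_add[OF _ e1]) (simp add: l_def d1)
    from has_derivative_compose[OF this DERIV_exp[unfolded has_field_derivative_def]]
    have f1: "((\<lambda>w. exp (fst (l w) + u1 (l w))) has_derivative (\<lambda>v. E1 * (v$1 / z$1 + (a * (v$1 / z$1) + b * (v$2 / z$2))))) (at z)"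
      by (simp add: E1_def)
    have "((\<lambda>w. snd (l w) + u2 (l w)) has_derivative (\<lambda>v. v$2 / z$2 + (c * (v$1 / z$1) + d * (v$2 / z$2)))) (at z)"
      by (rule has_derivative_add[OF _ e2]) (simp add: l_def d2)
    from has_derivative_compose[OF this DERIV_exp[unfolded has_field_derivative_def]]
    have f2: "((\<lambda>w. exp (snd (l w) + u2 (l w))) has_derivative (\<lambda>v. E2 * (v$2 / z$2 + (c * (v$1 / z$1) + d * (v$2 / z$2))))) (at z)"
      by (simp add: E2_def)
    define A where "A = (vector [vec2 (E1 * (1 + a) / z$1) (E1 * b / z$2), vec2 (E2 * c / z$1) (E2 * (1 + d) / z$2)] :: complex^2^2)"
    have Av: "A *v v = vec2 (E1 * (v$1 / z$1 + (a * (v$1 / z$1) + b * (v$2 / z$2)))) (E2 * (v$2 / z$2 + (c * (v$1 / z$1) + d * (v$2 / z$2))))" for v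
      unfolding A_def matrix_vector_2 by (simp add: vec2_eq_iff algebra_simps add_divide_distrib)
    have h: "hmap w = vec2 (exp (fst (l w) + u1 (l w))) (exp (snd (l w) + u2 (l w)))" if w: "w \<in> annuli" for w
      using hmap_cexp2[OF lw(1)[OF w]] unfolding lw(2)[OF w] by (simp add: cexp2_def hl_def)
    show thesis
    proof (rule result)
      have "((\<lambda>w. vec2 (exp (fst (l w) + u1 (l w))) (exp (snd (l w) + u2 (l w)))) has_derivative (\<lambda>v. A *v v)) (at z)"
        unfolding Av by (rule has_derivative_vec2[OF f1 f2])
      then show "(hmap has_derivative (\<lambda>v. A *v v)) (at z)"
        by (rule has_derivative_transform_within_open[OF _ open_annuli z]) (simp add: h)
      fix v assume "A *v v = 0"
      define w1 w2 where "w1 = v$1 / z$1" and "w2 = v$2 / z$2"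
      have "w1 + (a * w1 + b * w2) = 0" "w2 + (c * w1 + d * w2) = 0"
        using \<open>A *v v = 0\<close> by (simp_all add: Av E1_def E2_def w1_def w2_def)
      \<comment> \<open>Diagonal dominance: both norms are at most 1/32 of their sum, so they
        vanish.\<close>
      then have "w1 = - (a * w1 + b * w2)" "w2 = - (c * w1 + d * w2)" by (simp_all only: eq_neg_iff_add_eq_0)
      then have "norm w1 = norm (a * w1 + b * w2)" "norm w2 = norm (c * w1 + d * w2)" by (metis norm_minus_cancel)+
      moreover have "norm (a * w1 + b * w2) \<le> 1/32 * norm w1 + 1/32 * norm w2"
        using norm_triangle_ineq[of "a * w1" "b * w2"] mult_right_mono[OF D(2) norm_ge_zero[of w1]] mult_right_mono[OF D(3) norm_ge_zero[of w2]]
        by (simp add: norm_mult)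
      moreover have "norm (c * w1 + d * w2) \<le> 1/32 * norm w1 + 1/32 * norm w2"
        using norm_triangle_ineq[of "c * w1" "d * w2"] mult_right_mono[OF D'(2) norm_ge_zero[of w1]] mult_right_mono[OF D'(3) norm_ge_zero[of w2]]
        by (simp add: norm_mult)
      moreover have "0 \<le> norm w1" "0 \<le> norm w2" by simp_all
      ultimately have "norm w1 = 0 \<and> norm w2 = 0" by linarith
      then show "v = 0" using z0 by (simp add: w1_def w2_def vec_eq_iff forall_2)
    qed
  qed
  show thesis
  proof (rule u_derivatives[OF fb(1)], rule u_derivatives[OF fb(2)])
    fix D1 D2 D1' D2'
    assume "\<And>x. x \<in> strip (1/4) \<Longrightarrow> (u1 has_derivative (\<lambda>h. D1 x * fst h + D2 x * snd h)) (at x)"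
      "\<And>x. x \<in> strip (1/4) \<Longrightarrow> norm (D1 x) \<le> 1/32" "\<And>x. x \<in> strip (1/4) \<Longrightarrow> norm (D2 x) \<le> 1/32"
      "\<And>x. x \<in> strip (1/4) \<Longrightarrow> (u2 has_derivative (\<lambda>h. D1' x * fst h + D2' x * snd h)) (at x)"
      "\<And>x. x \<in> strip (1/4) \<Longrightarrow> norm (D1' x) \<le> 1/32" "\<And>x. x \<in> strip (1/4) \<Longrightarrow> norm (D2' x) \<le> 1/32"
    note this[OF xs]
    then show thesis by (rule key)
  qed
qed

lemma continuous_on_hmap: "continuous_on annuli hmap"
proof (rule continuous_at_imp_continuous_on, rule ballI)
  fix z assume "z \<in> annuli"
  then obtain A :: "complex^2^2" where "(hmap has_derivative (\<lambda>v. A *v v)) (at z)" by (rule hmap_has_derivative)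
  then show "isCont hmap z" by (rule has_derivative_continuous)
qed

lemma open_hmap_image: "open U \<Longrightarrow> U \<subseteq> annuli \<Longrightarrow> open (hmap ` U)"
  by (rule invariance_of_domain) (auto intro: continuous_on_subset[OF continuous_on_hmap] inj_on_subset[OF inj_on_hmap])

lemma inv_hmap_has_derivative:
  assumes "w \<in> hmap ` annuli"
  obtains B :: "complex^2^2" where "(inv_into annuli hmap has_derivative (\<lambda>v. B *v v)) (at w)"
proof -
  obtain z where z: "z \<in> annuli" "w = hmap z" using assms by blast
  show ?thesis
  proof (rule hmap_has_derivative[OF z(1)])
    fix A :: "complex^2^2"
    assume A: "(hmap has_derivative (\<lambda>v. A *v v)) (at z)" "\<And>v. A *v v = 0 \<Longrightarrow> v = 0"
    show ?thesis
      by (rule inv_into_has_derivative[OF open_annuli z(1) continuous_on_hmap inj_on_hmap A]) (use that z(2) in blast)+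
  qed
qed

lemma Re_u_imaginary:
  assumes "fst x = \<i> * of_real s1" "snd x = \<i> * of_real s2"
  shows "Re (u1 x) = 0" "Re (u2 x) = 0"
proof -
  have "refl x = x" using assms by (simp add: refl_def prod_eq_iff)
  moreover have "x \<in> strip (1/2)" using assms by (simp add: strip_def)
  ultimately have "u1 x = - cnj (u1 x)" "u2 x = - cnj (u2 x)" using odd unfolding odd_sym_def by metis+
  then show "Re (u1 x) = 0" "Re (u2 x) = 0" by (simp_all add: complex_eq_iff)
qed

text \<open>On imaginary arguments the displacement is imaginary with Lipschitz constant at most
  1/8. Prescribing the arguments of the image is therefore a fixed point problem for a contraction
  \<open>T\<close> of the real plane.\<close>

lemma hmap_covers_unit_torus:
  assumes "norm a = 1" "norm b = 1"
  shows "vec2 a b \<in> hmap ` annuli"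
proof -
  define J where "J s = (\<i> * of_real (fst s), \<i> * of_real (snd s))" for s :: "real \<times> real"
  define T where "T s = (Arg a - Im (u1 (J s)), Arg b - Im (u2 (J s)))" for s
  have Js: "J s \<in> strip (1/4)" for s by (simp add: J_def strip_def)
  have Jd: "norm (J s - J s') = norm (s - s')" for s s'
    by (simp add: J_def norm_prod_def norm_mult flip: right_diff_distrib of_real_diff)
  have "dist (T s) (T s') \<le> 1/8 * dist s s'" for s s'
  proof -
    have "dist (T s) (T s') \<le> norm (Im (u1 (J s') - u1 (J s))) + norm (Im (u2 (J s') - u2 (J s)))"
      using norm_Pair_le[of "fst (T s - T s')" "snd (T s - T s')"] by (simp add: T_def dist_norm)
    also have "\<dots> \<le> norm (u1 (J s') - u1 (J s)) + norm (u2 (J s') - u2 (J s))"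
      using abs_Im_le_cmod by (intro add_mono) (simp_all del: minus_complex.simps)
    also have "\<dots> \<le> 1/16 * norm (s - s') + 1/16 * norm (s - s')"
      using u_lipschitz[OF fb(1) Js Js, of s' s] u_lipschitz[OF fb(2) Js Js, of s' s] unfolding Jd
      by (simp add: norm_minus_commute)
    finally show ?thesis by (simp add: dist_norm)
  qed
  then obtain s where s: "T s = s" using banach_fix_type[of "1/8" T] by auto
  have "fst s + Im (u1 (J s)) = Arg a" "snd s + Im (u2 (J s)) = Arg b"
    using arg_cong[OF s, of fst] arg_cong[OF s, of snd] by (simp_all add: T_def)
  moreover have "Re (u1 (J s)) = 0" "Re (u2 (J s)) = 0" by (rule Re_u_imaginary; simp add: J_def)+
  ultimately have "hl (J s) = (\<i> * of_real (Arg a), \<i> * of_real (Arg b))"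
    by (simp add: hl_def J_def complex_eq_iff)
  then have "cexp2 (hl (J s)) = vec2 (cis (Arg a)) (cis (Arg b))" by (simp add: cexp2_def cis_conv_exp)
  also have "\<dots> = vec2 a b"
  proof -
    have "a \<noteq> 0" "b \<noteq> 0" using assms by auto
    then show ?thesis using assms by (simp add: cis_Arg sgn_div_norm)
  qed
  finally have "hmap (cexp2 (J s)) = vec2 a b" unfolding hmap_cexp2[OF Js] .
  moreover have "cexp2 (J s) \<in> annuli" by (simp add: cexp2_in_annuli_iff Js)
  ultimately show ?thesis by (metis imageI)
qed

end

section \<open>Charts of the surface in the circle coordinates\<close>

text \<open>The Moebius transition from the circle coordinate to the affine coordinate of
  \<open>affine_P1 s\<close>; \<open>unchart s\<close> is its inverse. The poles are named so that
  they can be excluded, since division by zero has a value.\<close>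

definition chart :: "bool \<Rightarrow> complex \<Rightarrow> complex" where
  "chart s a = (if s then \<i> * (1 + a) / (1 - a) else (1 - a) / (\<i> * (1 + a)))"

definition unchart :: "bool \<Rightarrow> complex \<Rightarrow> complex" where
  "unchart s t = (if s then (t - \<i>) / (t + \<i>) else (1 - \<i> * t) / (1 + \<i> * t))"

definition chart_pole :: "bool \<Rightarrow> complex" where
  "chart_pole s = (if s then 1 else -1)"

definition unchart_pole :: "bool \<Rightarrow> complex" where
  "unchart_pole s = (if s then - \<i> else \<i>)"

lemma apt_eq_proj: "apt a = proj (vec2 (\<i> * (1 + a)) (1 - a))"
  by (simp add: apt_def pt_def ucay_def add.commute)

lemma affine_P1_chart:
  assumes "a \<noteq> chart_pole s"
  shows "affine_P1 s (chart s a) = apt a"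
proof (cases s)
  case True
  define c where "c = 1 - a"
  have c: "c \<noteq> 0" using True assms by (auto simp: chart_pole_def c_def)
  then have "vec2 (\<i> * (1 + a)) c = c *s vec2 (\<i> * (1 + a) / c) 1" by (simp add: vec2_eq_iff)
  then show ?thesis using True c by (simp add: affine_P1_def apt_eq_proj proj_scale chart_def flip: c_def)
next
  case False
  define c where "c = \<i> * (1 + a)"
  have c: "c \<noteq> 0" using False assms by (auto simp: chart_pole_def c_def add_eq_0_iff)
  then have "vec2 c (1 - a) = c *s vec2 1 ((1 - a) / c)" by (simp add: vec2_eq_iff)
  then show ?thesis using False c by (simp add: affine_P1_def apt_eq_proj proj_scale chart_def flip: c_def)
qed

lemma affine_P1_inject: "affine_P1 s t = affine_P1 s t' \<longleftrightarrow> t = t'"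
proof
  assume *: "affine_P1 s t = affine_P1 s t'"
  show "t = t'"
  proof (cases s)
    case True
    then have "proj (vec2 t 1) = proj (vec2 t' 1)" using * by (simp add: affine_P1_def)
    then show ?thesis by (subst (asm) proj_eq_iff) (auto simp: vec2_eq_iff)
  next
    case False
    then have "proj (vec2 1 t) = proj (vec2 1 t')" using * by (simp add: affine_P1_def)
    then show ?thesis by (subst (asm) proj_eq_iff) (auto simp: vec2_eq_iff)
  qed
qed simp

lemma unchart_chart: "t \<noteq> unchart_pole s \<Longrightarrow> unchart s t \<noteq> chart_pole s \<and> chart s (unchart s t) = t"
proof (cases s)
  case True
  assume "t \<noteq> unchart_pole s"
  then have t: "t + \<i> \<noteq> 0" using True by (auto simp: unchart_pole_def eq_neg_iff_add_eq_0)
  have e: "unchart s t * (t + \<i>) = t - \<i>" using t True by (simp add: unchart_def)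
  have "(1 + unchart s t) * (t + \<i>) = 2 * t" "(1 - unchart s t) * (t + \<i>) = 2 * \<i>"
    unfolding distrib_right left_diff_distrib e by simp_all
  then have "(1 - unchart s t) \<noteq> 0" "(1 + unchart s t) * \<i> = t * (1 - unchart s t)"
    using t by (auto, algebra)
  then show ?thesis using True by (auto simp: chart_def chart_pole_def field_simps)
next
  case False
  assume "t \<noteq> unchart_pole s"
  then have t: "1 + \<i> * t \<noteq> 0" using False by (auto simp: unchart_pole_def complex_eq_iff)
  have e: "unchart s t * (1 + \<i> * t) = 1 - \<i> * t" using t False by (simp add: unchart_def)
  define U W where "U = 1 + unchart s t" and "W = 1 - unchart s t"
  have UW: "U * (1 + \<i> * t) = 2" "W * (1 + \<i> * t) = 2 * (\<i> * t)"
    unfolding U_def W_def distrib_right left_diff_distrib e by simp_all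
  have U0: "U \<noteq> 0" using UW by auto
  have "(t * (\<i> * U)) * (1 + \<i> * t) = t * \<i> * (U * (1 + \<i> * t))" by (simp only: mult_ac)
  also have "\<dots> = W * (1 + \<i> * t)" unfolding UW by simp
  finally have "W = t * (\<i> * U)" using t by simp
  then have "W / (\<i> * U) = t" using U0 by simp
  then show ?thesis using False U0 by (auto simp: chart_def chart_pole_def U_def W_def)
qed

lemma chart_not_pole: "a \<noteq> chart_pole s \<Longrightarrow> chart s a \<noteq> unchart_pole s \<and> unchart s (chart s a) = a"
proof (cases s)
  case True
  assume "a \<noteq> chart_pole s"
  then have a: "1 - a \<noteq> 0" using True by (auto simp: chart_pole_def)
  have e: "chart s a * (1 - a) = \<i> * (1 + a)" using a True by (simp add: chart_def)
  have f: "(chart s a + \<i>) * (1 - a) = 2 * \<i>" "(chart s a - \<i>) * (1 - a) = 2 * \<i> * a"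
    unfolding distrib_right left_diff_distrib e by (simp_all add: algebra_simps)
  then have n: "chart s a + \<i> \<noteq> 0" by auto
  have "(chart s a - \<i>) = a * (chart s a + \<i>)" using f a by algebra
  then show ?thesis using True n by (auto simp: unchart_def unchart_pole_def)
next
  case False
  assume "a \<noteq> chart_pole s"
  then have a: "1 + a \<noteq> 0" using False by (auto simp: chart_pole_def add_eq_0_iff)
  have e: "\<i> * chart s a * (1 + a) = 1 - a" using a False by (simp add: chart_def)
  have f: "(1 + \<i> * chart s a) * (1 + a) = 2" "(1 - \<i> * chart s a) * (1 + a) = 2 * a"
    unfolding distrib_right left_diff_distrib e by simp_all
  then have n: "1 + \<i> * chart s a \<noteq> 0" by auto
  have "(1 - \<i> * chart s a) * (1 + a) = a * (1 + \<i> * chart s a) * (1 + a)" unfolding mult.assoc[of a] f by simp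
  then have "(1 - \<i> * chart s a) = a * (1 + \<i> * chart s a)" using a by (metis mult_right_cancel)
  then show ?thesis using False n by (auto simp: unchart_def unchart_pole_def)
qed

lemma affine_P1_eq_apt_iff: "affine_P1 s t = apt a \<longleftrightarrow> t \<noteq> unchart_pole s \<and> a = unchart s t"
proof
  assume *: "affine_P1 s t = apt a"
  have "a \<noteq> chart_pole s"
  proof
    assume "a = chart_pole s"
    then show False using *
      by (cases s) (auto simp: chart_pole_def affine_P1_def apt_eq_proj proj_eq_iff vec2_eq_iff)
  qed
  then have "t = chart s a" using * affine_P1_chart affine_P1_inject by metis
  then show "t \<noteq> unchart_pole s \<and> a = unchart s t" using chart_not_pole[OF \<open>a \<noteq> chart_pole s\<close>] by simp
next
  assume "t \<noteq> unchart_pole s \<and> a = unchart s t"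
  then show "affine_P1 s t = apt a" using affine_P1_chart[of a s] unchart_chart by metis
qed

lemma apt_in_range_affine_P1_iff: "apt a \<in> range (affine_P1 s) \<longleftrightarrow> a \<noteq> chart_pole s"
proof
  assume "apt a \<in> range (affine_P1 s)"
  then obtain t where "affine_P1 s t = apt a" by auto
  then have "t \<noteq> unchart_pole s" "a = unchart s t" using affine_P1_eq_apt_iff[of s t a] by simp_all
  then show "a \<noteq> chart_pole s" using unchart_chart[of t s] by simp
next
  assume "a \<noteq> chart_pole s"
  then show "apt a \<in> range (affine_P1 s)" by (intro range_eqI[where x = "chart s a"]) (simp add: affine_P1_chart)
qed

lemma chart_has_derivative:
  assumes "a \<noteq> chart_pole s"
  obtains d where "(chart s has_field_derivative d) (at a)"
proof (cases s)
  case True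
  then have a: "1 - a \<noteq> 0" and f: "chart s = (\<lambda>a. \<i> * (1 + a) / (1 - a))" using assms by (auto simp: chart_pole_def chart_def)
  have "(\<lambda>a. \<i> * (1 + a) / (1 - a)) field_differentiable (at a)"
    using a by (intro derivative_intros) auto
  then show ?thesis using that unfolding f field_differentiable_def by blast
next
  case False
  then have a: "\<i> * (1 + a) \<noteq> 0" and f: "chart s = (\<lambda>a. (1 - a) / (\<i> * (1 + a)))" using assms by (auto simp: chart_pole_def chart_def add_eq_0_iff)
  have "(\<lambda>a. (1 - a) / (\<i> * (1 + a))) field_differentiable (at a)"
    using a by (intro derivative_intros) auto
  then show ?thesis using that unfolding f field_differentiable_def by blast
qed

lemma unchart_has_derivative:
  assumes "t \<noteq> unchart_pole s"
  obtains d where "(unchart s has_field_derivative d) (at t)"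
proof (cases s)
  case True
  then have a: "t + \<i> \<noteq> 0" and f: "unchart s = (\<lambda>t. (t - \<i>) / (t + \<i>))" using assms by (auto simp: unchart_pole_def unchart_def eq_neg_iff_add_eq_0)
  have "(\<lambda>t. (t - \<i>) / (t + \<i>)) field_differentiable (at t)"
    using a by (intro derivative_intros) auto
  then show ?thesis using that unfolding f field_differentiable_def by blast
next
  case False
  then have a: "1 + \<i> * t \<noteq> 0" and f: "unchart s = (\<lambda>t. (1 - \<i> * t) / (1 + \<i> * t))" using assms by (auto simp: unchart_pole_def unchart_def complex_eq_iff)
  have "(\<lambda>t. (1 - \<i> * t) / (1 + \<i> * t)) field_differentiable (at t)"
    using a by (intro derivative_intros) auto
  then show ?thesis using that unfolding f field_differentiable_def by blast
qed

lemma continuous_on_affine_X: "continuous_on UNIV (affine_X s s')"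
proof -
  have "continuous_on UNIV (\<lambda>z :: complex^2. affine_P1 b (z$i))" for b i
    unfolding affine_P1_def
    by (cases b; simp; rule continuous_on_compose2[OF continuous_on_proj])
       (auto intro!: continuous_on_vec2 continuous_intros)
  then show ?thesis unfolding affine_X_def by (intro continuous_on_Pair)
qed

lemma affine_X_inject: "affine_X s s' z = affine_X s s' w \<longleftrightarrow> z = w"
  by (auto simp: affine_X_def affine_P1_inject vec2_eq_iff)

definition apt2 :: "complex^2 \<Rightarrow> X" where
  "apt2 z = (apt (z$1), apt (z$2))"

lemma apt2_inject [simp]: "apt2 z = apt2 w \<longleftrightarrow> z = w"
  by (simp add: apt2_def vec2_eq_iff)

lemma continuous_on_apt2: "continuous_on S f \<Longrightarrow> continuous_on S (\<lambda>x. apt2 (f x))"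
  unfolding apt2_def by (intro continuous_on_Pair continuous_on_apt continuous_on_component)

text \<open>The image equals that of an open cone of homogeneous vectors under the open map
  \<open>proj\<close>.\<close>

lemma open_apt_image:
  assumes "open A"
  shows "open (apt ` A)"
proof -
  define V where "V = {x. cay x $ 2 \<noteq> 0}"
  have V: "open V" unfolding V_def cay_def by (simp, intro open_Collect_neq continuous_intros)
  have "continuous_on V (\<lambda>x. cay x $ 1 / cay x $ 2)"
    unfolding V_def cay_def by (auto intro!: continuous_intros)
  then have "open ((\<lambda>x. cay x $ 1 / cay x $ 2) -` A \<inter> V)"
    using V assms by (simp add: continuous_on_open_vimage)
  moreover have "0 \<notin> (\<lambda>x. cay x $ 1 / cay x $ 2) -` A \<inter> V" by (simp add: V_def cay_def)
  ultimately have "open (proj ` ((\<lambda>x. cay x $ 1 / cay x $ 2) -` A \<inter> V))" by (rule open_proj_image)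
  also have "proj ` ((\<lambda>x. cay x $ 1 / cay x $ 2) -` A \<inter> V) = apt ` A"
  proof (intro equalityI subsetI)
    fix r assume "r \<in> proj ` ((\<lambda>x. cay x $ 1 / cay x $ 2) -` A \<inter> V)"
    then obtain x where x: "r = proj x" "cay x $ 1 / cay x $ 2 \<in> A" "cay x $ 2 \<noteq> 0" by (auto simp: V_def)
    then have "x \<noteq> 0" by (auto simp: cay_def)
    have "cay x = (cay x $ 2) *s vec2 (cay x $ 1 / cay x $ 2) 1" using x(3) by (simp add: vec2_eq_iff)
    then have "pt (cay x) = apt (cay x $ 1 / cay x $ 2)" using x(3) unfolding apt_def by (metis pt_scale vec2_eq_0_iff zero_neq_one)
    then show "r \<in> apt ` A" using x proj_eq_pt[OF \<open>x \<noteq> 0\<close>] by auto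
  next
    fix r assume "r \<in> apt ` A"
    then obtain a where a: "a \<in> A" "r = proj (ucay (vec2 a 1))" by (auto simp: apt_def pt_def)
    have "ucay (vec2 a 1) \<in> (\<lambda>x. cay x $ 1 / cay x $ 2) -` A \<inter> V" using a(1) by (simp add: V_def cay_ucay)
    then show "r \<in> proj ` ((\<lambda>x. cay x $ 1 / cay x $ 2) -` A \<inter> V)" using a(2) by blast
  qed
  finally show ?thesis .
qed

lemma open_apt2_image:
  assumes "open W"
  shows "open (apt2 ` W)"
  unfolding open_prod_def
proof (intro ballI)
  fix r assume "r \<in> apt2 ` W"
  then obtain z where z: "z \<in> W" "r = apt2 z" by blast
  have "continuous_on UNIV (\<lambda>p :: complex \<times> complex. vec2 (fst p) (snd p))"
    by (intro continuous_on_vec2 continuous_intros)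
  then have "open ((\<lambda>p. vec2 (fst p) (snd p)) -` W)" using assms by (simp add: continuous_on_open_vimage[OF open_UNIV])
  moreover have "(z$1, z$2) \<in> (\<lambda>p. vec2 (fst p) (snd p)) -` W" using z by simp
  ultimately obtain S T where ST: "open S" "open T" "(z$1, z$2) \<in> S \<times> T" "S \<times> T \<subseteq> (\<lambda>p. vec2 (fst p) (snd p)) -` W"
    by (rule open_prod_elim)
  have "apt ` S \<times> apt ` T \<subseteq> apt2 ` W"
  proof
    fix r assume "r \<in> apt ` S \<times> apt ` T"
    then obtain a b where ab: "a \<in> S" "b \<in> T" "r = (apt a, apt b)" by auto
    then have "vec2 a b \<in> W" using ST(4) by auto
    moreover have "r = apt2 (vec2 a b)" using ab by (simp add: apt2_def)
    ultimately show "r \<in> apt2 ` W" by blast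
  qed
  moreover have "r \<in> apt ` S \<times> apt ` T" using ST(3) z(2) by (auto simp: apt2_def)
  ultimately show "\<exists>A B. open A \<and> open B \<and> r \<in> A \<times> B \<and> A \<times> B \<subseteq> apt2 ` W"
    using open_apt_image[OF ST(1)] open_apt_image[OF ST(2)] by blast
qed

subsection \<open>Biholomorphism onto the image\<close>

context near_identity
begin

definition psi :: "complex^2 \<Rightarrow> X" where
  "psi z = apt2 (hmap z)"

lemma inj_on_psi: "inj_on psi annuli"
  using inj_on_hmap by (auto simp: psi_def inj_on_def)

lemma continuous_on_psi: "continuous_on annuli psi"
  unfolding psi_def by (rule continuous_on_apt2[OF continuous_on_hmap])

lemma open_psi_image: "open U \<Longrightarrow> U \<subseteq> annuli \<Longrightarrow> open (psi ` U)"
  unfolding psi_def image_image[symmetric, of apt2 hmap] by (intro open_apt2_image open_hmap_image)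

lemma inv_psi_affine:
  assumes "affine_X s s' w \<in> psi ` annuli"
  shows "w$1 \<noteq> unchart_pole s" "w$2 \<noteq> unchart_pole s'" "vec2 (unchart s (w$1)) (unchart s' (w$2)) \<in> hmap ` annuli"
    "inv_into annuli psi (affine_X s s' w) = inv_into annuli hmap (vec2 (unchart s (w$1)) (unchart s' (w$2)))"
proof -
  obtain z where z: "z \<in> annuli" "affine_X s s' w = psi z" using assms by blast
  then have *: "affine_P1 s (w$1) = apt (hmap z $ 1)" "affine_P1 s' (w$2) = apt (hmap z $ 2)"
    by (simp_all add: psi_def apt2_def affine_X_def)
  then have h: "w$1 \<noteq> unchart_pole s" "w$2 \<noteq> unchart_pole s'" "hmap z = vec2 (unchart s (w$1)) (unchart s' (w$2))"
    by (simp_all add: affine_P1_eq_apt_iff vec2_eq_iff)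
  then show "w$1 \<noteq> unchart_pole s" "w$2 \<noteq> unchart_pole s'" "vec2 (unchart s (w$1)) (unchart s' (w$2)) \<in> hmap ` annuli"
    using z(1) by (auto intro: image_eqI[OF sym])
  show "inv_into annuli psi (affine_X s s' w) = inv_into annuli hmap (vec2 (unchart s (w$1)) (unchart s' (w$2)))"
    unfolding z(2) h(3)[symmetric] using z(1) inj_on_psi inj_on_hmap by simp
qed

lemma psi_in_chart:
  "psi z \<in> range (affine_X s s') \<longleftrightarrow> hmap z $ 1 \<noteq> chart_pole s \<and> hmap z $ 2 \<noteq> chart_pole s'"
proof -
  have "psi z \<in> range (affine_X s s') \<longleftrightarrow> apt (hmap z $ 1) \<in> range (affine_P1 s) \<and> apt (hmap z $ 2) \<in> range (affine_P1 s')"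
  proof
    assume "psi z \<in> range (affine_X s s')"
    then obtain t where "psi z = affine_X s s' t" by blast
    then show "apt (hmap z $ 1) \<in> range (affine_P1 s) \<and> apt (hmap z $ 2) \<in> range (affine_P1 s')"
      by (simp add: psi_def apt2_def affine_X_def)
  next
    assume "apt (hmap z $ 1) \<in> range (affine_P1 s) \<and> apt (hmap z $ 2) \<in> range (affine_P1 s')"
    then obtain a b where "apt (hmap z $ 1) = affine_P1 s a" "apt (hmap z $ 2) = affine_P1 s' b" by blast
    then have "psi z = affine_X s s' (vec2 a b)" by (simp add: psi_def apt2_def affine_X_def)
    then show "psi z \<in> range (affine_X s s')" by blast
  qed
  then show ?thesis by (simp add: apt_in_range_affine_P1_iff)
qed

lemma holomorphic_chart_psi:
  "holomorphic_C2 (inv (affine_X s s') \<circ> psi) (annuli \<inter> psi -` range (affine_X s s'))"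
  unfolding holomorphic_C2_def
proof
  define S where "S = annuli \<inter> psi -` range (affine_X s s')"
  define V where "V = {w :: complex^2. w$1 \<noteq> chart_pole s \<and> w$2 \<noteq> chart_pole s'}"
  have SV: "S = annuli \<inter> hmap -` V" unfolding S_def V_def by (intro set_eqI) (simp only: Int_iff vimage_eq mem_Collect_eq psi_in_chart)
  have "open V" unfolding V_def Collect_conj_eq by (intro open_Int open_Collect_neq continuous_intros)
  then have S: "open S" unfolding SV by (rule continuous_open_preimage[OF continuous_on_hmap open_annuli])
  fix z assume z: "z \<in> annuli \<inter> psi -` range (affine_X s s')"
  then have zS: "z \<in> S" "z \<in> annuli" and ok: "hmap z $ 1 \<noteq> chart_pole s" "hmap z $ 2 \<noteq> chart_pole s'"
    unfolding S_def using z by (simp_all only: Int_iff vimage_eq psi_in_chart simp_thms)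
  obtain d1 d2 where d: "(chart s has_field_derivative d1) (at (hmap z $ 1))" "(chart s' has_field_derivative d2) (at (hmap z $ 2))"
    using chart_has_derivative[OF ok(1)] chart_has_derivative[OF ok(2)] by metis
  obtain A :: "complex^2^2" where A: "(hmap has_derivative (\<lambda>v. A *v v)) (at z)" by (rule hmap_has_derivative[OF zS(2)])
  note has_derivative_matrix_compose[OF A has_derivative_diagonal[OF d]]
  then have "((inv (affine_X s s') \<circ> psi) has_derivative (\<lambda>v. ((vector [vec2 d1 0, vec2 0 d2] :: complex^2^2) ** A) *v v)) (at z)"
  proof (rule has_derivative_transform_within_open[OF _ S zS(1)])
    fix w assume "w \<in> S"
    then have "hmap w $ 1 \<noteq> chart_pole s" "hmap w $ 2 \<noteq> chart_pole s'"
      unfolding S_def by (simp_all only: Int_iff vimage_eq psi_in_chart simp_thms)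
    then have "affine_X s s' (vec2 (chart s (hmap w $ 1)) (chart s' (hmap w $ 2))) = psi w"
      by (simp add: affine_X_def psi_def apt2_def affine_P1_chart)
    moreover have "inj (affine_X s s')" using affine_X_inject by (auto intro!: injI)
    ultimately show "vec2 (chart s (hmap w $ 1)) (chart s' (hmap w $ 2)) = (inv (affine_X s s') \<circ> psi) w"
      by (metis comp_apply inv_f_f)
  qed
  then show "\<exists>A :: complex^2^2. ((inv (affine_X s s') \<circ> psi) has_derivative (\<lambda>v. A *v v)) (at z)" by blast
qed

lemma holomorphic_inv_psi_affine:
  "holomorphic_C2 (inv_into annuli psi \<circ> affine_X s s') (affine_X s s' -` (psi ` annuli))"
  unfolding holomorphic_C2_def
proof
  define S where "S = affine_X s s' -` (psi ` annuli)"
  have S: "open S" unfolding S_def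
    using continuous_on_affine_X open_psi_image[OF open_annuli order_refl] by (simp add: continuous_on_open_vimage)
  fix w assume w: "w \<in> affine_X s s' -` (psi ` annuli)"
  then have ws: "affine_X s s' w \<in> psi ` annuli" "w \<in> S" by (simp_all add: S_def)
  note i = inv_psi_affine[OF ws(1)]
  obtain d1 d2 where d: "(unchart s has_field_derivative d1) (at (w$1))" "(unchart s' has_field_derivative d2) (at (w$2))"
    using unchart_has_derivative[OF i(1)] unchart_has_derivative[OF i(2)] by metis
  obtain B :: "complex^2^2" where B: "(inv_into annuli hmap has_derivative (\<lambda>v. B *v v)) (at (vec2 (unchart s (w$1)) (unchart s' (w$2))))"
    by (rule inv_hmap_has_derivative[OF i(3)])
  note has_derivative_matrix_compose[OF has_derivative_diagonal[OF d] B]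
  then have "((inv_into annuli psi \<circ> affine_X s s') has_derivative (\<lambda>v. (B ** (vector [vec2 d1 0, vec2 0 d2] :: complex^2^2)) *v v)) (at w)"
    by (rule has_derivative_transform_within_open[OF _ S ws(2)]) (simp add: S_def inv_psi_affine)
  then show "\<exists>A :: complex^2^2. ((inv_into annuli psi \<circ> affine_X s s') has_derivative (\<lambda>v. A *v v)) (at w)" by blast
qed

lemma biholomorphism_psi: "biholomorphism psi annuli (psi ` annuli)"
  unfolding biholomorphism_def
  using open_annuli open_psi_image[OF open_annuli order_refl] inj_on_psi continuous_on_psi holomorphic_chart_psi holomorphic_inv_psi_affine
  by (simp add: bij_betw_def)

lemma X_real_subset_psi_image: "X_real \<subseteq> psi ` annuli"
proof
  fix r assume "r \<in> X_real"
  then obtain r1 r2 where r: "r = (r1, r2)" "r1 \<in> P1_real" "r2 \<in> P1_real" by (auto simp: X_real_def)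
  obtain a where a: "norm a = 1" "r1 = pt (vec2 a 1)" by (rule P1_real_cases[OF r(2)])
  obtain b where b: "norm b = 1" "r2 = pt (vec2 b 1)" by (rule P1_real_cases[OF r(3)])
  obtain z where "z \<in> annuli" "hmap z = vec2 a b" using hmap_covers_unit_torus[OF a(1) b(1)] by (metis imageE)
  then have "r = psi z" using r a b by (simp add: psi_def apt2_def apt_def)
  then show "r \<in> psi ` annuli" using \<open>z \<in> annuli\<close> by blast
qed

lemma continuous_on_inv_psi: "continuous_on (psi ` annuli) (inv_into annuli psi)"
proof (rule continuous_on_inverse_open_map[OF continuous_on_psi refl])
  show "inv_into annuli psi (psi x) = x" if "x \<in> annuli" for x using that inj_on_psi by simp
  fix U assume "openin (top_of_set annuli) U"
  then have "open U" "U \<subseteq> annuli" unfolding openin_open_eq[OF open_annuli] by blast+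
  then have "open (psi ` U)" "psi ` U \<subseteq> psi ` annuli" using open_psi_image by blast+
  then show "openin (top_of_set (psi ` annuli)) (psi ` U)"
    unfolding openin_open_eq[OF open_psi_image[OF open_annuli order_refl]] by blast
qed

end

section \<open>Rotations\<close>

definition cmul2 :: "complex^2 \<Rightarrow> complex^2 \<Rightarrow> complex^2" where
  "cmul2 l z = vec2 (l$1 * z$1) (l$2 * z$2)"

definition cis2 :: "real^2 \<Rightarrow> complex^2" where
  "cis2 \<alpha> = vec2 (cis (\<alpha>$1)) (cis (\<alpha>$2))"

text \<open>The angles of the iterates are unbounded, but their multipliers stay in this compact
  set, from which convergent subsequences are drawn.\<close>

definition unit_torus :: "(complex^2) set" where
  "unit_torus = {l. norm (l$1) = 1 \<and> norm (l$2) = 1}"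

lemma rotation_cmul2: "rotation \<alpha> z = cmul2 (cis2 \<alpha>) z"
  by (simp add: rotation_def cmul2_def cis2_def vec2_eq_iff)

lemma rotation_add: "rotation \<alpha> (rotation \<beta> z) = rotation (\<alpha> + \<beta>) z"
  by (simp add: rotation_def vec2_eq_iff mult.assoc flip: cis_mult)

lemma rotation_0 [simp]: "rotation 0 z = z"
  by (simp add: rotation_def vec2_eq_iff)

lemma cmul2_annuli: "l \<in> unit_torus \<Longrightarrow> z \<in> annuli \<Longrightarrow> cmul2 l z \<in> annuli"
  by (simp add: cmul2_def annuli_def unit_torus_def norm_mult)

lemma cis2_in_unit_torus: "cis2 \<alpha> \<in> unit_torus"
  by (simp add: cis2_def unit_torus_def)

lemma rotation_annuli: "z \<in> annuli \<Longrightarrow> rotation \<alpha> z \<in> annuli"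
  unfolding rotation_cmul2 by (rule cmul2_annuli[OF cis2_in_unit_torus])

lemma rotation_cexp2: "rotation \<alpha> (cexp2 x) = cexp2 (x + (\<i> * of_real (\<alpha>$1), \<i> * of_real (\<alpha>$2)))"
  by (simp add: rotation_def cexp2_def vec2_eq_iff cis_conv_exp exp_add mult.commute)

lemma circular_domain_annuli: "circular_domain annuli"
proof -
  have "vec2 1 1 \<in> annuli" by (simp add: annuli_def)
  then show ?thesis
    unfolding circular_domain_def using open_annuli connected_annuli rotation_annuli by blast
qed

lemma compact_unit_torus: "compact unit_torus"
proof -
  have "closed unit_torus" unfolding unit_torus_def Collect_conj_eq
    by (intro closed_Int closed_Collect_eq continuous_intros)
  moreover have "bounded unit_torus"
  proof (rule boundedI)
    fix l assume "l \<in> unit_torus"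
    then have "(norm l)\<^sup>2 \<le> 2\<^sup>2" by (simp add: norm_sq_C2 unit_torus_def)
    then show "norm l \<le> 2" by (rule power2_le_imp_le) simp
  qed
  ultimately show ?thesis by (simp add: compact_eq_bounded_closed)
qed

lemma ppow_semiconj:
  assumes "\<And>z. z \<in> annuli \<Longrightarrow> F (\<psi> z) = Some (\<psi> (rotation \<beta> z))" "z \<in> annuli"
  shows "ppow F n (\<psi> z) = Some (\<psi> (rotation (of_nat n *\<^sub>R \<beta>) z))"
  using assms(2)
proof (induction n)
  case (Suc n)
  then have "ppow F (Suc n) (\<psi> z) = F (\<psi> (rotation (of_nat n *\<^sub>R \<beta>) z))" by simp
  also have "\<dots> = Some (\<psi> (rotation \<beta> (rotation (of_nat n *\<^sub>R \<beta>) z)))"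
    using Suc rotation_annuli by (intro assms(1))
  finally show ?case by (simp add: rotation_add scaleR_left_distrib)
qed simp

text \<open>The multipliers of the map are the prescribed rotation factors corrected by
  \<open>exp c1\<close> and \<open>exp c2\<close>, of modulus 1 because these constants are
  imaginary.\<close>

locale conjugated_torus_map = near_identity +
  fixes p :: real and c1 c2 :: complex and \<alpha> :: "real^2"
  assumes small: "small_param p" and c: "Re c1 = 0" "Re c2 = 0"
    and res: "\<And>x. x \<in> strip (1/2) \<Longrightarrow> res1 p (\<i> * of_real (\<alpha>$1), \<i> * of_real (\<alpha>$2)) u1 u2 c1 x = 0"
      "\<And>x. x \<in> strip (1/2) \<Longrightarrow> res2 p (\<i> * of_real (\<alpha>$1), \<i> * of_real (\<alpha>$2)) u1 u2 c2 x = 0"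
begin

abbreviation "f \<equiv> fmap p (p ^ 4) (exp (\<i> * of_real (\<alpha>$1) + c1)) (exp (\<i> * of_real (\<alpha>$2) + c2))"
abbreviation "g \<equiv> gmap p (p ^ 4) (exp (\<i> * of_real (\<alpha>$1) + c1)) (exp (\<i> * of_real (\<alpha>$2) + c2))"

sublocale torus_map p "p ^ 4" "exp (\<i> * of_real (\<alpha>$1) + c1)" "exp (\<i> * of_real (\<alpha>$2) + c2)"
proof
  have "0 < p" "p < 1" using small_param_less[OF small] by auto
  then show "0 < p ^ 4" "p ^ 4 < p ^ 3" "0 < p" "p < 1" by (simp_all add: power_strict_decreasing)
qed (simp_all add: c)

text \<open>The exponential of the vanishing residuals, \<open>res2\<close> giving the new second
  coordinate and \<open>res1\<close> then the new first one. All arguments of \<open>slog\<close>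
  have real part at most 1/4 + 1/128, within reach of \<open>exp_slog\<close>.\<close>

lemma psi_step:
  assumes z: "z \<in> annuli"
  shows "f (psi z) = Some (psi (rotation \<alpha> z))" "g (psi (rotation \<alpha> z)) = Some (psi z)"
proof -
  define x where "x = cln2 z"
  have x: "x \<in> strip (1/4)" "cexp2 x = z" unfolding x_def using cln2_in_strip cexp2_cln2 z by blast+
  define t where "t = (\<i> * complex_of_real (\<alpha>$1), \<i> * complex_of_real (\<alpha>$2))"
  define y where "y = x + t"
  have y: "y \<in> strip (1/4)" using x(1) by (simp add: y_def t_def strip_def)
  define a b a' b' where "a = exp (fst x + u1 x)" and "b = exp (snd x + u2 x)"
    and "a' = exp (fst y + u1 y)" and "b' = exp (snd y + u2 y)"
  have pz: "psi z = (pt (vec2 a 1), pt (vec2 b 1))"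
    using hmap_cexp2[OF x(1), unfolded x(2)] by (simp add: psi_def apt2_def apt_def hl_def cexp2_def a_def b_def)
  have pr: "psi (rotation \<alpha> z) = (pt (vec2 a' 1), pt (vec2 b' 1))"
    using hmap_cexp2[OF y, unfolded y_def t_def, folded rotation_cexp2, folded t_def, folded y_def, unfolded x(2)]
    by (simp add: psi_def apt2_def apt_def hl_def cexp2_def a'_def b'_def)
  have "\<bar>Re (fst x)\<bar> < 1/4" "\<bar>Re (snd y)\<bar> < 1/4" using x(1) y by (simp_all add: strip_def)
  moreover have "norm (u1 x) \<le> 1/128" "norm (u2 y) \<le> 1/128"
    using norm_le_fbound[OF fb(1) strip_mem[OF x(1)]] norm_le_fbound[OF fb(2) strip_mem[OF y]] by simp_all
  then have "\<bar>Re (u1 x)\<bar> \<le> 1/128" "\<bar>Re (u2 y)\<bar> \<le> 1/128"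
    using abs_Re_le_cmod[of "u1 x"] abs_Re_le_cmod[of "u2 y"] by linarith+
  ultimately have re: "\<bar>Re (fst x + u1 x)\<bar> \<le> 1" "\<bar>Re (snd y + u2 y)\<bar> \<le> 1" by simp_all
  note ea = exp_slog[OF small re(1), folded a_def] and eb = exp_slog[OF small re(2), folded b'_def]
  have "u2 y = u2 x + c2 + slog p (fst x + u1 x)"
    using res(2)[OF strip_mem[OF x(1)], folded t_def] by (simp add: res2_def y_def algebra_simps)
  then have "b' = exp ((snd t + c2) + (snd x + u2 x) + slog p (fst x + u1 x))"
    by (simp add: b'_def y_def algebra_simps)
  then have b': "b' = exp (\<i> * of_real (\<alpha>$2) + c2) * b * bq a"
    unfolding exp_add[of _ "slog p (fst x + u1 x)"] ea(3) exp_add[of "snd t + c2"] bq_def by (simp add: t_def b_def)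
  have "u1 y = u1 x + c1 + slog p (snd y + u2 y)"
    using res(1)[OF strip_mem[OF x(1)], folded t_def] by (simp add: res1_def y_def algebra_simps)
  then have "a' = exp ((fst t + c1) + (fst x + u1 x) + slog p (snd y + u2 y))"
    by (simp add: a'_def y_def algebra_simps)
  then have a': "a' = exp (\<i> * of_real (\<alpha>$1) + c1) * a * bq b'"
    unfolding exp_add[of _ "slog p (snd y + u2 y)"] eb(3) exp_add[of "fst t + c1"] bq_def by (simp add: t_def a_def)
  have "a \<noteq> 0" "b \<noteq> 0" by (simp_all add: a_def b_def)
  from affine_step[OF this(1) ea(1,2) this(2) b' eb(1,2) a']
  show "f (psi z) = Some (psi (rotation \<alpha> z))" "g (psi (rotation \<alpha> z)) = Some (psi z)"
    unfolding pz pr .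
qed

lemma rat_zpow_psi:
  assumes z: "z \<in> annuli"
  shows "rat_zpow f k (psi z) = Some (psi (rotation (of_int k *\<^sub>R \<alpha>) z))"
proof (cases "0 \<le> k")
  case True
  then show ?thesis
    using ppow_semiconj[of f psi \<alpha> z "nat k"] psi_step(1) z by (simp add: rat_zpow_fmap)
next
  case False
  have "g (psi w) = Some (psi (rotation (- \<alpha>) w))" if "w \<in> annuli" for w
    using psi_step(2)[OF rotation_annuli[OF that, of "- \<alpha>"]] by (simp add: rotation_add)
  from ppow_semiconj[of g psi "- \<alpha>" z "nat (- k)", OF this z]
  show ?thesis using False by (simp add: rat_zpow_fmap)
qed

text \<open>In the coordinates of \<open>psi\<close> every iterate, forward or backward, is a
  multiplication by a point of the torus. A subsequence of multipliers converges, and uniform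
  continuity on the torus times a compact set makes the maps converge uniformly.\<close>

lemma iterates_normal: "iterates_normal_on f (psi ` annuli)"
  unfolding iterates_normal_on_def
proof
  fix n :: "nat \<Rightarrow> int"
  define L where "L j = cis2 (of_int (n j) *\<^sub>R \<alpha>)" for j
  have "\<forall>j. L j \<in> unit_torus" using cis2_in_unit_torus by (simp add: L_def)
  then obtain l r where l: "l \<in> unit_torus" "strict_mono r" "(L \<circ> r) \<longlonglongrightarrow> l"
    using compact_imp_seq_compact[OF compact_unit_torus] seq_compactE by metis
  define G where "G q = psi (cmul2 l (inv_into annuli psi q))" for q
  have "uniform_limit K (\<lambda>j q. the (rat_zpow f (n (r j)) q)) G sequentially"
    if K: "compact K" "K \<subseteq> psi ` annuli" for K
    unfolding uniform_limit_iff
  proof (intro allI impI)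
    fix e :: real assume e: "0 < e"
    define K' where "K' = inv_into annuli psi ` K"
    have "compact K'" unfolding K'_def
      by (rule compact_continuous_image[OF continuous_on_subset[OF continuous_on_inv_psi K(2)] K(1)])
    have K'D: "K' \<subseteq> annuli" unfolding K'_def using K(2) inv_into_into[of _ psi annuli] by blast
    have "continuous_on (unit_torus \<times> K') (\<lambda>q. cmul2 (fst q) (snd q))"
      unfolding cmul2_def by (intro continuous_on_vec2 continuous_intros)
    then have "continuous_on (unit_torus \<times> K') (\<lambda>q. psi (cmul2 (fst q) (snd q)))"
      by (rule continuous_on_compose2[OF continuous_on_psi]) (use cmul2_annuli K'D in auto)
    then have "uniformly_continuous_on (unit_torus \<times> K') (\<lambda>q. psi (cmul2 (fst q) (snd q)))"
      by (rule compact_uniformly_continuous[OF _ compact_Times[OF compact_unit_torus \<open>compact K'\<close>]])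
    then obtain d where d: "0 < d" "\<And>q q'. q \<in> unit_torus \<times> K' \<Longrightarrow> q' \<in> unit_torus \<times> K' \<Longrightarrow> dist q' q < d \<Longrightarrow>
        dist (psi (cmul2 (fst q') (snd q'))) (psi (cmul2 (fst q) (snd q))) < e"
      unfolding uniformly_continuous_on_def using e by meson
    have "\<forall>\<^sub>F j in sequentially. dist ((L \<circ> r) j) l < d" using l(3) d(1) by (rule tendstoD)
    then show "\<forall>\<^sub>F j in sequentially. \<forall>q\<in>K. dist (the (rat_zpow f (n (r j)) q)) (G q) < e"
    proof (rule eventually_mono, intro ballI)
      fix j q assume j: "dist ((L \<circ> r) j) l < d" and q: "q \<in> K"
      define z where "z = inv_into annuli psi q"
      have z: "z \<in> K'" "z \<in> annuli" "psi z = q"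
        using q K(2) K'D f_inv_into_f[of q psi annuli] by (auto simp: z_def K'_def)
      have "the (rat_zpow f (n (r j)) q) = psi (cmul2 (L (r j)) z)"
        using rat_zpow_psi[OF z(2), of "n (r j)"] by (simp add: z(3) rotation_cmul2 L_def)
      moreover have "dist (psi (cmul2 (L (r j)) z)) (psi (cmul2 l z)) < e"
        using d(2)[of "(l, z)" "(L (r j), z)"] j l(1) z(1) cis2_in_unit_torus by (simp add: dist_Pair_Pair L_def)
      ultimately show "dist (the (rat_zpow f (n (r j)) q)) (G q) < e" by (simp add: G_def z_def)
    qed
  qed
  then show "\<exists>r G. strict_mono r \<and> (\<forall>K. compact K \<and> K \<subseteq> psi ` annuli \<longrightarrow>
      uniform_limit K (\<lambda>j q. the (rat_zpow f (n (r j)) q)) G sequentially)"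
    using l(2) by blast
qed

lemma X_real_subset_fatou_set: "X_real \<subseteq> fatou_set f"
proof
  fix r assume "r \<in> X_real"
  then have r: "r \<in> psi ` annuli" using X_real_subset_psi_image by blast
  have d: "psi ` annuli \<subseteq> dom (rat_zpow f k)" for k
    by (rule image_subsetI, rule domI, rule rat_zpow_psi)
  show "r \<in> fatou_set f"
    unfolding fatou_set_def mem_Collect_eq
    by (rule exI[of _ "psi ` annuli"], intro conjI allI open_psi_image[OF open_annuli order_refl] r d iterates_normal)
qed

lemma strong_rotation_domain_psi: "strong_rotation_domain f (psi ` annuli)"
  unfolding strong_rotation_domain_def
  using open_psi_image[OF open_annuli order_refl] circular_domain_annuli biholomorphism_psi psi_step(1) by blast

end

theorem mainTheorem8:
  shows "(\<exists>q :: real^2 \<Rightarrow> X. quotient_map euclidean (top_of_set X_real) q \<and>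
            (\<forall>u v. q u = q v \<longleftrightarrow> (\<forall>i. u$i - v$i \<in> \<int>)))
    \<and> (\<exists>f. birational_map f \<and> real_map f \<and>
          dynamical_degree f > 1 \<and>
          X_real \<subseteq> fatou_set f \<and>
          (\<exists>\<Omega>. strong_rotation_domain f \<Omega> \<and> X_real \<subseteq> \<Omega>))"
proof (rule conjI[OF torus_quotient_map])
  define \<alpha> :: "real^2" where "\<alpha> = vector [2 * pi * sqrt 2, 2 * pi * sqrt 3]"
  have d: "dioph 125 (\<i> * of_real (\<alpha>$1), \<i> * of_real (\<alpha>$2))"
    using dioph_exists by (simp add: \<alpha>_def)
  show "\<exists>f. birational_map f \<and> real_map f \<and> dynamical_degree f > 1 \<and> X_real \<subseteq> fatou_set f \<and>
      (\<exists>\<Omega>. strong_rotation_domain f \<Omega> \<and> X_real \<subseteq> \<Omega>)"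
  proof (rule kam_conjugacy[OF d])
    fix p u1 u2 c1 c2
    assume *: "small_param p" "fbound (1/2) (1/128) u1" "fbound (1/2) (1/128) u2"
      "odd_sym (1/2) u1" "odd_sym (1/2) u2" "Re c1 = 0" "Re c2 = 0"
      "\<And>x. x \<in> strip (1/2) \<Longrightarrow> res1 p (\<i> * of_real (\<alpha>$1), \<i> * of_real (\<alpha>$2)) u1 u2 c1 x = 0"
      "\<And>x. x \<in> strip (1/2) \<Longrightarrow> res2 p (\<i> * of_real (\<alpha>$1), \<i> * of_real (\<alpha>$2)) u1 u2 c2 x = 0"
    interpret conjugated_torus_map u1 u2 p c1 c2 \<alpha> by unfold_locales (fact *)+
    have "0 \<le> sqrt 2" by simp
    then have "1 < dynamical_degree f" unfolding dynamical_degree_fmap by linarith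
    then show ?thesis
      by (intro exI[of _ f] exI[of _ "psi ` annuli"] conjI birational_fmap real_map_fmap X_real_subset_fatou_set
          strong_rotation_domain_psi X_real_subset_psi_image)
  qed simp
qed

end
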